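(* Suppose that $\varepsilon$ is piecewise $C^2$ in $\mathbb{R}^2$, that there are constants $c_1,c_2>0$ with $\Im(\varepsilon)>c_1$ and $\Re(\varepsilon)>c_2$ in $\Omega$, and that the interfaces are graphs of piecewise $C^2$ functions. Then for every slicing of $\Omega$ the two variational problems $$B_\varepsilon(u,v)=f_\varepsilon(v)\ \ \forall v\in H^1_{qp}(\Omega),\qquad B_{\varepsilon_h}(u^h,v)=f_{\varepsilon_h}(v)\ \ \forall v\in H^1_{qp}(\Omega)$$ have unique solutions $u\in H^1_{qp}(\Omega)$ and $u^h\in H^1_{qp}(\Omega)$, respectively. Furthermore, if $s_1\in(0,1/2)$ is such that $u\in H^{1+s_1}(\Omega)$, there is a constant $C>0$ independent of the slice thickness parameter $h>0$ such that $$\|u-u^h\|_{H^1(\Omega)}\le C\,h^{s_1/2}.$$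
   Context: Fix $L_x,H,\kappa>0$, positive constants $\varepsilon_+,\varepsilon_-$, and an angle $\theta\in(-\pi/2,\pi/2)$. Put $\alpha_0=\kappa\sqrt{\varepsilon_+}\sin\theta$, $\alpha_n=\alpha_0+2\pi n/L_x$ ($n\in\mathbb{Z}$), and assume $\alpha_n^2\neq\kappa^2\varepsilon_\pm$ for all $n$. Points are $\mathbf{x}=(x_1,x_2)$; $\Omega=(0,L_x)\times(-H,H)$, $\Gamma_{\pm H}=(0,L_x)\times\{\pm H\}$. The relative permittivity $\varepsilon$ on $\mathbb{R}^2$ is complex-valued, $L_x$-periodic in $x_1$, with $\varepsilon=\varepsilon_+$ for $x_2>H$ and $\varepsilon=\varepsilon_-$ for $x_2<-H$. "Piecewise $C^2$" means: one period is divided by finitely many interfaces into finitely many Lipschitz subdomains on each of which $\varepsilon$ is $C^2$ up to the boundary; $\varepsilon$ may jump across interfaces (and across $\Gamma_{\pm H}$), its value on an interface being one of the one-sided limits. $H^1_{qp}(\Omega)$ is the closure in $H^1(\Omega)$ of restrictions to $\Omega$ of smooth functions $w$ with $w(x_1+L_x,x_2)=e^{i\alpha_0L_x}w(x_1,x_2)$. Let $\beta_n^\pm=\sqrt{\kappa^2\varepsilon_\pm-\alpha_n^2}$ if $\alpha_n^2<\kappa^2\varepsilon_\pm$ and $\beta_n^\pm=i\sqrt{\alpha_n^2-\kappa^2\varepsilon_\pm}$ if $\alpha_n^2>\kappa^2\varepsilon_\pm$. For $\phi=\sum_n\phi_ne^{i\alpha_nx_1}$ on $\Gamma_{\pm H}$,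 $T^\pm\phi=\frac{i}{\varepsilon_\pm}\sum_n\beta_n^\pm\phi_ne^{i\alpha_nx_1}$. For a coefficient $\eta$, $$B_\eta(w,v)=\int_\Omega\Big(\frac1\eta\nabla w\cdot\nabla\overline v-\kappa^2w\overline v\Big)-\int_{\Gamma_{-H}}\overline v\,T^-(w)-\int_{\Gamma_H}\overline v\,T^+(w)$$ (boundary integrals are understood as $H^{-1/2}$–$H^{1/2}$ dualities). Incident field: $u^{\rm inc}(x_1,x_2)=\exp[i\kappa\sqrt{\varepsilon_+}(x_1\sin\theta-x_2\cos\theta)]$. The source functional $f_\eta$ is $f_\eta(v)=-\int_\Omega\nabla\cdot[(\varepsilon_+^{-1}-\eta^{-1})\nabla u^{\rm inc}]\,\overline v$, understood by integration by parts with the exterior values $\varepsilon_\pm$ of $\eta$ on $\Gamma_{\pm H}$: $$f_\eta(v)=\int_\Omega(\varepsilon_+^{-1}-\eta^{-1})\nabla u^{\rm inc}\cdot\nabla\overline v+(\varepsilon_+^{-1}-\varepsilon_-^{-1})\int_{\Gamma_{-H}}\frac{\partial u^{\rm inc}}{\partial x_2}\overline v .$$ Slicing: for a mesh $-H=h_0<h_1<\dots<h_S=H$, let $S_j=(0,L_x)\times(h_{j-1},h_j)$, $h=\max_j(h_j-h_{j-1})$, and $\varepsilon_h(x_1,x_2)=\varepsilon(x_1,\tfrac12(h_{j-1}+h_j))$ for $\mathbf{x}\in S_j$. *)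

theory Defs
  imports "HOL-Analysis.Analysis"
begin

section \<open>Sobolev spaces\<close>

definition dpart :: "'a::euclidean_space \<Rightarrow> ('a \<Rightarrow> complex) \<Rightarrow> 'a \<Rightarrow> complex" where
  "dpart b f x = frechet_derivative f (at x) b"

text \<open>Only meant for open \<open>U\<close>, where \<open>differentiable_on\<close> does not see the boundary.\<close>

primrec Ck_on :: "nat \<Rightarrow> 'a::euclidean_space set \<Rightarrow> ('a \<Rightarrow> complex) \<Rightarrow> bool" where
  "Ck_on 0 U f \<longleftrightarrow> continuous_on U f"
| "Ck_on (Suc k) U f \<longleftrightarrow> f differentiable_on U \<and> (\<forall>b\<in>Basis. Ck_on k U (dpart b f))"

definition smooth :: "('a::euclidean_space \<Rightarrow> complex) \<Rightarrow> bool" where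
  "smooth f \<longleftrightarrow> (\<forall>k. Ck_on k UNIV f)"

text \<open>\<open>Ck_closure k U f\<close>: on the open set \<open>U\<close>, \<open>f\<close> is of class \<open>C^k\<close>, and \<open>f\<close> and its partial
  derivatives of order at most \<open>k\<close> extend continuously to the closure of \<open>U\<close>.\<close>

primrec Ck_closure :: "nat \<Rightarrow> 'a::euclidean_space set \<Rightarrow> ('a \<Rightarrow> complex) \<Rightarrow> bool" where
  "Ck_closure 0 U f \<longleftrightarrow> (\<exists>g. continuous_on (closure U) g \<and> (\<forall>x\<in>U. g x = f x))"
| "Ck_closure (Suc k) U f \<longleftrightarrow>
     (\<exists>g. continuous_on (closure U) g \<and> (\<forall>x\<in>U. g x = f x)) \<and>
     f differentiable_on U \<and> (\<forall>b\<in>Basis. Ck_closure k U (dpart b f))"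

definition test_functions :: "'a::euclidean_space set \<Rightarrow> ('a \<Rightarrow> complex) set" where
  "test_functions U =
     {\<phi>. smooth \<phi> \<and> compact (closure {x. \<phi> x \<noteq> 0}) \<and> closure {x. \<phi> x \<noteq> 0} \<subseteq> U}"

text \<open>Elements of the function spaces are representatives: total functions of which only the
  almost-everywhere class on \<open>U\<close> matters.\<close>

definition L2 :: "'a::euclidean_space set \<Rightarrow> ('a \<Rightarrow> complex) set" where
  "L2 U = {u. u \<in> borel_measurable (lebesgue_on U) \<and>
              integrable (lebesgue_on U) (\<lambda>x. (cmod (u x))\<^sup>2)}"

definition L2_norm :: "'a::euclidean_space set \<Rightarrow> ('a \<Rightarrow> complex) \<Rightarrow> real" where
  "L2_norm U u = sqrt (\<integral>x. (cmod (u x))\<^sup>2 \<partial>lebesgue_on U)"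

definition has_weak_deriv ::
  "'a::euclidean_space set \<Rightarrow> 'a \<Rightarrow> ('a \<Rightarrow> complex) \<Rightarrow> ('a \<Rightarrow> complex) \<Rightarrow> bool" where
  "has_weak_deriv U b u g \<longleftrightarrow>
     (\<forall>\<phi>\<in>test_functions U.
        (\<integral>x. u x * dpart b \<phi> x \<partial>lebesgue_on U) = - (\<integral>x. g x * \<phi> x \<partial>lebesgue_on U))"

definition H1 :: "'a::euclidean_space set \<Rightarrow> ('a \<Rightarrow> complex) set" where
  "H1 U = {u \<in> L2 U. \<forall>b\<in>Basis. \<exists>g\<in>L2 U. has_weak_deriv U b u g}"

text \<open>Determined almost everywhere on \<open>U\<close> when \<open>u \<in> H1 U\<close> and \<open>U\<close> is open.\<close>

definition weak_deriv ::
  "'a::euclidean_space set \<Rightarrow> 'a \<Rightarrow> ('a \<Rightarrow> complex) \<Rightarrow> 'a \<Rightarrow> complex" where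
  "weak_deriv U b u = (SOME g. g \<in> L2 U \<and> has_weak_deriv U b u g)"

definition H1_norm :: "'a::euclidean_space set \<Rightarrow> ('a \<Rightarrow> complex) \<Rightarrow> real" where
  "H1_norm U u = sqrt ((L2_norm U u)\<^sup>2 + (\<Sum>b\<in>Basis. (L2_norm U (weak_deriv U b u))\<^sup>2))"

text \<open>Sobolev--Slobodeckij spaces of order \<open>s\<close> and \<open>1 + s\<close> for \<open>0 < s < 1\<close>
  (the Gagliardo integrand is \<open>0\<close> on the diagonal, since division by zero gives zero).\<close>

definition Hs :: "real \<Rightarrow> 'a::euclidean_space set \<Rightarrow> ('a \<Rightarrow> complex) set" where
  "Hs s U = {g \<in> L2 U. integrable (lebesgue_on (U \<times> U))
      (\<lambda>(x, y). (cmod (g x - g y))\<^sup>2 / norm (x - y) powr (real DIM('a) + 2 * s))}"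

definition H1s :: "real \<Rightarrow> 'a::euclidean_space set \<Rightarrow> ('a \<Rightarrow> complex) set" where
  "H1s s U = {u \<in> H1 U. \<forall>b\<in>Basis. weak_deriv U b u \<in> Hs s U}"


section \<open>The quasi-periodic variational problem\<close>

type_synonym point = "real \<times> real"

definition Omega :: "real \<Rightarrow> real \<Rightarrow> point set" where
  "Omega Lx H = {0<..<Lx} \<times> {-H<..<H}"

definition alpha0 :: "real \<Rightarrow> real \<Rightarrow> real \<Rightarrow> real" where
  "alpha0 \<kappa> \<epsilon>p \<theta> = \<kappa> * sqrt \<epsilon>p * sin \<theta>"

definition alpha :: "real \<Rightarrow> real \<Rightarrow> int \<Rightarrow> real" where
  "alpha Lx a0 n = a0 + 2 * pi * of_int n / Lx"

definition beta :: "real \<Rightarrow> real \<Rightarrow> real \<Rightarrow> real \<Rightarrow> int \<Rightarrow> complex" where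
  "beta Lx a0 \<kappa> e n =
     (if (alpha Lx a0 n)\<^sup>2 < \<kappa>\<^sup>2 * e then complex_of_real (sqrt (\<kappa>\<^sup>2 * e - (alpha Lx a0 n)\<^sup>2))
      else \<i> * complex_of_real (sqrt ((alpha Lx a0 n)\<^sup>2 - \<kappa>\<^sup>2 * e)))"

definition quasi_periodic :: "real \<Rightarrow> real \<Rightarrow> (point \<Rightarrow> complex) \<Rightarrow> bool" where
  "quasi_periodic Lx a0 w \<longleftrightarrow>
     (\<forall>x1 x2. w (x1 + Lx, x2) = exp (\<i> * complex_of_real (a0 * Lx)) * w (x1, x2))"

definition H1qp :: "real \<Rightarrow> real \<Rightarrow> real \<Rightarrow> (point \<Rightarrow> complex) set" where
  "H1qp Lx H a0 = {u \<in> H1 (Omega Lx H).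
     \<forall>e>0. \<exists>w. smooth w \<and> quasi_periodic Lx a0 w \<and> H1_norm (Omega Lx H) (\<lambda>x. u x - w x) < e}"

text \<open>\<open>g\<close>, as a function of \<open>x1\<close>, is the trace of \<open>u\<close> on the segment \<open>x2 = y\<close>: the extension by
  density of restriction, used for \<open>y = H\<close> and \<open>y = - H\<close>.\<close>

definition has_trace ::
  "real \<Rightarrow> real \<Rightarrow> real \<Rightarrow> (point \<Rightarrow> complex) \<Rightarrow> (real \<Rightarrow> complex) \<Rightarrow> bool" where
  "has_trace Lx H y u g \<longleftrightarrow> g \<in> L2 {0<..<Lx} \<and>
     (\<exists>w :: nat \<Rightarrow> point \<Rightarrow> complex. (\<forall>n. smooth (w n)) \<and>
        (\<lambda>n. H1_norm (Omega Lx H) (\<lambda>x. u x - w n x)) \<longlonglongrightarrow> 0 \<and>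
        (\<lambda>n. L2_norm {0<..<Lx} (\<lambda>t. g t - w n (t, y))) \<longlonglongrightarrow> 0)"

definition trace_at :: "real \<Rightarrow> real \<Rightarrow> real \<Rightarrow> (point \<Rightarrow> complex) \<Rightarrow> real \<Rightarrow> complex" where
  "trace_at Lx H y u = (SOME g. has_trace Lx H y u g)"

text \<open>Coefficients \<open>\<phi>\<^sub>n\<close> in \<open>\<phi>(t) = \<Sum>\<^sub>n \<phi>\<^sub>n exp (i \<alpha>\<^sub>n t)\<close>.\<close>

definition fcoeff :: "real \<Rightarrow> real \<Rightarrow> (real \<Rightarrow> complex) \<Rightarrow> int \<Rightarrow> complex" where
  "fcoeff Lx a0 \<phi> n =
     (\<integral>t. \<phi> t * exp (- (\<i> * complex_of_real (alpha Lx a0 n * t))) \<partial>lebesgue_on {0<..<Lx})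
       / complex_of_real Lx"

text \<open>An element of \<open>H\<close> of order \<open>-1/2\<close> on a boundary segment is represented by its coefficient
  sequence with respect to \<open>exp (i \<alpha>\<^sub>n t)\<close>. For such a \<open>c\<close> the duality with \<open>v\<close> extends
  the integral of \<open>cnj v * (\<Sum>\<^sub>n c\<^sub>n exp (i \<alpha>\<^sub>n t))\<close> over \<open>(0, Lx)\<close>, hence the factor \<open>Lx\<close>.\<close>

definition DtN :: "real \<Rightarrow> real \<Rightarrow> real \<Rightarrow> real \<Rightarrow> (real \<Rightarrow> complex) \<Rightarrow> int \<Rightarrow> complex" where
  "DtN Lx a0 \<kappa> e \<phi> n = \<i> / complex_of_real e * beta Lx a0 \<kappa> e n * fcoeff Lx a0 \<phi> n"

definition duality :: "real \<Rightarrow> real \<Rightarrow> (int \<Rightarrow> complex) \<Rightarrow> (real \<Rightarrow> complex) \<Rightarrow> complex" where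
  "duality Lx a0 c v = complex_of_real Lx * (\<Sum>\<^sub>\<infinity>n\<in>UNIV. c n * cnj (fcoeff Lx a0 v n))"

definition B_form ::
  "real \<Rightarrow> real \<Rightarrow> real \<Rightarrow> real \<Rightarrow> real \<Rightarrow> real \<Rightarrow> (point \<Rightarrow> complex) \<Rightarrow>
   (point \<Rightarrow> complex) \<Rightarrow> (point \<Rightarrow> complex) \<Rightarrow> complex" where
  "B_form Lx H \<kappa> \<epsilon>p \<epsilon>m \<theta> \<eta> w v =
     (let U = Omega Lx H; a0 = alpha0 \<kappa> \<epsilon>p \<theta> in
      (\<integral>x. 1 / \<eta> x * (\<Sum>b\<in>Basis. weak_deriv U b w x * cnj (weak_deriv U b v x))
           - (complex_of_real \<kappa>)\<^sup>2 * w x * cnj (v x) \<partial>lebesgue_on U)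
      - duality Lx a0 (DtN Lx a0 \<kappa> \<epsilon>m (trace_at Lx H (- H) w)) (trace_at Lx H (- H) v)
      - duality Lx a0 (DtN Lx a0 \<kappa> \<epsilon>p (trace_at Lx H H w)) (trace_at Lx H H v))"

definition u_inc :: "real \<Rightarrow> real \<Rightarrow> real \<Rightarrow> point \<Rightarrow> complex" where
  "u_inc \<kappa> \<epsilon>p \<theta> = (\<lambda>(x1, x2).
     exp (\<i> * complex_of_real (\<kappa> * sqrt \<epsilon>p * (x1 * sin \<theta> - x2 * cos \<theta>))))"

definition source ::
  "real \<Rightarrow> real \<Rightarrow> real \<Rightarrow> real \<Rightarrow> real \<Rightarrow> real \<Rightarrow> (point \<Rightarrow> complex) \<Rightarrow>
   (point \<Rightarrow> complex) \<Rightarrow> complex" where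
  "source Lx H \<kappa> \<epsilon>p \<epsilon>m \<theta> \<eta> v =
     (let U = Omega Lx H; ui = u_inc \<kappa> \<epsilon>p \<theta> in
      (\<integral>x. (1 / complex_of_real \<epsilon>p - 1 / \<eta> x) *
            (\<Sum>b\<in>Basis. dpart b ui x * cnj (weak_deriv U b v x)) \<partial>lebesgue_on U)
      + (1 / complex_of_real \<epsilon>p - 1 / complex_of_real \<epsilon>m) *
        (\<integral>t. dpart (0, 1) ui (t, - H) * cnj (trace_at Lx H (- H) v t) \<partial>lebesgue_on {0<..<Lx}))"

definition is_solution ::
  "real \<Rightarrow> real \<Rightarrow> real \<Rightarrow> real \<Rightarrow> real \<Rightarrow> real \<Rightarrow> (point \<Rightarrow> complex) \<Rightarrow>
   (point \<Rightarrow> complex) \<Rightarrow> bool" where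
  "is_solution Lx H \<kappa> \<epsilon>p \<epsilon>m \<theta> \<eta> u \<longleftrightarrow>
     u \<in> H1qp Lx H (alpha0 \<kappa> \<epsilon>p \<theta>) \<and>
     (\<forall>v\<in>H1qp Lx H (alpha0 \<kappa> \<epsilon>p \<theta>).
        B_form Lx H \<kappa> \<epsilon>p \<epsilon>m \<theta> \<eta> u v = source Lx H \<kappa> \<epsilon>p \<epsilon>m \<theta> \<eta> v)"

definition uniquely_solvable ::
  "real \<Rightarrow> real \<Rightarrow> real \<Rightarrow> real \<Rightarrow> real \<Rightarrow> real \<Rightarrow> (point \<Rightarrow> complex) \<Rightarrow> bool" where
  "uniquely_solvable Lx H \<kappa> \<epsilon>p \<epsilon>m \<theta> \<eta> \<longleftrightarrow>
     (\<exists>u. is_solution Lx H \<kappa> \<epsilon>p \<epsilon>m \<theta> \<eta> u \<and>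
        (\<forall>u'. is_solution Lx H \<kappa> \<epsilon>p \<epsilon>m \<theta> \<eta> u' \<longrightarrow> (AE x in lebesgue_on (Omega Lx H). u' x = u x)))"


section \<open>Piecewise regular permittivities\<close>

definition nodes :: "real \<Rightarrow> real \<Rightarrow> nat \<Rightarrow> (nat \<Rightarrow> real) \<Rightarrow> bool" where
  "nodes a b N q \<longleftrightarrow> q 0 = a \<and> q N = b \<and> (\<forall>j<N. q j < q (Suc j))"

definition C2_interval :: "real \<Rightarrow> real \<Rightarrow> (real \<Rightarrow> real) \<Rightarrow> bool" where
  "C2_interval a b g \<longleftrightarrow> (\<exists>g1 g2.
     (\<forall>t\<in>{a..b}. (g has_real_derivative g1 t) (at t within {a..b})) \<and>
     (\<forall>t\<in>{a..b}. (g1 has_real_derivative g2 t) (at t within {a..b})) \<and>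
     continuous_on {a..b} g2)"

text \<open>Continuity across the nodes comes from the closed pieces overlapping there.\<close>

definition piecewise_C2_fun :: "real \<Rightarrow> real \<Rightarrow> (real \<Rightarrow> real) \<Rightarrow> bool" where
  "piecewise_C2_fun a b g \<longleftrightarrow>
     (\<exists>N q. nodes a b N q \<and> (\<forall>j<N. C2_interval (q j) (q (Suc j)) g))"

definition is_piecewise_C2_graph :: "real \<Rightarrow> point set \<Rightarrow> bool" where
  "is_piecewise_C2_graph Lx \<sigma> \<longleftrightarrow>
     (\<exists>a b g. 0 \<le> a \<and> a < b \<and> b \<le> Lx \<and> piecewise_C2_fun a b g \<and> \<sigma> = (\<lambda>t. (t, g t)) ` {a..b})"

text \<open>Near each boundary point \<open>p\<close>, in orthonormal coordinates centred at \<open>p\<close> with second axis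
  \<open>e\<close>, the domain is the strict epigraph of a Lipschitz function.\<close>

definition Lipschitz_domain :: "point set \<Rightarrow> bool" where
  "Lipschitz_domain D \<longleftrightarrow> D \<noteq> {} \<and> open D \<and> connected D \<and> bounded D \<and>
     (\<forall>p\<in>frontier D. \<exists>r>0. \<exists>e \<gamma> L. norm e = 1 \<and> L-lipschitz_on UNIV \<gamma> \<and>
        (\<forall>x\<in>ball p r. x \<in> D \<longleftrightarrow> \<gamma> ((x - p) \<bullet> (snd e, - fst e)) < (x - p) \<bullet> e))"

definition periodized :: "real \<Rightarrow> point set \<Rightarrow> point set" where
  "periodized Lx A = (\<Union>k::int. (\<lambda>x. x + (of_int k * Lx, 0)) ` A)"

text \<open>\<open>\<S>\<close> is the set of interfaces in one period and \<open>\<D>\<close> the set of subdomains. The last two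
  conditions express that in the whole plane the permittivity has no other singularities than the
  periodic copies of the interfaces and the two lines \<open>x2 = H\<close>, \<open>x2 = - H\<close> (in particular none
  on the lateral sides of a period), and that its value there is a one-sided limit.\<close>

definition piecewise_C2_permittivity ::
  "real \<Rightarrow> real \<Rightarrow> (point \<Rightarrow> complex) \<Rightarrow> point set set \<Rightarrow> point set set \<Rightarrow> bool" where
  "piecewise_C2_permittivity Lx H \<epsilon> \<S> \<D> \<longleftrightarrow>
     finite \<S> \<and> (\<forall>\<sigma>\<in>\<S>. closed \<sigma> \<and> \<sigma> \<subseteq> closure (Omega Lx H)) \<and>
     finite \<D> \<and> (\<forall>D\<in>\<D>. Lipschitz_domain D) \<and> disjoint \<D> \<and> \<Union>\<D> = Omega Lx H - \<Union>\<S> \<and>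
     (\<forall>D\<in>\<D>. Ck_closure 2 D \<epsilon>) \<and>
     (let Z = periodized Lx (\<Union>\<S>) \<union> {x. snd x = H} \<union> {x. snd x = - H};
          \<P> = (\<Union>D\<in>\<D>. \<Union>k::int. {(\<lambda>x. x + (of_int k * Lx, 0)) ` D})
              \<union> {{x. snd x > H}, {x. snd x < - H}}
      in Ck_on 2 (- Z) \<epsilon> \<and> (\<forall>x\<in>Z. \<exists>P\<in>\<P>. x \<in> closure P \<and> (\<epsilon> \<longlongrightarrow> \<epsilon> x) (at x within P)))"


section \<open>Slicing\<close>

definition thickness :: "nat \<Rightarrow> (nat \<Rightarrow> real) \<Rightarrow> real" where
  "thickness N q = Max ((\<lambda>j. q (Suc j) - q j) ` {..<N})"

text \<open>Outside the open slices (in particular on the null set of slice boundaries) \<open>\<epsilon>\<close> is kept.\<close>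

definition sliced :: "nat \<Rightarrow> (nat \<Rightarrow> real) \<Rightarrow> (point \<Rightarrow> complex) \<Rightarrow> point \<Rightarrow> complex" where
  "sliced N q \<epsilon> = (\<lambda>(x1, x2).
     if \<exists>j<N. q j < x2 \<and> x2 < q (Suc j)
     then let j = (THE j. j < N \<and> q j < x2 \<and> x2 < q (Suc j)) in \<epsilon> (x1, (q j + q (Suc j)) / 2)
     else \<epsilon> (x1, x2))"

end

theory Submission
  imports Defs
begin

text \<open>With \<open>\<phi>\<^sub>n\<^sup>\<plusminus>\<close> the Fourier coefficients of the traces of \<open>u\<close>, \<open>- Im B\<^sub>\<eta>(u, u)\<close> equals the integral
  of \<open>- Im (1/\<eta>) |\<nabla>u|\<^sup>2\<close> plus the sum of the terms \<open>(Lx/\<epsilon>\<^sub>\<plusminus>) Re \<beta>\<^sub>n\<^sup>\<plusminus> |\<phi>\<^sub>n\<^sup>\<plusminus>|\<^sup>2\<close>. As \<open>Im \<eta> > c1\<close>, this controls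
  the gradient; a constant is quasi-periodic only if some \<open>\<alpha>\<^sub>n\<close> vanishes, and that mode propagates.
  Hence \<open>B\<^sub>\<eta>\<close> is coercive, uniformly for all \<open>\<eta>\<close> with the bounds of \<open>\<epsilon>\<close>, and the Lax--Milgram theorem
  applies. Subtracting the two problems, \<open>u - u\<^sup>h\<close> is bounded by the norm of
  \<open>(1/\<epsilon>\<^sub>h - 1/\<epsilon>) \<nabla>(u + u\<^sup>i\<^sup>n\<^sup>c)\<close>. The factor is \<open>O(h)\<close> except at vertical distance at most \<open>h\<close> from the
  interfaces, which are graphs. On this thin set the \<open>L\<^sup>2\<close> norm of a function of Sobolev order \<open>s\<close> is
  \<open>O(h powr (s/2))\<close>, which is seen by comparing it with its values on squares of size \<open>sqrt h\<close>.\<close>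

section \<open>The Lax--Milgram theorem\<close>

text \<open>Functions are representatives, and \<open>weak_deriv\<close> and \<open>trace_at\<close>
  are choices, so derivatives and traces are linear only almost everywhere or up to norm zero. The
  Hilbert space theory is therefore developed for semidefinite products, with limits determined up
  to norm zero. Coercivity is read off the imaginary part because the real part contains the
  negative term -\<kappa>^2 |u|^2. Its constant must not depend on the slicing: coefficients enter
  only through pointwise bounds, and a sliced coefficient takes in the cell only values that
  \<epsilon> takes there. In the error estimate the coefficient difference multiplies the gradient
  of the fixed solution u, so one Gagliardo integral serves all slicings. Near the interfaces that
  difference is of order one, and smallness must come from the thinness of the set: averaging at
  scale r leaves r^(2s) + h/r. The choice r ~ sqrt h gives h^s + h^(1/2), of order h^s since s <
  1/2, and a square root yields the exponent s/2.\<close>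

locale semi_ip =
  fixes V :: "('a \<Rightarrow> complex) set"
    and ip :: "('a \<Rightarrow> complex) \<Rightarrow> ('a \<Rightarrow> complex) \<Rightarrow> complex"
  assumes zero_mem: "(\<lambda>x. 0) \<in> V"
    and lin_mem: "\<And>u v c. u \<in> V \<Longrightarrow> v \<in> V \<Longrightarrow> (\<lambda>x. u x + c * v x) \<in> V"
    and ip_lin: "\<And>u v w c. u \<in> V \<Longrightarrow> v \<in> V \<Longrightarrow> w \<in> V \<Longrightarrow>
        ip (\<lambda>x. u x + c * v x) w = ip u w + c * ip v w"
    and ip_herm: "\<And>u v. u \<in> V \<Longrightarrow> v \<in> V \<Longrightarrow> ip v u = cnj (ip u v)"
    and ip_pos: "\<And>u. u \<in> V \<Longrightarrow> Re (ip u u) \<ge> 0"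
begin

definition nrm :: "('a \<Rightarrow> complex) \<Rightarrow> real" where
  "nrm u = sqrt (Re (ip u u))"

lemma diff_mem: "u \<in> V \<Longrightarrow> v \<in> V \<Longrightarrow> (\<lambda>x. u x - v x) \<in> V"
  using lin_mem[of u v "-1"] by simp

lemma scale_mem: "u \<in> V \<Longrightarrow> (\<lambda>x. c * u x) \<in> V"
  using lin_mem[OF zero_mem, of u c] by simp

lemma add_mem: "u \<in> V \<Longrightarrow> v \<in> V \<Longrightarrow> (\<lambda>x. u x + v x) \<in> V"
  using lin_mem[of u v 1] by simp

lemma ip_lin2:
  assumes "u \<in> V" "v \<in> V" "w \<in> V"
  shows "ip w (\<lambda>x. u x + c * v x) = ip w u + cnj c * ip w v"
proof -
  have "ip w (\<lambda>x. u x + c * v x) = cnj (ip (\<lambda>x. u x + c * v x) w)"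
    using assms by (intro ip_herm lin_mem)
  also have "\<dots> = cnj (ip u w) + cnj c * cnj (ip v w)"
    using assms by (simp add: ip_lin)
  also have "\<dots> = ip w u + cnj c * ip w v"
    by (simp only: ip_herm[OF assms(1,3)] ip_herm[OF assms(2,3)])
  finally show ?thesis .
qed

lemma ip_diff: "u \<in> V \<Longrightarrow> v \<in> V \<Longrightarrow> w \<in> V \<Longrightarrow> ip (\<lambda>x. u x - v x) w = ip u w - ip v w"
  using ip_lin[of u v w "-1"] by simp

lemma nrm_nonneg [simp]: "u \<in> V \<Longrightarrow> 0 \<le> nrm u"
  by (simp add: nrm_def ip_pos)

lemma nrm_sq: "u \<in> V \<Longrightarrow> (nrm u)\<^sup>2 = Re (ip u u)"
  by (simp add: nrm_def ip_pos)

lemma nrm_lin_sq: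
  assumes "u \<in> V" "v \<in> V"
  shows "(nrm (\<lambda>x. u x + c * v x))\<^sup>2 = (nrm u)\<^sup>2 + 2 * Re (cnj c * ip u v) + (cmod c)\<^sup>2 * (nrm v)\<^sup>2"
proof -
  have "ip (\<lambda>x. u x + c * v x) (\<lambda>x. u x + c * v x)
      = ip u u + cnj c * ip u v + c * (cnj (ip u v) + cnj c * ip v v)"
    using assms by (simp add: ip_lin ip_lin2 lin_mem flip: ip_herm[of u v])
  moreover have "Im (ip v v) = 0"
    using ip_herm[OF assms(2) assms(2)] by (simp add: complex_eq_iff)
  ultimately show ?thesis
    unfolding nrm_sq[OF lin_mem[OF assms]] nrm_sq[OF assms(1)] nrm_sq[OF assms(2)]
    by (simp add: cmod_power2) (simp add: algebra_simps power2_eq_square)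
qed

text \<open>Choosing c = -t z reduces the hypothesis to a real quadratic in t. If b = 0 a large t
  forces z = 0; otherwise t = 1/b is the minimiser. Besides the Cauchy-Schwarz inequality, the case
  a = 0 is the first-order condition of a minimisation.\<close>

lemma quadratic_nonneg_imp:
  fixes a b :: real
  assumes "\<And>c. 0 \<le> a + 2 * Re (cnj c * z) + (cmod c)\<^sup>2 * b" and "a \<ge> 0" and "b \<ge> 0"
  shows "(cmod z)\<^sup>2 \<le> a * b"
proof -
  have *: "0 \<le> a - 2 * t * (cmod z)\<^sup>2 + t\<^sup>2 * (cmod z)\<^sup>2 * b" for t :: real
  proof -
    have "Re (cnj (- of_real t * z) * z) = - t * (cmod z)\<^sup>2"
      by (simp add: cmod_power2) (simp add: algebra_simps power2_eq_square)
    thus ?thesis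
      using assms(1)[of "- of_real t * z"]
      by (simp add: norm_mult power_mult_distrib)
  qed
  show ?thesis
  proof (cases "b = 0")
    case True
    have "(cmod z)\<^sup>2 = 0"
    proof (rule ccontr)
      assume "(cmod z)\<^sup>2 \<noteq> 0"
      hence "(cmod z)\<^sup>2 > 0" by simp
      thus False using *[of "(a + 1) / (cmod z)\<^sup>2"] True assms(2) by simp
    qed
    thus ?thesis using True by simp
  next
    case False
    hence "b > 0" using assms(3) by simp
    thus ?thesis using *[of "1 / b"] by (simp add: field_simps power2_eq_square)
  qed
qed

lemma Cauchy_Schwarz:
  assumes "u \<in> V" "v \<in> V"
  shows "cmod (ip u v) \<le> nrm u * nrm v"
proof -
  have "(cmod (ip u v))\<^sup>2 \<le> (nrm u)\<^sup>2 * (nrm v)\<^sup>2"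
    by (rule quadratic_nonneg_imp, unfold nrm_lin_sq[OF assms, symmetric]) simp_all
  thus ?thesis
    using assms by - (rule power2_le_imp_le, simp_all add: power_mult_distrib)
qed

lemma nrm_triangle:
  assumes "u \<in> V" "v \<in> V"
  shows "nrm (\<lambda>x. u x + v x) \<le> nrm u + nrm v"
proof -
  have "Re (ip u v) \<le> nrm u * nrm v"
    using Cauchy_Schwarz[OF assms] complex_Re_le_cmod order_trans by blast
  hence "(nrm (\<lambda>x. u x + v x))\<^sup>2 \<le> (nrm u + nrm v)\<^sup>2"
    using nrm_lin_sq[OF assms, of 1] by (simp add: power2_sum)
  thus ?thesis
    using assms by - (rule power2_le_imp_le, simp_all)
qed

lemma nrm_scale: "u \<in> V \<Longrightarrow> nrm (\<lambda>x. c * u x) = cmod c * nrm u"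
proof -
  assume u: "u \<in> V"
  have "ip (\<lambda>x. 0) v = 0" if "v \<in> V" for v
    using ip_lin[OF zero_mem zero_mem that, of 1] by simp
  hence "(nrm (\<lambda>x. c * u x))\<^sup>2 = (cmod c * nrm u)\<^sup>2"
    using nrm_lin_sq[OF zero_mem u, of c] u
    by (simp add: power_mult_distrib nrm_sq zero_mem)
  thus ?thesis
    using u by - (rule power2_eq_imp_eq, simp_all add: scale_mem)
qed

lemma nrm_minus_commute:
  assumes "u \<in> V" "v \<in> V"
  shows "nrm (\<lambda>x. u x - v x) = nrm (\<lambda>x. v x - u x)"
proof -
  have "nrm (\<lambda>x. (-1) * (v x - u x)) = cmod (-1) * nrm (\<lambda>x. v x - u x)"
    by (rule nrm_scale[OF diff_mem[OF assms(2,1)]])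
  moreover have "(\<lambda>x. (-1) * (v x - u x)) = (\<lambda>x. u x - v x)" by (simp add: fun_eq_iff)
  ultimately show ?thesis by (simp only: norm_minus_cancel norm_one mult_1)
qed

lemma nrm_triangle_diff:
  assumes "u \<in> V" "v \<in> V" "w \<in> V"
  shows "nrm (\<lambda>x. u x - w x) \<le> nrm (\<lambda>x. u x - v x) + nrm (\<lambda>x. v x - w x)"
proof -
  have eq: "(\<lambda>x. (u x - v x) + (v x - w x)) = (\<lambda>x. u x - w x)" by (simp add: fun_eq_iff)
  show ?thesis using nrm_triangle[OF diff_mem[OF assms(1,2)] diff_mem[OF assms(2,3)]] unfolding eq .
qed

lemma nrm_diff_le:
  assumes "u \<in> V" "v \<in> V"
  shows "nrm u \<le> nrm v + nrm (\<lambda>x. u x - v x)"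
proof -
  have eq: "(\<lambda>x. v x + (u x - v x)) = u" by (simp add: fun_eq_iff)
  show ?thesis using nrm_triangle[OF assms(2) diff_mem[OF assms]] unfolding eq .
qed

lemma nrm_tendsto:
  assumes "\<And>n. s n \<in> V" "u \<in> V" "(\<lambda>n. nrm (\<lambda>x. s n x - u x)) \<longlonglongrightarrow> 0"
  shows "(\<lambda>n. nrm (s n)) \<longlonglongrightarrow> nrm u"
proof -
  have "norm (nrm (s n) - nrm u) \<le> nrm (\<lambda>x. s n x - u x)" for n
  proof -
    have "s n \<in> V" by (rule assms(1))
    from nrm_diff_le[OF this assms(2)] nrm_diff_le[OF assms(2) this]
      nrm_minus_commute[OF assms(2) this]
    show ?thesis unfolding real_norm_def by linarith
  qed
  hence "(\<lambda>n. nrm (s n) - nrm u) \<longlonglongrightarrow> 0"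
    by - (rule Lim_null_comparison[OF _ assms(3)], simp)
  thus ?thesis by (rule LIM_zero_cancel)
qed

end

locale complete_semi_ip = semi_ip +
  assumes complete: "\<And>s. (\<And>n. s n \<in> V) \<Longrightarrow>
      (\<And>e. e > 0 \<Longrightarrow> \<exists>N. \<forall>m\<ge>N. \<forall>n\<ge>N. nrm (\<lambda>x. s m x - s n x) < e) \<Longrightarrow>
      \<exists>u\<in>V. (\<lambda>n. nrm (\<lambda>x. s n x - u x)) \<longlonglongrightarrow> 0"
begin

lemma bounded_form_tendsto:
  assumes lin: "\<And>u v c. u \<in> V \<Longrightarrow> v \<in> V \<Longrightarrow> g (\<lambda>x. u x + c * v x) = g u + c * g v"
    and bd: "\<And>u. u \<in> V \<Longrightarrow> cmod (g u) \<le> K * nrm u"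
    and s: "\<And>n. s n \<in> V" "u \<in> V" "(\<lambda>n. nrm (\<lambda>x. s n x - u x)) \<longlonglongrightarrow> 0"
  shows "(\<lambda>n. g (s n)) \<longlonglongrightarrow> g u"
proof (rule LIM_zero_cancel, rule Lim_null_comparison)
  have "g (s n) - g u = g (\<lambda>x. s n x - u x)" for n
    using lin[of "s n" u "-1"] s by simp
  thus "\<forall>\<^sub>F n in sequentially. cmod (g (s n) - g u) \<le> K * nrm (\<lambda>x. s n x - u x)"
    using bd s by (simp add: diff_mem)
  show "(\<lambda>n. K * nrm (\<lambda>x. s n x - u x)) \<longlonglongrightarrow> 0"
    using tendsto_mult[OF tendsto_const s(3), of K] by simp
qed

text \<open>The representative minimises \<open>J v\<close> = |v|^2 - 2 Re f(v). The parallelogram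
  law makes a minimising sequence Cauchy, and optimality against all complex multiples of v gives
  \<open>ip r v = f v\<close>. The functional is conjugate-linear, as the second slot of
  \<open>ip\<close> is.\<close>

lemma Riesz:
  assumes lin: "\<And>u v c. u \<in> V \<Longrightarrow> v \<in> V \<Longrightarrow> f (\<lambda>x. u x + c * v x) = f u + cnj c * f v"
    and bd: "\<And>u. u \<in> V \<Longrightarrow> cmod (f u) \<le> K * nrm u"
  shows "\<exists>r\<in>V. \<forall>v\<in>V. ip r v = f v"
proof -
  define J where "J v = (nrm v)\<^sup>2 - 2 * Re (f v)" for v
  have Jlow: "- K\<^sup>2 \<le> J v" if "v \<in> V" for v
  proof -
    have "Re (f v) \<le> K * nrm v" using bd[OF that] complex_Re_le_cmod order_trans by blast
    moreover have "0 \<le> (nrm v - K)\<^sup>2" by simp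
    ultimately show ?thesis unfolding J_def power2_diff by (simp add: mult.commute)
  qed
  have bdd: "bdd_below (J ` V)" using Jlow by (meson bdd_belowI2)
  have ne: "J ` V \<noteq> {}" using zero_mem by auto
  define d where "d = Inf (J ` V)"
  have dle: "d \<le> J v" if "v \<in> V" for v
    unfolding d_def by (intro cInf_lower bdd imageI that)
  have "\<exists>v\<in>V. J v < d + 1 / (real n + 1)" for n
    using cInf_lessD[OF ne, of "d + 1 / (real n + 1)"] d_def by auto
  then obtain s where sV: "\<And>n. s n \<in> V" and sJ: "\<And>n. J (s n) < d + 1 / (real n + 1)"
    by metis
  have Jlin: "J (\<lambda>x. u x + c * v x) = J u + 2 * Re (cnj c * (ip u v - f v)) + (cmod c)\<^sup>2 * (nrm v)\<^sup>2"
    if "u \<in> V" "v \<in> V" for u v c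
    unfolding J_def using that by (simp add: nrm_lin_sq lin algebra_simps)
  \<comment> \<open>The parallelogram law for J, with the midpoint of u and v written as v + (u -
    v)/2 so that \<open>Jlin\<close> applies with c = 1 and c = 1/2. Since J is at least d at the
    midpoint, near-minimal values at u and v force u and v to be close.\<close>
  have par: "(nrm (\<lambda>x. u x - v x))\<^sup>2 = 2 * (J u + J v) - 4 * J (\<lambda>x. v x + (1/2) * (u x - v x))"
    if "u \<in> V" "v \<in> V" for u v
  proof -
    define w where "w = (\<lambda>x. u x - v x)"
    have w: "w \<in> V" unfolding w_def using that diff_mem by simp
    have u: "u = (\<lambda>x. v x + 1 * w x)" by (simp add: w_def)
    have "J u = J v + 2 * Re (ip v w - f w) + (nrm w)\<^sup>2"
      using Jlin[OF that(2) w, of 1] u by simp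
    moreover have "J (\<lambda>x. v x + (1/2) * w x) = J v + Re (ip v w - f w) + (1/4) * (nrm w)\<^sup>2"
      using Jlin[OF that(2) w, of "1/2"] by (simp add: power2_eq_square)
    ultimately show ?thesis by (simp add: w_def)
  qed
  have cau: "(nrm (\<lambda>x. s m x - s n x))\<^sup>2 \<le> 2 / (real m + 1) + 2 / (real n + 1)" for m n
  proof -
    have "J (\<lambda>x. s n x + (1/2) * (s m x - s n x)) \<ge> d"
      by (intro dle lin_mem diff_mem sV)
    thus ?thesis
      using par[OF sV sV, of m n] sJ[of m] sJ[of n] by simp
  qed
  have "\<exists>N. \<forall>m\<ge>N. \<forall>n\<ge>N. nrm (\<lambda>x. s m x - s n x) < e" if "e > 0" for e
  proof -
    obtain N where N: "1 / (real N + 1) < e\<^sup>2 / 4"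
      using reals_Archimedean[of "e\<^sup>2 / 4"] \<open>e > 0\<close> by (simp add: inverse_eq_divide add.commute) blast
    have "nrm (\<lambda>x. s m x - s n x) < e" if "m \<ge> N" "n \<ge> N" for m n
    proof -
      have "2 / (real m + 1) + 2 / (real n + 1) \<le> 2 / (real N + 1) + 2 / (real N + 1)"
        using that by (intro add_mono divide_left_mono) auto
      also have "\<dots> < e\<^sup>2" using N by simp
      finally have "(nrm (\<lambda>x. s m x - s n x))\<^sup>2 < e\<^sup>2" using cau[of m n] by simp
      thus ?thesis using \<open>e > 0\<close> power_less_imp_less_base by fastforce
    qed
    thus ?thesis by blast
  qed
  then obtain r where r: "r \<in> V" "(\<lambda>n. nrm (\<lambda>x. s n x - r x)) \<longlonglongrightarrow> 0"
    using complete[of s, OF sV] by blast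
  have "ip r v = f v" if v: "v \<in> V" for v
  proof -
    have lim: "(\<lambda>n. ip (s n) v) \<longlonglongrightarrow> ip r v"
      by (rule bounded_form_tendsto[where K = "nrm v"])
        (use v r sV ip_lin Cauchy_Schwarz in \<open>auto simp: mult.commute\<close>)
    \<comment> \<open>Optimality passes to the limit along the minimising sequence: moving from
      \<open>s n\<close> by c v lowers J by at most 1/(n+1). With a = 0 the quadratic inequality
      then forces \<open>ip r v - f v\<close> to vanish.\<close>
    have "0 \<le> 0 + 2 * Re (cnj c * (ip r v - f v)) + (cmod c)\<^sup>2 * (nrm v)\<^sup>2" for c
    proof (rule LIMSEQ_le)
      show "(\<lambda>n. - (1 / (real n + 1))) \<longlonglongrightarrow> 0"
        using LIMSEQ_inverse_real_of_nat
        by (intro tendsto_minus_cancel[of _ 0]) (simp add: inverse_eq_divide add.commute)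
      show "(\<lambda>n. 0 + 2 * Re (cnj c * (ip (s n) v - f v)) + (cmod c)\<^sup>2 * (nrm v)\<^sup>2)
          \<longlonglongrightarrow> 0 + 2 * Re (cnj c * (ip r v - f v)) + (cmod c)\<^sup>2 * (nrm v)\<^sup>2"
        by (intro tendsto_intros lim)
      have "- (1 / (real n + 1)) \<le> 0 + 2 * Re (cnj c * (ip (s n) v - f v)) + (cmod c)\<^sup>2 * (nrm v)\<^sup>2" for n
        using Jlin[OF sV v, of n c] sJ[of n] dle[OF lin_mem[OF sV v, of n c]] by linarith
      thus "\<exists>N. \<forall>n\<ge>N. - (1 / (real n + 1)) \<le> 0 + 2 * Re (cnj c * (ip (s n) v - f v)) + (cmod c)\<^sup>2 * (nrm v)\<^sup>2"
        by blast
    qed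
    from quadratic_nonneg_imp[OF this] v show ?thesis by simp
  qed
  thus ?thesis using r(1) by blast
qed

lemma Cauchy_of_geometric:
  assumes s: "\<And>n. s n \<in> V" and q: "0 \<le> q" "q < 1"
    and step: "\<And>n. nrm (\<lambda>x. s (Suc n) x - s n x) \<le> A * q ^ n" and e: "e > 0"
  shows "\<exists>N. \<forall>m\<ge>N. \<forall>n\<ge>N. nrm (\<lambda>x. s m x - s n x) < e"
proof -
  have A: "0 \<le> A" using order_trans[OF nrm_nonneg step[of 0]] s by (simp add: diff_mem)
  have tail: "nrm (\<lambda>x. s (n + k) x - s n x) \<le> A * q ^ n / (1 - q)" for n k
  proof -
    have "nrm (\<lambda>x. s (n + k) x - s n x) \<le> A * q ^ n * (\<Sum>i<k. q ^ i)"
    proof (induction k)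
      case 0
      have "nrm (\<lambda>x. 0) = 0" using nrm_scale[OF zero_mem, of 0] by simp
      thus ?case by simp
    next
      case (Suc k)
      have "nrm (\<lambda>x. s (n + Suc k) x - s n x)
          \<le> nrm (\<lambda>x. s (Suc (n + k)) x - s (n + k) x) + nrm (\<lambda>x. s (n + k) x - s n x)"
        unfolding add_Suc_right by (rule nrm_triangle_diff) (rule s)+
      thus ?case using Suc step[of "n + k"] by (simp add: algebra_simps power_add)
    qed
    also have "\<dots> \<le> A * q ^ n * (1 / (1 - q))"
      using A q by (intro mult_left_mono) (auto simp: sum_gp_strict divide_right_mono)
    finally show ?thesis by simp
  qed
  have "(\<lambda>n. A * q ^ n / (1 - q)) \<longlonglongrightarrow> A * 0 / (1 - q)"
    using q by (intro tendsto_intros LIMSEQ_power_zero) auto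
  hence "\<forall>\<^sub>F n in sequentially. A * q ^ n / (1 - q) < e"
    using e by (intro order_tendstoD) auto
  then obtain N where N: "\<And>n. n \<ge> N \<Longrightarrow> A * q ^ n / (1 - q) < e"
    by (auto simp: eventually_sequentially)
  have *: "nrm (\<lambda>x. s m x - s n x) < e" if "N \<le> n" "n \<le> m" for m n
    using tail[of n "m - n"] N[of n] that by simp
  have "nrm (\<lambda>x. s m x - s n x) < e" if "N \<le> n" "N \<le> m" for m n
  proof (cases "n \<le> m")
    case False
    thus ?thesis using *[of m n] that by (subst nrm_minus_commute[OF s s]) simp
  qed (use *[of n m] that in simp)
  thus ?thesis by blast
qed

text \<open>For small \<open>\<rho>\<close>, the map \<open>u \<mapsto> u - \<rho> R u\<close> is a contraction, where \<open>R u\<close> is the Riesz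
  representative of \<open>B u - f\<close>.\<close>

theorem Lax_Milgram:
  assumes B1: "\<And>u v w c. u \<in> V \<Longrightarrow> v \<in> V \<Longrightarrow> w \<in> V \<Longrightarrow> B (\<lambda>x. u x + c * v x) w = B u w + c * B v w"
    and B2: "\<And>u v w c. u \<in> V \<Longrightarrow> v \<in> V \<Longrightarrow> w \<in> V \<Longrightarrow> B w (\<lambda>x. u x + c * v x) = B w u + cnj c * B w v"
    and Bbd: "\<And>u v. u \<in> V \<Longrightarrow> v \<in> V \<Longrightarrow> cmod (B u v) \<le> K * nrm u * nrm v"
    and Bco: "\<And>u. u \<in> V \<Longrightarrow> c0 * (nrm u)\<^sup>2 \<le> Re (B u u)" and c0: "c0 > 0"
    and f1: "\<And>u v c. u \<in> V \<Longrightarrow> v \<in> V \<Longrightarrow> f (\<lambda>x. u x + c * v x) = f u + cnj c * f v"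
    and fbd: "\<And>u. u \<in> V \<Longrightarrow> cmod (f u) \<le> F * nrm u"
  shows "\<exists>u\<in>V. \<forall>v\<in>V. B u v = f v"
proof -
  \<comment> \<open>K may be small or negative. Enlarging it to a positive bound that is at least c0
    keeps the radicand in q nonnegative.\<close>
  define L where "L = max K (max c0 1)"
  have L: "L \<ge> c0" "L > 0" "L \<ge> K" using c0 by (auto simp: L_def)
  have BbdL: "cmod (B u v) \<le> L * nrm u * nrm v" if "u \<in> V" "v \<in> V" for u v
  proof -
    have "K * (nrm u * nrm v) \<le> L * (nrm u * nrm v)" using L that by (intro mult_right_mono) auto
    thus ?thesis using Bbd[OF that] by (simp add: mult.assoc)
  qed
  have "\<exists>r\<in>V. \<forall>v\<in>V. ip r v = B u v - f v" if u: "u \<in> V" for u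
  proof (rule Riesz[where K = "L * nrm u + F"])
    show "cmod (B u v - f v) \<le> (L * nrm u + F) * nrm v" if "v \<in> V" for v
      using BbdL[OF u that] fbd[OF that] norm_triangle_ineq4[of "B u v" "f v"]
      by (simp add: algebra_simps)
  qed (use u B2 f1 in \<open>simp add: algebra_simps\<close>)
  then obtain R where RV: "\<And>u. u \<in> V \<Longrightarrow> R u \<in> V"
    and R: "\<And>u v. u \<in> V \<Longrightarrow> v \<in> V \<Longrightarrow> ip (R u) v = B u v - f v" by metis
  \<comment> \<open>This \<rho> minimises 1 - 2 \<rho> c0 + \<rho>^2 L^2, the bound for the squared
    contraction factor; the minimum is q^2 = 1 - c0^2/L^2.\<close>
  define \<rho> where "\<rho> = c0 / L\<^sup>2"
  define q where "q = sqrt (1 - c0\<^sup>2 / L\<^sup>2)"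
  have q1: "c0\<^sup>2 / L\<^sup>2 \<le> 1" "c0\<^sup>2 / L\<^sup>2 > 0" using L c0 by (auto simp: power_mono)
  have q: "0 \<le> q" "q < 1" "q\<^sup>2 = 1 - c0\<^sup>2 / L\<^sup>2" using q1 by (auto simp: q_def)
  have \<rho>: "\<rho> > 0" using L c0 by (simp add: \<rho>_def)
  define T where "T u = (\<lambda>x. u x + (- of_real \<rho>) * R u x)" for u
  have TV: "T u \<in> V" if "u \<in> V" for u unfolding T_def by (intro lin_mem that RV)
  have contr: "nrm (\<lambda>x. T u x - T v x) \<le> q * nrm (\<lambda>x. u x - v x)" if uv: "u \<in> V" "v \<in> V" for u v
  proof -
    define d where "d = (\<lambda>x. u x - v x)"
    define e where "e = (\<lambda>x. R u x - R v x)"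
    have d: "d \<in> V" and e: "e \<in> V" unfolding d_def e_def by (intro diff_mem uv RV)+
    \<comment> \<open>The functional f cancels in the difference, so e represents B d. Testing with
      w = e bounds |e| by L |d|, and testing with w = d brings in the coercivity.\<close>
    have ipe: "ip e w = B d w" if "w \<in> V" for w
      using B1[OF uv that, of "-1"] uv that RV
      by (simp add: e_def d_def ip_diff R)
    have "(nrm e)\<^sup>2 \<le> L * nrm d * nrm e"
      using ipe[OF e] e BbdL[OF d e] complex_Re_le_cmod[of "B d e"] by (simp add: nrm_sq)
    hence ne: "nrm e \<le> L * nrm d"
      using e d L by (cases "nrm e = 0") (auto simp: power2_eq_square less_le)
    have eqd: "(\<lambda>x. T u x - T v x) = (\<lambda>x. d x + (- of_real \<rho>) * e x)"
      by (auto simp: T_def d_def e_def algebra_simps)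
    have "Re (ip d e) = Re (ip e d)" using ip_herm[OF d e] by simp
    hence "c0 * (nrm d)\<^sup>2 \<le> Re (ip d e)" using ipe[OF d] Bco[OF d] by simp
    moreover have "(nrm (\<lambda>x. T u x - T v x))\<^sup>2 = (nrm d)\<^sup>2 - 2 * \<rho> * Re (ip d e) + \<rho>\<^sup>2 * (nrm e)\<^sup>2"
      unfolding eqd nrm_lin_sq[OF d e] using \<rho> by simp
    moreover have "(nrm e)\<^sup>2 \<le> L\<^sup>2 * (nrm d)\<^sup>2"
      using power_mono[OF ne, of 2] e by (simp add: power_mult_distrib)
    ultimately have "(nrm (\<lambda>x. T u x - T v x))\<^sup>2 \<le>
        (nrm d)\<^sup>2 - 2 * \<rho> * (c0 * (nrm d)\<^sup>2) + \<rho>\<^sup>2 * (L\<^sup>2 * (nrm d)\<^sup>2)"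
      using \<rho> by (smt (verit) mult_left_mono zero_le_power2 mult_pos_pos)
    also have "\<dots> = (q * nrm d)\<^sup>2"
      unfolding power_mult_distrib q(3) using L
      by (simp add: \<rho>_def field_simps power2_eq_square)
    finally have "(nrm (\<lambda>x. T u x - T v x))\<^sup>2 \<le> (q * nrm d)\<^sup>2" .
    thus ?thesis using q d by - (rule power2_le_imp_le, auto simp: d_def)
  qed
  define s where "s n = (T ^^ n) (\<lambda>x. 0)" for n
  have sS: "s (Suc n) = T (s n)" for n by (simp add: s_def)
  have sV: "s n \<in> V" for n by (induction n) (auto simp: s_def zero_mem TV)
  define A where "A = nrm (\<lambda>x. s (Suc 0) x - s 0 x)"
  have step: "nrm (\<lambda>x. s (Suc n) x - s n x) \<le> A * q ^ n" for n
  proof (induction n)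
    case (Suc n)
    have "nrm (\<lambda>x. s (Suc (Suc n)) x - s (Suc n) x) \<le> q * nrm (\<lambda>x. s (Suc n) x - s n x)"
      using contr[OF sV[of "Suc n"] sV[of n]] by (simp add: sS)
    also have "\<dots> \<le> q * (A * q ^ n)" using q Suc by (intro mult_left_mono)
    finally show ?case by (simp add: mult_ac)
  qed (simp add: A_def)
  obtain u where u: "u \<in> V" "(\<lambda>n. nrm (\<lambda>x. s n x - u x)) \<longlonglongrightarrow> 0"
    using complete[of s, OF sV Cauchy_of_geometric[OF sV q(1,2) step]] by blast
  have "B u v = f v" if v: "v \<in> V" for v
  proof -
    have "(\<lambda>n. B (s n) v) \<longlonglongrightarrow> B u v"
      by (rule bounded_form_tendsto[where K = "L * nrm v"])
        (use v u sV B1 BbdL in \<open>auto simp: mult_ac\<close>)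
    hence 1: "(\<lambda>n. B (s n) v - f v) \<longlonglongrightarrow> B u v - f v" by (intro tendsto_intros)
    have 2: "(\<lambda>n. B (s n) v - f v) \<longlonglongrightarrow> 0"
    proof (rule Lim_null_comparison)
      \<comment> \<open>The residual at \<open>s n\<close> is represented by \<open>R (s n)\<close>,
        which is the next increment divided by -\<rho>. It decays geometrically, so the limit solves
        the equation.\<close>
      have "cmod (B (s n) v - f v) \<le> A / \<rho> * nrm v * q ^ n" for n
      proof -
        have "\<rho> * nrm (R (s n)) = nrm (\<lambda>x. s (Suc n) x - s n x)"
          using nrm_scale[OF RV[OF sV], of "- of_real \<rho>" n] \<rho> by (simp add: sS T_def)
        hence "nrm (R (s n)) \<le> A * q ^ n / \<rho>" using step[of n] \<rho> by (simp add: field_simps)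
        hence "nrm (R (s n)) * nrm v \<le> A * q ^ n / \<rho> * nrm v" by (intro mult_right_mono) (auto simp: v)
        thus ?thesis
          using R[OF sV v] Cauchy_Schwarz[OF RV[OF sV] v, of n] by (simp add: mult_ac)
      qed
      thus "\<forall>\<^sub>F n in sequentially. cmod (B (s n) v - f v) \<le> A / \<rho> * nrm v * q ^ n" by simp
      show "(\<lambda>n. A / \<rho> * nrm v * q ^ n) \<longlonglongrightarrow> 0"
        using q by (intro tendsto_mult_right_zero LIMSEQ_power_zero) auto
    qed
    show ?thesis using LIMSEQ_unique[OF 1 2] by simp
  qed
  thus ?thesis using u by blast
qed

end

section \<open>Square-integrable functions\<close>

lemma L2_measurable [measurable_dest]: "u \<in> L2 U \<Longrightarrow> u \<in> borel_measurable (lebesgue_on U)"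
  by (simp add: L2_def)

lemma L2_square_integrable: "u \<in> L2 U \<Longrightarrow> integrable (lebesgue_on U) (\<lambda>x. (cmod (u x))\<^sup>2)"
  by (simp add: L2_def)

lemma L2_dominated:
  assumes "f \<in> borel_measurable (lebesgue_on U)" "integrable (lebesgue_on U) g"
    and "\<And>x. x \<in> U \<Longrightarrow> (cmod (f x))\<^sup>2 \<le> g x"
  shows "f \<in> L2 U"
proof -
  have "integrable (lebesgue_on U) (\<lambda>x. (cmod (f x))\<^sup>2)"
  proof (rule Bochner_Integration.integrable_bound[OF assms(2)])
    show "(\<lambda>x. (cmod (f x))\<^sup>2) \<in> borel_measurable (lebesgue_on U)" using assms(1) by measurable
    show "AE x in lebesgue_on U. norm ((cmod (f x))\<^sup>2) \<le> norm (g x)"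
      using assms(3) by (intro AE_I2) (fastforce intro: order_trans[OF _ abs_ge_self])
  qed
  thus ?thesis using assms(1) by (simp add: L2_def)
qed

lemma L2_integrable_mult:
  assumes "u \<in> L2 U" "v \<in> L2 U"
  shows "integrable (lebesgue_on U) (\<lambda>x. u x * v x)"
proof (rule Bochner_Integration.integrable_bound)
  show "integrable (lebesgue_on U) (\<lambda>x. (cmod (u x))\<^sup>2 + (cmod (v x))\<^sup>2)"
    using assms by (intro Bochner_Integration.integrable_add L2_square_integrable)
  show "(\<lambda>x. u x * v x) \<in> borel_measurable (lebesgue_on U)"
    using assms by (intro borel_measurable_times L2_measurable)
  have "cmod a * cmod b \<le> (cmod a)\<^sup>2 + (cmod b)\<^sup>2" for a b
    using sum_squares_bound[of "cmod a" "cmod b"] mult_nonneg_nonneg[OF norm_ge_zero[of a] norm_ge_zero[of b]]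
    by linarith
  thus "AE x in lebesgue_on U. norm (u x * v x) \<le> norm ((cmod (u x))\<^sup>2 + (cmod (v x))\<^sup>2)"
    by (intro AE_I2) (simp add: norm_mult)
qed

lemma L2_cnj: "u \<in> L2 U \<Longrightarrow> (\<lambda>x. cnj (u x)) \<in> L2 U"
proof -
  assume u: "u \<in> L2 U"
  have "(\<lambda>x. cnj (u x)) \<in> borel_measurable (lebesgue_on U)"
    by (rule measurable_compose[OF L2_measurable[OF u]])
      (intro borel_measurable_continuous_onI continuous_intros)
  thus ?thesis using u by (simp add: L2_def)
qed

lemma L2_integrable_cnj:
  "u \<in> L2 U \<Longrightarrow> v \<in> L2 U \<Longrightarrow> integrable (lebesgue_on U) (\<lambda>x. u x * cnj (v x))"
  by (intro L2_integrable_mult L2_cnj)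

lemma norm_add_sq_le: "(norm (a + b :: 'a::real_normed_vector))\<^sup>2 \<le> 2 * (norm a)\<^sup>2 + 2 * (norm b)\<^sup>2"
proof -
  have "(norm (a + b))\<^sup>2 \<le> (norm a + norm b)\<^sup>2" by (intro power_mono norm_triangle_ineq) simp
  also have "\<dots> \<le> 2 * (norm a)\<^sup>2 + 2 * (norm b)\<^sup>2"
    using sum_squares_bound[of "norm a" "norm b"] by (simp add: power2_sum)
  finally show ?thesis .
qed

lemma L2_lin:
  assumes "u \<in> L2 U" "v \<in> L2 U"
  shows "(\<lambda>x. u x + c * v x) \<in> L2 U"
proof (rule L2_dominated)
  show "(\<lambda>x. u x + c * v x) \<in> borel_measurable (lebesgue_on U)"
    using assms by (intro borel_measurable_add borel_measurable_times borel_measurable_const L2_measurable)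
  show "integrable (lebesgue_on U) (\<lambda>x. 2 * (cmod (u x))\<^sup>2 + 2 * ((cmod c)\<^sup>2 * (cmod (v x))\<^sup>2))"
    using assms by (intro Bochner_Integration.integrable_add integrable_mult_right L2_square_integrable)
  show "(cmod (u x + c * v x))\<^sup>2 \<le> 2 * (cmod (u x))\<^sup>2 + 2 * ((cmod c)\<^sup>2 * (cmod (v x))\<^sup>2)" for x
    using norm_add_sq_le[of "u x" "c * v x"] by (simp add: norm_mult power_mult_distrib)
qed

lemma Re_integral_mult_cnj:
  "Re (\<integral>x. u x * cnj (u x) \<partial>M) = (\<integral>x. (cmod (u x))\<^sup>2 \<partial>M)"
proof -
  have "(\<integral>x. u x * cnj (u x) \<partial>M) = (\<integral>x. complex_of_real ((cmod (u x))\<^sup>2) \<partial>M)"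
    by (simp only: complex_norm_square)
  thus ?thesis by (simp only: integral_complex_of_real Re_complex_of_real)
qed

interpretation L2ip: semi_ip "L2 U" "\<lambda>u v. \<integral>x. u x * cnj (v x) \<partial>lebesgue_on U"
  rewrites "semi_ip.nrm (\<lambda>u v. \<integral>x. u x * cnj (v x) \<partial>lebesgue_on U) = L2_norm U"
  for U :: "'a::euclidean_space set"
proof -
  show s: "semi_ip (L2 U) (\<lambda>u v. \<integral>x. u x * cnj (v x) \<partial>lebesgue_on U)"
  proof
    show "(\<lambda>x. 0) \<in> L2 U" by (simp add: L2_def)
    show "(\<lambda>x. u x + c * v x) \<in> L2 U" if "u \<in> L2 U" "v \<in> L2 U" for u v c
      by (rule L2_lin[OF that])
    show "(\<integral>x. (u x + c * v x) * cnj (w x) \<partial>lebesgue_on U) =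
        (\<integral>x. u x * cnj (w x) \<partial>lebesgue_on U) + c * (\<integral>x. v x * cnj (w x) \<partial>lebesgue_on U)"
      if "u \<in> L2 U" "v \<in> L2 U" "w \<in> L2 U" for u v w c
    proof -
      have "(\<integral>x. (u x + c * v x) * cnj (w x) \<partial>lebesgue_on U) =
          (\<integral>x. u x * cnj (w x) + c * (v x * cnj (w x)) \<partial>lebesgue_on U)"
        by (simp add: algebra_simps)
      also have "\<dots> = (\<integral>x. u x * cnj (w x) \<partial>lebesgue_on U) + (\<integral>x. c * (v x * cnj (w x)) \<partial>lebesgue_on U)"
        using that by (intro Bochner_Integration.integral_add integrable_mult_right L2_integrable_cnj)
      finally show ?thesis by simp
    qed
    show "(\<integral>x. v x * cnj (u x) \<partial>lebesgue_on U) = cnj (\<integral>x. u x * cnj (v x) \<partial>lebesgue_on U)" for u v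
      unfolding Bochner_Integration.integral_cnj[symmetric] by (simp add: mult.commute)
    show "0 \<le> Re (\<integral>x. u x * cnj (u x) \<partial>lebesgue_on U)" for u
      by (simp only: Re_integral_mult_cnj) simp
  qed
  show "semi_ip.nrm (\<lambda>u v. \<integral>x. u x * cnj (v x) \<partial>lebesgue_on U) = L2_norm U"
    by (rule ext) (simp only: semi_ip.nrm_def[OF s] L2_norm_def Re_integral_mult_cnj)
qed

lemma L2_norm_sq: "(L2_norm U u)\<^sup>2 = (\<integral>x. (cmod (u x))\<^sup>2 \<partial>lebesgue_on U)"
  by (simp add: L2_norm_def)

lemma L2_norm_nonneg [simp]: "0 \<le> L2_norm U u"
  by (simp add: L2_norm_def)

lemma L2_norm_cong_AE:
  assumes "u \<in> L2 U" "v \<in> L2 U" "AE x in lebesgue_on U. u x = v x"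
  shows "L2_norm U u = L2_norm U v"
proof -
  have "(\<integral>x. (cmod (u x))\<^sup>2 \<partial>lebesgue_on U) = (\<integral>x. (cmod (v x))\<^sup>2 \<partial>lebesgue_on U)"
    using assms by (intro integral_cong_AE borel_measurable_integrable L2_square_integrable) auto
  thus ?thesis by (simp add: L2_norm_def)
qed

lemma L2_norm_eq_0_AE:
  assumes "u \<in> L2 U" "L2_norm U u = 0"
  shows "AE x in lebesgue_on U. u x = 0"
proof -
  have "(\<integral>x. (cmod (u x))\<^sup>2 \<partial>lebesgue_on U) = 0" using assms(2) by (simp add: L2_norm_def)
  thus ?thesis
    using integral_nonneg_eq_0_iff_AE[OF L2_square_integrable[OF assms(1)]] by simp
qed

lemma nn_integral_L2: "u \<in> L2 U \<Longrightarrow>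
  (\<integral>\<^sup>+x. ennreal ((cmod (u x))\<^sup>2) \<partial>lebesgue_on U) = ennreal ((L2_norm U u)\<^sup>2)"
  by (subst nn_integral_eq_integral[OF L2_square_integrable]) (simp_all add: L2_norm_sq)

lemma L2_norm_le_of_nn_integral:
  assumes "u \<in> borel_measurable (lebesgue_on U)"
    and "(\<integral>\<^sup>+x. ennreal ((cmod (u x))\<^sup>2) \<partial>lebesgue_on U) \<le> ennreal (e\<^sup>2)" "e \<ge> 0"
  shows "u \<in> L2 U" "L2_norm U u \<le> e"
proof -
  have "integrable (lebesgue_on U) (\<lambda>x. (cmod (u x))\<^sup>2)"
  proof (rule integrableI_bounded)
    show "(\<lambda>x. (cmod (u x))\<^sup>2) \<in> borel_measurable (lebesgue_on U)" using assms(1) by measurable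
    show "(\<integral>\<^sup>+x. ennreal (norm ((cmod (u x))\<^sup>2)) \<partial>lebesgue_on U) < \<infinity>"
      using le_less_trans[OF assms(2) ennreal_less_top] by simp
  qed
  thus u: "u \<in> L2 U" using assms(1) by (simp add: L2_def)
  have "(L2_norm U u)\<^sup>2 \<le> e\<^sup>2" using assms(2) by (simp add: nn_integral_L2[OF u])
  thus "L2_norm U u \<le> e" using assms(3) power2_le_imp_le by blast
qed

text \<open>Along a fast subsequence, \<open>\<Sum>\<^sub>k 2^k |d\<^sub>k|\<^sup>2\<close> is integrable for the increments \<open>d\<^sub>k\<close>, so these are
  almost everywhere dominated by a geometric series; Fatou's lemma does the rest.\<close>

theorem L2_complete:
  fixes s :: "nat \<Rightarrow> 'a::euclidean_space \<Rightarrow> complex"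
  assumes s: "\<And>n. s n \<in> L2 U"
    and cau: "\<And>e. e > 0 \<Longrightarrow> \<exists>N. \<forall>m\<ge>N. \<forall>n\<ge>N. L2_norm U (\<lambda>x. s m x - s n x) < e"
  shows "\<exists>u\<in>L2 U. (\<lambda>n. L2_norm U (\<lambda>x. s n x - u x)) \<longlonglongrightarrow> 0"
proof -
  let ?M = "lebesgue_on U"
  have "\<exists>N. \<forall>m\<ge>N. \<forall>n\<ge>N. L2_norm U (\<lambda>x. s m x - s n x) < (1/2)^k" for k :: nat
    by (rule cau) simp
  then obtain N0 where N0: "\<And>k m n. m \<ge> N0 k \<Longrightarrow> n \<ge> N0 k \<Longrightarrow> L2_norm U (\<lambda>x. s m x - s n x) < (1/2)^k"
    by metis
  \<comment> \<open>Summing all earlier indices makes both \<open>r k\<close> and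
    \<open>r (Suc k)\<close> at least \<open>N0 k\<close>, so that the k-th increment has norm at
    most 2^(-k); the summand k makes the indices tend to infinity.\<close>
  define r where "r k = (\<Sum>i\<le>k. N0 i) + k" for k
  have r1: "r k \<ge> N0 k" for k by (simp add: r_def sum_nonneg trans_le_add1 member_le_sum)
  have r2: "r (Suc k) \<ge> N0 k" for k using r1[of k] by (simp add: r_def)
  have r3: "r k \<ge> k" for k by (simp add: r_def)
  define d where "d k = (\<lambda>x. s (r (Suc k)) x - s (r k) x)" for k
  have dL: "d k \<in> L2 U" for k unfolding d_def by (intro L2ip.diff_mem s)
  have dn: "L2_norm U (d k) \<le> (1/2)^k" for k
    unfolding d_def by (intro less_imp_le N0 r1 r2)
  \<comment> \<open>The weight 2^k is still beaten by the squared norm 4^(-k). Where W is finite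
    with value w, the k-th increment is at most sqrt w times 2^(-k/2), hence summable.\<close>
  define W where "W x = (\<Sum>k. ennreal (2^k * (cmod (d k x))\<^sup>2))" for x
  have meas: "(\<lambda>x. ennreal (2^k * (cmod (d k x))\<^sup>2)) \<in> borel_measurable ?M" for k
    using L2_measurable[OF dL[of k]] by measurable
  have int_k: "(\<integral>\<^sup>+x. ennreal (2^k * (cmod (d k x))\<^sup>2) \<partial>?M) \<le> ennreal ((1/2)^k)" for k
  proof -
    have "(\<integral>\<^sup>+x. ennreal (2^k * (cmod (d k x))\<^sup>2) \<partial>?M) = (\<integral>\<^sup>+x. ennreal (2^k) * ennreal ((cmod (d k x))\<^sup>2) \<partial>?M)"
      by (simp add: ennreal_mult)
    also have "\<dots> = ennreal (2^k) * (\<integral>\<^sup>+x. ennreal ((cmod (d k x))\<^sup>2) \<partial>?M)"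
      using L2_measurable[OF dL[of k]] by (intro nn_integral_cmult) measurable
    also have "\<dots> = ennreal (2^k * (L2_norm U (d k))\<^sup>2)"
      by (simp add: nn_integral_L2[OF dL] ennreal_mult)
    also have "\<dots> \<le> ennreal (2^k * ((1/2)^k)\<^sup>2)"
      using dn[of k] by (intro ennreal_leI mult_left_mono power_mono) simp_all
    also have "(2::real)^k * ((1/2)^k)\<^sup>2 = (1/2)^k"
      by (simp add: power2_eq_square power_one_over field_simps)
    finally show ?thesis .
  qed
  have "(\<integral>\<^sup>+x. W x \<partial>?M) = (\<Sum>k. \<integral>\<^sup>+x. ennreal (2^k * (cmod (d k x))\<^sup>2) \<partial>?M)"
    unfolding W_def by (rule nn_integral_suminf) (rule meas)
  also have "\<dots> \<le> (\<Sum>k. ennreal ((1/2)^k))"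
    by (intro suminf_le int_k) auto
  also have "\<dots> = ennreal (\<Sum>k. (1/2)^k)"
    by (intro suminf_ennreal2) (simp_all add: summable_geometric)
  finally have "(\<integral>\<^sup>+x. W x \<partial>?M) \<noteq> \<infinity>"
    unfolding infinity_ennreal_def by (rule neq_top_trans[OF ennreal_neq_top])
  moreover have "W \<in> borel_measurable ?M"
    unfolding W_def using meas by measurable
  ultimately have AEW: "AE x in ?M. W x \<noteq> \<infinity>" by (rule nn_integral_PInf_AE[rotated])
  have conv: "convergent (\<lambda>k. s (r k) x)" if W: "W x \<noteq> \<infinity>" for x
  proof -
    define w where "w = enn2real (W x)"
    have leW: "ennreal (2^k * (cmod (d k x))\<^sup>2) \<le> W x" for k
    proof -
      have "sum (\<lambda>k. ennreal (2^k * (cmod (d k x))\<^sup>2)) {k} \<le> W x"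
        unfolding W_def by (rule sum_le_suminf) (rule summableI, rule finite.intros, rule finite.intros, rule zero_le)
      thus ?thesis by (simp only: sum.insert finite.emptyI empty_iff not_False_eq_True sum.empty add_0_right)
    qed
    have le: "2^k * (cmod (d k x))\<^sup>2 \<le> w" for k
    proof -
      have "W x = ennreal w" using W by (simp add: w_def less_top)
      with leW[of k] have "ennreal (2^k * (cmod (d k x))\<^sup>2) \<le> ennreal w" by (simp only:)
      thus ?thesis by (subst (asm) ennreal_le_iff) (simp_all add: w_def)
    qed
    have "summable (\<lambda>k. d k x)"
    proof (rule summable_comparison_test)
      have "cmod (d k x) \<le> sqrt w * (1 / sqrt 2)^k" for k
      proof -
        have "cmod (d k x) = sqrt ((cmod (d k x))\<^sup>2)" by simp
        also have "\<dots> \<le> sqrt (w / 2^k)" using le[of k] by (intro real_sqrt_le_mono) (simp add: field_simps)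
        also have "\<dots> = sqrt w * (1 / sqrt 2)^k" by (simp add: real_sqrt_divide real_sqrt_power power_one_over)
        finally show ?thesis .
      qed
      thus "\<exists>N. \<forall>n\<ge>N. norm (d n x) \<le> sqrt w * (1 / sqrt 2)^n" by blast
      show "summable (\<lambda>n. sqrt w * (1 / sqrt 2)^n)"
        by (intro summable_mult summable_geometric) simp
    qed
    hence "convergent (\<lambda>n. \<Sum>k<n. d k x)" by (simp add: summable_iff_convergent)
    moreover have "(\<Sum>k<n. d k x) = s (r n) x - s (r 0) x" for n
      unfolding d_def by (rule sum_lessThan_telescope)
    ultimately have "convergent (\<lambda>n. s (r n) x - s (r 0) x)" by simp
    hence "convergent (\<lambda>n. (s (r n) x - s (r 0) x) + s (r 0) x)"
      by (intro convergent_add convergent_const)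
    thus ?thesis by simp
  qed
  define u where "u x = lim (\<lambda>k. s (r k) x)" for x
  have um: "u \<in> borel_measurable ?M"
    unfolding u_def using L2_measurable[OF s] by (intro borel_measurable_lim_metric)
  have lims: "AE x in ?M. (\<lambda>k. s (r k) x) \<longlonglongrightarrow> u x"
    using AEW by (rule AE_mp) (use conv in \<open>auto simp: u_def convergent_LIMSEQ_iff\<close>)
  \<comment> \<open>Fatou's lemma is applied in the second index along the fast subsequence while n
    stays free. This gives convergence of the whole sequence and, taking one n, membership of u in
    the space.\<close>
  have key: "(\<lambda>x. s n x - u x) \<in> L2 U \<and> L2_norm U (\<lambda>x. s n x - u x) \<le> (1/2)^j" if n: "n \<ge> N0 j" for n j
  proof -
    have "(\<integral>\<^sup>+x. ennreal ((cmod (s n x - u x))\<^sup>2) \<partial>?M)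
        = (\<integral>\<^sup>+x. liminf (\<lambda>k. ennreal ((cmod (s n x - s (r k) x))\<^sup>2)) \<partial>?M)"
    proof (rule nn_integral_cong_AE, rule AE_mp[OF lims], rule AE_I2, rule impI)
      fix x assume "(\<lambda>k. s (r k) x) \<longlonglongrightarrow> u x"
      hence "(\<lambda>k. ennreal ((cmod (s n x - s (r k) x))\<^sup>2)) \<longlonglongrightarrow> ennreal ((cmod (s n x - u x))\<^sup>2)"
        by (intro tendsto_intros tendsto_ennrealI)
      from lim_imp_Liminf[OF trivial_limit_sequentially this]
      show "ennreal ((cmod (s n x - u x))\<^sup>2) = liminf (\<lambda>k. ennreal ((cmod (s n x - s (r k) x))\<^sup>2))"
        by (rule sym)
    qed
    also have "\<dots> \<le> liminf (\<lambda>k. \<integral>\<^sup>+x. ennreal ((cmod (s n x - s (r k) x))\<^sup>2) \<partial>?M)"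
    proof (rule nn_integral_liminf)
      show "(\<lambda>x. ennreal ((cmod (s n x - s (r k) x))\<^sup>2)) \<in> borel_measurable ?M" for k
        using L2_measurable[OF L2ip.diff_mem[OF s[of n] s[of "r k"]]] by measurable
    qed
    also have "\<dots> \<le> ennreal (((1/2)^j)\<^sup>2)"
    proof (rule Liminf_le)
      have "(\<integral>\<^sup>+x. ennreal ((cmod (s n x - s (r k) x))\<^sup>2) \<partial>?M) \<le> ennreal (((1/2)^j)\<^sup>2)" if "k \<ge> N0 j" for k
        unfolding nn_integral_L2[OF L2ip.diff_mem[OF s[of n] s[of "r k"]]]
        by (intro ennreal_leI power_mono L2_norm_nonneg less_imp_le[OF N0[OF n order_trans[OF that r3]]])
      thus "\<forall>\<^sub>F k in sequentially. (\<integral>\<^sup>+x. ennreal ((cmod (s n x - s (r k) x))\<^sup>2) \<partial>?M) \<le> ennreal (((1/2)^j)\<^sup>2)"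
        by (auto simp: eventually_sequentially)
    qed simp
    finally have le: "(\<integral>\<^sup>+x. ennreal ((cmod (s n x - u x))\<^sup>2) \<partial>?M) \<le> ennreal (((1/2)^j)\<^sup>2)" .
    have m: "(\<lambda>x. s n x - u x) \<in> borel_measurable ?M"
      using L2_measurable[OF s] um by (intro borel_measurable_diff)
    show ?thesis using L2_norm_le_of_nn_integral[OF m le] by simp
  qed
  have "(\<lambda>x. s (N0 0) x - (s (N0 0) x - u x)) \<in> L2 U"
    by (rule L2ip.diff_mem[OF s conjunct1[OF key[OF order_refl]]])
  hence uL: "u \<in> L2 U" by simp
  have "(\<lambda>n. L2_norm U (\<lambda>x. s n x - u x)) \<longlonglongrightarrow> 0"
  proof (rule LIMSEQ_I)
    fix e :: real assume "e > 0"
    then obtain j where j: "(1/2)^j < e" using real_arch_pow_inv[of e "1/2"] by auto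
    have "norm (L2_norm U (\<lambda>x. s n x - u x) - 0) < e" if "n \<ge> N0 j" for n
      using le_less_trans[OF conjunct2[OF key[OF that]] j] by (simp only: diff_0_right real_norm_def abs_of_nonneg L2_norm_nonneg)
    thus "\<exists>no. \<forall>n\<ge>no. norm (L2_norm U (\<lambda>x. s n x - u x) - 0) < e" by blast
  qed
  thus ?thesis using uL by blast
qed

lemma L2_bounded_mult:
  assumes "u \<in> L2 U" "f \<in> borel_measurable (lebesgue_on U)" "\<And>x. x \<in> U \<Longrightarrow> cmod (f x) \<le> K"
  shows "(\<lambda>x. f x * u x) \<in> L2 U" "L2_norm U (\<lambda>x. f x * u x) \<le> K * L2_norm U u"
proof -
  have le: "(cmod (f x * u x))\<^sup>2 \<le> K\<^sup>2 * (cmod (u x))\<^sup>2" if "x \<in> U" for x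
    unfolding norm_mult power_mult_distrib using assms(3)[OF that]
    by (intro mult_right_mono power_mono) simp_all
  have int: "integrable (lebesgue_on U) (\<lambda>x. K\<^sup>2 * (cmod (u x))\<^sup>2)"
    by (intro integrable_mult_right L2_square_integrable assms(1))
  show fu: "(\<lambda>x. f x * u x) \<in> L2 U"
  proof (rule L2_dominated[OF _ int le])
    show "(\<lambda>x. f x * u x) \<in> borel_measurable (lebesgue_on U)"
      using assms L2_measurable by (intro borel_measurable_times) auto
  qed
  show "L2_norm U (\<lambda>x. f x * u x) \<le> K * L2_norm U u"
  \<comment> \<open>On the empty set the bound on f is vacuous and K may be negative; both norms are
    then zero.\<close>
  proof (cases "U = {}")
    case True
    thus ?thesis by (simp add: L2_norm_def)
  next
    case False
    hence K: "K \<ge> 0" using assms(3) norm_ge_zero order_trans by blast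
    have "(L2_norm U (\<lambda>x. f x * u x))\<^sup>2 \<le> (K * L2_norm U u)\<^sup>2"
      unfolding power_mult_distrib L2_norm_sq
      using integral_mono[OF L2_square_integrable[OF fu] int] le by simp
    thus ?thesis using K by (meson L2_norm_nonneg mult_nonneg_nonneg power2_le_imp_le)
  qed
qed

lemma L2_const_bounded:
  assumes "f \<in> borel_measurable (lebesgue_on U)" "U \<in> lmeasurable" "\<And>x. x \<in> U \<Longrightarrow> cmod (f x) \<le> K"
  shows "f \<in> L2 U"
proof (rule L2_dominated[OF assms(1), of "\<lambda>x. K\<^sup>2"])
  interpret finite_measure "lebesgue_on U" by (rule finite_measure_lebesgue_on[OF assms(2)])
  show "integrable (lebesgue_on U) (\<lambda>x. K\<^sup>2)" by simp
  show "(cmod (f x))\<^sup>2 \<le> K\<^sup>2" if "x \<in> U" for x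
    using assms(3)[OF that] by (intro power_mono) simp_all
qed

section \<open>Test functions and weak derivatives\<close>

text \<open>The class C^k on the real line. Derivatives are supplied as witnesses instead of by an
  operator, so that the differentiation rules combine directly in inductions on k.\<close>

primrec diff_times :: "nat \<Rightarrow> (real \<Rightarrow> real) \<Rightarrow> bool" where
  "diff_times 0 p \<longleftrightarrow> continuous_on UNIV p"
| "diff_times (Suc k) p \<longleftrightarrow> (\<exists>p'. (\<forall>t. (p has_real_derivative p' t) (at t)) \<and> diff_times k p')"

lemma diff_times_SucI:
  "(\<And>t. (p has_real_derivative p' t) (at t)) \<Longrightarrow> diff_times k p' \<Longrightarrow> diff_times (Suc k) p"
  by (simp, rule exI[of _ p']) simp

lemma diff_times_Suc_D: "diff_times (Suc k) p \<Longrightarrow> diff_times k p"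
proof (induction k arbitrary: p)
  case 0
  then obtain p' where "\<And>t. (p has_real_derivative p' t) (at t)" by auto
  thus ?case using DERIV_continuous_on[of UNIV p p'] by simp
next
  case (Suc k)
  then obtain p' where "\<forall>t. (p has_real_derivative p' t) (at t)" "diff_times (Suc k) p'" by auto
  thus ?case using Suc.IH[of p'] by auto
qed

lemma diff_times_add: "diff_times k p \<Longrightarrow> diff_times k q \<Longrightarrow> diff_times k (\<lambda>t. p t + q t)"
proof (induction k arbitrary: p q)
  case 0
  thus ?case by (auto intro: continuous_on_add)
next
  case (Suc k)
  then obtain p' q' where "\<forall>t. (p has_real_derivative p' t) (at t)" "diff_times k p'"
    "\<forall>t. (q has_real_derivative q' t) (at t)" "diff_times k q'" by auto
  thus ?case using Suc.IH[of p' q'] by (auto intro!: exI[of _ "\<lambda>t. p' t + q' t"] DERIV_add)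
qed

lemma diff_times_mult: "diff_times k p \<Longrightarrow> diff_times k q \<Longrightarrow> diff_times k (\<lambda>t. p t * q t)"
proof (induction k arbitrary: p q)
  case 0
  thus ?case by (auto intro: continuous_on_mult)
next
  case (Suc k)
  then obtain p' q' where p: "\<forall>t. (p has_real_derivative p' t) (at t)" "diff_times k p'"
    and q: "\<forall>t. (q has_real_derivative q' t) (at t)" "diff_times k q'" by auto
  have "diff_times k (\<lambda>t. p' t * q t + q' t * p t)"
    using Suc.IH[OF p(2) diff_times_Suc_D[OF Suc.prems(2)]]
      Suc.IH[OF q(2) diff_times_Suc_D[OF Suc.prems(1)]] by (rule diff_times_add)
  moreover have "((\<lambda>t. p t * q t) has_real_derivative p' t * q t + q' t * p t) (at t)" for t
    using DERIV_mult[OF p(1)[rule_format, of t] q(1)[rule_format, of t]] .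
  ultimately show ?case by (auto intro!: exI[of _ "\<lambda>t. p' t * q t + q' t * p t"])
qed

lemma diff_times_affine: "diff_times k p \<Longrightarrow> diff_times k (\<lambda>t. d * p (m * t + e))"
proof (induction k arbitrary: p d)
  case 0
  have "continuous_on UNIV (\<lambda>t. m * t + e)" by (intro continuous_intros)
  from continuous_on_compose2[OF 0[unfolded diff_times.simps] this]
  show ?case by (simp add: continuous_on_mult_left)
next
  case (Suc k)
  then obtain p' where p: "\<forall>t. (p has_real_derivative p' t) (at t)" "diff_times k p'" by auto
  have "((\<lambda>t. d * p (m * t + e)) has_real_derivative (d * m) * p' (m * t + e)) (at t)" for t
  proof -
    have "((\<lambda>t. p (m * t + e)) has_real_derivative p' (m * t + e) * m) (at t)"
      by (rule DERIV_chain2[OF p(1)[rule_format]]) (auto intro!: derivative_eq_intros)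
    from DERIV_cmult[OF this, of d] show ?thesis by (simp add: mult_ac)
  qed
  thus ?case by (rule diff_times_SucI) (rule Suc.IH[OF p(2)])
qed

text \<open>The classical flat function exp(-c/t), divided by all powers of t: this family is closed
  under differentiation up to linear combinations, so smoothness follows by one induction over all
  n.\<close>

definition flat_exp :: "nat \<Rightarrow> real \<Rightarrow> real \<Rightarrow> real" where
  "flat_exp n c t = (if t > 0 then exp (- c / t) / t ^ n else 0)"

text \<open>The inequality x <= exp x at x = c/(t(n+1)), raised to the power n+1, bounds exp(-c/t)
  by a multiple of t^(n+1). The remaining factor t gives decay at the origin, where
  differentiability has to be checked by hand.\<close>

lemma flat_exp_bound:
  assumes "c > 0"
  shows "\<exists>K\<ge>0. \<forall>t. \<bar>flat_exp n c t\<bar> \<le> K * \<bar>t\<bar>"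
proof (intro exI[of _ "(real (Suc n) / c) ^ Suc n"] conjI allI)
  fix t :: real
  show "\<bar>flat_exp n c t\<bar> \<le> (real (Suc n) / c) ^ Suc n * \<bar>t\<bar>"
  proof (cases "t > 0")
    case True
    define s where "s = c / t"
    have s: "s > 0" using True assms by (simp add: s_def)
    have "s / real (Suc n) \<le> exp (s / real (Suc n))"
      using exp_ge_add_one_self[of "s / real (Suc n)"] by linarith
    hence "(s / real (Suc n)) ^ Suc n \<le> exp (s / real (Suc n)) ^ Suc n"
      using s by (intro power_mono) auto
    also have "\<dots> = exp s" by (rule exp_divide_power_eq) simp
    finally have "exp (- s) \<le> inverse ((s / real (Suc n)) ^ Suc n)"
      using s by (simp add: exp_minus le_imp_inverse_le del: power_Suc)
    also have "\<dots> = (real (Suc n) / c * t) ^ Suc n"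
      using True assms unfolding power_inverse[symmetric] by (simp add: s_def field_simps del: power_Suc)
    also have "\<dots> = (real (Suc n) / c) ^ Suc n * t ^ Suc n"
      by (rule power_mult_distrib)
    finally have "exp (- c / t) / t ^ n \<le> (real (Suc n) / c) ^ Suc n * t ^ Suc n / t ^ n"
      using True by (intro divide_right_mono) (simp_all add: s_def)
    thus ?thesis using True by (simp add: flat_exp_def)
  next
    case False
    have "0 \<le> (real (Suc n) / c) ^ Suc n * \<bar>t\<bar>"
      using assms by (intro mult_nonneg_nonneg zero_le_power divide_nonneg_nonneg) auto
    thus ?thesis using False by (simp add: flat_exp_def del: power_Suc)
  qed
qed (use assms in simp)

lemma flat_exp_deriv:
  assumes "c > 0"
  shows "(flat_exp n c has_real_derivative c * flat_exp (n + 2) c t - real n * flat_exp (n + 1) c t) (at t)"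
proof (cases t "0 :: real" rule: linorder_cases)
  case less
  have "((\<lambda>t. 0) has_real_derivative 0) (at t)" by simp
  hence "(flat_exp n c has_real_derivative 0) (at t)"
    by (rule has_field_derivative_transform_within_open[of _ _ _ "{..<0}"]) (use less in \<open>auto simp: flat_exp_def\<close>)
  thus ?thesis using less by (simp add: flat_exp_def)
next
  case equal
  obtain K where K: "\<And>t. \<bar>flat_exp (n + 1) c t\<bar> \<le> K * \<bar>t\<bar>"
    using flat_exp_bound[OF assms, of "n + 1"] by blast
  \<comment> \<open>For h > 0 the difference quotient at 0 is \<open>flat_exp (n + 1) c h\<close>,
    for h < 0 it is 0; both are at most K |h|.\<close>
  have "((\<lambda>h. (flat_exp n c (0 + h) - flat_exp n c 0) / h) \<longlongrightarrow> 0) (at 0)"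
  proof (rule Lim_null_comparison)
    have "norm ((flat_exp n c (0 + h) - flat_exp n c 0) / h) \<le> K * \<bar>h\<bar>" for h
      using K[of h] by (auto simp: flat_exp_def abs_mult field_simps split: if_splits)
    thus "\<forall>\<^sub>F h in at 0. norm ((flat_exp n c (0 + h) - flat_exp n c 0) / h) \<le> K * \<bar>h\<bar>" by simp
    have "((\<lambda>h. K * \<bar>h\<bar>) \<longlongrightarrow> K * \<bar>0\<bar>) (at (0::real))" by (intro tendsto_intros)
    thus "((\<lambda>h. K * \<bar>h\<bar>) \<longlongrightarrow> 0) (at (0::real))" by simp
  qed
  thus ?thesis using equal by (simp add: DERIV_def flat_exp_def)
next
  case greater
  have "((\<lambda>t. exp (- c / t) / t ^ n) has_real_derivative c * (exp (- c / t) / t ^ (n + 2)) - real n * (exp (- c / t) / t ^ (n + 1))) (at t)"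
  proof -
    have e: "((\<lambda>t. exp (- c / t)) has_real_derivative exp (- c / t) * (c / t\<^sup>2)) (at t)"
      using greater by (auto intro!: derivative_eq_intros simp: power2_eq_square)
    have "real n * t ^ (n - Suc 0) = real n * t ^ n / t" using greater by (cases n) auto
    hence p: "((\<lambda>t. t ^ n) has_real_derivative real n * t ^ n / t) (at t)"
      using DERIV_pow[of n t UNIV] by simp
    have "(exp (- c / t) * (c / t\<^sup>2) * t ^ n - exp (- c / t) * (real n * t ^ n / t)) / (t ^ n * t ^ n)
        = c * (exp (- c / t) / t ^ (n + 2)) - real n * (exp (- c / t) / t ^ (n + 1))"
      using greater by (simp add: divide_simps power2_eq_square) (simp add: algebra_simps)
    thus ?thesis
      using DERIV_divide[OF e p] greater by simp
  qed
  hence "(flat_exp n c has_real_derivative c * (exp (- c / t) / t ^ (n + 2)) - real n * (exp (- c / t) / t ^ (n + 1))) (at t)"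
    by (rule has_field_derivative_transform_within_open[of _ _ _ "{0<..}"]) (use greater in \<open>auto simp: flat_exp_def\<close>)
  thus ?thesis using greater by (simp add: flat_exp_def)
qed

lemma diff_times_flat_exp: "c > 0 \<Longrightarrow> diff_times k (flat_exp n c)"
proof (induction k arbitrary: n)
  case 0
  show ?case using DERIV_continuous_on[OF flat_exp_deriv[OF 0, THEN has_field_derivative_at_within]] by simp
next
  case (Suc k)
  have "diff_times k (\<lambda>t. c * flat_exp (n + 2) c (1 * t + 0) + (- real n) * flat_exp (n + 1) c (1 * t + 0))"
    by (rule diff_times_add[OF diff_times_affine[OF Suc.IH[OF Suc.prems]] diff_times_affine[OF Suc.IH[OF Suc.prems]]])
  moreover have "(flat_exp n c has_real_derivative c * flat_exp (n + 2) c (1 * t + 0) + (- real n) * flat_exp (n + 1) c (1 * t + 0)) (at t)" for t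
    using flat_exp_deriv[OF Suc.prems, of n t] by simp
  ultimately show ?case by (intro diff_times_SucI)
qed

text \<open>As \<open>c \<rightarrow> 0\<close>, these functions converge boundedly to the indicator of \<open>(a, b)\<close>.\<close>

definition bump :: "real \<Rightarrow> real \<Rightarrow> real \<Rightarrow> real \<Rightarrow> real" where
  "bump c a b t = flat_exp 0 c (t - a) * flat_exp 0 c (b - t)"

lemma diff_times_bump: "c > 0 \<Longrightarrow> diff_times k (bump c a b)"
proof -
  assume c: "c > 0"
  have "diff_times k (\<lambda>t. (1 * flat_exp 0 c (1 * t + (- a))) * (1 * flat_exp 0 c ((-1) * t + b)))"
    by (rule diff_times_mult[OF diff_times_affine[OF diff_times_flat_exp[OF c]]
          diff_times_affine[OF diff_times_flat_exp[OF c]]])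
  thus ?thesis by (simp add: bump_def[abs_def])
qed

lemma bump_nonzero: "bump c a b t \<noteq> 0 \<longleftrightarrow> a < t \<and> t < b"
  by (auto simp: bump_def flat_exp_def)

lemma bump_bounds: "c > 0 \<Longrightarrow> 0 \<le> bump c a b t" "c > 0 \<Longrightarrow> bump c a b t \<le> 1"
  by (auto simp: bump_def flat_exp_def intro!: mult_le_one)

lemma bump_tendsto: "(\<lambda>n. bump (inverse (real (Suc n))) a b t) \<longlonglongrightarrow> indicator {a<..<b} t"
proof (cases "a < t \<and> t < b")
  case True
  have "(\<lambda>n. exp (- inverse (real (Suc n)) / (t - a)) * exp (- inverse (real (Suc n)) / (b - t)))
      \<longlonglongrightarrow> exp (- 0 / (t - a)) * exp (- 0 / (b - t))"
    using True by (intro tendsto_intros LIMSEQ_inverse_real_of_nat) auto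
  thus ?thesis using True by (simp add: bump_def flat_exp_def)
next
  case False
  have "bump (inverse (real (Suc n))) a b t = 0" for n using False bump_nonzero by blast
  thus ?thesis using False by (auto simp: indicator_def)
qed

section \<open>Tensor products of bumps as test functions in the plane\<close>

lemma Basis_point: "(Basis :: (real \<times> real) set) = {(1, 0), (0, 1)}"
  by (auto simp: Basis_prod_def)

lemma dpart_eq: "(f has_derivative D) (at x) \<Longrightarrow> dpart b f x = D b"
  unfolding dpart_def by (simp flip: frechet_derivative_at)

text \<open>A partial derivative of a tensor product is again a tensor product, so the induction
  runs over all pairs of factors at once.\<close>

lemma Ck_on_tensor:
  assumes "diff_times k P" "diff_times k Q"
  shows "Ck_on k UNIV (\<lambda>x :: real \<times> real. complex_of_real (P (fst x) * Q (snd x)))"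
  using assms
proof (induction k arbitrary: P Q)
  case 0
  hence "continuous_on UNIV P" "continuous_on UNIV Q" by simp_all
  hence "continuous_on UNIV (\<lambda>x :: real \<times> real. P (fst x))" "continuous_on UNIV (\<lambda>x :: real \<times> real. Q (snd x))"
    by (auto intro!: continuous_on_compose2[of UNIV P UNIV fst] continuous_on_compose2[of UNIV Q UNIV snd]
        continuous_on_fst continuous_on_snd continuous_on_id)
  thus ?case by (auto intro!: continuous_intros)
next
  case (Suc k)
  then obtain P' Q' where P: "\<And>t. (P has_real_derivative P' t) (at t)" "diff_times k P'"
    and Q: "\<And>t. (Q has_real_derivative Q' t) (at t)" "diff_times k Q'" by auto
  let ?f = "\<lambda>x :: real \<times> real. complex_of_real (P (fst x) * Q (snd x))"
  have d: "(?f has_derivative (\<lambda>h. complex_of_real (P (fst x) * (snd h * Q' (snd x)) + (fst h * P' (fst x)) * Q (snd x)))) (at x)" for x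
    by (intro has_derivative_of_real has_derivative_mult DERIV_compose_FDERIV P Q has_derivative_fst has_derivative_snd has_derivative_ident)
  have "dpart (1, 0) ?f = (\<lambda>x. complex_of_real (P' (fst x) * Q (snd x)))"
    "dpart (0, 1) ?f = (\<lambda>x. complex_of_real (P (fst x) * Q' (snd x)))"
    by (simp_all only: fun_eq_iff dpart_eq[OF d]) simp_all
  moreover have "?f differentiable_on UNIV"
    using d by (auto simp: differentiable_on_def differentiable_def intro: has_derivative_at_withinI)
  ultimately show ?case
    using Suc.IH[OF P(2) diff_times_Suc_D[OF Suc.prems(2)]] Suc.IH[OF diff_times_Suc_D[OF Suc.prems(1)] Q(2)]
    unfolding Ck_on.simps Basis_point by (simp only: ball_simps simp_thms)
qed

lemma box_point: "box (a1, a2) (b1, b2) = {a1<..<b1 :: real} \<times> {a2<..<b2 :: real}"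
  by (auto simp: box_def Basis_point inner_prod_def)

lemma cbox_point: "cbox (a1, a2) (b1, b2) = {a1..b1 :: real} \<times> {a2..b2 :: real}"
  by (auto simp: cbox_Pair_eq)

lemma bump_test_function:
  assumes "c > 0" "cbox (a1, a2) (b1, b2) \<subseteq> U"
  shows "(\<lambda>x. complex_of_real (bump c a1 b1 (fst x) * bump c a2 b2 (snd x))) \<in> test_functions U"
proof -
  let ?f = "\<lambda>x. complex_of_real (bump c a1 b1 (fst x) * bump c a2 b2 (snd x))"
  have "smooth ?f"
    unfolding smooth_def by (intro allI Ck_on_tensor diff_times_bump assms(1))
  moreover have sub: "closure {x. ?f x \<noteq> 0} \<subseteq> cbox (a1, a2) (b1, b2)"
    by (rule closure_minimal[OF _ closed_cbox]) (auto simp: bump_nonzero cbox_point)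
  moreover have "compact (closure {x. ?f x \<noteq> 0})"
    using sub compact_cbox compact_Int_closed[of "cbox (a1, a2) (b1, b2)" "closure {x. ?f x \<noteq> 0}"]
    by (simp add: Int_absorb1)
  ultimately show ?thesis using assms(2) by (auto simp: test_functions_def)
qed

section \<open>The fundamental lemma of the calculus of variations\<close>

lemma AE_zero_of_box_integrals_lborel:
  fixes f :: "'a::euclidean_space \<Rightarrow> real"
  assumes f: "integrable lborel f" and z: "\<And>a b. (LINT x:box a b|lborel. f x) = 0"
  shows "AE x in lborel. f x = 0"
proof (rule density_unique_real[OF f integrable_zero])
  \<comment> \<open>Open boxes form an intersection-stable generator of the Borel sets, so vanishing
    integrals extend from boxes to all Borel sets by a Dynkin argument; then f and 0 are densities
    with the same integrals.\<close>
  let ?G = "range (\<lambda>(a, b). box a b :: 'a set)"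
  have sets: "sets lborel = sigma_sets UNIV ?G" by (simp add: borel_eq_box)
  have si: "set_integrable lborel A f" if "A \<in> sets lborel" for A
    unfolding set_integrable_def by (rule integrable_mult_indicator[OF that f])
  \<comment> \<open>Complements in the Dynkin argument require the integral over the whole space,
    obtained by exhausting it with boxes.\<close>
  have tot: "(LINT x|lborel. f x) = 0"
  proof -
    have "(\<lambda>n. LINT x:box (- real n *\<^sub>R One) (real n *\<^sub>R One)|lborel. f x) \<longlonglongrightarrow> (LINT x|lborel. f x)"
      unfolding set_lebesgue_integral_def
    proof (rule integral_dominated_convergence[where w = "\<lambda>x. norm (f x)"])
      show "AE x in lborel. (\<lambda>n. indicat_real (box (- real n *\<^sub>R One) (real n *\<^sub>R One)) x *\<^sub>R f x) \<longlonglongrightarrow> f x"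
      proof (rule AE_I2)
        fix x :: 'a
        have "x \<in> (\<Union>i::nat. box (- (real i *\<^sub>R One)) (real i *\<^sub>R One))"
          unfolding UN_box_eq_UNIV by simp
        then obtain N where N: "x \<in> box (- real N *\<^sub>R One) (real N *\<^sub>R One)" by auto
        have "x \<in> box (- real n *\<^sub>R One) (real n *\<^sub>R One)" if "n \<ge> N" for n
          using N that by (fastforce simp: box_def)
        hence "\<forall>\<^sub>F n in sequentially. indicat_real (box (- real n *\<^sub>R One) (real n *\<^sub>R One)) x *\<^sub>R f x = f x"
          by (auto simp: eventually_sequentially indicator_def)
        thus "(\<lambda>n. indicat_real (box (- real n *\<^sub>R One) (real n *\<^sub>R One)) x *\<^sub>R f x) \<longlonglongrightarrow> f x"
          by (rule tendsto_eventually)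
      qed
    qed (use f in \<open>auto simp: indicator_def\<close>)
    thus ?thesis using z LIMSEQ_unique[OF _ tendsto_const] by simp
  qed
  fix A :: "'a set" assume "A \<in> sets lborel"
  hence A: "A \<in> sigma_sets UNIV ?G" by (simp only: sets)
  have "(LINT x:A|lborel. f x) = 0"
  proof (rule sigma_sets_induct_disjoint[OF _ _ A, where P = "\<lambda>A. (LINT x:A|lborel. f x) = 0"])
    show "Int_stable ?G" by (auto simp: Int_stable_def box_Int_box)
    show "?G \<subseteq> Pow UNIV" by simp
    show "(LINT x:A|lborel. f x) = 0" if "A \<in> ?G" for A using that z by auto
    show "(LINT x:{}|lborel. f x) = 0" by (simp add: set_lebesgue_integral_def)
    show "(LINT x:UNIV - A|lborel. f x) = 0" if "A \<in> sigma_sets UNIV ?G" "(LINT x:A|lborel. f x) = 0" for A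
    proof -
      have A: "A \<in> sets lborel" using that by (simp only: sets)
      have "(LINT x:UNIV - A \<union> A|lborel. f x) = (LINT x:UNIV - A|lborel. f x) + (LINT x:A|lborel. f x)"
        using A by (intro set_integral_Un si) auto
      thus ?thesis using that tot by (simp add: set_lebesgue_integral_def)
    qed
    show "(LINT x:\<Union> (range A)|lborel. f x) = 0"
      if "disjoint_family A" "range A \<subseteq> sigma_sets UNIV ?G" "\<And>i. (LINT x:A i|lborel. f x) = 0" for A :: "nat \<Rightarrow> 'a set"
    proof -
      have A: "A i \<in> sets lborel" for i using that(2) by (simp only: sets) blast
      have "(LINT x:\<Union> (range A)|lborel. f x) = (\<Sum>i. LINT x:A i|lborel. f x)"
        using that(1) A by (intro lebesgue_integral_countable_add si sets.countable_UN) (auto simp: disjoint_family_on_def)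
      thus ?thesis using that(3) by simp
    qed
  qed
  thus "(LINT x:A|lborel. f x) = (LINT x:A|lborel. 0)" by (simp add: set_lebesgue_integral_def)
qed

text \<open>A Borel function agreeing almost everywhere reduces the Lebesgue measurable case to the
  Borel one.\<close>

lemma AE_zero_of_box_integrals:
  fixes f :: "'a::euclidean_space \<Rightarrow> real"
  assumes f: "integrable lebesgue f" and z: "\<And>a b. (LINT x:box a b|lebesgue. f x) = 0"
  shows "AE x in lebesgue. f x = 0"
proof -
  obtain g where g: "g \<in> borel_measurable lborel" "AE x in lborel. f x = g x"
    using completion_ex_borel_measurable_real[OF borel_measurable_integrable[OF f]] by blast
  have ae: "AE x in lebesgue. f x = g x" by (rule AE_completion[OF g(2)])
  have gm: "g \<in> borel_measurable lebesgue" using g(1) by (rule measurable_completion)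
  have gi: "integrable lebesgue g"
    using f integrable_cong_AE[OF borel_measurable_integrable[OF f] gm ae] by simp
  have "AE x in lborel. g x = 0"
  proof (rule AE_zero_of_box_integrals_lborel)
    show "integrable lborel g" using gi integrable_completion[OF g(1)] by simp
    fix a b :: 'a
    have m: "(\<lambda>x. indicat_real (box a b) x *\<^sub>R g x) \<in> borel_measurable lborel" using g(1) by measurable
    have "(LINT x:box a b|lborel. g x) = (LINT x:box a b|lebesgue. g x)"
      unfolding set_lebesgue_integral_def by (rule integral_completion[OF m, symmetric])
    also have "\<dots> = (LINT x:box a b|lebesgue. f x)"
      unfolding set_lebesgue_integral_def
    proof (rule integral_cong_AE)
      show "(\<lambda>x. indicat_real (box a b) x *\<^sub>R g x) \<in> borel_measurable lebesgue"
        by (rule measurable_completion[OF m])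
      show "(\<lambda>x. indicat_real (box a b) x *\<^sub>R f x) \<in> borel_measurable lebesgue"
        using integrable_mult_indicator[OF _ f, of "box a b"] by (intro borel_measurable_integrable) simp
      show "AE x in lebesgue. indicat_real (box a b) x *\<^sub>R g x = indicat_real (box a b) x *\<^sub>R f x"
        using ae by eventually_elim simp
    qed
    finally show "(LINT x:box a b|lborel. g x) = 0" by (simp only: z)
  qed
  from AE_completion[OF this] ae show ?thesis by eventually_elim simp
qed

text \<open>Products of bumps are test functions bounded by 1 and converge to the indicator of the
  open box, so dominated convergence replaces test functions by boxes.\<close>

lemma fundamental_lemma_box:
  fixes g :: "real \<times> real \<Rightarrow> complex"
  assumes g: "integrable (lebesgue_on U) g" and sub: "cbox (a1, a2) (b1, b2) \<subseteq> U"
    and z: "\<And>\<phi>. \<phi> \<in> test_functions U \<Longrightarrow> (\<integral>x. g x * \<phi> x \<partial>lebesgue_on U) = 0"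
  shows "(\<integral>x. indicat_real (box (a1, a2) (b1, b2)) x *\<^sub>R g x \<partial>lebesgue_on U) = 0"
proof -
  define \<phi> where "\<phi> n x = complex_of_real (bump (inverse (real (Suc n))) a1 b1 (fst x) *
      bump (inverse (real (Suc n))) a2 b2 (snd x))" for n x
  have t: "\<phi> n \<in> test_functions U" for n
    unfolding \<phi>_def[abs_def] by (rule bump_test_function[OF _ sub]) simp
  have cont: "continuous_on UNIV (\<phi> n)" for n
  proof -
    have "Ck_on 0 UNIV (\<phi> n)" using t[of n] unfolding test_functions_def smooth_def by blast
    thus ?thesis by simp
  qed
  have phm: "\<phi> n \<in> borel_measurable (lebesgue_on U)" for n
    using borel_measurable_continuous_onI[OF cont[of n]]
    by (intro measurable_restrict_space1 measurable_completion) simp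
  have "(\<lambda>n. \<integral>x. g x * \<phi> n x \<partial>lebesgue_on U) \<longlonglongrightarrow>
      (\<integral>x. indicat_real (box (a1, a2) (b1, b2)) x *\<^sub>R g x \<partial>lebesgue_on U)"
  proof (rule integral_dominated_convergence[where w = "\<lambda>x. cmod (g x)"])
    show pm: "(\<lambda>x. g x * \<phi> n x) \<in> borel_measurable (lebesgue_on U)" for n
      by (intro borel_measurable_times borel_measurable_integrable[OF g] phm)
    have lim: "(\<lambda>n. g x * \<phi> n x) \<longlonglongrightarrow> indicat_real (box (a1, a2) (b1, b2)) x *\<^sub>R g x" for x
    proof -
      have "(\<lambda>n. g x * \<phi> n x) \<longlonglongrightarrow> g x * complex_of_real (indicator {a1<..<b1} (fst x) * indicator {a2<..<b2} (snd x))"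
        unfolding \<phi>_def by (intro tendsto_intros bump_tendsto)
      thus ?thesis by (cases x) (simp add: box_point indicator_times scaleR_conv_of_real mult.commute)
    qed
    show "(\<lambda>x. indicat_real (box (a1, a2) (b1, b2)) x *\<^sub>R g x) \<in> borel_measurable (lebesgue_on U)"
      by (rule borel_measurable_LIMSEQ_metric[OF pm lim])
    show "AE x in lebesgue_on U. (\<lambda>n. g x * \<phi> n x) \<longlonglongrightarrow> indicat_real (box (a1, a2) (b1, b2)) x *\<^sub>R g x"
      by (intro AE_I2 lim)
    show "integrable (lebesgue_on U) (\<lambda>x. cmod (g x))" by (rule integrable_norm[OF g])
    have "cmod (\<phi> n x) \<le> 1" for n x
      unfolding \<phi>_def norm_of_real abs_mult by (intro mult_le_one) (simp_all add: bump_bounds)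
    thus "AE x in lebesgue_on U. cmod (g x * \<phi> n x) \<le> cmod (g x)" for n
      by (intro AE_I2) (simp add: norm_mult mult_left_le)
  qed
  thus ?thesis using z[OF t] LIMSEQ_unique[OF _ tendsto_const] by simp
qed

lemma AE_zero_on_box:
  fixes g :: "real \<times> real \<Rightarrow> real"
  assumes g: "integrable lebesgue g" and U: "cbox a b \<subseteq> U"
    and z: "\<And>a b. cbox a b \<subseteq> U \<Longrightarrow> (\<integral>x. indicat_real (box a b) x *\<^sub>R g x \<partial>lebesgue) = 0"
  shows "AE x in lebesgue. x \<in> box a b \<longrightarrow> g x = 0"
proof -
  have "AE x in lebesgue. indicat_real (box a b) x *\<^sub>R g x = 0"
  proof (rule AE_zero_of_box_integrals)
    show "integrable lebesgue (\<lambda>x. indicat_real (box a b) x *\<^sub>R g x)"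
      by (rule integrable_mult_indicator[OF _ g]) simp
    fix c d
    obtain e f where ef: "box c d \<inter> box a b = box e f"
      using box_Int_box by blast
    have "(LINT x:box c d|lebesgue. indicat_real (box a b) x *\<^sub>R g x)
        = (\<integral>x. indicat_real (box e f) x *\<^sub>R g x \<partial>lebesgue)"
      unfolding set_lebesgue_integral_def ef[symmetric] by (simp add: indicator_inter_arith mult.assoc)
    also have "\<dots> = 0"
    proof (cases "box e f = {}")
      case True
      thus ?thesis by simp
    next
      case False
      \<comment> \<open>A nonempty open box has the corresponding closed box as its closure. Hence
        the intersection of any box with \<open>box a b\<close> still has its closed box inside U,
        where the hypothesis on integrals applies.\<close>
      hence "cbox e f = closure (box c d \<inter> box a b)" by (simp add: ef)
      also have "\<dots> \<subseteq> cbox a b" by (rule closure_minimal[OF _ closed_cbox]) (use box_subset_cbox in auto)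
      finally show ?thesis using U by (intro z) simp
    qed
    finally show "(LINT x:box c d|lebesgue. indicat_real (box a b) x *\<^sub>R g x) = 0" .
  qed
  thus ?thesis by eventually_elim (auto simp: indicator_def)
qed

text \<open>Boxes with closure in U are the only ones that test functions reach, so U is covered by
  countably many closed boxes. On the interior of each the real and imaginary parts vanish almost
  everywhere, and the faces are null sets.\<close>

theorem fundamental_lemma:
  fixes g :: "real \<times> real \<Rightarrow> complex"
  assumes U: "open U" and g: "integrable (lebesgue_on U) g"
    and z: "\<And>\<phi>. \<phi> \<in> test_functions U \<Longrightarrow> (\<integral>x. g x * \<phi> x \<partial>lebesgue_on U) = 0"
  shows "AE x in lebesgue_on U. g x = 0"
proof -
  have Um: "U \<in> sets lebesgue" "U \<inter> space lebesgue \<in> sets lebesgue" using U by simp_all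
  define G where "G x = indicat_real U x *\<^sub>R g x" for x
  have G: "integrable lebesgue G"
    using g unfolding G_def integrable_restrict_space[OF Um(2)] .
  have zG: "(\<integral>x. indicat_real (box a b) x *\<^sub>R G x \<partial>lebesgue) = 0" if "cbox a b \<subseteq> U" for a b
  proof -
    have "(\<integral>x. indicat_real (box a b) x *\<^sub>R G x \<partial>lebesgue) = (\<integral>x. indicat_real (box a b) x *\<^sub>R g x \<partial>lebesgue_on U)"
      unfolding integral_restrict_space[OF Um(2)] G_def by (simp add: mult.commute)
    also have "\<dots> = 0"
      using fundamental_lemma_box[OF g _ z, of "fst a" "snd a" "fst b" "snd b"] that by (simp only: prod.collapse)
    finally show ?thesis .
  qed
  have ind: "integrable lebesgue (\<lambda>x. indicat_real (box a b) x *\<^sub>R G x)" for a b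
    by (rule integrable_mult_indicator[OF _ G]) simp
  have zRe: "(\<integral>x. indicat_real (box a b) x *\<^sub>R Re (G x) \<partial>lebesgue) = 0"
    and zIm: "(\<integral>x. indicat_real (box a b) x *\<^sub>R Im (G x) \<partial>lebesgue) = 0" if "cbox a b \<subseteq> U" for a b
    using integral_Re[OF ind[of a b]] integral_Im[OF ind[of a b]] zG[OF that] by simp_all
  obtain \<D> where D: "countable \<D>" "\<And>X. X \<in> \<D> \<Longrightarrow> X \<subseteq> U \<and> (\<exists>a b. X = cbox a b)" "\<Union>\<D> = U"
    using open_countable_Union_open_cbox[OF U] by (metis Pow_iff subset_iff)
  have "AE x in lebesgue. \<forall>X\<in>\<D>. x \<in> X \<longrightarrow> G x = 0"
  proof (rule AE_ball_countable'[OF _ D(1)])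
    fix X assume "X \<in> \<D>"
    then obtain a b where X: "X = cbox a b" "cbox a b \<subseteq> U" using D(2) by blast
    have 1: "AE x in lebesgue. x \<in> box a b \<longrightarrow> Re (G x) = 0"
      by (rule AE_zero_on_box[OF integrable_Re[OF G] X(2) zRe])
    have 2: "AE x in lebesgue. x \<in> box a b \<longrightarrow> Im (G x) = 0"
      by (rule AE_zero_on_box[OF integrable_Im[OF G] X(2) zIm])
    have "negligible (cbox a b - box a b)" by (rule negligible_frontier_interval)
    hence 3: "AE x in lebesgue. x \<notin> cbox a b - box a b"
      unfolding negligible_iff_null_sets by (rule AE_not_in)
    show "AE x in lebesgue. x \<in> X \<longrightarrow> G x = 0"
      using 1 2 3 by eventually_elim (auto simp: X complex_eq_iff)
  qed
  hence "AE x in lebesgue. x \<in> U \<longrightarrow> g x = 0"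
    by eventually_elim (metis D(3) G_def UnionE indicator_simps(1) scaleR_one)
  thus ?thesis by (simp add: AE_restrict_space_iff[OF Um(2)])
qed

section \<open>Calculus of smooth functions of two variables\<close>

lemma dpart_lin:
  assumes "f differentiable (at x)" "g differentiable (at x)"
  shows "dpart b (\<lambda>x. f x + c * g x) x = dpart b f x + c * dpart b g x"
proof -
  have "(f has_derivative frechet_derivative f (at x)) (at x)"
    "(g has_derivative frechet_derivative g (at x)) (at x)"
    using assms by (simp_all add: frechet_derivative_works)
  hence "((\<lambda>x. f x + c * g x) has_derivative
      (\<lambda>h. frechet_derivative f (at x) h + c * frechet_derivative g (at x) h)) (at x)"
    by (intro has_derivative_add has_derivative_mult_right)
  from dpart_eq[OF this, of b] show ?thesis by (simp add: dpart_def)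
qed

lemma Ck_on_lin: "Ck_on k UNIV f \<Longrightarrow> Ck_on k UNIV g \<Longrightarrow> Ck_on k UNIV (\<lambda>x. f x + c * g x)"
proof (induction k arbitrary: f g)
  case 0
  thus ?case by (auto intro!: continuous_intros)
next
  case (Suc k)
  have df: "f differentiable (at x)" "g differentiable (at x)" for x
    using Suc.prems by (simp_all add: differentiable_on_def)
  have "dpart b (\<lambda>x. f x + c * g x) = (\<lambda>x. dpart b f x + c * dpart b g x)" for b
    by (rule ext) (rule dpart_lin[OF df])
  moreover have "Ck_on k UNIV (\<lambda>x. dpart b f x + c * dpart b g x)" if "b \<in> Basis" for b
    using Suc.prems that by (intro Suc.IH) auto
  moreover have "(\<lambda>x. f x + c * g x) differentiable_on UNIV"
    using df by (simp add: differentiable_on_def)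
  ultimately show ?case by simp
qed

lemma smooth_lin: "smooth f \<Longrightarrow> smooth g \<Longrightarrow> smooth (\<lambda>x. f x + c * g x)"
  by (simp add: smooth_def Ck_on_lin)

lemma smooth_continuous: "smooth w \<Longrightarrow> continuous_on UNIV w"
proof -
  assume "smooth w"
  hence "Ck_on 0 UNIV w" by (simp only: smooth_def)
  thus ?thesis by simp
qed

lemma smooth_C1:
  assumes "smooth w"
  shows "w differentiable (at x)" "b \<in> Basis \<Longrightarrow> continuous_on UNIV (dpart b w)"
proof -
  have "Ck_on (Suc 0) UNIV w" using assms by (simp only: smooth_def)
  thus "w differentiable (at x)" "b \<in> Basis \<Longrightarrow> continuous_on UNIV (dpart b w)"
    by (auto simp: differentiable_on_def)
qed

lemma smooth_has_derivative:
  fixes w :: "real \<times> real \<Rightarrow> complex"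
  assumes "smooth w"
  shows "(w has_derivative (\<lambda>h. fst h *\<^sub>R dpart (1, 0) w x + snd h *\<^sub>R dpart (0, 1) w x)) (at x)"
proof -
  let ?D = "frechet_derivative w (at x)"
  have d: "(w has_derivative ?D) (at x)"
    using smooth_C1(1)[OF assms] by (simp add: frechet_derivative_works)
  have l: "linear ?D" by (rule has_derivative_linear[OF d])
  have "?D h = fst h *\<^sub>R dpart (1, 0) w x + snd h *\<^sub>R dpart (0, 1) w x" for h
  proof -
    have "h = fst h *\<^sub>R (1, 0) + snd h *\<^sub>R (0, 1)" by (cases h) simp
    hence "?D h = ?D (fst h *\<^sub>R (1, 0) + snd h *\<^sub>R (0, 1))" by simp
    also have "\<dots> = fst h *\<^sub>R ?D (1, 0) + snd h *\<^sub>R ?D (0, 1)"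
      by (simp only: linear_add[OF l] linear_scale[OF l])
    finally show ?thesis by (simp only: dpart_def)
  qed
  hence "?D = (\<lambda>h. fst h *\<^sub>R dpart (1, 0) w x + snd h *\<^sub>R dpart (0, 1) w x)" by blast
  thus ?thesis using d by simp
qed

lemma partial_vector_derivative:
  fixes f :: "real \<times> real \<Rightarrow> complex"
  assumes "\<And>x. (f has_derivative (\<lambda>h. fst h *\<^sub>R p x + snd h *\<^sub>R q x)) (at x)"
  shows "((\<lambda>t. f (t, y)) has_vector_derivative p (t, y)) (at t within S)"
    and "((\<lambda>t. f (y, t)) has_vector_derivative q (y, t)) (at t within S)"
proof -
  have 1: "((\<lambda>t. (t, y)) has_derivative (\<lambda>h. (h, 0))) (at t within S)"
    and 2: "((\<lambda>t. (y, t)) has_derivative (\<lambda>h. (0, h))) (at t within S)"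
    by (auto intro!: derivative_eq_intros)
  show "((\<lambda>t. f (t, y)) has_vector_derivative p (t, y)) (at t within S)"
    using has_derivative_compose[OF 1 assms] by (simp add: has_vector_derivative_def)
  show "((\<lambda>t. f (y, t)) has_vector_derivative q (y, t)) (at t within S)"
    using has_derivative_compose[OF 2 assms] by (simp add: has_vector_derivative_def)
qed

text \<open>The order of integration is chosen so that the inner integral runs in the direction of
  the derivative; it is then a difference of two values of f on the sides of the box, where f
  vanishes.\<close>

lemma integral_derivative_zero:
  fixes f :: "real \<times> real \<Rightarrow> complex"
  assumes d: "\<And>x. (f has_derivative (\<lambda>h. fst h *\<^sub>R p x + snd h *\<^sub>R q x)) (at x)"
    and c: "continuous_on UNIV p" "continuous_on UNIV q"
    and z: "\<And>x. x \<notin> box (a1, a2) (b1, b2) \<Longrightarrow> f x = 0" and le: "a1 \<le> b1" "a2 \<le> b2"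
  shows "integral (cbox (a1, a2) (b1, b2)) p = 0" "integral (cbox (a1, a2) (b1, b2)) q = 0"
proof -
  have ftc1: "integral {a1..b1} (\<lambda>t. p (t, y)) = 0" for y
  proof -
    have "((\<lambda>t. p (t, y)) has_integral f (b1, y) - f (a1, y)) {a1..b1}"
      by (intro fundamental_theorem_of_calculus le partial_vector_derivative[OF d])
    thus ?thesis using z[of "(b1, y)"] z[of "(a1, y)"] by (simp add: box_point integral_unique)
  qed
  have ftc2: "integral {a2..b2} (\<lambda>t. q (y, t)) = 0" for y
  proof -
    have "((\<lambda>t. q (y, t)) has_integral f (y, b2) - f (y, a2)) {a2..b2}"
      by (intro fundamental_theorem_of_calculus le partial_vector_derivative[OF d])
    thus ?thesis using z[of "(y, b2)"] z[of "(y, a2)"] by (simp add: box_point integral_unique)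
  qed
  have cp: "continuous_on (cbox (a1, a2) (b1, b2)) p" "continuous_on (cbox (a1, a2) (b1, b2)) q"
    using c continuous_on_subset by blast+
  have "integral (cbox (a1, a2) (b1, b2)) p = integral (cbox a1 b1) (\<lambda>x. integral (cbox a2 b2) (\<lambda>y. p (x, y)))"
    by (rule integral_prod_continuous[OF cp(1)])
  also have "\<dots> = integral (cbox a2 b2) (\<lambda>y. integral (cbox a1 b1) (\<lambda>x. p (x, y)))"
    by (rule integral_swap_continuous) (use cp(1) in \<open>simp add: case_prod_unfold\<close>)
  finally show "integral (cbox (a1, a2) (b1, b2)) p = 0" using ftc1 by simp
  show "integral (cbox (a1, a2) (b1, b2)) q = 0"
    using integral_prod_continuous[OF cp(2)] ftc2 by simp
qed

lemma continuous_compact_support_integral: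
  fixes f :: "real \<times> real \<Rightarrow> complex"
  assumes U: "U \<in> sets lebesgue" and c: "continuous_on UNIV f"
    and K: "\<And>x. f x \<noteq> 0 \<Longrightarrow> x \<in> K" "K \<subseteq> U" "K \<subseteq> cbox a b"
  shows "integrable (lebesgue_on U) f" "(\<integral>x. f x \<partial>lebesgue_on U) = integral (cbox a b) f"
proof -
  have eq: "(\<lambda>x. indicat_real U x *\<^sub>R f x) = (\<lambda>x. indicat_real (cbox a b) x *\<^sub>R f x)"
    using K by (fastforce simp: indicator_def fun_eq_iff)
  have U': "U \<inter> space lebesgue \<in> sets lebesgue" "cbox a b \<inter> space lebesgue \<in> sets lebesgue"
    using U by simp_all
  have i: "integrable (lebesgue_on (cbox a b)) f"
    by (rule continuous_imp_integrable[OF continuous_on_subset[OF c subset_UNIV]])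
  show "integrable (lebesgue_on U) f"
    using i unfolding integrable_restrict_space[OF U'(1)] integrable_restrict_space[OF U'(2)] eq .
  have "(\<integral>x. f x \<partial>lebesgue_on U) = (\<integral>x. f x \<partial>lebesgue_on (cbox a b))"
    unfolding integral_restrict_space[OF U'(1)] integral_restrict_space[OF U'(2)] eq ..
  also have "\<dots> = integral (cbox a b) f" by (rule lebesgue_integral_eq_integral[OF i]) simp
  finally show "(\<integral>x. f x \<partial>lebesgue_on U) = integral (cbox a b) f" .
qed

lemma L2_mult_tendsto:
  assumes s: "\<And>n. s n \<in> L2 U" and u: "u \<in> L2 U" and p: "p \<in> L2 U"
    and lim: "(\<lambda>n. L2_norm U (\<lambda>x. s n x - u x)) \<longlonglongrightarrow> 0"
  shows "(\<lambda>n. \<integral>x. s n x * p x \<partial>lebesgue_on U) \<longlonglongrightarrow> (\<integral>x. u x * p x \<partial>lebesgue_on U)"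
proof -
  let ?q = "\<lambda>x. cnj (p x)"
  have q: "?q \<in> L2 U" by (rule L2_cnj[OF p])
  have le: "cmod ((\<integral>x. s n x * p x \<partial>lebesgue_on U) - (\<integral>x. u x * p x \<partial>lebesgue_on U))
      \<le> L2_norm U (\<lambda>x. s n x - u x) * L2_norm U ?q" for n
    using L2ip.Cauchy_Schwarz[OF L2ip.diff_mem[OF s u] q, of n] L2ip.ip_diff[OF s u q, of n] by simp
  have "(\<lambda>n. (\<integral>x. s n x * p x \<partial>lebesgue_on U) - (\<integral>x. u x * p x \<partial>lebesgue_on U)) \<longlonglongrightarrow> 0"
    by (rule Lim_null_comparison[OF always_eventually[OF allI[OF le]]])
      (rule tendsto_mult_left_zero[OF lim])
  thus ?thesis by (rule LIM_zero_cancel)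
qed

lemma continuous_L2_bounded:
  fixes f :: "'a::euclidean_space \<Rightarrow> complex"
  assumes "continuous_on UNIV f" "bounded U" "U \<in> lmeasurable"
  shows "f \<in> L2 U"
proof -
  have "compact (f ` closure U)"
    using assms by (intro compact_continuous_image continuous_on_subset[OF assms(1)]) auto
  from compact_imp_bounded[OF this] obtain K where K: "\<And>y. y \<in> f ` closure U \<Longrightarrow> cmod y \<le> K"
    unfolding bounded_iff by meson
  show ?thesis
  proof (rule L2_const_bounded[OF _ assms(3)])
    show "f \<in> borel_measurable (lebesgue_on U)"
      using borel_measurable_continuous_onI[OF assms(1)]
      by (intro measurable_restrict_space1 measurable_completion) simp
    show "cmod (f x) \<le> K" if "x \<in> U" for x
      by (rule K[OF imageI[OF subsetD[OF closure_subset that]]])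
  qed
qed

section \<open>Weak derivatives and the Sobolev space on a bounded open set\<close>

locale bounded_domain =
  fixes U :: "(real \<times> real) set"
  assumes open_dom: "open U" and bounded_dom: "bounded U"
begin

lemma dom_lmeasurable: "U \<in> lmeasurable"
  by (rule bounded_set_imp_lmeasurable) (use open_dom bounded_dom in auto)

lemma smooth_L2: "smooth w \<Longrightarrow> w \<in> L2 U" "smooth w \<Longrightarrow> b \<in> Basis \<Longrightarrow> dpart b w \<in> L2 U"
  by (rule continuous_L2_bounded[OF smooth_continuous bounded_dom dom_lmeasurable], assumption)
    (rule continuous_L2_bounded[OF smooth_C1(2) bounded_dom dom_lmeasurable])

lemma L2_integrable: "g \<in> L2 U \<Longrightarrow> integrable (lebesgue_on U) g"
proof -
  assume g: "g \<in> L2 U"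
  have "(\<lambda>x. 1) \<in> L2 U" by (rule L2_const_bounded[OF _ dom_lmeasurable, of _ 1]) auto
  from L2_integrable_mult[OF g this] show ?thesis by simp
qed

text \<open>Integration by parts without boundary terms: the product of w and the test function
  vanishes off a compact subset K of U. Its partial derivatives therefore integrate to zero over a
  square around K, and the product rule splits this integral. U itself may have any shape.\<close>

lemma smooth_weak_deriv:
  assumes w: "smooth w" and b: "b \<in> Basis"
  shows "has_weak_deriv U b w (dpart b w)"
  unfolding has_weak_deriv_def
proof
  fix \<phi> assume t: "\<phi> \<in> test_functions U"
  define K where "K = closure {x. \<phi> x \<noteq> 0}"
  have ph: "smooth \<phi>" and K: "compact K" "K \<subseteq> U"
    using t by (auto simp: test_functions_def K_def)
  obtain a0 where a0: "K \<subseteq> box (- a0) a0"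
    using compact_imp_bounded[OF K(1)] bounded_subset_box_symmetric by blast
  obtain a1 a2 where a: "a0 = (a1, a2)" by (cases a0)
  define r where "r = max \<bar>a1\<bar> \<bar>a2\<bar>"
  have sub: "K \<subseteq> box (- r, - r) (r, r)" "r \<ge> 0"
  proof -
    show "K \<subseteq> box (- r, - r) (r, r)"
    proof
      fix x assume "x \<in> K"
      hence "x \<in> box (- a1, - a2) (a1, a2)" using a0 by (auto simp: a)
      thus "x \<in> box (- r, - r) (r, r)" by (auto simp: box_point r_def)
    qed
  qed (simp add: r_def)
  have Kc: "K \<subseteq> cbox (- r, - r) (r, r)" using sub(1) box_subset_cbox by blast
  let ?f = "\<lambda>x. w x * \<phi> x"
  let ?h = "\<lambda>b x. w x * dpart b \<phi> x + dpart b w x * \<phi> x"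
  have cont: "continuous_on UNIV w" "continuous_on UNIV \<phi>" "b \<in> Basis \<Longrightarrow> continuous_on UNIV (dpart b w)"
    "b \<in> Basis \<Longrightarrow> continuous_on UNIV (dpart b \<phi>)" for b
    by (rule smooth_continuous[OF w] smooth_continuous[OF ph] smooth_C1(2)[OF w] smooth_C1(2)[OF ph]; assumption)+
  have z: "\<phi> x = 0" "dpart b \<phi> x = 0" if x: "x \<notin> K" for b x
  proof -
    show "\<phi> x = 0" using x closure_subset[of "{x. \<phi> x \<noteq> 0}"] by (auto simp: K_def)
    \<comment> \<open>The complement of K is open, so near x the test function is identically zero
      and its derivatives vanish too.\<close>
    have "((\<lambda>x. 0) has_derivative (\<lambda>h. 0)) (at x)" by simp
    hence "(\<phi> has_derivative (\<lambda>h. 0)) (at x)"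
    proof (rule has_derivative_transform_within_open)
      show "open (- K)" "x \<in> - K" using x K(1) by (auto simp: compact_imp_closed open_Compl)
      show "0 = \<phi> y" if "y \<in> - K" for y
        using that closure_subset[of "{x. \<phi> x \<noteq> 0}"] by (auto simp: K_def)
    qed
    thus "dpart b \<phi> x = 0" by (rule dpart_eq)
  qed
  have d: "(?f has_derivative (\<lambda>h. fst h *\<^sub>R ?h (1, 0) x + snd h *\<^sub>R ?h (0, 1) x)) (at x)" for x
    by (rule has_derivative_eq_rhs[OF has_derivative_mult[OF smooth_has_derivative[OF w] smooth_has_derivative[OF ph]]])
      (simp add: fun_eq_iff algebra_simps scaleR_conv_of_real)
  have hc: "continuous_on UNIV (?h b)" if "b \<in> Basis" for b
    using cont that by (intro continuous_intros) auto
  have "integral (cbox (- r, - r) (r, r)) (?h b) = 0"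
  proof -
    have f0: "?f x = 0" if "x \<notin> box (- r, - r) (r, r)" for x using z(1)[of x] sub(1) that by auto
    have le: "- r \<le> r" using sub by simp
    have "(1, 0) \<in> (Basis :: (real \<times> real) set)" "(0, 1) \<in> (Basis :: (real \<times> real) set)" by (simp_all add: Basis_point)
    from integral_derivative_zero[OF d hc[OF this(1)] hc[OF this(2)] f0 le le] b
    show ?thesis by (auto simp: Basis_point)
  qed
  moreover have "(\<integral>x. ?h b x \<partial>lebesgue_on U) = integral (cbox (- r, - r) (r, r)) (?h b)"
  proof (rule continuous_compact_support_integral(2)[OF _ hc[OF b] _ K(2) Kc])
    show "U \<in> sets lebesgue" using open_dom by simp
    show "x \<in> K" if "?h b x \<noteq> 0" for x
    proof (rule ccontr)
      assume "x \<notin> K"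
      from z[OF this] that show False by simp
    qed
  qed
  moreover have "(\<integral>x. ?h b x \<partial>lebesgue_on U) =
      (\<integral>x. w x * dpart b \<phi> x \<partial>lebesgue_on U) + (\<integral>x. dpart b w x * \<phi> x \<partial>lebesgue_on U)"
    using w ph b by (intro Bochner_Integration.integral_add L2_integrable_mult smooth_L2)
  ultimately show "(\<integral>x. w x * dpart b \<phi> x \<partial>lebesgue_on U) = - (\<integral>x. dpart b w x * \<phi> x \<partial>lebesgue_on U)"
    by (simp add: eq_neg_iff_add_eq_0)
qed

lemma test_smooth: "\<phi> \<in> test_functions U \<Longrightarrow> smooth \<phi>"
  by (simp add: test_functions_def)

text \<open>The difference of two weak derivatives annihilates all test functions. Since
  \<open>weak_deriv\<close> is a choice, this is what ties it to any derivative computed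
  explicitly.\<close>

lemma weak_deriv_unique:
  assumes g: "g \<in> L2 U" "g' \<in> L2 U" and "has_weak_deriv U b u g" "has_weak_deriv U b u g'"
  shows "AE x in lebesgue_on U. g x = g' x"
proof -
  have "AE x in lebesgue_on U. g x - g' x = 0"
  proof (rule fundamental_lemma[OF open_dom L2_integrable[OF L2ip.diff_mem[OF g]]])
    fix \<phi> assume t: "\<phi> \<in> test_functions U"
    have ph: "\<phi> \<in> L2 U" by (rule smooth_L2(1)[OF test_smooth[OF t]])
    have "(\<integral>x. (g x - g' x) * \<phi> x \<partial>lebesgue_on U) = (\<integral>x. g x * \<phi> x \<partial>lebesgue_on U) - (\<integral>x. g' x * \<phi> x \<partial>lebesgue_on U)"
      unfolding left_diff_distrib by (intro Bochner_Integration.integral_diff L2_integrable_mult g ph)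
    also have "\<dots> = 0" using assms(3,4) t by (auto simp: has_weak_deriv_def)
    finally show "(\<integral>x. (g x - g' x) * \<phi> x \<partial>lebesgue_on U) = 0" .
  qed
  thus ?thesis by eventually_elim simp
qed

lemma has_weak_deriv_lin:
  assumes L: "u \<in> L2 U" "v \<in> L2 U" "g \<in> L2 U" "k \<in> L2 U" and b: "b \<in> Basis"
    and w: "has_weak_deriv U b u g" "has_weak_deriv U b v k"
  shows "has_weak_deriv U b (\<lambda>x. u x + c * v x) (\<lambda>x. g x + c * k x)"
  unfolding has_weak_deriv_def
proof
  fix \<phi> assume t: "\<phi> \<in> test_functions U"
  have split: "(\<integral>x. (f x + c * h x) * p x \<partial>lebesgue_on U)
      = (\<integral>x. f x * p x \<partial>lebesgue_on U) + c * (\<integral>x. h x * p x \<partial>lebesgue_on U)"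
    if "f \<in> L2 U" "h \<in> L2 U" "p \<in> L2 U" for f h p
    using L2ip.ip_lin[OF that(1,2) L2_cnj[OF that(3)], of c] by simp
  have ph: "\<phi> \<in> L2 U" "dpart b \<phi> \<in> L2 U" using smooth_L2[OF test_smooth[OF t]] b by auto
  show "(\<integral>x. (u x + c * v x) * dpart b \<phi> x \<partial>lebesgue_on U) = - (\<integral>x. (g x + c * k x) * \<phi> x \<partial>lebesgue_on U)"
    unfolding split[OF L(1,2) ph(2)] split[OF L(3,4) ph(1)]
    using w t by (simp add: has_weak_deriv_def algebra_simps)
qed

text \<open>The weak derivative is a closed operator: for a fixed test function both sides of its
  definition are continuous in the L2 norm.\<close>

lemma has_weak_deriv_limit:
  assumes s: "\<And>n. s n \<in> L2 U" "u \<in> L2 U" "(\<lambda>n. L2_norm U (\<lambda>x. s n x - u x)) \<longlonglongrightarrow> 0"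
    and g: "\<And>n. g n \<in> L2 U" "k \<in> L2 U" "(\<lambda>n. L2_norm U (\<lambda>x. g n x - k x)) \<longlonglongrightarrow> 0"
    and w: "\<And>n. has_weak_deriv U b (s n) (g n)" and b: "b \<in> Basis"
  shows "has_weak_deriv U b u k"
  unfolding has_weak_deriv_def
proof
  fix \<phi> assume t: "\<phi> \<in> test_functions U"
  have ph: "\<phi> \<in> L2 U" "dpart b \<phi> \<in> L2 U" using smooth_L2[OF test_smooth[OF t]] b by auto
  have 1: "(\<lambda>n. \<integral>x. s n x * dpart b \<phi> x \<partial>lebesgue_on U) \<longlonglongrightarrow> (\<integral>x. u x * dpart b \<phi> x \<partial>lebesgue_on U)"
    by (rule L2_mult_tendsto[OF s(1,2) ph(2) s(3)])
  have "(\<lambda>n. - (\<integral>x. g n x * \<phi> x \<partial>lebesgue_on U)) \<longlonglongrightarrow> - (\<integral>x. k x * \<phi> x \<partial>lebesgue_on U)"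
    by (rule tendsto_minus[OF L2_mult_tendsto[OF g(1,2) ph(1) g(3)]])
  moreover have "- (\<integral>x. g n x * \<phi> x \<partial>lebesgue_on U) = (\<integral>x. s n x * dpart b \<phi> x \<partial>lebesgue_on U)" for n
    using w[of n] t by (simp add: has_weak_deriv_def)
  ultimately show "(\<integral>x. u x * dpart b \<phi> x \<partial>lebesgue_on U) = - (\<integral>x. k x * \<phi> x \<partial>lebesgue_on U)"
    using 1 LIMSEQ_unique by simp
qed

lemma weak_deriv_spec:
  assumes "u \<in> H1 U" "b \<in> Basis"
  shows "weak_deriv U b u \<in> L2 U" "has_weak_deriv U b u (weak_deriv U b u)"
proof -
  have "\<exists>g. g \<in> L2 U \<and> has_weak_deriv U b u g" using assms by (auto simp: H1_def)
  from someI_ex[OF this]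
  show "weak_deriv U b u \<in> L2 U" "has_weak_deriv U b u (weak_deriv U b u)"
    by (simp_all add: weak_deriv_def)
qed

lemma weak_deriv_AE:
  assumes "u \<in> H1 U" "b \<in> Basis" "g \<in> L2 U" "has_weak_deriv U b u g"
  shows "AE x in lebesgue_on U. weak_deriv U b u x = g x"
  using weak_deriv_unique[OF weak_deriv_spec(1)[OF assms(1,2)] assms(3) weak_deriv_spec(2)[OF assms(1,2)] assms(4)] .

lemma H1_imp_L2: "u \<in> H1 U \<Longrightarrow> u \<in> L2 U"
  by (simp add: H1_def)

lemma smooth_H1: "smooth w \<Longrightarrow> w \<in> H1 U"
  unfolding H1_def using smooth_L2 smooth_weak_deriv by blast

lemma weak_deriv_smooth:
  "smooth w \<Longrightarrow> b \<in> Basis \<Longrightarrow> AE x in lebesgue_on U. weak_deriv U b w x = dpart b w x"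
  by (intro weak_deriv_AE smooth_H1 smooth_L2 smooth_weak_deriv)

lemma H1_I: "u \<in> L2 U \<Longrightarrow> (\<And>b. b \<in> Basis \<Longrightarrow> g b \<in> L2 U \<and> has_weak_deriv U b u (g b)) \<Longrightarrow> u \<in> H1 U"
  unfolding H1_def by blast

lemma H1_lin:
  assumes "u \<in> H1 U" "v \<in> H1 U"
  shows "(\<lambda>x. u x + c * v x) \<in> H1 U"
proof (rule H1_I[where g = "\<lambda>b x. weak_deriv U b u x + c * weak_deriv U b v x"])
  show "(\<lambda>x. u x + c * v x) \<in> L2 U" by (intro L2_lin H1_imp_L2 assms)
  fix b :: "real \<times> real" assume b: "b \<in> Basis"
  note D = weak_deriv_spec[OF assms(1) b] weak_deriv_spec[OF assms(2) b]
  show "(\<lambda>x. weak_deriv U b u x + c * weak_deriv U b v x) \<in> L2 U \<and>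
      has_weak_deriv U b (\<lambda>x. u x + c * v x) (\<lambda>x. weak_deriv U b u x + c * weak_deriv U b v x)"
    using L2_lin[OF D(1,3)] has_weak_deriv_lin[OF H1_imp_L2[OF assms(1)] H1_imp_L2[OF assms(2)] D(1,3) b D(2,4)] by blast
qed

lemma weak_deriv_lin:
  assumes "u \<in> H1 U" "v \<in> H1 U" "b \<in> Basis"
  shows "AE x in lebesgue_on U. weak_deriv U b (\<lambda>x. u x + c * v x) x = weak_deriv U b u x + c * weak_deriv U b v x"
proof -
  note D = weak_deriv_spec[OF assms(1,3)] weak_deriv_spec[OF assms(2,3)]
  show ?thesis
    by (rule weak_deriv_AE[OF H1_lin[OF assms(1,2)] assms(3) L2_lin[OF D(1,3)]
          has_weak_deriv_lin[OF H1_imp_L2[OF assms(1)] H1_imp_L2[OF assms(2)] D(1,3) assms(3) D(2,4)]])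
qed

definition H1_ip :: "(real \<times> real \<Rightarrow> complex) \<Rightarrow> (real \<times> real \<Rightarrow> complex) \<Rightarrow> complex" where
  "H1_ip u v = (\<integral>x. u x * cnj (v x) \<partial>lebesgue_on U) +
     (\<Sum>b\<in>Basis. \<integral>x. weak_deriv U b u x * cnj (weak_deriv U b v x) \<partial>lebesgue_on U)"

text \<open>Additivity in the first slot rests on \<open>weak_deriv_lin\<close>, an identity almost
  everywhere only, which the integrals do not notice.\<close>

lemma H1_semi_ip: "semi_ip (H1 U) H1_ip"
proof
  show z: "(\<lambda>x. 0) \<in> H1 U"
    by (rule H1_I[where g = "\<lambda>b x. 0"]) (simp_all add: L2ip.zero_mem has_weak_deriv_def)
  show "(\<lambda>x. u x + c * v x) \<in> H1 U" if "u \<in> H1 U" "v \<in> H1 U" for u v c by (rule H1_lin[OF that])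
  show "H1_ip (\<lambda>x. u x + c * v x) w = H1_ip u w + c * H1_ip v w"
    if u: "u \<in> H1 U" and v: "v \<in> H1 U" and w: "w \<in> H1 U" for u v w c
  proof -
    have "(\<integral>x. weak_deriv U b (\<lambda>x. u x + c * v x) x * cnj (weak_deriv U b w x) \<partial>lebesgue_on U)
        = (\<integral>x. weak_deriv U b u x * cnj (weak_deriv U b w x) \<partial>lebesgue_on U)
          + c * (\<integral>x. weak_deriv U b v x * cnj (weak_deriv U b w x) \<partial>lebesgue_on U)"
      if b: "b \<in> Basis" for b
    proof -
      have Dw: "weak_deriv U b w \<in> L2 U" and Du: "weak_deriv U b u \<in> L2 U" and Dv: "weak_deriv U b v \<in> L2 U"
        and Duv: "weak_deriv U b (\<lambda>x. u x + c * v x) \<in> L2 U"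
        using weak_deriv_spec(1) u v w b H1_lin by auto
      have "(\<integral>x. weak_deriv U b (\<lambda>x. u x + c * v x) x * cnj (weak_deriv U b w x) \<partial>lebesgue_on U)
          = (\<integral>x. (weak_deriv U b u x + c * weak_deriv U b v x) * cnj (weak_deriv U b w x) \<partial>lebesgue_on U)"
      proof (rule integral_cong_AE)
        show "AE x in lebesgue_on U. weak_deriv U b (\<lambda>x. u x + c * v x) x * cnj (weak_deriv U b w x) =
            (weak_deriv U b u x + c * weak_deriv U b v x) * cnj (weak_deriv U b w x)"
          using weak_deriv_lin[OF u v b, of c] by eventually_elim simp
      qed (use Dw Du Dv Duv L2_lin in \<open>auto intro!: borel_measurable_integrable[OF L2_integrable_cnj]\<close>)
      also have "\<dots> = (\<integral>x. weak_deriv U b u x * cnj (weak_deriv U b w x) \<partial>lebesgue_on U)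
          + c * (\<integral>x. weak_deriv U b v x * cnj (weak_deriv U b w x) \<partial>lebesgue_on U)"
        by (rule L2ip.ip_lin[OF Du Dv Dw])
      finally show ?thesis .
    qed
    thus ?thesis
      unfolding H1_ip_def L2ip.ip_lin[OF H1_imp_L2[OF u] H1_imp_L2[OF v] H1_imp_L2[OF w]]
      by (simp add: sum.distrib sum_distrib_left algebra_simps)
  qed
  show "H1_ip v u = cnj (H1_ip u v)" for u v
    unfolding H1_ip_def complex_cnj_add cnj_sum Bochner_Integration.integral_cnj[symmetric]
    by (simp add: mult.commute)
  show "0 \<le> Re (H1_ip u u)" for u
    unfolding H1_ip_def plus_complex.sel Re_sum Re_integral_mult_cnj by (simp add: sum_nonneg)
qed

lemma H1_norm_eq_nrm: "semi_ip.nrm H1_ip = H1_norm U"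
  by (rule ext) (simp only: semi_ip.nrm_def[OF H1_semi_ip] H1_norm_def H1_ip_def plus_complex.sel Re_sum
      Re_integral_mult_cnj L2_norm_sq)

sublocale H1: semi_ip "H1 U" H1_ip
  rewrites "semi_ip.nrm H1_ip = H1_norm U"
  by (rule H1_semi_ip) (rule H1_norm_eq_nrm)

lemma H1_norm_sq: "(H1_norm U u)\<^sup>2 = (L2_norm U u)\<^sup>2 + (\<Sum>b\<in>Basis. (L2_norm U (weak_deriv U b u))\<^sup>2)"
  unfolding H1_norm_def by (rule real_sqrt_pow2) (simp add: sum_nonneg)

lemma H1_norm_nonneg [simp]: "0 \<le> H1_norm U u"
  unfolding H1_norm_def by (simp add: sum_nonneg)

lemma L2_le_H1_norm: "L2_norm U u \<le> H1_norm U u"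
  by (rule power2_le_imp_le) (simp_all add: H1_norm_sq sum_nonneg)

lemma weak_deriv_le_H1_norm: "b \<in> Basis \<Longrightarrow> L2_norm U (weak_deriv U b u) \<le> H1_norm U u"
proof (rule power2_le_imp_le)
  assume "b \<in> Basis"
  hence "(L2_norm U (weak_deriv U b u))\<^sup>2 \<le> (\<Sum>b\<in>Basis. (L2_norm U (weak_deriv U b u))\<^sup>2)"
    by (intro member_le_sum) auto
  thus "(L2_norm U (weak_deriv U b u))\<^sup>2 \<le> (H1_norm U u)\<^sup>2"
    by (simp add: H1_norm_sq add_increasing)
qed simp

lemma L2_norm_weak_deriv_diff:
  assumes "u \<in> H1 U" "v \<in> H1 U" "b \<in> Basis"
  shows "L2_norm U (weak_deriv U b (\<lambda>x. u x - v x)) = L2_norm U (\<lambda>x. weak_deriv U b u x - weak_deriv U b v x)"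
proof (rule L2_norm_cong_AE)
  show "AE x in lebesgue_on U. weak_deriv U b (\<lambda>x. u x - v x) x = weak_deriv U b u x - weak_deriv U b v x"
    using weak_deriv_lin[OF assms, of "-1"] by simp
qed (use assms in \<open>auto intro!: weak_deriv_spec H1.diff_mem L2ip.diff_mem\<close>)

text \<open>The functions and each of their derivatives are Cauchy in L2. Closedness of the weak
  derivative identifies the limits of the derivatives as derivatives of the limit.\<close>

lemma H1_complete:
  assumes s: "\<And>n. s n \<in> H1 U"
    and cau: "\<And>e. e > 0 \<Longrightarrow> \<exists>N. \<forall>m\<ge>N. \<forall>n\<ge>N. H1_norm U (\<lambda>x. s m x - s n x) < e"
  shows "\<exists>u\<in>H1 U. (\<lambda>n. H1_norm U (\<lambda>x. s n x - u x)) \<longlonglongrightarrow> 0"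
proof -
  have "\<exists>u\<in>L2 U. (\<lambda>n. L2_norm U (\<lambda>x. s n x - u x)) \<longlonglongrightarrow> 0"
  proof (rule L2_complete)
    show "s n \<in> L2 U" for n by (rule H1_imp_L2[OF s])
    show "\<exists>N. \<forall>m\<ge>N. \<forall>n\<ge>N. L2_norm U (\<lambda>x. s m x - s n x) < e" if "e > 0" for e
      using cau[OF that] le_less_trans[OF L2_le_H1_norm] by meson
  qed
  then obtain u where u: "u \<in> L2 U" "(\<lambda>n. L2_norm U (\<lambda>x. s n x - u x)) \<longlonglongrightarrow> 0" by blast
  have "\<exists>g\<in>L2 U. (\<lambda>n. L2_norm U (\<lambda>x. weak_deriv U b (s n) x - g x)) \<longlonglongrightarrow> 0" if b: "b \<in> Basis" for b
  proof (rule L2_complete)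
    show "weak_deriv U b (s n) \<in> L2 U" for n by (rule weak_deriv_spec(1)[OF s b])
    have "L2_norm U (\<lambda>x. weak_deriv U b (s m) x - weak_deriv U b (s n) x) \<le> H1_norm U (\<lambda>x. s m x - s n x)" for m n
      using weak_deriv_le_H1_norm[OF b, of "\<lambda>x. s m x - s n x"] L2_norm_weak_deriv_diff[OF s s b, of m n] by linarith
    thus "\<exists>N. \<forall>m\<ge>N. \<forall>n\<ge>N. L2_norm U (\<lambda>x. weak_deriv U b (s m) x - weak_deriv U b (s n) x) < e" if "e > 0" for e
      using cau[OF that] le_less_trans by meson
  qed
  hence "\<forall>b\<in>Basis. \<exists>g. g \<in> L2 U \<and> (\<lambda>n. L2_norm U (\<lambda>x. weak_deriv U b (s n) x - g x)) \<longlonglongrightarrow> 0"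
    by blast
  from bchoice[OF this] obtain g where
    "\<forall>b\<in>Basis. g b \<in> L2 U \<and> (\<lambda>n. L2_norm U (\<lambda>x. weak_deriv U b (s n) x - g b x)) \<longlonglongrightarrow> 0" ..
  hence g: "g b \<in> L2 U" "(\<lambda>n. L2_norm U (\<lambda>x. weak_deriv U b (s n) x - g b x)) \<longlonglongrightarrow> 0"
    if "b \<in> Basis" for b using that by blast+
  have w: "has_weak_deriv U b u (g b)" if b: "b \<in> Basis" for b
    by (rule has_weak_deriv_limit[OF H1_imp_L2[OF s] u weak_deriv_spec(1)[OF s b] g(1)[OF b] g(2)[OF b]
          weak_deriv_spec(2)[OF s b] b])
  have uH: "u \<in> H1 U" by (rule H1_I[where g = g]) (simp_all add: u g w)
  have eq: "L2_norm U (weak_deriv U b (\<lambda>x. s n x - u x)) = L2_norm U (\<lambda>x. weak_deriv U b (s n) x - g b x)"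
    if b: "b \<in> Basis" for b n
    unfolding L2_norm_weak_deriv_diff[OF s uH b]
  proof (rule L2_norm_cong_AE)
    show "AE x in lebesgue_on U. weak_deriv U b (s n) x - weak_deriv U b u x = weak_deriv U b (s n) x - g b x"
      using weak_deriv_AE[OF uH b g(1)[OF b] w[OF b]] by eventually_elim simp
  qed (intro L2ip.diff_mem weak_deriv_spec(1) s uH b g)+
  have "(\<lambda>n. sqrt ((L2_norm U (\<lambda>x. s n x - u x))\<^sup>2 + (\<Sum>b\<in>Basis. (L2_norm U (\<lambda>x. weak_deriv U b (s n) x - g b x))\<^sup>2)))
      \<longlonglongrightarrow> sqrt (0\<^sup>2 + (\<Sum>b\<in>(Basis :: (real \<times> real) set). 0\<^sup>2))"
    by (intro tendsto_intros u g)
  hence "(\<lambda>n. H1_norm U (\<lambda>x. s n x - u x)) \<longlonglongrightarrow> 0"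
    unfolding H1_norm_def by (simp add: eq cong: sum.cong)
  thus ?thesis using uH by blast
qed

lemma H1_norm_cong_AE:
  assumes u: "u \<in> H1 U" and v: "v \<in> H1 U" and z: "H1_norm U (\<lambda>x. u x - v x) = 0"
  shows "AE x in lebesgue_on U. u x = v x"
proof -
  have "L2_norm U (\<lambda>x. u x - v x) = 0"
    using L2_le_H1_norm[of "\<lambda>x. u x - v x"] L2_norm_nonneg[of U "\<lambda>x. u x - v x"] z by linarith
  from L2_norm_eq_0_AE[OF L2ip.diff_mem[OF H1_imp_L2[OF u] H1_imp_L2[OF v]] this]
  show ?thesis by eventually_elim simp
qed

end

section \<open>Fourier coefficients and traces\<close>

context semi_ip
begin

text \<open>Induction removes one projection at a time: subtracting the component along
  \<open>e m\<close> leaves the other coefficients unchanged and lowers L |u|^2 by exactly the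
  square of the removed coefficient. The common squared length L is left unnormalised, since the
  waves have squared norm \<open>Lx\<close>.\<close>

lemma Bessel:
  assumes "finite F" and "u \<in> V" and "\<And>n. n \<in> F \<Longrightarrow> e n \<in> V" and L: "L > 0"
    and orth: "\<And>m n. m \<in> F \<Longrightarrow> n \<in> F \<Longrightarrow> ip (e m) (e n) = (if m = n then of_real L else 0)"
  shows "(\<Sum>n\<in>F. (cmod (ip u (e n)))\<^sup>2) \<le> L * (nrm u)\<^sup>2"
  using assms(1,2,3) orth
proof (induction F arbitrary: u rule: finite_induct)
  case empty
  thus ?case using L by simp
next
  case (insert m F)
  define c where "c = - ip u (e m) / of_real L"
  define u' where "u' = (\<lambda>x. u x + c * e m x)"
  have em: "e m \<in> V" and u: "u \<in> V" using insert.prems by auto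
  have u': "u' \<in> V" unfolding u'_def by (rule lin_mem[OF u em])
  have same: "ip u' (e n) = ip u (e n)" if "n \<in> F" for n
  proof -
    have "ip (e m) (e n) = 0" using insert.prems(3)[of m n] insert.hyps(2) that by auto
    thus ?thesis unfolding u'_def using ip_lin[OF u em, of "e n" c] insert.prems(2) that by simp
  qed
  have nem: "(nrm (e m))\<^sup>2 = L" using insert.prems(3)[of m m] em by (simp add: nrm_sq)
  have "Re (cnj c * ip u (e m)) = - (cmod (ip u (e m)))\<^sup>2 / L"
    by (simp add: c_def cmod_power2) (simp add: power2_eq_square add_divide_distrib diff_divide_distrib)
  moreover have "(cmod c)\<^sup>2 * L = (cmod (ip u (e m)))\<^sup>2 / L"
    using L by (simp add: c_def norm_divide power_divide power2_eq_square)
  ultimately have "(nrm u')\<^sup>2 = (nrm u)\<^sup>2 - (cmod (ip u (e m)))\<^sup>2 / L"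
    unfolding u'_def nrm_lin_sq[OF u em] nem by simp
  hence eq: "L * (nrm u')\<^sup>2 = L * (nrm u)\<^sup>2 - (cmod (ip u (e m)))\<^sup>2" using L by (simp add: right_diff_distrib)
  have "(\<Sum>n\<in>F. (cmod (ip u' (e n)))\<^sup>2) \<le> L * (nrm u')\<^sup>2"
    by (rule insert.IH[OF u']) (use insert.prems in auto)
  moreover have "(\<Sum>n\<in>F. (cmod (ip u' (e n)))\<^sup>2) = (\<Sum>n\<in>F. (cmod (ip u (e n)))\<^sup>2)"
    by (rule sum.cong[OF refl]) (simp add: same)
  ultimately show ?case using eq insert.hyps by simp
qed

end

text \<open>This is the nonnegativity of the variance: c is the mean of f, and the square of f - c
  is integrated.\<close>

lemma integral_Cauchy_Schwarz:
  fixes f :: "real \<Rightarrow> real"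
  assumes "continuous_on {a..b} f" "a < b"
  shows "(integral {a..b} f)\<^sup>2 \<le> (b - a) * integral {a..b} (\<lambda>t. (f t)\<^sup>2)"
proof -
  define c where "c = integral {a..b} f / (b - a)"
  have f: "(f has_integral integral {a..b} f) {a..b}"
    using assms(1) integrable_continuous_real integrable_integral by blast
  have f2: "((\<lambda>t. (f t)\<^sup>2) has_integral integral {a..b} (\<lambda>t. (f t)\<^sup>2)) {a..b}"
    by (intro integrable_integral integrable_continuous_real continuous_intros assms)
  have k: "((\<lambda>t. c\<^sup>2) has_integral (b - a) * c\<^sup>2) {a..b}"
    using has_integral_const_real[of "c\<^sup>2" a b] assms(2) by simp
  have hi: "((\<lambda>t. (f t)\<^sup>2 - 2 * c * f t + c\<^sup>2) has_integral
      integral {a..b} (\<lambda>t. (f t)\<^sup>2) - 2 * c * integral {a..b} f + (b - a) * c\<^sup>2) {a..b}"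
    by (intro has_integral_add has_integral_diff has_integral_mult_right f f2 k)
  have "0 \<le> (f t)\<^sup>2 - 2 * c * f t + c\<^sup>2" for t
    using zero_le_power2[of "f t - c"] unfolding power2_diff by (simp add: mult_ac)
  hence "0 \<le> integral {a..b} (\<lambda>t. (f t)\<^sup>2) - 2 * c * integral {a..b} f + (b - a) * c\<^sup>2"
    by (rule has_integral_nonneg[OF hi])
  hence "0 \<le> (b - a) * (integral {a..b} (\<lambda>t. (f t)\<^sup>2) - 2 * c * integral {a..b} f + (b - a) * c\<^sup>2)"
    using assms(2) by simp
  also have "\<dots> = (b - a) * integral {a..b} (\<lambda>t. (f t)\<^sup>2) - (integral {a..b} f)\<^sup>2"
  proof -
    have "integral {a..b} f = c * (b - a)" using assms(2) by (simp add: c_def)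
    thus ?thesis by (simp only:) (simp add: algebra_simps power2_eq_square)
  qed
  finally show ?thesis by simp
qed

lemma increment_le_integral:
  fixes f :: "real \<Rightarrow> complex"
  assumes d: "\<And>t. t \<in> {a..b} \<Longrightarrow> (f has_vector_derivative f' t) (at t within {a..b})"
    and c: "continuous_on {a..b} f'" and st: "s \<in> {a..b}" "t \<in> {a..b}"
  shows "cmod (f s - f t) \<le> integral {a..b} (\<lambda>t. cmod (f' t))"
proof -
  have le: "cmod (f y - f x) \<le> integral {a..b} (\<lambda>t. cmod (f' t))"
    if xy: "x \<in> {a..b}" "y \<in> {a..b}" "x \<le> y" for x y
  proof -
    have sub: "{x..y} \<subseteq> {a..b}" using xy by auto
    have "(f' has_integral f y - f x) {x..y}"
      by (rule fundamental_theorem_of_calculus[OF xy(3)])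
        (rule has_vector_derivative_within_subset[OF d sub], use sub in auto)
    hence "cmod (f y - f x) = cmod (integral {x..y} f')" by (simp add: integral_unique)
    also have "\<dots> \<le> integral {x..y} (\<lambda>t. cmod (f' t))"
      by (rule Henstock_Kurzweil_Integration.integral_norm_bound_integral)
        (auto intro!: integrable_continuous_real continuous_intros continuous_on_subset[OF c sub])
    also have "\<dots> \<le> integral {a..b} (\<lambda>t. cmod (f' t))"
      by (rule integral_subset_le[OF sub])
        (auto intro!: integrable_continuous_real continuous_intros continuous_on_subset[OF c sub] c)
    finally show ?thesis .
  qed
  show ?thesis
  proof (cases "t \<le> s")
    case True
    thus ?thesis using le[of t s] st by simp
  next
    case False
    thus ?thesis using le[of s t] st by (simp add: norm_minus_commute)
  qed
qed

text \<open>The weight y + y0 vanishes at the endpoint opposite to y0, so integrating the derivative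
  of (1+A)(y+y0)|z|^2 isolates the value at y0. Young's inequality turns (1+A)|z||z'| into A^2 |z|^2
  and |z'|^2: the factor A on the left against A^2 on the right is the half derivative lost by a
  trace. A will be the modulus of a wave number, or 0 for the plain L2 trace.\<close>

lemma endpoint_estimate:
  fixes z :: "real \<Rightarrow> complex"
  assumes H: "H > 0" and y0: "y0 = H \<or> y0 = - H" and A: "A \<ge> 0"
    and d: "\<And>y. y \<in> {-H..H} \<Longrightarrow> (z has_vector_derivative z' y) (at y within {-H..H})" and c: "continuous_on {-H..H} z'"
  shows "(1 + A) * (cmod (z y0))\<^sup>2 \<le>
    (1 / H + 2) * integral {-H..H} (\<lambda>y. (1 + A\<^sup>2) * (cmod (z y))\<^sup>2 + (cmod (z' y))\<^sup>2)"
proof -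
  have cz: "continuous_on {-H..H} z" by (rule continuous_on_vector_derivative[OF d])
  define F where "F y = (1 + A) * ((y + y0) * (z y \<bullet> z y))" for y
  define F' where "F' y = (1 + A) * ((y + y0) * (2 * (z y \<bullet> z' y)) + z y \<bullet> z y)" for y
  have "(F has_vector_derivative F' y) (at y within {-H..H})" if "y \<in> {-H..H}" for y
  proof -
    have 1: "((\<lambda>y. z y \<bullet> z y) has_vector_derivative z y \<bullet> z' y + z' y \<bullet> z y) (at y within {-H..H})"
      by (rule bounded_bilinear.has_vector_derivative[OF bounded_bilinear_inner d[OF that] d[OF that]])
    have 2: "((\<lambda>y. y + y0) has_vector_derivative 1) (at y within {-H..H})"
      by (auto intro!: derivative_eq_intros)
    have "((\<lambda>y. (y + y0) * (z y \<bullet> z y)) has_vector_derivative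
        (y + y0) * (z y \<bullet> z' y + z' y \<bullet> z y) + 1 * (z y \<bullet> z y)) (at y within {-H..H})"
      by (rule has_vector_derivative_mult[OF 2 1])
    from has_vector_derivative_mult_right[OF this, of "1 + A"] show ?thesis
      by (simp add: F_def[abs_def] F'_def inner_commute)
  qed
  hence "(F' has_integral F H - F (- H)) {-H..H}"
    by (intro fundamental_theorem_of_calculus) (use H in auto)
  moreover have "F H - F (- H) = (1 + A) * (2 * H * (cmod (z y0))\<^sup>2)"
    using y0 by (auto simp: F_def power2_norm_eq_inner algebra_simps)
  ultimately have F': "(F' has_integral (1 + A) * (2 * H * (cmod (z y0))\<^sup>2)) {-H..H}" by simp
  \<comment> \<open>The factor 2 + 4H is 2H (1/H + 2); the 2H is cancelled by the weight 2H at the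
    endpoint.\<close>
  let ?G = "\<lambda>y. (2 + 4 * H) * ((1 + A\<^sup>2) * (cmod (z y))\<^sup>2 + (cmod (z' y))\<^sup>2)"
  have G: "?G integrable_on {-H..H}"
    by (intro integrable_continuous_real continuous_intros cz c)
  have le: "F' y \<le> ?G y" if "y \<in> {-H..H}" for y
  proof -
    define p q where "p = cmod (z y)" and "q = cmod (z' y)"
    have pq: "p \<ge> 0" "q \<ge> 0" by (simp_all add: p_def q_def)
    have "\<bar>y + y0\<bar> \<le> 2 * H" using y0 that by auto
    moreover have "\<bar>z y \<bullet> z' y\<bar> \<le> p * q" unfolding p_def q_def by (rule Cauchy_Schwarz_ineq2)
    ultimately have "\<bar>(y + y0) * (2 * (z y \<bullet> z' y))\<bar> \<le> 2 * H * (2 * (p * q))"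
      unfolding abs_mult by (intro mult_mono) auto
    moreover have "z y \<bullet> z y = p\<^sup>2" by (simp add: p_def power2_norm_eq_inner)
    ultimately have "(y + y0) * (2 * (z y \<bullet> z' y)) + z y \<bullet> z y \<le> 2 * H * (2 * (p * q)) + p\<^sup>2"
      by linarith
    hence "F' y \<le> (1 + A) * (2 * H * (2 * (p * q)) + p\<^sup>2)"
      unfolding F'_def using A by (intro mult_left_mono) auto
    also have "\<dots> = 2 * H * (2 * ((1 + A) * p) * q) + (1 + A) * p\<^sup>2" by (simp add: algebra_simps)
    also have "\<dots> \<le> 2 * H * (((1 + A) * p)\<^sup>2 + q\<^sup>2) + (2 * (1 + A\<^sup>2)) * p\<^sup>2"
    proof (intro add_mono mult_left_mono mult_right_mono sum_squares_bound)
      show "1 + A \<le> 2 * (1 + A\<^sup>2)"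
      proof (cases "A \<le> 1")
        case False
        hence "A \<le> A\<^sup>2" by (intro self_le_power) auto
        thus ?thesis using A by simp
      qed (simp add: add_increasing2)
    qed (use H in auto)
    also have "\<dots> \<le> 2 * H * ((2 * (1 + A\<^sup>2)) * p\<^sup>2 + 2 * q\<^sup>2) + (2 * (1 + A\<^sup>2)) * p\<^sup>2 + 2 * q\<^sup>2"
    proof -
      have "(1 + A)\<^sup>2 \<le> 2 * (1 + A\<^sup>2)" using norm_add_sq_le[of 1 A] by simp
      hence "((1 + A) * p)\<^sup>2 \<le> (2 * (1 + A\<^sup>2)) * p\<^sup>2" unfolding power_mult_distrib by (intro mult_right_mono) auto
      moreover have "q\<^sup>2 \<le> 2 * q\<^sup>2" "0 \<le> 2 * q\<^sup>2" by auto
      ultimately have "2 * H * (((1 + A) * p)\<^sup>2 + q\<^sup>2) \<le> 2 * H * ((2 * (1 + A\<^sup>2)) * p\<^sup>2 + 2 * q\<^sup>2)"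
        using H by (intro mult_left_mono add_mono) auto
      thus ?thesis by (simp add: add_increasing2)
    qed
    also have "\<dots> = ?G y" unfolding p_def q_def by (simp add: algebra_simps)
    finally show ?thesis .
  qed
  have "(1 + A) * (2 * H * (cmod (z y0))\<^sup>2) \<le> integral {-H..H} ?G"
    using has_integral_le[OF F' integrable_integral[OF G] le] .
  also have "\<dots> = (2 + 4 * H) * integral {-H..H} (\<lambda>y. (1 + A\<^sup>2) * (cmod (z y))\<^sup>2 + (cmod (z' y))\<^sup>2)" by simp
  finally have "(1 + A) * (cmod (z y0))\<^sup>2 * (2 * H) \<le>
      ((1 / H + 2) * integral {-H..H} (\<lambda>y. (1 + A\<^sup>2) * (cmod (z y))\<^sup>2 + (cmod (z' y))\<^sup>2)) * (2 * H)"
    using H by (simp add: algebra_simps)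
  thus ?thesis using H by simp
qed

lemma L2_norm_continuous_box:
  fixes f :: "'a::euclidean_space \<Rightarrow> complex"
  assumes "continuous_on UNIV f"
  shows "(L2_norm (box a b) f)\<^sup>2 = integral (cbox a b) (\<lambda>x. (cmod (f x))\<^sup>2)"
proof -
  have "f \<in> L2 (box a b)" by (rule continuous_L2_bounded[OF assms]) auto
  hence "(L2_norm (box a b) f)\<^sup>2 = integral (box a b) (\<lambda>x. (cmod (f x))\<^sup>2)"
    unfolding L2_norm_sq by (intro lebesgue_integral_eq_integral L2_square_integrable) auto
  thus ?thesis by (simp only: integral_open_interval)
qed

text \<open>The offset a0 cancels between the two factors; what is left is an ordinary Fourier mode
  of period \<open>Lx\<close>.\<close>

lemma exp_alpha_orthogonal:
  assumes "Lx > 0"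
  shows "integral {0..Lx} (\<lambda>t. exp (\<i> * of_real (alpha Lx a0 m * t)) * cnj (exp (\<i> * of_real (alpha Lx a0 n * t))))
    = (if m = n then of_real Lx else 0)"
proof -
  define k where "k = 2 * pi * of_int (m - n) / Lx"
  have k: "alpha Lx a0 m - alpha Lx a0 n = k" using assms by (simp add: alpha_def k_def field_simps)
  have eq: "exp (\<i> * of_real (alpha Lx a0 m * t)) * cnj (exp (\<i> * of_real (alpha Lx a0 n * t))) = exp (\<i> * of_real k * of_real t)" for t
    unfolding exp_cnj exp_add[symmetric] k[symmetric] by (simp add: algebra_simps)
  show ?thesis
  proof (cases "m = n")
    case True
    thus ?thesis using assms unfolding eq by (simp add: k_def scaleR_conv_of_real)
  next
    case False
    hence k0: "k \<noteq> 0" using assms by (simp add: k_def)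
    have "((\<lambda>t. exp (\<i> * of_real k * of_real t)) has_integral
        exp (\<i> * of_real k * of_real Lx) / (\<i> * of_real k) - exp (\<i> * of_real k * of_real 0) / (\<i> * of_real k)) {0..Lx}"
    proof (rule fundamental_theorem_of_calculus)
      show "((\<lambda>t. exp (\<i> * of_real k * of_real t) / (\<i> * of_real k)) has_vector_derivative exp (\<i> * of_real k * of_real t)) (at t within {0..Lx})" for t
      proof -
        have "((\<lambda>z. exp (\<i> * of_real k * z) / (\<i> * of_real k)) has_field_derivative exp (\<i> * of_real k * of_real t)) (at (of_real t))"
          using k0 by (auto intro!: derivative_eq_intros)
        thus ?thesis by (rule has_vector_derivative_real_field[THEN has_vector_derivative_at_within])
      qed
    qed (use assms in simp)
    moreover have "exp (\<i> * of_real k * of_real Lx) = 1"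
    proof -
      have "\<i> * of_real k * of_real Lx = \<i> * complex_of_real (2 * pi * of_int (m - n))"
        using assms by (simp add: k_def)
      hence "exp (\<i> * of_real k * of_real Lx) = cis (2 * pi * of_int (m - n))" by (simp only: cis_conv_exp)
      also have "\<dots> = 1" by (rule cis_multiple_2pi) simp
      finally show ?thesis .
    qed
    ultimately show ?thesis using False unfolding eq by (simp add: integral_unique)
  qed
qed

section \<open>Fourier coefficients and iterated integrals on the period cell\<close>

locale cell =
  fixes Lx H a0 :: real
  assumes Lx: "Lx > 0" and H: "H > 0"
begin

lemma Omega_box: "Omega Lx H = box (0, - H) (Lx, H)"
  by (simp add: Omega_def box_point)

sublocale bounded_domain "Omega Lx H"
  by unfold_locales (simp_all only: Omega_box open_box bounded_box)

lemma interval_box: "{0<..<Lx} = box 0 Lx"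
  by (simp only: box_real)

lemma interval_lmeasurable: "{0<..<Lx} \<in> lmeasurable"
  unfolding interval_box by (rule lmeasurable_box)

abbreviation wave :: "int \<Rightarrow> real \<Rightarrow> complex" where
  "wave n \<equiv> \<lambda>t. exp (\<i> * of_real (alpha Lx a0 n * t))"

lemma wave_continuous: "continuous_on S (wave n)"
  by (intro continuous_intros)

lemma wave_L2: "wave n \<in> L2 {0<..<Lx}"
  by (rule continuous_L2_bounded[OF wave_continuous _ interval_lmeasurable]) simp

lemma cnj_wave: "cnj (wave n t) = exp (- (\<i> * of_real (alpha Lx a0 n * t)))"
  by (simp add: exp_cnj)

lemma fcoeff_ip: "fcoeff Lx a0 g n = (\<integral>t. g t * cnj (wave n t) \<partial>lebesgue_on {0<..<Lx}) / of_real Lx"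
  unfolding fcoeff_def cnj_wave ..

lemma fcoeff_lin:
  assumes "g \<in> L2 {0<..<Lx}" "k \<in> L2 {0<..<Lx}"
  shows "fcoeff Lx a0 (\<lambda>t. g t + c * k t) n = fcoeff Lx a0 g n + c * fcoeff Lx a0 k n"
  unfolding fcoeff_ip L2ip.ip_lin[OF assms wave_L2] by (simp add: add_divide_distrib)

lemma fcoeff_continuous:
  assumes "continuous_on UNIV g"
  shows "fcoeff Lx a0 g n = integral {0..Lx} (\<lambda>t. g t * cnj (wave n t)) / of_real Lx"
proof -
  have c: "continuous_on UNIV (\<lambda>t. g t * cnj (wave n t))"
    by (intro continuous_intros assms)
  have "g \<in> L2 {0<..<Lx}" by (rule continuous_L2_bounded[OF assms]) (simp_all add: interval_lmeasurable)
  hence "(\<integral>t. g t * cnj (wave n t) \<partial>lebesgue_on {0<..<Lx}) = integral {0<..<Lx} (\<lambda>t. g t * cnj (wave n t))"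
    by (intro lebesgue_integral_eq_integral L2_integrable_cnj wave_L2) auto
  thus ?thesis unfolding fcoeff_ip interval_box integral_open_interval by simp
qed

lemma Bessel_fcoeff:
  assumes "finite F" "g \<in> L2 {0<..<Lx}"
  shows "Lx * (\<Sum>n\<in>F. (cmod (fcoeff Lx a0 g n))\<^sup>2) \<le> (L2_norm {0<..<Lx} g)\<^sup>2"
proof -
  have "(\<Sum>n\<in>F. (cmod (\<integral>t. g t * cnj (wave n t) \<partial>lebesgue_on {0<..<Lx}))\<^sup>2) \<le> Lx * (L2_norm {0<..<Lx} g)\<^sup>2"
  proof (rule L2ip.Bessel[OF assms wave_L2 Lx])
    fix m n
    have "(\<integral>t. wave m t * cnj (wave n t) \<partial>lebesgue_on {0<..<Lx}) = fcoeff Lx a0 (wave m) n * of_real Lx"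
      using Lx by (simp add: fcoeff_ip)
    also have "\<dots> = integral {0..Lx} (\<lambda>t. wave m t * cnj (wave n t))"
      unfolding fcoeff_continuous[OF wave_continuous] using Lx by simp
    also have "\<dots> = (if m = n then of_real Lx else 0)"
      by (rule exp_alpha_orthogonal[OF Lx])
    finally show "(\<integral>t. wave m t * cnj (wave n t) \<partial>lebesgue_on {0<..<Lx}) = (if m = n then of_real Lx else 0)" .
  qed
  moreover have "(cmod (\<integral>t. g t * cnj (wave n t) \<partial>lebesgue_on {0<..<Lx}))\<^sup>2 = Lx\<^sup>2 * (cmod (fcoeff Lx a0 g n))\<^sup>2" for n
    using Lx by (simp add: fcoeff_ip norm_divide power_divide)
  ultimately have "Lx * (Lx * (\<Sum>n\<in>F. (cmod (fcoeff Lx a0 g n))\<^sup>2)) \<le> Lx * (L2_norm {0<..<Lx} g)\<^sup>2"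
    by (simp add: power2_eq_square sum_distrib_left mult.assoc)
  thus ?thesis using Lx by simp
qed

lemma fcoeff_bound:
  assumes "g \<in> L2 {0<..<Lx}"
  shows "Lx * (cmod (fcoeff Lx a0 g n))\<^sup>2 \<le> (L2_norm {0<..<Lx} g)\<^sup>2"
  using Bessel_fcoeff[of "{n}", OF _ assms] by simp

lemma integral_cell:
  fixes f :: "real \<times> real \<Rightarrow> real"
  assumes "continuous_on UNIV f"
  shows "integral (cbox (0, - H) (Lx, H)) f = integral {0..Lx} (\<lambda>x. integral {-H..H} (\<lambda>y. f (x, y)))"
    and "integral (cbox (0, - H) (Lx, H)) f = integral {-H..H} (\<lambda>y. integral {0..Lx} (\<lambda>x. f (x, y)))"
proof -
  have c: "continuous_on (cbox (0, - H) (Lx, H)) f" by (rule continuous_on_subset[OF assms subset_UNIV])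
  show 1: "integral (cbox (0, - H) (Lx, H)) f = integral {0..Lx} (\<lambda>x. integral {-H..H} (\<lambda>y. f (x, y)))"
    using integral_prod_continuous[OF c] by simp
  have "integral (cbox 0 Lx) (\<lambda>x. integral (cbox (- H) H) (\<lambda>y. f (x, y)))
      = integral (cbox (- H) H) (\<lambda>y. integral (cbox 0 Lx) (\<lambda>x. f (x, y)))"
    by (rule integral_swap_continuous) (use c in \<open>simp add: case_prod_unfold\<close>)
  thus "integral (cbox (0, - H) (Lx, H)) f = integral {-H..H} (\<lambda>y. integral {0..Lx} (\<lambda>x. f (x, y)))"
    using 1 by simp
qed

lemma section_continuous:
  fixes f :: "real \<times> real \<Rightarrow> 'b::topological_space"
  assumes "continuous_on UNIV f"
  shows "continuous_on S (\<lambda>x. f (x, y))" "continuous_on S (\<lambda>y. f (x, y))"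
proof -
  have "continuous_on S (\<lambda>x. (x, y))" "continuous_on S (\<lambda>y. (x, y))" by (intro continuous_intros)+
  from this[THEN continuous_on_compose2[OF assms]]
  show "continuous_on S (\<lambda>x. f (x, y))" "continuous_on S (\<lambda>y. f (x, y))" by simp_all
qed

lemma param_integral_continuous:
  fixes f :: "real \<times> real \<Rightarrow> 'b::banach"
  assumes "continuous_on UNIV f"
  shows "continuous_on S (\<lambda>y. integral {a..b} (\<lambda>x. f (x, y)))" "continuous_on S (\<lambda>x. integral {a..b} (\<lambda>y. f (x, y)))"
proof -
  have "continuous_on (S \<times> cbox a b) (\<lambda>(y, x). f (x, y))"
    unfolding case_prod_unfold
    by (rule continuous_on_compose2[OF assms, where f = "\<lambda>p. (snd p, fst p)", simplified]) (intro continuous_intros)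
  from integral_continuous_on_param[OF this] show "continuous_on S (\<lambda>y. integral {a..b} (\<lambda>x. f (x, y)))" by simp
  have "continuous_on (S \<times> cbox a b) (\<lambda>(x, y). f (x, y))"
    using continuous_on_subset[OF assms subset_UNIV] by simp
  from integral_continuous_on_param[OF this] show "continuous_on S (\<lambda>x. integral {a..b} (\<lambda>y. f (x, y)))" by simp
qed

end

section \<open>Trace estimates for smooth functions\<close>

context cell
begin

definition grad_sq :: "(real \<times> real \<Rightarrow> complex) \<Rightarrow> real" where
  "grad_sq u = (\<Sum>b\<in>Basis. (L2_norm (Omega Lx H) (weak_deriv (Omega Lx H) b u))\<^sup>2)"

lemma H1_norm_grad: "(H1_norm (Omega Lx H) u)\<^sup>2 = (L2_norm (Omega Lx H) u)\<^sup>2 + grad_sq u"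
  unfolding H1_norm_sq grad_sq_def ..

lemma grad_sq_nonneg: "0 \<le> grad_sq u"
  by (simp add: grad_sq_def sum_nonneg)

lemma smooth_partials:
  assumes w: "smooth w"
  shows "((\<lambda>t. w (t, y)) has_vector_derivative dpart (1, 0) w (t, y)) (at t within S)"
    and "((\<lambda>t. w (y, t)) has_vector_derivative dpart (0, 1) w (y, t)) (at t within S)"
    and "continuous_on UNIV (dpart (1, 0) w)" and "continuous_on UNIV (dpart (0, 1) w)"
proof -
  show "((\<lambda>t. w (t, y)) has_vector_derivative dpart (1, 0) w (t, y)) (at t within S)"
    "((\<lambda>t. w (y, t)) has_vector_derivative dpart (0, 1) w (y, t)) (at t within S)"
    by (rule partial_vector_derivative[OF smooth_has_derivative[OF w]])+
  show "continuous_on UNIV (dpart (1, 0) w)" "continuous_on UNIV (dpart (0, 1) w)"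
    by (rule smooth_C1(2)[OF w], simp add: Basis_point)+
qed

lemma L2_norm_cell:
  assumes "continuous_on UNIV f"
  shows "(L2_norm (Omega Lx H) f)\<^sup>2 = integral (cbox (0, - H) (Lx, H)) (\<lambda>x. (cmod (f x))\<^sup>2)"
  unfolding Omega_box by (rule L2_norm_continuous_box[OF assms])

lemma L2_norm_interval:
  assumes "continuous_on UNIV f"
  shows "(L2_norm {0<..<Lx} f)\<^sup>2 = integral {0..Lx} (\<lambda>x. (cmod (f x))\<^sup>2)"
  unfolding interval_box L2_norm_continuous_box[OF assms] by simp

lemma grad_sq_smooth:
  assumes w: "smooth w"
  shows "grad_sq w = (L2_norm (Omega Lx H) (dpart (1, 0) w))\<^sup>2 + (L2_norm (Omega Lx H) (dpart (0, 1) w))\<^sup>2"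
proof -
  have "L2_norm (Omega Lx H) (weak_deriv (Omega Lx H) b w) = L2_norm (Omega Lx H) (dpart b w)" if b: "b \<in> Basis" for b
    by (rule L2_norm_cong_AE[OF weak_deriv_spec(1)[OF smooth_H1[OF w] b] smooth_L2(2)[OF w b] weak_deriv_smooth[OF w b]])
  hence "grad_sq w = (\<Sum>b\<in>Basis. (L2_norm (Omega Lx H) (dpart b w))\<^sup>2)"
    unfolding grad_sq_def by (intro sum.cong) simp_all
  thus ?thesis by (simp add: Basis_point)
qed

lemma cont_cmod_sq: "continuous_on UNIV f \<Longrightarrow> continuous_on UNIV (\<lambda>x. (cmod (f x))\<^sup>2)"
  by (intro continuous_intros)

lemma H1_norm_smooth:
  assumes w: "smooth w"
  shows "(H1_norm (Omega Lx H) w)\<^sup>2 = integral {-H..H} (\<lambda>y. integral {0..Lx} (\<lambda>x.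
      (cmod (w (x, y)))\<^sup>2 + (cmod (dpart (1, 0) w (x, y)))\<^sup>2 + (cmod (dpart (0, 1) w (x, y)))\<^sup>2))"
proof -
  note c = smooth_continuous[OF w] smooth_partials(3,4)[OF w]
  have i: "(\<lambda>x. (cmod (f x))\<^sup>2) integrable_on cbox (0, - H) (Lx, H)" if "continuous_on UNIV f" for f :: "real \<times> real \<Rightarrow> complex"
    by (rule integrable_continuous[OF continuous_on_subset[OF cont_cmod_sq[OF that] subset_UNIV]])
  have "(H1_norm (Omega Lx H) w)\<^sup>2 = integral (cbox (0, - H) (Lx, H)) (\<lambda>x. (cmod (w x))\<^sup>2 +
      (cmod (dpart (1, 0) w x))\<^sup>2 + (cmod (dpart (0, 1) w x))\<^sup>2)"
    unfolding H1_norm_grad grad_sq_smooth[OF w] L2_norm_cell[OF c(1)] L2_norm_cell[OF c(2)] L2_norm_cell[OF c(3)]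
    by (subst Henstock_Kurzweil_Integration.integral_add Henstock_Kurzweil_Integration.integral_add[OF i i];
        (intro integrable_add i c | simp))+
  also have "\<dots> = integral {-H..H} (\<lambda>y. integral {0..Lx} (\<lambda>x.
      (cmod (w (x, y)))\<^sup>2 + (cmod (dpart (1, 0) w (x, y)))\<^sup>2 + (cmod (dpart (0, 1) w (x, y)))\<^sup>2))"
    by (rule integral_cell(2)) (intro continuous_on_add cont_cmod_sq c)
  finally show ?thesis .
qed

lemma section_integrable:
  fixes f :: "real \<times> real \<Rightarrow> 'b::banach"
  assumes "continuous_on UNIV f"
  shows "(\<lambda>x. f (x, y)) integrable_on {a..b}" "(\<lambda>y. f (x, y)) integrable_on {a..b}"
    "(\<lambda>y. integral {c..d} (\<lambda>x. f (x, y))) integrable_on {a..b}"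
    "(\<lambda>x. integral {c..d} (\<lambda>y. f (x, y))) integrable_on {a..b}"
  by (rule integrable_continuous_real section_continuous[OF assms] param_integral_continuous[OF assms])+

text \<open>The endpoint estimate with A = 0 on every vertical segment, integrated over x1.
  Quasi-periodicity is not assumed, because the approximating functions in \<open>has_trace\<close>
  need not have it.\<close>

lemma trace_smooth:
  assumes w: "smooth w" and y0: "y0 = H \<or> y0 = - H"
  shows "(L2_norm {0<..<Lx} (\<lambda>t. w (t, y0)))\<^sup>2 \<le> (1 / H + 2) * (H1_norm (Omega Lx H) w)\<^sup>2"
proof -
  note c = smooth_continuous[OF w] smooth_partials(3,4)[OF w]
  let ?g = "\<lambda>x. (1 + 0\<^sup>2) * (cmod (w x))\<^sup>2 + (cmod (dpart (0, 1) w x))\<^sup>2"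
  have cg: "continuous_on UNIV ?g" by (intro continuous_on_add continuous_on_mult_left cont_cmod_sq c)
  have C: "0 \<le> 1 / H + 2" using H by simp
  have "(L2_norm {0<..<Lx} (\<lambda>t. w (t, y0)))\<^sup>2 = integral {0..Lx} (\<lambda>t. (cmod (w (t, y0)))\<^sup>2)"
    by (rule L2_norm_interval[OF section_continuous(1)[OF c(1)]])
  also have "\<dots> \<le> integral {0..Lx} (\<lambda>x. (1 / H + 2) * integral {-H..H} (\<lambda>y. ?g (x, y)))"
  proof (rule integral_le)
    show "(\<lambda>t. (cmod (w (t, y0)))\<^sup>2) integrable_on {0..Lx}"
      by (rule section_integrable(1)[OF cont_cmod_sq[OF c(1)]])
    show "(\<lambda>x. (1 / H + 2) * integral {-H..H} (\<lambda>y. ?g (x, y))) integrable_on {0..Lx}"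
      by (rule integrable_on_mult_right[OF section_integrable(4)[OF cg]])
    show "(cmod (w (x, y0)))\<^sup>2 \<le> (1 / H + 2) * integral {-H..H} (\<lambda>y. ?g (x, y))" for x
      using endpoint_estimate[OF H y0 order_refl smooth_partials(2)[OF w] section_continuous(2)[OF c(3)], of x] by (simp only: add_0_right mult_1)
  qed
  also have "\<dots> = (1 / H + 2) * integral (cbox (0, - H) (Lx, H)) ?g"
    unfolding integral_cell(1)[OF cg] by simp
  also have "\<dots> \<le> (1 / H + 2) * integral (cbox (0, - H) (Lx, H)) (\<lambda>x. (cmod (w x))\<^sup>2 +
      (cmod (dpart (1, 0) w x))\<^sup>2 + (cmod (dpart (0, 1) w x))\<^sup>2)"
  proof (intro mult_left_mono C integral_le)
    show "?g integrable_on cbox (0, - H) (Lx, H)"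
      by (rule integrable_continuous[OF continuous_on_subset[OF cg subset_UNIV]])
    show "(\<lambda>x. (cmod (w x))\<^sup>2 + (cmod (dpart (1, 0) w x))\<^sup>2 + (cmod (dpart (0, 1) w x))\<^sup>2) integrable_on cbox (0, - H) (Lx, H)"
      by (rule integrable_continuous[OF continuous_on_subset[OF _ subset_UNIV]]) (intro continuous_on_add cont_cmod_sq c)
  qed simp
  also have "integral (cbox (0, - H) (Lx, H)) (\<lambda>x. (cmod (w x))\<^sup>2 +
      (cmod (dpart (1, 0) w x))\<^sup>2 + (cmod (dpart (0, 1) w x))\<^sup>2) = (H1_norm (Omega Lx H) w)\<^sup>2"
    unfolding H1_norm_smooth[OF w] by (rule integral_cell(2)) (intro continuous_on_add cont_cmod_sq c)
  finally show ?thesis .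
qed

lemma wave_derivative:
  "((\<lambda>t. cnj (wave n t)) has_vector_derivative - (\<i> * of_real (alpha Lx a0 n)) * cnj (wave n t)) (at t within S)"
proof -
  define a where "a = - (\<i> * complex_of_real (alpha Lx a0 n))"
  have "((\<lambda>z. exp (a * z)) has_field_derivative a * exp (a * of_real t)) (at (of_real t))"
    by (rule derivative_eq_intros refl | simp)+
  hence "((\<lambda>t. exp (a * of_real t)) has_vector_derivative a * exp (a * of_real t)) (at t within S)"
    by (rule has_vector_derivative_real_field[THEN has_vector_derivative_at_within])
  moreover have "cnj (wave n t) = exp (a * of_real t)" for t unfolding cnj_wave a_def by (simp add: mult.assoc)
  ultimately show ?thesis by (simp add: a_def)
qed

text \<open>Since \<alpha>_n \<open>Lx\<close> differs from a0 \<open>Lx\<close> by a multiple of 2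
  pi, the Bloch factor is cancelled exactly. This removes the boundary terms when a quasi-periodic
  function is integrated by parts against a wave.\<close>

lemma wave_period: "exp (\<i> * of_real (a0 * Lx)) * cnj (wave n Lx) = 1"
proof -
  have "\<i> * of_real (a0 * Lx) + - (\<i> * of_real (alpha Lx a0 n * Lx)) = \<i> * complex_of_real (2 * pi * of_int (- n))"
    using Lx by (simp add: alpha_def field_simps)
  hence "exp (\<i> * of_real (a0 * Lx)) * cnj (wave n Lx) = cis (2 * pi * of_int (- n))"
    unfolding cnj_wave exp_add[symmetric] by (simp only: cis_conv_exp)
  also have "\<dots> = 1" by (rule cis_multiple_2pi) simp
  finally show ?thesis .
qed

text \<open>Integration by parts over a period; the two boundary terms cancel by quasi-periodicity,
  so the horizontal derivative becomes multiplication by i \<alpha>_n.\<close>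

lemma fcoeff_partial1:
  assumes w: "smooth w" and q: "quasi_periodic Lx a0 w"
  shows "fcoeff Lx a0 (\<lambda>t. dpart (1, 0) w (t, y)) n = \<i> * of_real (alpha Lx a0 n) * fcoeff Lx a0 (\<lambda>t. w (t, y)) n"
proof -
  note c = smooth_continuous[OF w] smooth_partials(3,4)[OF w]
  let ?a = "\<i> * of_real (alpha Lx a0 n)"
  have "((\<lambda>t. w (t, y) * (- ?a * cnj (wave n t)) + dpart (1, 0) w (t, y) * cnj (wave n t))
      has_integral w (Lx, y) * cnj (wave n Lx) - w (0, y) * cnj (wave n 0)) {0..Lx}"
    by (intro fundamental_theorem_of_calculus has_vector_derivative_mult smooth_partials(1)[OF w] wave_derivative)
      (use Lx in simp)
  moreover have "w (Lx, y) * cnj (wave n Lx) - w (0, y) * cnj (wave n 0) = 0"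
  proof -
    have "w (0 + Lx, y) = exp (\<i> * complex_of_real (a0 * Lx)) * w (0, y)"
      using q unfolding quasi_periodic_def by blast
    hence "w (Lx, y) * cnj (wave n Lx) = w (0, y) * (exp (\<i> * of_real (a0 * Lx)) * cnj (wave n Lx))"
      by (simp add: mult_ac)
    thus ?thesis unfolding wave_period by simp
  qed
  ultimately have z: "((\<lambda>t. w (t, y) * (- ?a * cnj (wave n t)) + dpart (1, 0) w (t, y) * cnj (wave n t)) has_integral 0) {0..Lx}"
    by simp
  have i: "((\<lambda>t. f (t, y) * cnj (wave n t)) has_integral integral {0..Lx} (\<lambda>t. f (t, y) * cnj (wave n t))) {0..Lx}"
    if "continuous_on UNIV f" for f :: "real \<times> real \<Rightarrow> complex"
    by (intro integrable_integral integrable_continuous_real continuous_on_mult section_continuous(1)[OF that]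
        continuous_on_cnj wave_continuous)
  have A: "((\<lambda>t. - ?a * (w (t, y) * cnj (wave n t)) + dpart (1, 0) w (t, y) * cnj (wave n t)) has_integral
      - ?a * integral {0..Lx} (\<lambda>t. w (t, y) * cnj (wave n t)) + integral {0..Lx} (\<lambda>t. dpart (1, 0) w (t, y) * cnj (wave n t))) {0..Lx}"
    by (rule has_integral_add[OF has_integral_mult_right[OF i[OF c(1)]] i[OF c(2)]])
  have eq: "(\<lambda>t. - ?a * (w (t, y) * cnj (wave n t)) + dpart (1, 0) w (t, y) * cnj (wave n t))
      = (\<lambda>t. w (t, y) * (- ?a * cnj (wave n t)) + dpart (1, 0) w (t, y) * cnj (wave n t))"
    by (rule ext) (simp only: mult_ac)
  have "- ?a * integral {0..Lx} (\<lambda>t. w (t, y) * cnj (wave n t)) + integral {0..Lx} (\<lambda>t. dpart (1, 0) w (t, y) * cnj (wave n t)) = 0"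
    by (rule has_integral_unique[OF A[unfolded eq] z])
  hence "integral {0..Lx} (\<lambda>t. dpart (1, 0) w (t, y) * cnj (wave n t)) = ?a * integral {0..Lx} (\<lambda>t. w (t, y) * cnj (wave n t))"
    by (simp add: add_eq_0_iff)
  thus ?thesis
    unfolding fcoeff_continuous[OF section_continuous(1)[OF c(1)]] fcoeff_continuous[OF section_continuous(1)[OF c(2)]] by simp
qed

lemma mult_wave_continuous:
  "continuous_on UNIV f \<Longrightarrow> continuous_on UNIV (\<lambda>x :: real \<times> real. f x * cnj (wave n (fst x)))"
  by (intro continuous_intros)

lemma fcoeff_section_continuous:
  fixes f :: "real \<times> real \<Rightarrow> complex"
  assumes "continuous_on UNIV f"
  shows "continuous_on S (\<lambda>y. fcoeff Lx a0 (\<lambda>t. f (t, y)) n)"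
  unfolding fcoeff_continuous[OF section_continuous(1)[OF assms]]
  using param_integral_continuous(1)[OF mult_wave_continuous[OF assms], of S 0 Lx n] Lx
  by (intro continuous_on_divide continuous_on_const) auto

lemma fcoeff_partial2:
  assumes w: "smooth w" and y: "y \<in> {-H..H}"
  shows "((\<lambda>y. fcoeff Lx a0 (\<lambda>t. w (t, y)) n) has_vector_derivative fcoeff Lx a0 (\<lambda>t. dpart (0, 1) w (t, y)) n) (at y within {-H..H})"
proof -
  note c = smooth_continuous[OF w] smooth_partials(3,4)[OF w]
  have "((\<lambda>y. integral (cbox 0 Lx) (\<lambda>t. w (t, y) * cnj (wave n t))) has_vector_derivative
      integral (cbox 0 Lx) (\<lambda>t. dpart (0, 1) w (t, y) * cnj (wave n t))) (at y within {-H..H})"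
  proof (rule leibniz_rule_vector_derivative[OF _ _ _ y])
    show "((\<lambda>y. w (t, y) * cnj (wave n t)) has_vector_derivative dpart (0, 1) w (t, y) * cnj (wave n t)) (at y within {-H..H})" for y t
      by (rule has_vector_derivative_mult_left[OF smooth_partials(2)[OF w]])
    show "(\<lambda>t. w (t, y) * cnj (wave n t)) integrable_on cbox 0 Lx" for y
      using section_integrable(1)[OF mult_wave_continuous[OF c(1), of n], where y = y and a = 0 and b = Lx] by simp
    have "continuous_on ({-H..H} \<times> cbox 0 Lx) (\<lambda>p. dpart (0, 1) w (snd p, fst p) * cnj (wave n (snd p)))"
    proof -
      have "continuous_on ({-H..H} \<times> cbox 0 Lx) (\<lambda>p :: real \<times> real. (snd p, fst p))"
        by (intro continuous_intros)
      from continuous_on_compose2[OF mult_wave_continuous[OF c(3), of n] this subset_UNIV]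
      show ?thesis by (simp only: fst_conv snd_conv)
    qed
    thus "continuous_on ({-H..H} \<times> cbox 0 Lx) (\<lambda>(y, t). dpart (0, 1) w (t, y) * cnj (wave n t))"
      by (simp add: case_prod_unfold)
  qed simp
  hence "((\<lambda>y. integral {0..Lx} (\<lambda>t. w (t, y) * cnj (wave n t)) / of_real Lx) has_vector_derivative
      integral {0..Lx} (\<lambda>t. dpart (0, 1) w (t, y) * cnj (wave n t)) / of_real Lx) (at y within {-H..H})"
    using bounded_linear.has_vector_derivative[OF bounded_linear_divide] by simp
  thus ?thesis
    unfolding fcoeff_continuous[OF section_continuous(1)[OF c(1)]] fcoeff_continuous[OF section_continuous(1)[OF c(3)]] .
qed

text \<open>The trace theorem into the space of order 1/2, in Fourier form. Each mode is a function
  of x2 alone, to which the endpoint estimate applies with A = |\<alpha>_n|; the factor 1 +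
  \<alpha>_n^2 on the right counts the modes of w and of its horizontal derivative. Bessel's
  inequality on each horizontal line sums the modes.\<close>

lemma trace_fcoeff_smooth:
  assumes w: "smooth w" and q: "quasi_periodic Lx a0 w" and y0: "y0 = H \<or> y0 = - H" and F: "finite F"
  shows "Lx * (\<Sum>n\<in>F. (1 + \<bar>alpha Lx a0 n\<bar>) * (cmod (fcoeff Lx a0 (\<lambda>t. w (t, y0)) n))\<^sup>2)
    \<le> (1 / H + 2) * (H1_norm (Omega Lx H) w)\<^sup>2"
proof -
  note c = smooth_continuous[OF w] smooth_partials(3,4)[OF w]
  let ?W = "\<lambda>n y. fcoeff Lx a0 (\<lambda>t. w (t, y)) n"
  let ?W1 = "\<lambda>n y. fcoeff Lx a0 (\<lambda>t. dpart (1, 0) w (t, y)) n"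
  let ?W2 = "\<lambda>n y. fcoeff Lx a0 (\<lambda>t. dpart (0, 1) w (t, y)) n"
  let ?g = "\<lambda>n y. (1 + \<bar>alpha Lx a0 n\<bar>\<^sup>2) * (cmod (?W n y))\<^sup>2 + (cmod (?W2 n y))\<^sup>2"
  let ?e = "\<lambda>x. (cmod (w x))\<^sup>2 + (cmod (dpart (1, 0) w x))\<^sup>2 + (cmod (dpart (0, 1) w x))\<^sup>2"
  have C: "0 \<le> 1 / H + 2" using H by simp
  have ce: "continuous_on UNIV ?e" by (intro continuous_on_add cont_cmod_sq c)
  have gi: "?g n integrable_on {-H..H}" for n
    by (intro integrable_continuous_real continuous_on_add continuous_on_mult_left continuous_on_power
        continuous_on_norm fcoeff_section_continuous c)
  have 1: "(1 + \<bar>alpha Lx a0 n\<bar>) * (cmod (?W n y0))\<^sup>2 \<le> (1 / H + 2) * integral {-H..H} (?g n)" for n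
    by (rule endpoint_estimate[OF H y0 abs_ge_zero fcoeff_partial2[OF w] fcoeff_section_continuous[OF c(3)]])
  have 2: "Lx * (\<Sum>n\<in>F. ?g n y) \<le> integral {0..Lx} (\<lambda>x. ?e (x, y))" for y
  proof -
    have B: "Lx * (\<Sum>n\<in>F. (cmod (fcoeff Lx a0 (\<lambda>t. f (t, y)) n))\<^sup>2) \<le> integral {0..Lx} (\<lambda>x. (cmod (f (x, y)))\<^sup>2)"
      if "continuous_on UNIV f" for f :: "real \<times> real \<Rightarrow> complex"
    proof -
      have "(\<lambda>t. f (t, y)) \<in> L2 {0<..<Lx}"
        by (rule continuous_L2_bounded[OF section_continuous(1)[OF that] _ interval_lmeasurable]) simp
      from Bessel_fcoeff[OF F this] show ?thesis
        unfolding L2_norm_interval[OF section_continuous(1)[OF that]] .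
    qed
    have "?g n y = (cmod (?W n y))\<^sup>2 + (cmod (?W1 n y))\<^sup>2 + (cmod (?W2 n y))\<^sup>2" for n
      unfolding fcoeff_partial1[OF w q] by (simp add: norm_mult power_mult_distrib algebra_simps)
    hence "Lx * (\<Sum>n\<in>F. ?g n y) = Lx * (\<Sum>n\<in>F. (cmod (?W n y))\<^sup>2) + Lx * (\<Sum>n\<in>F. (cmod (?W1 n y))\<^sup>2) + Lx * (\<Sum>n\<in>F. (cmod (?W2 n y))\<^sup>2)"
      by (simp only: sum.distrib distrib_left)
    also have "\<dots> \<le> integral {0..Lx} (\<lambda>x. (cmod (w (x, y)))\<^sup>2) + integral {0..Lx} (\<lambda>x. (cmod (dpart (1, 0) w (x, y)))\<^sup>2)
        + integral {0..Lx} (\<lambda>x. (cmod (dpart (0, 1) w (x, y)))\<^sup>2)"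
      by (intro add_mono B c)
    also have "\<dots> = integral {0..Lx} (\<lambda>x. ?e (x, y))"
    proof -
      note i = section_integrable(1)[OF cont_cmod_sq[OF c(1)], of y 0 Lx] section_integrable(1)[OF cont_cmod_sq[OF c(2)], of y 0 Lx]
        section_integrable(1)[OF cont_cmod_sq[OF c(3)], of y 0 Lx]
      show ?thesis
        by (simp only: Henstock_Kurzweil_Integration.integral_add[OF integrable_add[OF i(1,2)] i(3)]
            Henstock_Kurzweil_Integration.integral_add[OF i(1,2)])
    qed
    finally show ?thesis .
  qed
  have "Lx * (\<Sum>n\<in>F. (1 + \<bar>alpha Lx a0 n\<bar>) * (cmod (?W n y0))\<^sup>2) \<le> Lx * (\<Sum>n\<in>F. (1 / H + 2) * integral {-H..H} (?g n))"
    using Lx by (intro mult_left_mono sum_mono 1) simp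
  also have "\<dots> = (1 / H + 2) * integral {-H..H} (\<lambda>y. Lx * (\<Sum>n\<in>F. ?g n y))"
  proof -
    have "integral {-H..H} (\<lambda>y. \<Sum>n\<in>F. ?g n y) = (\<Sum>n\<in>F. integral {-H..H} (?g n))"
      by (rule integral_sum[OF F gi])
    moreover have "Lx * (\<Sum>n\<in>F. (1 / H + 2) * integral {-H..H} (?g n)) = (1 / H + 2) * (Lx * (\<Sum>n\<in>F. integral {-H..H} (?g n)))"
      by (simp only: sum_distrib_left[symmetric] mult.left_commute)
    ultimately show ?thesis by (simp only: integral_mult_right)
  qed
  also have "\<dots> \<le> (1 / H + 2) * integral {-H..H} (\<lambda>y. integral {0..Lx} (\<lambda>x. ?e (x, y)))"
  proof (intro mult_left_mono C integral_le 2)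
    show "(\<lambda>y. Lx * (\<Sum>n\<in>F. ?g n y)) integrable_on {-H..H}"
      by (intro integrable_on_mult_right integrable_sum F gi)
    show "(\<lambda>y. integral {0..Lx} (\<lambda>x. ?e (x, y))) integrable_on {-H..H}"
      by (rule section_integrable(3)[OF ce])
  qed
  finally show ?thesis unfolding H1_norm_smooth[OF w] .
qed

end

section \<open>The Poincare inequality\<close>

context cell
begin

text \<open>Integrates a pointwise bound by a horizontal line integral over the cell: the line
  integral does not depend on x1 and picks up \<open>Lx\<close>, the constant B picks up the area 2
  H \<open>Lx\<close>.\<close>

lemma cell_bound:
  fixes f g :: "real \<times> real \<Rightarrow> complex"
  assumes f: "continuous_on UNIV f" and g: "continuous_on UNIV g"
    and le: "\<And>x y. x \<in> {0..Lx} \<Longrightarrow> y \<in> {-H..H} \<Longrightarrow>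
      (cmod (f (x, y)))\<^sup>2 \<le> A * integral {0..Lx} (\<lambda>t. (cmod (g (t, y)))\<^sup>2) + B"
  shows "(L2_norm (Omega Lx H) f)\<^sup>2 \<le> Lx * A * (L2_norm (Omega Lx H) g)\<^sup>2 + 2 * H * Lx * B"
proof -
  let ?p = "\<lambda>y. integral {0..Lx} (\<lambda>t. (cmod (g (t, y)))\<^sup>2)"
  have pi: "?p integrable_on {-H..H}" by (rule section_integrable(3)[OF cont_cmod_sq[OF g]])
  have "(L2_norm (Omega Lx H) f)\<^sup>2 = integral {-H..H} (\<lambda>y. integral {0..Lx} (\<lambda>x. (cmod (f (x, y)))\<^sup>2))"
    unfolding L2_norm_cell[OF f] by (rule integral_cell(2)[OF cont_cmod_sq[OF f]])
  also have "\<dots> \<le> integral {-H..H} (\<lambda>y. Lx * A * ?p y + Lx * B)"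
  proof (rule integral_le)
    show "(\<lambda>y. integral {0..Lx} (\<lambda>x. (cmod (f (x, y)))\<^sup>2)) integrable_on {-H..H}"
      by (rule section_integrable(3)[OF cont_cmod_sq[OF f]])
    show "(\<lambda>y. Lx * A * ?p y + Lx * B) integrable_on {-H..H}"
      by (rule integrable_add[OF integrable_on_mult_right[OF pi] integrable_const_ivl])
    fix y assume y: "y \<in> {-H..H}"
    have "integral {0..Lx} (\<lambda>x. (cmod (f (x, y)))\<^sup>2) \<le> integral {0..Lx} (\<lambda>x. A * ?p y + B)"
      by (rule integral_le[OF section_integrable(1)[OF cont_cmod_sq[OF f]] integrable_const_ivl le[OF _ y]])
    also have "\<dots> = Lx * A * ?p y + Lx * B" using Lx by (simp add: algebra_simps)
    finally show "integral {0..Lx} (\<lambda>x. (cmod (f (x, y)))\<^sup>2) \<le> Lx * A * ?p y + Lx * B" .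
  qed
  also have "\<dots> = integral {-H..H} (\<lambda>y. Lx * A * ?p y) + integral {-H..H} (\<lambda>y. Lx * B)"
    by (rule Henstock_Kurzweil_Integration.integral_add[OF integrable_on_mult_right[OF pi] integrable_const_ivl])
  also have "\<dots> = Lx * A * integral {-H..H} ?p + 2 * H * Lx * B"
    using H by simp
  also have "integral {-H..H} ?p = (L2_norm (Omega Lx H) g)\<^sup>2"
    unfolding L2_norm_cell[OF g] by (rule integral_cell(2)[OF cont_cmod_sq[OF g], symmetric])
  finally show ?thesis .
qed

lemma horizontal_increment:
  fixes w :: "real \<times> real \<Rightarrow> complex"
  assumes w: "smooth w" and "x \<in> {0..Lx}" "t \<in> {0..Lx}"
  shows "cmod (w (x, y) - w (t, y)) \<le> integral {0..Lx} (\<lambda>s. cmod (dpart (1, 0) w (s, y)))"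
  by (rule increment_le_integral[OF smooth_partials(1)[OF w] section_continuous(1)[OF smooth_partials(3)[OF w]] assms(2,3)])

lemma vertical_increment:
  fixes w :: "real \<times> real \<Rightarrow> complex"
  assumes w: "smooth w" and "x \<in> {-H..H}" "t \<in> {-H..H}"
  shows "cmod (w (y, x) - w (y, t)) \<le> integral {-H..H} (\<lambda>s. cmod (dpart (0, 1) w (y, s)))"
  by (rule increment_le_integral[OF smooth_partials(2)[OF w] section_continuous(2)[OF smooth_partials(4)[OF w]] assms(2,3)])

lemma horizontal_CS:
  assumes "continuous_on UNIV (f :: real \<times> real \<Rightarrow> complex)"
  shows "(integral {0..Lx} (\<lambda>s. cmod (f (s, y))))\<^sup>2 \<le> Lx * integral {0..Lx} (\<lambda>s. (cmod (f (s, y)))\<^sup>2)"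
  using integral_Cauchy_Schwarz[OF continuous_on_norm[OF section_continuous(1)[OF assms]] Lx, of y] by simp

text \<open>If the Bloch factor is not 1, then w(Lx,y) - w(0,y) is a nonzero multiple of w(0,y). The
  horizontal variation thus controls w on the left side, and from there on the whole line.\<close>

lemma poincare_shift:
  assumes e: "exp (\<i> * complex_of_real (a0 * Lx)) \<noteq> 1"
  shows "\<exists>C\<ge>0. \<forall>w. smooth w \<and> quasi_periodic Lx a0 w \<longrightarrow> (L2_norm (Omega Lx H) w)\<^sup>2 \<le> C * grad_sq w"
proof -
  define q where "q = cmod (exp (\<i> * complex_of_real (a0 * Lx)) - 1)"
  have q: "q > 0" using e by (simp add: q_def)
  \<comment> \<open>The part 1/q bounds w(0,y) by the horizontal variation, the 1 accounts for
    moving from (0,y) to (x,y).\<close>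
  define K where "K = 1 / q + 1"
  have K: "K \<ge> 0" using q by (simp add: K_def)
  have "(L2_norm (Omega Lx H) w)\<^sup>2 \<le> (Lx * (K\<^sup>2 * Lx)) * grad_sq w"
    if w: "smooth w" and qp: "quasi_periodic Lx a0 w" for w
  proof -
    let ?w1 = "dpart (1, 0) w"
    have "(cmod (w (x, y)))\<^sup>2 \<le> (K\<^sup>2 * Lx) * integral {0..Lx} (\<lambda>t. (cmod (?w1 (t, y)))\<^sup>2) + 0"
      if x: "x \<in> {0..Lx}" for x y
    proof -
      define P where "P = integral {0..Lx} (\<lambda>s. cmod (?w1 (s, y)))"
      have "w (0 + Lx, y) = exp (\<i> * complex_of_real (a0 * Lx)) * w (0, y)"
        using qp unfolding quasi_periodic_def by blast
      hence "w (Lx, y) - w (0, y) = (exp (\<i> * complex_of_real (a0 * Lx)) - 1) * w (0, y)"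
        by (simp add: algebra_simps)
      hence "cmod (w (Lx, y) - w (0, y)) = q * cmod (w (0, y))" by (simp only: norm_mult q_def)
      moreover have "cmod (w (Lx, y) - w (0, y)) \<le> P"
        unfolding P_def by (rule horizontal_increment[OF w]) (use Lx in auto)
      ultimately have 1: "cmod (w (0, y)) \<le> P / q" using q by (simp add: field_simps)
      have 2: "cmod (w (x, y) - w (0, y)) \<le> P"
        unfolding P_def by (rule horizontal_increment[OF w x]) (use Lx in auto)
      have "cmod (w (x, y)) \<le> cmod (w (x, y) - w (0, y)) + cmod (w (0, y))"
        using norm_triangle_ineq[of "w (x, y) - w (0, y)" "w (0, y)"] by simp
      also have "\<dots> \<le> K * P" using 1 2 by (simp add: K_def algebra_simps)
      finally have "(cmod (w (x, y)))\<^sup>2 \<le> (K * P)\<^sup>2" by (intro power_mono) auto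
      also have "\<dots> = K\<^sup>2 * P\<^sup>2" by (rule power_mult_distrib)
      also have "\<dots> \<le> K\<^sup>2 * (Lx * integral {0..Lx} (\<lambda>t. (cmod (?w1 (t, y)))\<^sup>2))"
        unfolding P_def by (intro mult_left_mono horizontal_CS smooth_partials(3)[OF w]) simp
      finally show ?thesis by simp
    qed
    from cell_bound[OF smooth_continuous[OF w] smooth_partials(3)[OF w] this]
    have "(L2_norm (Omega Lx H) w)\<^sup>2 \<le> Lx * (K\<^sup>2 * Lx) * (L2_norm (Omega Lx H) ?w1)\<^sup>2" by simp
    also have "\<dots> \<le> Lx * (K\<^sup>2 * Lx) * grad_sq w"
      unfolding grad_sq_smooth[OF w] using Lx by (intro mult_left_mono) auto
    finally show ?thesis .
  qed
  moreover have "Lx * (K\<^sup>2 * Lx) \<ge> 0" using Lx by simp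
  ultimately show ?thesis by blast
qed

text \<open>When \<alpha>_m = 0 the m-th coefficient is the mean of w over the line x2 = H. Each
  point (x,y) is joined horizontally to (t,y) and then vertically to (t,H), and the resulting bound
  is averaged over t.\<close>

lemma poincare_mean:
  assumes m: "alpha Lx a0 m = 0"
  shows "\<exists>C\<ge>0. \<forall>w. smooth w \<longrightarrow>
    (L2_norm (Omega Lx H) w)\<^sup>2 \<le> C * (grad_sq w + (cmod (fcoeff Lx a0 (\<lambda>t. w (t, H)) m))\<^sup>2)"
proof -
  \<comment> \<open>The summands are the factors produced by \<open>cell_bound\<close> for the
    horizontal derivative, the vertical derivative and the mean; the sum dominates each of
    them.\<close>
  define C where "C = 4 * Lx\<^sup>2 + 16 * H\<^sup>2 + 4 * H * Lx"
  have "(L2_norm (Omega Lx H) w)\<^sup>2 \<le> C * (grad_sq w + (cmod (fcoeff Lx a0 (\<lambda>t. w (t, H)) m))\<^sup>2)"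
    if w: "smooth w" for w
  proof -
    let ?w1 = "dpart (1, 0) w" and ?w2 = "dpart (0, 1) w"
    define \<phi> where "\<phi> = fcoeff Lx a0 (\<lambda>t. w (t, H)) m"
    define R where "R t = integral {-H..H} (\<lambda>s. cmod (?w2 (t, s)))" for t
    define T where "T = integral {0..Lx} R / Lx"
    define Q2 where "Q2 = (L2_norm (Omega Lx H) ?w2)\<^sup>2"
    note c = smooth_continuous[OF w] smooth_partials(3,4)[OF w]
    have phi: "of_real Lx * \<phi> = integral {0..Lx} (\<lambda>t. w (t, H))"
      unfolding \<phi>_def fcoeff_continuous[OF section_continuous(1)[OF c(1)]] using Lx m by simp
    have Rc: "continuous_on S R" for S
      unfolding R_def by (rule param_integral_continuous(2)[OF continuous_on_norm[OF c(3)]])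
    have T2: "T\<^sup>2 \<le> (2 * H / Lx) * Q2"
    proof -
      have "(integral {0..Lx} R)\<^sup>2 \<le> Lx * integral {0..Lx} (\<lambda>t. (R t)\<^sup>2)"
        using integral_Cauchy_Schwarz[OF Rc Lx] by simp
      also have "integral {0..Lx} (\<lambda>t. (R t)\<^sup>2) \<le> integral {0..Lx} (\<lambda>t. 2 * H * integral {-H..H} (\<lambda>s. (cmod (?w2 (t, s)))\<^sup>2))"
      proof (rule integral_le)
        show "(\<lambda>t. (R t)\<^sup>2) integrable_on {0..Lx}" by (intro integrable_continuous_real continuous_on_power Rc)
        show "(\<lambda>t. 2 * H * integral {-H..H} (\<lambda>s. (cmod (?w2 (t, s)))\<^sup>2)) integrable_on {0..Lx}"
          by (rule integrable_on_mult_right[OF section_integrable(4)[OF cont_cmod_sq[OF c(3)]]])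
        show "(R t)\<^sup>2 \<le> 2 * H * integral {-H..H} (\<lambda>s. (cmod (?w2 (t, s)))\<^sup>2)" for t
          using integral_Cauchy_Schwarz[OF continuous_on_norm[OF section_continuous(2)[OF c(3)]], of "- H" H t] H
          by (simp add: R_def)
      qed
      also have "\<dots> = 2 * H * Q2"
        unfolding Q2_def L2_norm_cell[OF c(3)] integral_cell(1)[OF cont_cmod_sq[OF c(3)]] by simp
      finally have "(integral {0..Lx} R)\<^sup>2 \<le> Lx * (2 * H * Q2)" using Lx by simp
      hence "(integral {0..Lx} R)\<^sup>2 / Lx\<^sup>2 \<le> Lx * (2 * H * Q2) / Lx\<^sup>2" by (rule divide_right_mono) simp
      thus ?thesis using Lx by (simp add: T_def power_divide power2_eq_square)
    qed
    \<comment> \<open>P and T are the horizontal variation and the averaged vertical one, and |w -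
      mean| <= P + T. Using |a+b|^2 <= 2|a|^2 + 2|b|^2 twice gives the factors 4, 4 and 2.\<close>
    have "(cmod (w (x, y)))\<^sup>2 \<le> (4 * Lx) * integral {0..Lx} (\<lambda>t. (cmod (?w1 (t, y)))\<^sup>2) + (4 * ((2 * H / Lx) * Q2) + 2 * (cmod \<phi>)\<^sup>2)"
      if x: "x \<in> {0..Lx}" and y: "y \<in> {-H..H}" for x y
    proof -
      define P where "P = integral {0..Lx} (\<lambda>s. cmod (?w1 (s, y)))"
      have "((\<lambda>t. w (x, y) - w (t, H)) has_integral of_real Lx * w (x, y) - of_real Lx * \<phi>) {0..Lx}"
      proof (rule has_integral_diff)
        show "((\<lambda>t. w (x, y)) has_integral of_real Lx * w (x, y)) {0..Lx}"
          using has_integral_const_real[of "w (x, y)" 0 Lx] Lx by (simp add: scaleR_conv_of_real)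
        show "((\<lambda>t. w (t, H)) has_integral of_real Lx * \<phi>) {0..Lx}"
          unfolding phi by (rule integrable_integral[OF section_integrable(1)[OF c(1)]])
      qed
      moreover have "((\<lambda>t. P + R t) has_integral Lx * P + Lx * T) {0..Lx}"
      proof (rule has_integral_add)
        show "((\<lambda>t. P) has_integral Lx * P) {0..Lx}" using has_integral_const_real[of P 0 Lx] Lx by simp
        have "(R has_integral integral {0..Lx} R) {0..Lx}"
          by (rule integrable_integral[OF integrable_continuous_real[OF Rc]])
        thus "(R has_integral Lx * T) {0..Lx}" using Lx by (simp add: T_def)
      qed
      moreover have "cmod (w (x, y) - w (t, H)) \<le> P + R t" if t: "t \<in> {0..Lx}" for t
      proof -
        have "cmod (w (x, y) - w (t, H)) \<le> cmod (w (x, y) - w (t, y)) + cmod (w (t, y) - w (t, H))"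
          using norm_triangle_ineq[of "w (x, y) - w (t, y)" "w (t, y) - w (t, H)"] by simp
        also have "\<dots> \<le> P + R t"
          unfolding P_def R_def by (intro add_mono horizontal_increment[OF w x t] vertical_increment[OF w y]) (use H in simp)
        finally show ?thesis .
      qed
      ultimately have "cmod (of_real Lx * w (x, y) - of_real Lx * \<phi>) \<le> Lx * P + Lx * T"
        using integral_norm_bound_integral[of "\<lambda>t. w (x, y) - w (t, H)" "{0..Lx}" "\<lambda>t. P + R t"]
        by (simp add: has_integral_iff)
      moreover have "of_real Lx * w (x, y) - of_real Lx * \<phi> = of_real Lx * (w (x, y) - \<phi>)" by (simp add: algebra_simps)
      ultimately have "Lx * cmod (w (x, y) - \<phi>) \<le> Lx * (P + T)" using Lx by (simp add: norm_mult distrib_left)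
      hence "cmod (w (x, y) - \<phi>) \<le> P + T" using Lx by simp
      hence "(cmod (w (x, y) - \<phi>))\<^sup>2 \<le> (P + T)\<^sup>2" by (intro power_mono) auto
      also have "\<dots> \<le> 2 * P\<^sup>2 + 2 * T\<^sup>2" using norm_add_sq_le[of P T] by simp
      finally have 1: "(cmod (w (x, y) - \<phi>))\<^sup>2 \<le> 2 * P\<^sup>2 + 2 * T\<^sup>2" .
      have 2: "(cmod (w (x, y)))\<^sup>2 \<le> 2 * (cmod (w (x, y) - \<phi>))\<^sup>2 + 2 * (cmod \<phi>)\<^sup>2"
        using norm_add_sq_le[of "w (x, y) - \<phi>" \<phi>] by simp
      have 3: "P\<^sup>2 \<le> Lx * integral {0..Lx} (\<lambda>t. (cmod (?w1 (t, y)))\<^sup>2)"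
        unfolding P_def by (rule horizontal_CS[OF c(2)])
      show ?thesis using 1 2 3 T2 by linarith
    qed
    from cell_bound[OF c(1,2) this]
    have "(L2_norm (Omega Lx H) w)\<^sup>2 \<le> Lx * (4 * Lx) * (L2_norm (Omega Lx H) ?w1)\<^sup>2
        + 2 * H * Lx * (4 * ((2 * H / Lx) * Q2) + 2 * (cmod \<phi>)\<^sup>2)" .
    also have "\<dots> = (4 * Lx\<^sup>2) * (L2_norm (Omega Lx H) ?w1)\<^sup>2 + (16 * H\<^sup>2) * Q2 + (4 * H * Lx) * (cmod \<phi>)\<^sup>2"
      using Lx by (simp add: field_simps power2_eq_square)
    also have "\<dots> \<le> C * (L2_norm (Omega Lx H) ?w1)\<^sup>2 + C * Q2 + C * (cmod \<phi>)\<^sup>2"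
      by (intro add_mono mult_right_mono) (use Lx H in \<open>auto simp: C_def Q2_def\<close>)
    also have "\<dots> = C * (grad_sq w + (cmod \<phi>)\<^sup>2)"
      unfolding grad_sq_smooth[OF w] Q2_def by (simp add: distrib_left)
    finally show ?thesis unfolding \<phi>_def .
  qed
  moreover have "C \<ge> 0" using Lx H by (simp add: C_def)
  ultimately show ?thesis by blast
qed

text \<open>A nonzero constant is quasi-periodic only if some \<open>\<alpha>\<^sub>n\<close> vanishes, and then it is detected by
  the corresponding Fourier coefficient of its trace.\<close>

lemma poincare_smooth:
  "\<exists>C\<ge>0. \<exists>M. finite M \<and> (\<forall>n\<in>M. alpha Lx a0 n = 0) \<and> (\<forall>w. smooth w \<and> quasi_periodic Lx a0 w \<longrightarrow>
    (L2_norm (Omega Lx H) w)\<^sup>2 \<le> C * (grad_sq w + (\<Sum>n\<in>M. (cmod (fcoeff Lx a0 (\<lambda>t. w (t, H)) n))\<^sup>2)))"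
proof (cases "exp (\<i> * complex_of_real (a0 * Lx)) = 1")
  case False
  from poincare_shift[OF this] obtain C where "C \<ge> 0"
    "\<forall>w. smooth w \<and> quasi_periodic Lx a0 w \<longrightarrow> (L2_norm (Omega Lx H) w)\<^sup>2 \<le> C * grad_sq w" by blast
  thus ?thesis by (intro exI[of _ C] conjI exI[of _ "{}"]) auto
next
  case True
  \<comment> \<open>The Bloch factor is 1 exactly when a0 \<open>Lx\<close> = 2 pi k, and then the
    index -k has \<alpha> equal to zero.\<close>
  then obtain k :: int where k: "a0 * Lx = of_int (2 * k) * pi"
    unfolding exp_eq_1 by auto
  hence "alpha Lx a0 (- k) = 0" using Lx by (simp add: alpha_def field_simps)
  moreover from poincare_mean[OF this] obtain C where "C \<ge> 0" "\<forall>w. smooth w \<longrightarrow>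
    (L2_norm (Omega Lx H) w)\<^sup>2 \<le> C * (grad_sq w + (cmod (fcoeff Lx a0 (\<lambda>t. w (t, H)) (- k)))\<^sup>2)" by blast
  ultimately show ?thesis by (intro exI[of _ C] conjI exI[of _ "{- k}"]) auto
qed

end

section \<open>Quasi-periodic functions\<close>

lemma smooth_zero: "smooth (\<lambda>x. 0)"
proof -
  have z: "dpart b (\<lambda>x :: 'a. 0) = (\<lambda>x. 0)" for b :: "'a::euclidean_space"
    by (rule ext) (rule dpart_eq[OF has_derivative_const])
  have "Ck_on k UNIV (\<lambda>x :: 'a::euclidean_space. 0)" for k
    by (induction k) (simp_all add: z)
  thus ?thesis by (simp add: smooth_def)
qed

lemma tendsto_zero_bound:
  fixes a b x :: "nat \<Rightarrow> real"
  assumes "\<And>n. 0 \<le> x n" "\<And>n. x n \<le> a n + K * b n" "a \<longlonglongrightarrow> 0" "b \<longlonglongrightarrow> 0"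
  shows "x \<longlonglongrightarrow> 0"
proof (rule Lim_null_comparison)
  show "\<forall>\<^sub>F n in sequentially. norm (x n) \<le> a n + K * b n" using assms(1,2) by simp
  show "(\<lambda>n. a n + K * b n) \<longlonglongrightarrow> 0"
    using tendsto_add[OF assms(3) tendsto_mult_left[OF assms(4), of K]] by simp
qed

context cell
begin

abbreviation QP :: "(real \<times> real \<Rightarrow> complex) set" where
  "QP \<equiv> H1qp Lx H a0"

lemma QP_H1: "u \<in> QP \<Longrightarrow> u \<in> H1 (Omega Lx H)"
  by (simp add: H1qp_def)

lemma QP_approx:
  assumes "u \<in> QP"
  obtains w where "\<And>n :: nat. smooth (w n)" "\<And>n. quasi_periodic Lx a0 (w n)"
    "(\<lambda>n. H1_norm (Omega Lx H) (\<lambda>x. u x - w n x)) \<longlonglongrightarrow> 0"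
proof -
  have "\<exists>w. smooth w \<and> quasi_periodic Lx a0 w \<and> H1_norm (Omega Lx H) (\<lambda>x. u x - w x) < inverse (real (Suc n))" for n
    using assms by (simp add: H1qp_def)
  hence "\<forall>n. \<exists>w. smooth w \<and> quasi_periodic Lx a0 w \<and> H1_norm (Omega Lx H) (\<lambda>x. u x - w x) < inverse (real (Suc n))"
    by blast
  from choice[OF this] obtain w where w: "\<forall>n. smooth (w n) \<and> quasi_periodic Lx a0 (w n) \<and>
      H1_norm (Omega Lx H) (\<lambda>x. u x - w n x) < inverse (real (Suc n))" ..
  have "(\<lambda>n. H1_norm (Omega Lx H) (\<lambda>x. u x - w n x)) \<longlonglongrightarrow> 0"
  proof (rule Lim_null_comparison[OF _ LIMSEQ_inverse_real_of_nat])
    show "\<forall>\<^sub>F n in sequentially. norm (H1_norm (Omega Lx H) (\<lambda>x. u x - w n x)) \<le> inverse (real (Suc n))"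
      using w by (intro always_eventually allI) (simp add: less_imp_le)
  qed
  thus ?thesis using that w by blast
qed

lemma QP_lin:
  assumes u: "u \<in> QP" and v: "v \<in> QP"
  shows "(\<lambda>x. u x + c * v x) \<in> QP"
  unfolding H1qp_def
proof (intro CollectI conjI allI impI)
  show "(\<lambda>x. u x + c * v x) \<in> H1 (Omega Lx H)" by (rule H1_lin[OF QP_H1[OF u] QP_H1[OF v]])
  fix e :: real assume e: "e > 0"
  define d where "d = e / (2 * (1 + cmod c))"
  have c1: "1 + cmod c > 0" by (rule add_pos_nonneg) simp_all
  have d: "d > 0" using e c1 by (simp add: d_def)
  obtain w where w: "smooth w" "quasi_periodic Lx a0 w" "H1_norm (Omega Lx H) (\<lambda>x. u x - w x) < d"
    using u d by (auto simp: H1qp_def)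
  obtain w' where w': "smooth w'" "quasi_periodic Lx a0 w'" "H1_norm (Omega Lx H) (\<lambda>x. v x - w' x) < d"
    using v d by (auto simp: H1qp_def)
  have h: "(\<lambda>x. u x - w x) \<in> H1 (Omega Lx H)" "(\<lambda>x. v x - w' x) \<in> H1 (Omega Lx H)"
    by (rule H1.diff_mem[OF QP_H1[OF u] smooth_H1[OF w(1)]], rule H1.diff_mem[OF QP_H1[OF v] smooth_H1[OF w'(1)]])
  have eq: "(\<lambda>x. (u x + c * v x) - (w x + c * w' x)) = (\<lambda>x. (u x - w x) + c * (v x - w' x))"
    by (rule ext) (simp add: algebra_simps)
  have "H1_norm (Omega Lx H) (\<lambda>x. (u x - w x) + c * (v x - w' x))
      \<le> H1_norm (Omega Lx H) (\<lambda>x. u x - w x) + H1_norm (Omega Lx H) (\<lambda>x. c * (v x - w' x))"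
    by (rule H1.nrm_triangle[OF h(1) H1.scale_mem[OF h(2)]])
  also have "H1_norm (Omega Lx H) (\<lambda>x. c * (v x - w' x)) = cmod c * H1_norm (Omega Lx H) (\<lambda>x. v x - w' x)"
    by (rule H1.nrm_scale[OF h(2)])
  also have "H1_norm (Omega Lx H) (\<lambda>x. u x - w x) + cmod c * H1_norm (Omega Lx H) (\<lambda>x. v x - w' x) \<le> d + cmod c * d"
    using w(3) w'(3) by (intro add_mono mult_left_mono) auto
  also have "\<dots> = e / 2" using c1 by (simp add: d_def divide_simps) (simp add: algebra_simps)
  also have "\<dots> < e" using e by simp
  finally have "H1_norm (Omega Lx H) (\<lambda>x. (u x + c * v x) - (w x + c * w' x)) < e" unfolding eq .
  moreover have "quasi_periodic Lx a0 (\<lambda>x. w x + c * w' x)"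
    using w(2) w'(2) by (simp add: quasi_periodic_def algebra_simps)
  ultimately show "\<exists>w. smooth w \<and> quasi_periodic Lx a0 w \<and> H1_norm (Omega Lx H) (\<lambda>x. u x + c * v x - w x) < e"
    using smooth_lin[OF w(1) w'(1)] by blast
qed

lemma H1_norm_zero: "H1_norm (Omega Lx H) (\<lambda>x. 0) = 0"
  using H1.nrm_scale[OF H1.zero_mem, of 0] by simp

lemma QP_zero: "(\<lambda>x. 0) \<in> QP"
  unfolding H1qp_def
  using H1.zero_mem smooth_zero by (auto simp: quasi_periodic_def H1_norm_zero intro!: exI[of _ "\<lambda>x. 0"])

lemma QP_limit:
  assumes u: "u \<in> H1 (Omega Lx H)" and s: "\<And>n. s n \<in> QP"
    and lim: "(\<lambda>n. H1_norm (Omega Lx H) (\<lambda>x. s n x - u x)) \<longlonglongrightarrow> 0"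
  shows "u \<in> QP"
  unfolding H1qp_def
proof (intro CollectI conjI allI impI u)
  fix e :: real assume "e > 0"
  hence e: "0 < e / 2" by simp
  from order_tendstoD(2)[OF lim e] obtain n where n: "H1_norm (Omega Lx H) (\<lambda>x. s n x - u x) < e / 2"
    by (auto simp: eventually_sequentially)
  obtain w where w: "smooth w" "quasi_periodic Lx a0 w" "H1_norm (Omega Lx H) (\<lambda>x. s n x - w x) < e / 2"
    using s[of n] e unfolding H1qp_def by blast
  have "H1_norm (Omega Lx H) (\<lambda>x. u x - w x)
      \<le> H1_norm (Omega Lx H) (\<lambda>x. u x - s n x) + H1_norm (Omega Lx H) (\<lambda>x. s n x - w x)"
    by (rule H1.nrm_triangle_diff[OF u QP_H1[OF s] smooth_H1[OF w(1)]])
  hence "H1_norm (Omega Lx H) (\<lambda>x. u x - w x) < e"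
    using n w(3) H1.nrm_minus_commute[OF u QP_H1[OF s[of n]]] by linarith
  thus "\<exists>w. smooth w \<and> quasi_periodic Lx a0 w \<and> H1_norm (Omega Lx H) (\<lambda>x. u x - w x) < e"
    using w by blast
qed

lemma QP_semi_ip: "semi_ip QP H1_ip"
proof
  show "(\<lambda>x. 0) \<in> QP" by (rule QP_zero)
  show "(\<lambda>x. u x + c * v x) \<in> QP" if "u \<in> QP" "v \<in> QP" for u v c by (rule QP_lin[OF that])
  show "H1_ip (\<lambda>x. u x + c * v x) w = H1_ip u w + c * H1_ip v w" if "u \<in> QP" "v \<in> QP" "w \<in> QP" for u v w c
    by (rule H1.ip_lin[OF QP_H1[OF that(1)] QP_H1[OF that(2)] QP_H1[OF that(3)]])
  show "H1_ip v u = cnj (H1_ip u v)" if "u \<in> QP" "v \<in> QP" for u v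
    by (rule H1.ip_herm[OF QP_H1[OF that(1)] QP_H1[OF that(2)]])
  show "0 \<le> Re (H1_ip u u)" if "u \<in> QP" for u by (rule H1.ip_pos[OF QP_H1[OF that]])
qed

lemma QP_complete_semi_ip: "complete_semi_ip QP H1_ip"
proof (rule complete_semi_ip.intro[OF QP_semi_ip], unfold_locales, unfold H1_norm_eq_nrm)
  fix s :: "nat \<Rightarrow> real \<times> real \<Rightarrow> complex"
  assume s: "\<And>n. s n \<in> QP"
    and cau: "\<And>e. 0 < e \<Longrightarrow> \<exists>N. \<forall>m\<ge>N. \<forall>n\<ge>N. H1_norm (Omega Lx H) (\<lambda>x. s m x - s n x) < e"
  from H1_complete[OF QP_H1[OF s] cau]
  obtain u where u: "u \<in> H1 (Omega Lx H)" "(\<lambda>n. H1_norm (Omega Lx H) (\<lambda>x. s n x - u x)) \<longlonglongrightarrow> 0" by blast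
  thus "\<exists>u\<in>QP. (\<lambda>n. H1_norm (Omega Lx H) (\<lambda>x. s n x - u x)) \<longlonglongrightarrow> 0"
    using QP_limit[OF u(1) s u(2)] by blast
qed

sublocale QPip: complete_semi_ip QP H1_ip
  rewrites "semi_ip.nrm H1_ip = H1_norm (Omega Lx H)"
  by (rule QP_complete_semi_ip) (rule H1_norm_eq_nrm)

section \<open>Traces of Sobolev functions and their Fourier coefficients\<close>

lemma section_L2: "smooth w \<Longrightarrow> (\<lambda>t. w (t, y)) \<in> L2 {0<..<Lx}" for w :: "real \<times> real \<Rightarrow> complex"
  by (rule continuous_L2_bounded[OF section_continuous(1)[OF smooth_continuous] _ interval_lmeasurable]) simp_all

lemma has_trace_L2: "has_trace Lx H y u g \<Longrightarrow> g \<in> L2 {0<..<Lx}"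
  by (simp add: has_trace_def)

lemma has_trace_approx:
  assumes "has_trace Lx H y u g"
  obtains w where "\<And>n :: nat. smooth (w n)" "(\<lambda>n. H1_norm (Omega Lx H) (\<lambda>x. u x - w n x)) \<longlonglongrightarrow> 0"
    "(\<lambda>n. L2_norm {0<..<Lx} (\<lambda>t. g t - w n (t, y))) \<longlonglongrightarrow> 0"
  using assms unfolding has_trace_def by blast

lemma smooth_has_trace:
  assumes "smooth w"
  shows "has_trace Lx H y w (\<lambda>t. w (t, y))"
  unfolding has_trace_def
  using section_L2[OF assms] assms by (auto intro!: exI[of _ "\<lambda>n. w"] simp: H1_norm_zero L2_norm_def)

lemma has_trace_lin:
  assumes u: "u \<in> H1 (Omega Lx H)" "has_trace Lx H y u g" and v: "v \<in> H1 (Omega Lx H)" "has_trace Lx H y v k"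
  shows "has_trace Lx H y (\<lambda>x. u x + c * v x) (\<lambda>t. g t + c * k t)"
proof -
  obtain w where w: "\<And>n :: nat. smooth (w n)" "(\<lambda>n. H1_norm (Omega Lx H) (\<lambda>x. u x - w n x)) \<longlonglongrightarrow> 0"
    "(\<lambda>n. L2_norm {0<..<Lx} (\<lambda>t. g t - w n (t, y))) \<longlonglongrightarrow> 0" using has_trace_approx[OF u(2)] by blast
  obtain w' where w': "\<And>n :: nat. smooth (w' n)" "(\<lambda>n. H1_norm (Omega Lx H) (\<lambda>x. v x - w' n x)) \<longlonglongrightarrow> 0"
    "(\<lambda>n. L2_norm {0<..<Lx} (\<lambda>t. k t - w' n (t, y))) \<longlonglongrightarrow> 0" using has_trace_approx[OF v(2)] by blast
  note L = has_trace_L2[OF u(2)] has_trace_L2[OF v(2)]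
  have 1: "(\<lambda>n. H1_norm (Omega Lx H) (\<lambda>x. (u x + c * v x) - (w n x + c * w' n x))) \<longlonglongrightarrow> 0"
  proof (rule tendsto_zero_bound[OF _ _ w(2) w'(2)])
    fix n
    have h: "(\<lambda>x. u x - w n x) \<in> H1 (Omega Lx H)" "(\<lambda>x. v x - w' n x) \<in> H1 (Omega Lx H)"
      by (rule H1.diff_mem[OF u(1) smooth_H1[OF w(1)]], rule H1.diff_mem[OF v(1) smooth_H1[OF w'(1)]])
    have eq: "(\<lambda>x. (u x + c * v x) - (w n x + c * w' n x)) = (\<lambda>x. (u x - w n x) + c * (v x - w' n x))"
      by (rule ext) (simp add: algebra_simps)
    show "H1_norm (Omega Lx H) (\<lambda>x. (u x + c * v x) - (w n x + c * w' n x))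
        \<le> H1_norm (Omega Lx H) (\<lambda>x. u x - w n x) + cmod c * H1_norm (Omega Lx H) (\<lambda>x. v x - w' n x)"
      unfolding eq using H1.nrm_triangle[OF h(1) H1.scale_mem[OF h(2), of c]] H1.nrm_scale[OF h(2), of c] by linarith
  qed simp
  have 2: "(\<lambda>n. L2_norm {0<..<Lx} (\<lambda>t. (g t + c * k t) - (w n (t, y) + c * w' n (t, y)))) \<longlonglongrightarrow> 0"
  proof (rule tendsto_zero_bound[OF _ _ w(3) w'(3)])
    fix n
    have h: "(\<lambda>t. g t - w n (t, y)) \<in> L2 {0<..<Lx}" "(\<lambda>t. k t - w' n (t, y)) \<in> L2 {0<..<Lx}"
      by (rule L2ip.diff_mem[OF L(1) section_L2[OF w(1)]], rule L2ip.diff_mem[OF L(2) section_L2[OF w'(1)]])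
    have eq: "(\<lambda>t. (g t + c * k t) - (w n (t, y) + c * w' n (t, y))) = (\<lambda>t. (g t - w n (t, y)) + c * (k t - w' n (t, y)))"
      by (rule ext) (simp add: algebra_simps)
    show "L2_norm {0<..<Lx} (\<lambda>t. (g t + c * k t) - (w n (t, y) + c * w' n (t, y)))
        \<le> L2_norm {0<..<Lx} (\<lambda>t. g t - w n (t, y)) + cmod c * L2_norm {0<..<Lx} (\<lambda>t. k t - w' n (t, y))"
      unfolding eq using L2ip.nrm_triangle[OF h(1) L2ip.scale_mem[OF h(2), of c]] L2ip.nrm_scale[OF h(2), of c] by linarith
  qed simp
  show ?thesis
    unfolding has_trace_def
    by (intro conjI L2_lin L exI[of _ "\<lambda>n x. w n x + c * w' n x"] allI smooth_lin w(1) w'(1) 1 2)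
qed

text \<open>The bound for smooth functions passes to the limit on both sides along the sequence that
  defines the trace. Applied to the zero function it shows that traces are unique up to norm
  zero.\<close>

lemma has_trace_bound:
  assumes y: "y = H \<or> y = - H" and u: "u \<in> H1 (Omega Lx H)" and g: "has_trace Lx H y u g"
  shows "(L2_norm {0<..<Lx} g)\<^sup>2 \<le> (1 / H + 2) * (H1_norm (Omega Lx H) u)\<^sup>2"
proof -
  obtain w where w: "\<And>n :: nat. smooth (w n)" "(\<lambda>n. H1_norm (Omega Lx H) (\<lambda>x. u x - w n x)) \<longlonglongrightarrow> 0"
    "(\<lambda>n. L2_norm {0<..<Lx} (\<lambda>t. g t - w n (t, y))) \<longlonglongrightarrow> 0" using has_trace_approx[OF g] by blast
  have 1: "(\<lambda>n. H1_norm (Omega Lx H) (w n)) \<longlonglongrightarrow> H1_norm (Omega Lx H) u"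
    by (rule H1.nrm_tendsto[OF smooth_H1[OF w(1)] u w(2)[unfolded H1.nrm_minus_commute[OF u smooth_H1[OF w(1)]]]])
  have 2: "(\<lambda>n. L2_norm {0<..<Lx} (\<lambda>t. w n (t, y))) \<longlonglongrightarrow> L2_norm {0<..<Lx} g"
    by (rule L2ip.nrm_tendsto[OF section_L2[OF w(1)] has_trace_L2[OF g]
          w(3)[unfolded L2ip.nrm_minus_commute[OF has_trace_L2[OF g] section_L2[OF w(1)]]]])
  show ?thesis
  proof (rule LIMSEQ_le)
    show "(\<lambda>n. (L2_norm {0<..<Lx} (\<lambda>t. w n (t, y)))\<^sup>2) \<longlonglongrightarrow> (L2_norm {0<..<Lx} g)\<^sup>2"
      by (rule tendsto_power[OF 2])
    show "(\<lambda>n. (1 / H + 2) * (H1_norm (Omega Lx H) (w n))\<^sup>2) \<longlonglongrightarrow> (1 / H + 2) * (H1_norm (Omega Lx H) u)\<^sup>2"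
      by (rule tendsto_mult_left[OF tendsto_power[OF 1]])
    show "\<exists>N. \<forall>n\<ge>N. (L2_norm {0<..<Lx} (\<lambda>t. w n (t, y)))\<^sup>2 \<le> (1 / H + 2) * (H1_norm (Omega Lx H) (w n))\<^sup>2"
      using trace_smooth[OF w(1) y] by blast
  qed
qed

lemma has_trace_diff:
  assumes "u \<in> H1 (Omega Lx H)" "has_trace Lx H y u g" "v \<in> H1 (Omega Lx H)" "has_trace Lx H y v k"
  shows "has_trace Lx H y (\<lambda>x. u x - v x) (\<lambda>t. g t - k t)"
  using has_trace_lin[OF assms, of "-1"] by simp

lemma has_trace_unique:
  assumes y: "y = H \<or> y = - H" and u: "u \<in> H1 (Omega Lx H)" and g: "has_trace Lx H y u g" "has_trace Lx H y u k"
  shows "L2_norm {0<..<Lx} (\<lambda>t. g t - k t) = 0"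
  using has_trace_bound[OF y H1.diff_mem[OF u u] has_trace_diff[OF u g(1) u g(2)]] by (simp add: H1_norm_zero)

lemma fcoeff_cong:
  assumes "g \<in> L2 {0<..<Lx}" "k \<in> L2 {0<..<Lx}" "L2_norm {0<..<Lx} (\<lambda>t. g t - k t) = 0"
  shows "fcoeff Lx a0 g n = fcoeff Lx a0 k n"
proof -
  have "fcoeff Lx a0 (\<lambda>t. g t - k t) n = fcoeff Lx a0 g n - fcoeff Lx a0 k n"
    using fcoeff_lin[OF assms(1,2), of "-1" n] by simp
  moreover have "Lx * (cmod (fcoeff Lx a0 (\<lambda>t. g t - k t) n))\<^sup>2 \<le> 0"
    using fcoeff_bound[OF L2ip.diff_mem[OF assms(1,2)], of n] assms(3) by simp
  ultimately show ?thesis using Lx by (simp add: mult_le_0_iff)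
qed

text \<open>By the trace bound, the restrictions of an approximating sequence form a Cauchy sequence
  in L2 of the segment; its limit is a trace.\<close>

lemma trace_exists:
  assumes y: "y = H \<or> y = - H" and u: "u \<in> QP"
  shows "\<exists>g. has_trace Lx H y u g"
proof -
  obtain w where w: "\<And>n :: nat. smooth (w n)" "\<And>n. quasi_periodic Lx a0 (w n)"
    "(\<lambda>n. H1_norm (Omega Lx H) (\<lambda>x. u x - w n x)) \<longlonglongrightarrow> 0" using QP_approx[OF u] by blast
  define C where "C = sqrt (1 / H + 2)"
  have C: "C > 0" "C\<^sup>2 = 1 / H + 2" using H by (simp_all add: C_def add_pos_nonneg)
  note uH = QP_H1[OF u]
  have bd: "L2_norm {0<..<Lx} (\<lambda>t. w m (t, y) - w n (t, y)) \<le> C * H1_norm (Omega Lx H) (\<lambda>x. w m x - w n x)" for m n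
  proof -
    have "(L2_norm {0<..<Lx} (\<lambda>t. w m (t, y) - w n (t, y)))\<^sup>2 \<le> (C * H1_norm (Omega Lx H) (\<lambda>x. w m x - w n x))\<^sup>2"
      unfolding power_mult_distrib C(2)
      by (rule has_trace_bound[OF y H1.diff_mem[OF smooth_H1[OF w(1)] smooth_H1[OF w(1)]]
            has_trace_diff[OF smooth_H1[OF w(1)] smooth_has_trace[OF w(1)] smooth_H1[OF w(1)] smooth_has_trace[OF w(1)]]])
    moreover have "0 \<le> C * H1_norm (Omega Lx H) (\<lambda>x. w m x - w n x)" using C by simp
    ultimately show ?thesis by (rule power2_le_imp_le)
  qed
  have "\<exists>g\<in>L2 {0<..<Lx}. (\<lambda>n. L2_norm {0<..<Lx} (\<lambda>t. w n (t, y) - g t)) \<longlonglongrightarrow> 0"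
  proof (rule L2_complete[OF section_L2[OF w(1)]])
    fix e :: real assume "e > 0"
    hence "0 < e / (2 * C)" using C by simp
    from order_tendstoD(2)[OF w(3) this] obtain N where N: "\<And>n. n \<ge> N \<Longrightarrow> H1_norm (Omega Lx H) (\<lambda>x. u x - w n x) < e / (2 * C)"
      by (auto simp: eventually_sequentially)
    have "L2_norm {0<..<Lx} (\<lambda>t. w m (t, y) - w n (t, y)) < e" if mn: "m \<ge> N" "n \<ge> N" for m n
    proof -
      have "H1_norm (Omega Lx H) (\<lambda>x. w m x - w n x) \<le> H1_norm (Omega Lx H) (\<lambda>x. w m x - u x) + H1_norm (Omega Lx H) (\<lambda>x. u x - w n x)"
        by (rule H1.nrm_triangle_diff[OF smooth_H1[OF w(1)] uH smooth_H1[OF w(1)]])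
      also have "\<dots> < e / (2 * C) + e / (2 * C)"
        unfolding H1.nrm_minus_commute[OF smooth_H1[OF w(1)] uH] by (rule add_strict_mono[OF N[OF mn(1)] N[OF mn(2)]])
      finally have "C * H1_norm (Omega Lx H) (\<lambda>x. w m x - w n x) < e" using C by (simp add: field_simps)
      thus ?thesis using bd[of m n] by linarith
    qed
    thus "\<exists>N. \<forall>m\<ge>N. \<forall>n\<ge>N. L2_norm {0<..<Lx} (\<lambda>t. w m (t, y) - w n (t, y)) < e" by blast
  qed
  then obtain g where g: "g \<in> L2 {0<..<Lx}" "(\<lambda>n. L2_norm {0<..<Lx} (\<lambda>t. w n (t, y) - g t)) \<longlonglongrightarrow> 0" by blast
  have "(\<lambda>n. L2_norm {0<..<Lx} (\<lambda>t. g t - w n (t, y))) \<longlonglongrightarrow> 0"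
    unfolding L2ip.nrm_minus_commute[OF g(1) section_L2[OF w(1)]] by (rule g(2))
  thus ?thesis unfolding has_trace_def using g(1) w by blast
qed

lemma trace_at_spec:
  assumes "y = H \<or> y = - H" "u \<in> QP"
  shows "has_trace Lx H y u (trace_at Lx H y u)"
  unfolding trace_at_def by (rule someI_ex[OF trace_exists[OF assms]])

abbreviation tc :: "real \<Rightarrow> (real \<times> real \<Rightarrow> complex) \<Rightarrow> int \<Rightarrow> complex" where
  "tc y u \<equiv> fcoeff Lx a0 (trace_at Lx H y u)"

text \<open>Both functions are traces of the same combination, but \<open>trace_at\<close> is a
  choice, so they are identified only up to norm zero. The Fourier coefficients \<open>tc\<close>
  are then exactly linear.\<close>

lemma trace_at_lin:
  assumes y: "y = H \<or> y = - H" and u: "u \<in> QP" and v: "v \<in> QP"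
  shows "L2_norm {0<..<Lx} (\<lambda>t. trace_at Lx H y (\<lambda>x. u x + c * v x) t - (trace_at Lx H y u t + c * trace_at Lx H y v t)) = 0"
  by (rule has_trace_unique[OF y QP_H1[OF QP_lin[OF u v]] trace_at_spec[OF y QP_lin[OF u v]]
        has_trace_lin[OF QP_H1[OF u] trace_at_spec[OF y u] QP_H1[OF v] trace_at_spec[OF y v]]])

lemma trace_at_L2: "y = H \<or> y = - H \<Longrightarrow> u \<in> QP \<Longrightarrow> trace_at Lx H y u \<in> L2 {0<..<Lx}"
  by (rule has_trace_L2[OF trace_at_spec])

lemma tc_lin:
  assumes y: "y = H \<or> y = - H" and u: "u \<in> QP" and v: "v \<in> QP"
  shows "tc y (\<lambda>x. u x + c * v x) n = tc y u n + c * tc y v n"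
proof -
  note t = trace_at_L2[OF y u] trace_at_L2[OF y v]
  have "tc y (\<lambda>x. u x + c * v x) n = fcoeff Lx a0 (\<lambda>t. trace_at Lx H y u t + c * trace_at Lx H y v t) n"
    by (rule fcoeff_cong[OF trace_at_L2[OF y QP_lin[OF u v]] L2_lin[OF t] trace_at_lin[OF y u v]])
  thus ?thesis unfolding fcoeff_lin[OF t] .
qed

lemma tc_tendsto:
  assumes y: "y = H \<or> y = - H" and u: "u \<in> QP" and w: "\<And>n. smooth (w n)"
    and lim: "(\<lambda>n. H1_norm (Omega Lx H) (\<lambda>x. u x - w n x)) \<longlonglongrightarrow> 0"
  shows "(\<lambda>n. fcoeff Lx a0 (\<lambda>t. w n (t, y)) k) \<longlonglongrightarrow> tc y u k"
proof -
  define K where "K = sqrt ((1 / H + 2) / Lx)"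
  have K: "K \<ge> 0" "K\<^sup>2 = (1 / H + 2) / Lx" using H Lx by (simp_all add: K_def)
  have "cmod (fcoeff Lx a0 (\<lambda>t. w n (t, y)) k - tc y u k) \<le> K * H1_norm (Omega Lx H) (\<lambda>x. u x - w n x)" for n
  proof -
    note t = trace_at_L2[OF y u] section_L2[OF w, of n y]
    have eq: "fcoeff Lx a0 (\<lambda>s. trace_at Lx H y u s - w n (s, y)) k = tc y u k - fcoeff Lx a0 (\<lambda>t. w n (t, y)) k"
      using fcoeff_lin[OF t, of "-1" k] by simp
    have "Lx * (cmod (tc y u k - fcoeff Lx a0 (\<lambda>t. w n (t, y)) k))\<^sup>2 \<le> (L2_norm {0<..<Lx} (\<lambda>s. trace_at Lx H y u s - w n (s, y)))\<^sup>2"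
      using fcoeff_bound[OF L2ip.diff_mem[OF t], of k] unfolding eq .
    also have "\<dots> \<le> (1 / H + 2) * (H1_norm (Omega Lx H) (\<lambda>x. u x - w n x))\<^sup>2"
      by (rule has_trace_bound[OF y H1.diff_mem[OF QP_H1[OF u] smooth_H1[OF w]]
            has_trace_diff[OF QP_H1[OF u] trace_at_spec[OF y u] smooth_H1[OF w] smooth_has_trace[OF w]]])
    finally have "(cmod (tc y u k - fcoeff Lx a0 (\<lambda>t. w n (t, y)) k))\<^sup>2 \<le> (K * H1_norm (Omega Lx H) (\<lambda>x. u x - w n x))\<^sup>2"
      unfolding power_mult_distrib K(2) using Lx by (simp add: field_simps)
    hence "cmod (tc y u k - fcoeff Lx a0 (\<lambda>t. w n (t, y)) k) \<le> K * H1_norm (Omega Lx H) (\<lambda>x. u x - w n x)"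
      by (rule power2_le_imp_le) (simp add: K(1))
    thus ?thesis by (simp add: norm_minus_commute)
  qed
  hence ev: "\<forall>\<^sub>F n in sequentially. cmod (fcoeff Lx a0 (\<lambda>t. w n (t, y)) k - tc y u k) \<le> K * H1_norm (Omega Lx H) (\<lambda>x. u x - w n x)"
    by (intro always_eventually allI)
  have "(\<lambda>n. fcoeff Lx a0 (\<lambda>t. w n (t, y)) k - tc y u k) \<longlonglongrightarrow> 0"
    by (rule Lim_null_comparison[OF ev tendsto_mult_right_zero[OF lim]])
  thus ?thesis by (rule LIM_zero_cancel)
qed

lemma QP_norm_tendsto:
  assumes u: "u \<in> QP" and w: "\<And>n. smooth (w n)"
    and lim: "(\<lambda>n. H1_norm (Omega Lx H) (\<lambda>x. u x - w n x)) \<longlonglongrightarrow> 0"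
  shows "(\<lambda>n. H1_norm (Omega Lx H) (w n)) \<longlonglongrightarrow> H1_norm (Omega Lx H) u"
    and "(\<lambda>n. L2_norm (Omega Lx H) (w n)) \<longlonglongrightarrow> L2_norm (Omega Lx H) u"
proof -
  note c = H1.nrm_minus_commute[OF QP_H1[OF u] smooth_H1[OF w]] L2ip.nrm_minus_commute[OF H1_imp_L2[OF QP_H1[OF u]] smooth_L2(1)[OF w]]
  show "(\<lambda>n. H1_norm (Omega Lx H) (w n)) \<longlonglongrightarrow> H1_norm (Omega Lx H) u"
    by (rule H1.nrm_tendsto[OF smooth_H1[OF w] QP_H1[OF u] lim[unfolded c(1)]])
  have "(\<lambda>n. L2_norm (Omega Lx H) (\<lambda>x. u x - w n x)) \<longlonglongrightarrow> 0"
    by (rule Lim_null_comparison[OF _ lim]) (simp add: L2_le_H1_norm)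
  thus "(\<lambda>n. L2_norm (Omega Lx H) (w n)) \<longlonglongrightarrow> L2_norm (Omega Lx H) u"
    unfolding c(2) by (rule L2ip.nrm_tendsto[OF smooth_L2(1)[OF w] H1_imp_L2[OF QP_H1[OF u]]])
qed

text \<open>Finite sums pass to the limit termwise along quasi-periodic smooth approximations. The
  bound does not depend on F, which later yields summability over all modes.\<close>

lemma tc_sum_bound:
  assumes y: "y = H \<or> y = - H" and u: "u \<in> QP" and F: "finite F"
  shows "Lx * (\<Sum>n\<in>F. (1 + \<bar>alpha Lx a0 n\<bar>) * (cmod (tc y u n))\<^sup>2) \<le> (1 / H + 2) * (H1_norm (Omega Lx H) u)\<^sup>2"
proof -
  obtain w where w: "\<And>n :: nat. smooth (w n)" "\<And>n. quasi_periodic Lx a0 (w n)"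
    "(\<lambda>n. H1_norm (Omega Lx H) (\<lambda>x. u x - w n x)) \<longlonglongrightarrow> 0" using QP_approx[OF u] by blast
  show ?thesis
  proof (rule LIMSEQ_le)
    show "(\<lambda>k. Lx * (\<Sum>n\<in>F. (1 + \<bar>alpha Lx a0 n\<bar>) * (cmod (fcoeff Lx a0 (\<lambda>t. w k (t, y)) n))\<^sup>2))
        \<longlonglongrightarrow> Lx * (\<Sum>n\<in>F. (1 + \<bar>alpha Lx a0 n\<bar>) * (cmod (tc y u n))\<^sup>2)"
      by (intro tendsto_intros tc_tendsto[OF y u w(1,3)])
    show "(\<lambda>k. (1 / H + 2) * (H1_norm (Omega Lx H) (w k))\<^sup>2) \<longlonglongrightarrow> (1 / H + 2) * (H1_norm (Omega Lx H) u)\<^sup>2"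
      by (intro tendsto_intros QP_norm_tendsto(1)[OF u w(1,3)])
    show "\<exists>N. \<forall>k\<ge>N. Lx * (\<Sum>n\<in>F. (1 + \<bar>alpha Lx a0 n\<bar>) * (cmod (fcoeff Lx a0 (\<lambda>t. w k (t, y)) n))\<^sup>2)
        \<le> (1 / H + 2) * (H1_norm (Omega Lx H) (w k))\<^sup>2"
      using trace_fcoeff_smooth[OF w(1) w(2) y F] by blast
  qed
qed

lemma poincare:
  "\<exists>C\<ge>0. \<exists>M. finite M \<and> (\<forall>n\<in>M. alpha Lx a0 n = 0) \<and> (\<forall>u\<in>QP.
    (L2_norm (Omega Lx H) u)\<^sup>2 \<le> C * (grad_sq u + (\<Sum>n\<in>M. (cmod (tc H u n))\<^sup>2)))"
proof -
  obtain C M where C: "C \<ge> 0" "finite M" "\<forall>n\<in>M. alpha Lx a0 n = 0"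
    and P: "\<And>w. smooth w \<Longrightarrow> quasi_periodic Lx a0 w \<Longrightarrow>
      (L2_norm (Omega Lx H) w)\<^sup>2 \<le> C * (grad_sq w + (\<Sum>n\<in>M. (cmod (fcoeff Lx a0 (\<lambda>t. w (t, H)) n))\<^sup>2))"
    using poincare_smooth by blast
  have "(L2_norm (Omega Lx H) u)\<^sup>2 \<le> C * (grad_sq u + (\<Sum>n\<in>M. (cmod (tc H u n))\<^sup>2))" if u: "u \<in> QP" for u
  proof -
    obtain w where w: "\<And>n :: nat. smooth (w n)" "\<And>n. quasi_periodic Lx a0 (w n)"
      "(\<lambda>n. H1_norm (Omega Lx H) (\<lambda>x. u x - w n x)) \<longlonglongrightarrow> 0" using QP_approx[OF u] by blast
    \<comment> \<open>Expressed as a difference of squared norms, the gradient part is visibly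
      continuous along the approximating sequence.\<close>
    have g: "grad_sq v = (H1_norm (Omega Lx H) v)\<^sup>2 - (L2_norm (Omega Lx H) v)\<^sup>2" for v
      by (simp add: H1_norm_grad)
    have y: "H = H \<or> H = - H" by simp
    show ?thesis
    proof (rule LIMSEQ_le)
      show "(\<lambda>k. (L2_norm (Omega Lx H) (w k))\<^sup>2) \<longlonglongrightarrow> (L2_norm (Omega Lx H) u)\<^sup>2"
        by (intro tendsto_intros QP_norm_tendsto(2)[OF u w(1,3)])
      show "(\<lambda>k. C * (grad_sq (w k) + (\<Sum>n\<in>M. (cmod (fcoeff Lx a0 (\<lambda>t. w k (t, H)) n))\<^sup>2)))
          \<longlonglongrightarrow> C * (grad_sq u + (\<Sum>n\<in>M. (cmod (tc H u n))\<^sup>2))"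
        unfolding g by (intro tendsto_intros QP_norm_tendsto[OF u w(1,3)] tc_tendsto[OF y u w(1,3)])
      show "\<exists>N. \<forall>k\<ge>N. (L2_norm (Omega Lx H) (w k))\<^sup>2
          \<le> C * (grad_sq (w k) + (\<Sum>n\<in>M. (cmod (fcoeff Lx a0 (\<lambda>t. w k (t, H)) n))\<^sup>2))"
        using P[OF w(1) w(2)] by blast
    qed
  qed
  thus ?thesis using C by blast
qed

end

section \<open>The sesquilinear form\<close>

lemma integral_mult_cnj_cong_AE:
  assumes "p \<in> L2 U" "g \<in> L2 U" "k \<in> L2 U" "AE x in lebesgue_on U. g x = k x"
  shows "(\<integral>x. p x * cnj (g x) \<partial>lebesgue_on U) = (\<integral>x. p x * cnj (k x) \<partial>lebesgue_on U)"
    and "(\<integral>x. g x * cnj (p x) \<partial>lebesgue_on U) = (\<integral>x. k x * cnj (p x) \<partial>lebesgue_on U)"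
proof -
  note m = borel_measurable_integrable[OF L2_integrable_cnj]
  show "(\<integral>x. p x * cnj (g x) \<partial>lebesgue_on U) = (\<integral>x. p x * cnj (k x) \<partial>lebesgue_on U)"
    by (rule integral_cong_AE[OF m[OF assms(1,2)] m[OF assms(1,3)]]) (use assms(4) in eventually_elim, simp)
  show "(\<integral>x. g x * cnj (p x) \<partial>lebesgue_on U) = (\<integral>x. k x * cnj (p x) \<partial>lebesgue_on U)"
    by (rule integral_cong_AE[OF m[OF assms(2,1)] m[OF assms(3,1)]]) (use assms(4) in eventually_elim, simp)
qed

context bounded_domain
begin

lemma weak_deriv_ip_lin:
  assumes p: "p \<in> L2 U" and u: "u \<in> H1 U" and v: "v \<in> H1 U" and b: "b \<in> Basis"
  shows "(\<integral>x. p x * cnj (weak_deriv U b (\<lambda>x. u x + c * v x) x) \<partial>lebesgue_on U)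
    = (\<integral>x. p x * cnj (weak_deriv U b u x) \<partial>lebesgue_on U) + cnj c * (\<integral>x. p x * cnj (weak_deriv U b v x) \<partial>lebesgue_on U)"
proof -
  note D = weak_deriv_spec(1)[OF u b] weak_deriv_spec(1)[OF v b]
  show ?thesis
    unfolding integral_mult_cnj_cong_AE(1)[OF p weak_deriv_spec(1)[OF H1_lin[OF u v] b] L2_lin[OF D] weak_deriv_lin[OF u v b]]
    by (rule L2ip.ip_lin2[OF D p])
qed

lemma weighted_weak_deriv_ip_lin:
  assumes p: "p \<in> L2 U" and u: "u \<in> H1 U" and v: "v \<in> H1 U" and b: "b \<in> Basis"
    and r: "r \<in> borel_measurable (lebesgue_on U)" "\<And>x. x \<in> U \<Longrightarrow> cmod (r x) \<le> K"
  shows "(\<integral>x. (r x * weak_deriv U b (\<lambda>x. u x + c * v x) x) * cnj (p x) \<partial>lebesgue_on U)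
    = (\<integral>x. (r x * weak_deriv U b u x) * cnj (p x) \<partial>lebesgue_on U) + c * (\<integral>x. (r x * weak_deriv U b v x) * cnj (p x) \<partial>lebesgue_on U)"
proof -
  note R = L2_bounded_mult(1)[OF _ r]
  note D = R[OF weak_deriv_spec(1)[OF u b]] R[OF weak_deriv_spec(1)[OF v b]]
  have ae: "AE x in lebesgue_on U. r x * weak_deriv U b (\<lambda>x. u x + c * v x) x
      = r x * weak_deriv U b u x + c * (r x * weak_deriv U b v x)"
    using weak_deriv_lin[OF u v b, of c] by eventually_elim (simp add: algebra_simps)
  show ?thesis
    by (rule trans[OF integral_mult_cnj_cong_AE(2)[OF p R[OF weak_deriv_spec(1)[OF H1_lin[OF u v] b]] L2_lin[OF D] ae]
          L2ip.ip_lin[OF D p]])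
qed

end

text \<open>The growth is linear in |\<alpha>_n| and so matches the weight in
  \<open>tc_sum_bound\<close>: the Dirichlet-to-Neumann map loses one order, half of which is
  absorbed by each of the two traces.\<close>

lemma beta_bound:
  assumes "\<kappa> > 0" "e > 0"
  shows "cmod (beta Lx a0 \<kappa> e n) \<le> (\<kappa> * sqrt e + 1) * (1 + \<bar>alpha Lx a0 n\<bar>)"
proof -
  define a where "a = alpha Lx a0 n"
  have k: "0 \<le> \<kappa> * sqrt e" using assms by simp
  have ka: "0 \<le> \<kappa> * sqrt e * \<bar>a\<bar>" by (rule mult_nonneg_nonneg[OF k abs_ge_zero])
  have "cmod (beta Lx a0 \<kappa> e n) \<le> \<kappa> * sqrt e + \<bar>a\<bar>"
  proof (cases "a\<^sup>2 < \<kappa>\<^sup>2 * e")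
    case True
    have "sqrt (\<kappa>\<^sup>2 * e - a\<^sup>2) \<le> sqrt (\<kappa>\<^sup>2 * e)" by (rule real_sqrt_le_mono) simp
    also have "\<dots> = \<kappa> * sqrt e" using assms by (simp add: real_sqrt_mult)
    finally show ?thesis using True by (simp add: beta_def a_def)
  next
    case False
    have "sqrt (a\<^sup>2 - \<kappa>\<^sup>2 * e) \<le> sqrt (a\<^sup>2)" by (rule real_sqrt_le_mono) (use assms in simp)
    thus ?thesis using False k by (simp add: beta_def a_def norm_mult)
  qed
  also have "\<dots> \<le> (\<kappa> * sqrt e + 1) * (1 + \<bar>a\<bar>)" using k ka by (simp add: algebra_simps)
  finally show ?thesis by (simp add: a_def)
qed

lemma Re_beta_nonneg: "0 \<le> Re (beta Lx a0 \<kappa> e n)"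
  by (simp add: beta_def)

lemma beta_zero:
  assumes "\<kappa> > 0" "e > 0" "alpha Lx a0 n = 0"
  shows "Re (beta Lx a0 \<kappa> e n) = \<kappa> * sqrt e"
  using assms by (simp add: beta_def real_sqrt_mult)

section \<open>Boundedness and sign of the Dirichlet-to-Neumann terms\<close>

context cell
begin

text \<open>The weight is split as a product of two square roots, one for each trace, before
  applying the Cauchy-Schwarz inequality for sums.\<close>

lemma tc_weighted_sum:
  assumes y: "y = H \<or> y = - H" and u: "u \<in> QP" and v: "v \<in> QP" and F: "finite F"
  shows "(\<Sum>n\<in>F. (1 + \<bar>alpha Lx a0 n\<bar>) * (cmod (tc y u n) * cmod (tc y v n)))
    \<le> ((1 / H + 2) / Lx) * (H1_norm (Omega Lx H) u * H1_norm (Omega Lx H) v)"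
proof -
  let ?a = "\<lambda>n. 1 + \<bar>alpha Lx a0 n\<bar>"
  let ?C = "(1 / H + 2) / Lx"
  have C: "?C \<ge> 0" using H Lx by simp
  have bd: "(\<Sum>n\<in>F. (sqrt (?a n) * cmod (tc y f n))\<^sup>2) \<le> ?C * (H1_norm (Omega Lx H) f)\<^sup>2" if f: "f \<in> QP" for f
  proof -
    have "(\<Sum>n\<in>F. (sqrt (?a n) * cmod (tc y f n))\<^sup>2) = (\<Sum>n\<in>F. ?a n * (cmod (tc y f n))\<^sup>2)"
      by (intro sum.cong refl) (simp add: power_mult_distrib)
    thus ?thesis using tc_sum_bound[OF y f F] Lx by (simp add: field_simps)
  qed
  have "(\<Sum>n\<in>F. ?a n * (cmod (tc y u n) * cmod (tc y v n)))
      = (\<Sum>n\<in>F. (sqrt (?a n) * cmod (tc y u n)) * (sqrt (?a n) * cmod (tc y v n)))"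
  proof (intro sum.cong refl)
    fix n
    have "sqrt (?a n) * sqrt (?a n) = ?a n" by simp
    thus "?a n * (cmod (tc y u n) * cmod (tc y v n)) = (sqrt (?a n) * cmod (tc y u n)) * (sqrt (?a n) * cmod (tc y v n))"
      by (metis mult.assoc mult.left_commute)
  qed
  also have "\<dots> \<le> ?C * (H1_norm (Omega Lx H) u * H1_norm (Omega Lx H) v)" (is "?S \<le> ?R")
  proof (rule power2_le_imp_le)
    have "?S\<^sup>2 \<le> (\<Sum>n\<in>F. (sqrt (?a n) * cmod (tc y u n))\<^sup>2) * (\<Sum>n\<in>F. (sqrt (?a n) * cmod (tc y v n))\<^sup>2)"
      by (rule Cauchy_Schwarz_ineq_sum)
    also have "\<dots> \<le> (?C * (H1_norm (Omega Lx H) u)\<^sup>2) * (?C * (H1_norm (Omega Lx H) v)\<^sup>2)"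
      by (intro mult_mono bd u v sum_nonneg mult_nonneg_nonneg C) auto
    also have "\<dots> = ?R\<^sup>2" by (simp only: power2_eq_square mult_ac)
    finally show "?S\<^sup>2 \<le> ?R\<^sup>2" .
    show "0 \<le> ?R" using C by (intro mult_nonneg_nonneg) auto
  qed
  finally show ?thesis .
qed

lemma DtN_term_bound:
  assumes "\<kappa> > 0" "e > 0"
  shows "cmod (DtN Lx a0 \<kappa> e (trace_at Lx H y u) n * cnj (tc y v n))
    \<le> ((\<kappa> * sqrt e + 1) / e) * ((1 + \<bar>alpha Lx a0 n\<bar>) * (cmod (tc y u n) * cmod (tc y v n)))"
proof -
  have "cmod (DtN Lx a0 \<kappa> e (trace_at Lx H y u) n * cnj (tc y v n))
      = cmod (beta Lx a0 \<kappa> e n) * (cmod (tc y u n) * cmod (tc y v n)) / e"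
    using assms by (simp add: DtN_def norm_mult norm_divide)
  also have "\<dots> \<le> ((\<kappa> * sqrt e + 1) * (1 + \<bar>alpha Lx a0 n\<bar>)) * (cmod (tc y u n) * cmod (tc y v n)) / e"
    using assms by (intro divide_right_mono mult_right_mono beta_bound) auto
  finally show ?thesis by (simp add: mult_ac)
qed

text \<open>A bound on finite sums that is independent of F gives absolute summability. An infinite
  sum of a family that is not summable has the default value 0, so this is what makes
  \<open>duality\<close> meaningful and additive.\<close>

lemma DtN_summable:
  assumes y: "y = H \<or> y = - H" and u: "u \<in> QP" and v: "v \<in> QP" and pos: "\<kappa> > 0" "e > 0"
  shows "(\<lambda>n. cmod (DtN Lx a0 \<kappa> e (trace_at Lx H y u) n * cnj (tc y v n))) summable_on UNIV"
    and "cmod (\<Sum>\<^sub>\<infinity>n. DtN Lx a0 \<kappa> e (trace_at Lx H y u) n * cnj (tc y v n))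
      \<le> ((\<kappa> * sqrt e + 1) / e) * (((1 / H + 2) / Lx) * (H1_norm (Omega Lx H) u * H1_norm (Omega Lx H) v))" (is "_ \<le> ?R")
proof -
  let ?f = "\<lambda>n. DtN Lx a0 \<kappa> e (trace_at Lx H y u) n * cnj (tc y v n)"
  have fin: "(\<Sum>n\<in>F. cmod (?f n)) \<le> ?R" if F: "finite F" for F
  proof -
    have "(\<Sum>n\<in>F. cmod (?f n)) \<le> (\<Sum>n\<in>F. ((\<kappa> * sqrt e + 1) / e) * ((1 + \<bar>alpha Lx a0 n\<bar>) * (cmod (tc y u n) * cmod (tc y v n))))"
      by (intro sum_mono DtN_term_bound pos)
    also have "\<dots> \<le> ?R"
      unfolding sum_distrib_left[symmetric]
      by (intro mult_left_mono tc_weighted_sum y u v F) (use pos in simp)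
    finally show ?thesis .
  qed
  show s: "(\<lambda>n. cmod (?f n)) summable_on UNIV"
    by (rule nonneg_bdd_above_summable_on) (auto intro!: bdd_aboveI2[of _ _ ?R] fin)
  have "cmod (\<Sum>\<^sub>\<infinity>n. ?f n) \<le> (\<Sum>\<^sub>\<infinity>n. cmod (?f n))" by (rule norm_infsum_bound[OF s])
  also have "\<dots> \<le> ?R" by (rule infsum_le_finite_sums[OF s]) (rule fin)
  finally show "cmod (\<Sum>\<^sub>\<infinity>n. ?f n) \<le> ?R" .
qed

definition dual :: "real \<Rightarrow> real \<Rightarrow> real \<Rightarrow> (real \<times> real \<Rightarrow> complex) \<Rightarrow> (real \<times> real \<Rightarrow> complex) \<Rightarrow> complex" where
  "dual \<kappa> e y u v = duality Lx a0 (DtN Lx a0 \<kappa> e (trace_at Lx H y u)) (trace_at Lx H y v)"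

lemma dual_bound:
  assumes "y = H \<or> y = - H" "u \<in> QP" "v \<in> QP" "\<kappa> > 0" "e > 0"
  shows "cmod (dual \<kappa> e y u v) \<le> ((\<kappa> * sqrt e + 1) / e * (1 / H + 2)) * H1_norm (Omega Lx H) u * H1_norm (Omega Lx H) v"
proof -
  have "cmod (dual \<kappa> e y u v) = Lx * cmod (\<Sum>\<^sub>\<infinity>n. DtN Lx a0 \<kappa> e (trace_at Lx H y u) n * cnj (tc y v n))"
    using Lx by (simp add: dual_def duality_def norm_mult)
  also have "\<dots> \<le> Lx * (((\<kappa> * sqrt e + 1) / e) * (((1 / H + 2) / Lx) * (H1_norm (Omega Lx H) u * H1_norm (Omega Lx H) v)))"
    using Lx by (intro mult_left_mono DtN_summable assms) simp
  finally show ?thesis using Lx by simp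
qed

lemma dual_lin:
  assumes y: "y = H \<or> y = - H" and u: "u \<in> QP" and v: "v \<in> QP" and w: "w \<in> QP" and pos: "\<kappa> > 0" "e > 0"
  shows "dual \<kappa> e y (\<lambda>x. u x + c * v x) w = dual \<kappa> e y u w + c * dual \<kappa> e y v w"
    and "dual \<kappa> e y w (\<lambda>x. u x + c * v x) = dual \<kappa> e y w u + cnj c * dual \<kappa> e y w v"
proof -
  note s = abs_summable_summable[OF DtN_summable(1)[OF y _ _ pos]]
  let ?f = "\<lambda>u v n. DtN Lx a0 \<kappa> e (trace_at Lx H y u) n * cnj (tc y v n)"
  have 1: "?f (\<lambda>x. u x + c * v x) w n = ?f u w n + c * ?f v w n" for n
    unfolding DtN_def tc_lin[OF y u v] by (simp add: algebra_simps)
  have 2: "?f w (\<lambda>x. u x + c * v x) n = ?f w u n + cnj c * ?f w v n" for n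
    unfolding tc_lin[OF y u v] by (simp add: algebra_simps)
  show "dual \<kappa> e y (\<lambda>x. u x + c * v x) w = dual \<kappa> e y u w + c * dual \<kappa> e y v w"
    unfolding dual_def duality_def 1
      infsum_add[OF s[OF u w] summable_on_cmult_right[OF s[OF v w]]] infsum_cmult_right[OF s[OF v w]]
    by (simp add: algebra_simps)
  show "dual \<kappa> e y w (\<lambda>x. u x + c * v x) = dual \<kappa> e y w u + cnj c * dual \<kappa> e y w v"
    unfolding dual_def duality_def 2
      infsum_add[OF s[OF w u] summable_on_cmult_right[OF s[OF w v]]] infsum_cmult_right[OF s[OF w v]]
    by (simp add: algebra_simps)
qed

text \<open>The n-th term is i \<beta>_n |\<phi>_n|^2 / e. Evanescent modes, with imaginary
  \<beta>_n, contribute real numbers, and propagating modes contribute nonnegatively to the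
  imaginary part; any finite selection of modes is therefore a lower bound.\<close>

lemma Im_dual:
  assumes y: "y = H \<or> y = - H" and u: "u \<in> QP" and pos: "\<kappa> > 0" "e > 0" and M: "finite M"
  shows "(Lx / e) * (\<Sum>n\<in>M. Re (beta Lx a0 \<kappa> e n) * (cmod (tc y u n))\<^sup>2) \<le> Im (dual \<kappa> e y u u)"
proof -
  let ?f = "\<lambda>n. DtN Lx a0 \<kappa> e (trace_at Lx H y u) n * cnj (tc y u n)"
  note s = abs_summable_summable[OF DtN_summable(1)[OF y u u pos]]
  have eq: "Im (?f n) = (1 / e) * (Re (beta Lx a0 \<kappa> e n) * (cmod (tc y u n))\<^sup>2)" for n
  proof -
    have "?f n = \<i> * (beta Lx a0 \<kappa> e n * of_real ((cmod (tc y u n))\<^sup>2 / e))"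
      unfolding DtN_def of_real_divide complex_norm_square by simp
    thus ?thesis by simp
  qed
  have "(\<Sum>n\<in>M. Im (?f n)) \<le> (\<Sum>\<^sub>\<infinity>n. Im (?f n))"
    by (rule finite_sum_le_infsum[OF summable_on_Im[OF s] M])
      (use pos Re_beta_nonneg in \<open>auto simp only: eq subset_UNIV intro!: mult_nonneg_nonneg divide_nonneg_nonneg\<close>, simp_all)
  also have "\<dots> = Im (\<Sum>\<^sub>\<infinity>n. ?f n)" by (rule infsum_Im[OF s])
  finally have "Lx * (\<Sum>n\<in>M. Im (?f n)) \<le> Lx * Im (\<Sum>\<^sub>\<infinity>n. ?f n)" using Lx by simp
  moreover have "Im (dual \<kappa> e y u u) = Lx * Im (\<Sum>\<^sub>\<infinity>n. ?f n)" by (simp add: dual_def duality_def)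
  moreover have "Lx * (\<Sum>n\<in>M. Im (?f n)) = (Lx / e) * (\<Sum>n\<in>M. Re (beta Lx a0 \<kappa> e n) * (cmod (tc y u n))\<^sup>2)"
    unfolding eq sum_distrib_left[symmetric] by simp
  ultimately show ?thesis by simp
qed

end

section \<open>Continuity and coercivity of the sesquilinear form\<close>

locale grating =
  fixes Lx H \<kappa> \<epsilon>p \<epsilon>m \<theta> c1 c2 M0 :: real
  assumes Lx0: "Lx > 0" and H0: "H > 0" and \<kappa>: "\<kappa> > 0" and \<epsilon>p: "\<epsilon>p > 0" and \<epsilon>m: "\<epsilon>m > 0"
    and c1: "c1 > 0" and c2: "c2 > 0" and M0: "M0 > 0"
begin

sublocale cell Lx H "alpha0 \<kappa> \<epsilon>p \<theta>"
  by unfold_locales (rule Lx0, rule H0)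

abbreviation \<Omega> :: "(real \<times> real) set" where "\<Omega> \<equiv> Omega Lx H"

abbreviation D :: "real \<times> real \<Rightarrow> (real \<times> real \<Rightarrow> complex) \<Rightarrow> real \<times> real \<Rightarrow> complex" where
  "D \<equiv> weak_deriv \<Omega>"

text \<open>Contains the original and all sliced coefficients. Constants derived from membership
  depend on \<open>c1\<close>, \<open>c2\<close> and \<open>M0\<close>, not on the slicing.\<close>

definition admissible :: "(real \<times> real \<Rightarrow> complex) \<Rightarrow> bool" where
  "admissible \<eta> \<longleftrightarrow> \<eta> \<in> borel_measurable (lebesgue_on \<Omega>) \<and>
     (\<forall>x\<in>\<Omega>. cmod (\<eta> x) \<le> M0 \<and> Im (\<eta> x) > c1 \<and> Re (\<eta> x) > c2)"

text \<open>The imaginary part of 1/\<eta> is -Im \<eta> / |\<eta>|^2: inversion reverses the sign,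
  and the upper bound \<open>M0\<close> keeps the absorption away from zero.\<close>

lemma admissible_inverse:
  assumes "admissible \<eta>"
  shows "(\<lambda>x. 1 / \<eta> x) \<in> borel_measurable (lebesgue_on \<Omega>)"
    and "x \<in> \<Omega> \<Longrightarrow> cmod (1 / \<eta> x) \<le> 1 / c2"
    and "x \<in> \<Omega> \<Longrightarrow> Im (1 / \<eta> x) \<le> - (c1 / M0\<^sup>2)"
proof -
  show "(\<lambda>x. 1 / \<eta> x) \<in> borel_measurable (lebesgue_on \<Omega>)"
    using assms by (intro borel_measurable_divide) (auto simp: admissible_def)
  assume x: "x \<in> \<Omega>"
  have e: "cmod (\<eta> x) \<le> M0" "Im (\<eta> x) > c1" "Re (\<eta> x) > c2" using assms x by (auto simp: admissible_def)
  have "c2 \<le> cmod (\<eta> x)" using e(3) complex_Re_le_cmod[of "\<eta> x"] by linarith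
  thus "cmod (1 / \<eta> x) \<le> 1 / c2" using c2 by (simp add: norm_divide frac_le)
  have "(cmod (\<eta> x))\<^sup>2 > 0" using e c1 by auto
  moreover have "(cmod (\<eta> x))\<^sup>2 \<le> M0\<^sup>2" using e(1) by (intro power_mono) auto
  ultimately have "c1 / M0\<^sup>2 \<le> Im (\<eta> x) / (cmod (\<eta> x))\<^sup>2" using e(2) c1 by (intro frac_le) auto
  thus "Im (1 / \<eta> x) \<le> - (c1 / M0\<^sup>2)" by (simp add: Im_divide cmod_power2)
qed

abbreviation B :: "(real \<times> real \<Rightarrow> complex) \<Rightarrow> (real \<times> real \<Rightarrow> complex) \<Rightarrow> (real \<times> real \<Rightarrow> complex) \<Rightarrow> complex" where
  "B \<equiv> B_form Lx H \<kappa> \<epsilon>p \<epsilon>m \<theta>"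

abbreviation src :: "(real \<times> real \<Rightarrow> complex) \<Rightarrow> (real \<times> real \<Rightarrow> complex) \<Rightarrow> complex" where
  "src \<equiv> source Lx H \<kappa> \<epsilon>p \<epsilon>m \<theta>"

definition Dform :: "(real \<times> real \<Rightarrow> complex) \<Rightarrow> real \<times> real \<Rightarrow> (real \<times> real \<Rightarrow> complex) \<Rightarrow> (real \<times> real \<Rightarrow> complex) \<Rightarrow> complex" where
  "Dform \<eta> b w v = (\<integral>x. (1 / \<eta> x * D b w x) * cnj (D b v x) \<partial>lebesgue_on \<Omega>)"

lemma weighted_D_L2:
  assumes "admissible \<eta>" "w \<in> H1 \<Omega>" "b \<in> Basis"
  shows "(\<lambda>x. 1 / \<eta> x * D b w x) \<in> L2 \<Omega>" "L2_norm \<Omega> (\<lambda>x. 1 / \<eta> x * D b w x) \<le> 1 / c2 * L2_norm \<Omega> (D b w)"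
  using L2_bounded_mult[OF weak_deriv_spec(1)[OF assms(2,3)] admissible_inverse(1,2)[OF assms(1)]] by blast+

lemma B_expand:
  assumes a: "admissible \<eta>" and w: "w \<in> H1 \<Omega>" and v: "v \<in> H1 \<Omega>"
  shows "B \<eta> w v = (\<Sum>b\<in>Basis. Dform \<eta> b w v) - of_real (\<kappa>\<^sup>2) * (\<integral>x. w x * cnj (v x) \<partial>lebesgue_on \<Omega>)
    - dual \<kappa> \<epsilon>m (- H) w v - dual \<kappa> \<epsilon>p H w v"
proof -
  have i: "integrable (lebesgue_on \<Omega>) (\<lambda>x. (1 / \<eta> x * D b w x) * cnj (D b v x))" if "b \<in> Basis" for b
    by (rule L2_integrable_cnj[OF weighted_D_L2(1)[OF a w that] weak_deriv_spec(1)[OF v that]])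
  have j: "integrable (lebesgue_on \<Omega>) (\<lambda>x. w x * cnj (v x))"
    by (rule L2_integrable_cnj[OF H1_imp_L2[OF w] H1_imp_L2[OF v]])
  have "(\<integral>x. 1 / \<eta> x * (\<Sum>b\<in>Basis. D b w x * cnj (D b v x)) - (complex_of_real \<kappa>)\<^sup>2 * w x * cnj (v x) \<partial>lebesgue_on \<Omega>)
      = (\<integral>x. (\<Sum>b\<in>Basis. (1 / \<eta> x * D b w x) * cnj (D b v x)) - of_real (\<kappa>\<^sup>2) * (w x * cnj (v x)) \<partial>lebesgue_on \<Omega>)"
    by (simp add: sum_distrib_left mult.assoc)
  also have "\<dots> = (\<integral>x. (\<Sum>b\<in>Basis. (1 / \<eta> x * D b w x) * cnj (D b v x)) \<partial>lebesgue_on \<Omega>)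
      - (\<integral>x. of_real (\<kappa>\<^sup>2) * (w x * cnj (v x)) \<partial>lebesgue_on \<Omega>)"
    by (rule Bochner_Integration.integral_diff[OF Bochner_Integration.integrable_sum[OF i] integrable_mult_right[OF j]])
  also have "\<dots> = (\<Sum>b\<in>Basis. Dform \<eta> b w v) - of_real (\<kappa>\<^sup>2) * (\<integral>x. w x * cnj (v x) \<partial>lebesgue_on \<Omega>)"
    unfolding Dform_def by (simp only: Bochner_Integration.integral_sum[OF i] integral_mult_right_zero)
  finally show ?thesis unfolding B_form_def Let_def dual_def by simp
qed

lemma sides: "H = H \<or> H = - H" "- H = H \<or> - H = - H"
  by simp_all

lemma B_lin1:
  assumes a: "admissible \<eta>" and u: "u \<in> QP" and v: "v \<in> QP" and w: "w \<in> QP"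
  shows "B \<eta> (\<lambda>x. u x + c * v x) w = B \<eta> u w + c * B \<eta> v w"
proof -
  note h = QP_H1[OF u] QP_H1[OF v] QP_H1[OF w]
  have G: "Dform \<eta> b (\<lambda>x. u x + c * v x) w = Dform \<eta> b u w + c * Dform \<eta> b v w" if b: "b \<in> Basis" for b
    unfolding Dform_def
    by (rule weighted_weak_deriv_ip_lin[OF weak_deriv_spec(1)[OF h(3) b] h(1,2) b admissible_inverse(1,2)[OF a]])
  have "(\<Sum>b\<in>Basis. Dform \<eta> b (\<lambda>x. u x + c * v x) w) = (\<Sum>b\<in>Basis. Dform \<eta> b u w) + c * (\<Sum>b\<in>Basis. Dform \<eta> b v w)"
    using G by (simp add: sum.distrib sum_distrib_left cong: sum.cong)
  thus ?thesis
    unfolding B_expand[OF a H1_lin[OF h(1,2)] h(3)] B_expand[OF a h(1,3)] B_expand[OF a h(2,3)]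
      L2ip.ip_lin[OF h[THEN H1_imp_L2]] dual_lin(1)[OF sides(1) u v w \<kappa> \<epsilon>p] dual_lin(1)[OF sides(2) u v w \<kappa> \<epsilon>m]
    by (simp add: algebra_simps)
qed

lemma B_lin2:
  assumes a: "admissible \<eta>" and u: "u \<in> QP" and v: "v \<in> QP" and w: "w \<in> QP"
  shows "B \<eta> w (\<lambda>x. u x + c * v x) = B \<eta> w u + cnj c * B \<eta> w v"
proof -
  note h = QP_H1[OF u] QP_H1[OF v] QP_H1[OF w]
  have G: "Dform \<eta> b w (\<lambda>x. u x + c * v x) = Dform \<eta> b w u + cnj c * Dform \<eta> b w v" if b: "b \<in> Basis" for b
    unfolding Dform_def by (rule weak_deriv_ip_lin[OF weighted_D_L2(1)[OF a h(3) b] h(1,2) b])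
  have "(\<Sum>b\<in>Basis. Dform \<eta> b w (\<lambda>x. u x + c * v x)) = (\<Sum>b\<in>Basis. Dform \<eta> b w u) + cnj c * (\<Sum>b\<in>Basis. Dform \<eta> b w v)"
    using G by (simp add: sum.distrib sum_distrib_left cong: sum.cong)
  thus ?thesis
    unfolding B_expand[OF a h(3) H1_lin[OF h(1,2)]] B_expand[OF a h(3,1)] B_expand[OF a h(3,2)]
      L2ip.ip_lin2[OF h[THEN H1_imp_L2]] dual_lin(2)[OF sides(1) u v w \<kappa> \<epsilon>p] dual_lin(2)[OF sides(2) u v w \<kappa> \<epsilon>m]
    by (simp add: algebra_simps)
qed

lemma Dform_bound:
  assumes a: "admissible \<eta>" and w: "w \<in> H1 \<Omega>" and v: "v \<in> H1 \<Omega>" and b: "b \<in> Basis"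
  shows "cmod (Dform \<eta> b w v) \<le> (1 / c2) * (H1_norm \<Omega> w * H1_norm \<Omega> v)"
proof -
  have "cmod (Dform \<eta> b w v) \<le> L2_norm \<Omega> (\<lambda>x. 1 / \<eta> x * D b w x) * L2_norm \<Omega> (D b v)"
    unfolding Dform_def by (rule L2ip.Cauchy_Schwarz[OF weighted_D_L2(1)[OF a w b] weak_deriv_spec(1)[OF v b]])
  also have "\<dots> \<le> (1 / c2 * H1_norm \<Omega> w) * H1_norm \<Omega> v"
  proof (intro mult_mono)
    show "L2_norm \<Omega> (\<lambda>x. 1 / \<eta> x * D b w x) \<le> 1 / c2 * H1_norm \<Omega> w"
      using weighted_D_L2(2)[OF a w b] mult_left_mono[OF weak_deriv_le_H1_norm[OF b, of w], of "1 / c2"] c2 by simp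
  qed (use c2 in \<open>auto intro: weak_deriv_le_H1_norm b\<close>)
  finally show ?thesis by (simp add: mult.assoc)
qed

lemma B_bound:
  "\<exists>K. \<forall>\<eta> w v. admissible \<eta> \<and> w \<in> QP \<and> v \<in> QP \<longrightarrow> cmod (B \<eta> w v) \<le> K * H1_norm \<Omega> w * H1_norm \<Omega> v"
proof -
  define Kp where "Kp = (\<kappa> * sqrt \<epsilon>p + 1) / \<epsilon>p * (1 / H + 2)"
  define Km where "Km = (\<kappa> * sqrt \<epsilon>m + 1) / \<epsilon>m * (1 / H + 2)"
  have "cmod (B \<eta> w v) \<le> (2 / c2 + \<kappa>\<^sup>2 + Km + Kp) * H1_norm \<Omega> w * H1_norm \<Omega> v"
    if a: "admissible \<eta>" and w: "w \<in> QP" and v: "v \<in> QP" for \<eta> w v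
  proof -
    note h = QP_H1[OF w] QP_H1[OF v]
    define N where "N = H1_norm \<Omega> w * H1_norm \<Omega> v"
    have "cmod (\<Sum>b\<in>Basis. Dform \<eta> b w v) \<le> (\<Sum>b\<in>(Basis :: (real \<times> real) set). (1 / c2) * N)"
      unfolding N_def by (rule sum_norm_le) (rule Dform_bound[OF a h])
    hence 1: "cmod (\<Sum>b\<in>Basis. Dform \<eta> b w v) \<le> 2 / c2 * N" by simp
    have "cmod (\<integral>x. w x * cnj (v x) \<partial>lebesgue_on \<Omega>) \<le> L2_norm \<Omega> w * L2_norm \<Omega> v"
      by (rule L2ip.Cauchy_Schwarz[OF h[THEN H1_imp_L2]])
    also have "\<dots> \<le> N" unfolding N_def by (intro mult_mono L2_le_H1_norm) auto
    finally have 2: "cmod (of_real (\<kappa>\<^sup>2) * (\<integral>x. w x * cnj (v x) \<partial>lebesgue_on \<Omega>)) \<le> \<kappa>\<^sup>2 * N"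
      unfolding norm_mult norm_of_real by (simp add: mult_left_mono)
    have 3: "cmod (dual \<kappa> \<epsilon>m (- H) w v) \<le> Km * N" "cmod (dual \<kappa> \<epsilon>p H w v) \<le> Kp * N"
      using dual_bound[OF sides(2) w v \<kappa> \<epsilon>m] dual_bound[OF sides(1) w v \<kappa> \<epsilon>p]
      by (simp_all add: Km_def Kp_def N_def mult.assoc)
    have tri: "cmod (p - q - r - s) \<le> cmod p + cmod q + cmod r + cmod s" for p q r s
      using norm_triangle_ineq4[of "p - q - r" s] norm_triangle_ineq4[of "p - q" r] norm_triangle_ineq4[of p q] by linarith
    have "cmod (B \<eta> w v) \<le> 2 / c2 * N + \<kappa>\<^sup>2 * N + Km * N + Kp * N"
      unfolding B_expand[OF a h] by (rule order_trans[OF tri]) (intro add_mono 1 2 3)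
    thus ?thesis by (simp add: N_def algebra_simps)
  qed
  thus ?thesis by blast
qed

text \<open>The mass term is real and disappears from the imaginary part. Absorption controls the
  gradient, and the boundary terms have the right sign. The modes needed by the Poincare inequality
  have \<alpha>_n = 0, hence \<beta>_n = \<kappa> sqrt \<open>\<epsilon>p\<close>, and are
  controlled by the upper boundary term. The constant is chosen before the coefficient.\<close>

lemma B_coercive:
  "\<exists>c0>0. \<forall>\<eta> u. admissible \<eta> \<and> u \<in> QP \<longrightarrow> c0 * (H1_norm \<Omega> u)\<^sup>2 \<le> - Im (B \<eta> u u)"
proof -
  obtain C M where C: "C \<ge> 0" "finite M" and al: "\<forall>n\<in>M. alpha Lx (alpha0 \<kappa> \<epsilon>p \<theta>) n = 0"
    and P: "\<And>u. u \<in> QP \<Longrightarrow> (L2_norm \<Omega> u)\<^sup>2 \<le> C * (grad_sq u + (\<Sum>n\<in>M. (cmod (tc H u n))\<^sup>2))"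
    using poincare by blast
  \<comment> \<open>The smaller of the two available strengths: absorption in the gradient, and
    radiation of the modes with \<alpha>_n = 0 through the upper boundary. The Poincare inequality
    bounds the full norm by C + 1 times gradient plus modes, hence the quotient below.\<close>
  define g0 where "g0 = min (c1 / M0\<^sup>2) ((Lx / \<epsilon>p) * (\<kappa> * sqrt \<epsilon>p))"
  have g0: "g0 > 0" using c1 M0 Lx0 \<epsilon>p \<kappa> by (simp add: g0_def)
  have "g0 / (C + 1) * (H1_norm \<Omega> u)\<^sup>2 \<le> - Im (B \<eta> u u)" if a: "admissible \<eta>" and u: "u \<in> QP" for \<eta> u
  proof -
    note h = QP_H1[OF u]
    define S where "S = (\<Sum>n\<in>M. (cmod (tc H u n))\<^sup>2)"
    have S: "S \<ge> 0" by (simp add: S_def sum_nonneg)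
    have G: "Im (Dform \<eta> b u u) \<le> - (c1 / M0\<^sup>2) * (L2_norm \<Omega> (D b u))\<^sup>2" if b: "b \<in> Basis" for b
    proof -
      note L = weighted_D_L2(1)[OF a h b] weak_deriv_spec(1)[OF h b]
      have "Im (Dform \<eta> b u u) = (\<integral>x. Im ((1 / \<eta> x * D b u x) * cnj (D b u x)) \<partial>lebesgue_on \<Omega>)"
        unfolding Dform_def by (rule integral_Im[OF L2_integrable_cnj[OF L], symmetric])
      also have "\<dots> \<le> (\<integral>x. - (c1 / M0\<^sup>2) * (cmod (D b u x))\<^sup>2 \<partial>lebesgue_on \<Omega>)"
      proof (rule integral_mono[OF integrable_Im[OF L2_integrable_cnj[OF L]] integrable_mult_right[OF L2_square_integrable[OF L(2)]]])
        fix x assume "x \<in> space (lebesgue_on \<Omega>)"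
        hence x: "x \<in> \<Omega>" by simp
        have "(1 / \<eta> x * D b u x) * cnj (D b u x) = 1 / \<eta> x * of_real ((cmod (D b u x))\<^sup>2)"
          unfolding complex_norm_square by simp
        hence "Im ((1 / \<eta> x * D b u x) * cnj (D b u x)) = Im (1 / \<eta> x) * (cmod (D b u x))\<^sup>2"
          by (simp only: times_complex.sel Re_complex_of_real Im_complex_of_real mult_zero_right add_0_left)
        also have "\<dots> \<le> - (c1 / M0\<^sup>2) * (cmod (D b u x))\<^sup>2"
          by (intro mult_right_mono admissible_inverse(3)[OF a x]) simp
        finally show "Im ((1 / \<eta> x * D b u x) * cnj (D b u x)) \<le> - (c1 / M0\<^sup>2) * (cmod (D b u x))\<^sup>2" .
      qed
      also have "\<dots> = - (c1 / M0\<^sup>2) * (L2_norm \<Omega> (D b u))\<^sup>2"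
        unfolding L2_norm_sq by (rule integral_mult_right_zero)
      finally show ?thesis .
    qed
    have 1: "Im (\<Sum>b\<in>Basis. Dform \<eta> b u u) \<le> - (c1 / M0\<^sup>2) * grad_sq u"
      unfolding Im_sum grad_sq_def sum_distrib_left by (rule sum_mono) (rule G)
    have 2: "Im (of_real (\<kappa>\<^sup>2) * (\<integral>x. u x * cnj (u x) \<partial>lebesgue_on \<Omega>)) = 0"
      unfolding complex_norm_square[symmetric] of_real_power[symmetric] integral_complex_of_real of_real_mult[symmetric] by simp
    have 3: "0 \<le> Im (dual \<kappa> \<epsilon>m (- H) u u)" using Im_dual[OF sides(2) u \<kappa> \<epsilon>m, of "{}"] by simp
    have "(\<Sum>n\<in>M. Re (beta Lx (alpha0 \<kappa> \<epsilon>p \<theta>) \<kappa> \<epsilon>p n) * (cmod (tc H u n))\<^sup>2) = (\<kappa> * sqrt \<epsilon>p) * S"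
      unfolding S_def sum_distrib_left by (rule sum.cong[OF refl]) (use beta_zero[OF \<kappa> \<epsilon>p] al in simp)
    hence 4: "(Lx / \<epsilon>p) * ((\<kappa> * sqrt \<epsilon>p) * S) \<le> Im (dual \<kappa> \<epsilon>p H u u)"
      using Im_dual[OF sides(1) u \<kappa> \<epsilon>p C(2)] by simp
    have 5: "g0 * grad_sq u \<le> c1 / M0\<^sup>2 * grad_sq u" "g0 * S \<le> (Lx / \<epsilon>p) * (\<kappa> * sqrt \<epsilon>p) * S"
      by (intro mult_right_mono grad_sq_nonneg S; simp add: g0_def)+
    have "(H1_norm \<Omega> u)\<^sup>2 \<le> C * (grad_sq u + S) + (grad_sq u + S)"
      unfolding H1_norm_grad using P[OF u] S by (simp add: S_def)
    hence "(H1_norm \<Omega> u)\<^sup>2 \<le> (C + 1) * (grad_sq u + S)" by (simp add: algebra_simps)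
    hence "g0 / (C + 1) * (H1_norm \<Omega> u)\<^sup>2 \<le> g0 / (C + 1) * ((C + 1) * (grad_sq u + S))"
      using g0 C by (intro mult_left_mono) auto
    also have "\<dots> = g0 * grad_sq u + g0 * S" using C by (simp add: distrib_left)
    also have "\<dots> \<le> - Im (B \<eta> u u)"
      unfolding B_expand[OF a h h] minus_complex.sel 2 using 1 3 4 5 by (simp add: mult.assoc)
    finally show ?thesis .
  qed
  moreover have "g0 / (C + 1) > 0" using g0 C by simp
  ultimately show ?thesis by blast
qed

end

section \<open>The incident field and the source functional\<close>

lemma u_inc_derivative:
  "(u_inc \<kappa> \<epsilon>p \<theta> has_derivative (\<lambda>h. \<i> * complex_of_real (\<kappa> * sqrt \<epsilon>p * (fst h * sin \<theta> - snd h * cos \<theta>)) * u_inc \<kappa> \<epsilon>p \<theta> x)) (at x)"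
proof -
  let ?g = "\<lambda>x :: real \<times> real. \<i> * complex_of_real (\<kappa> * sqrt \<epsilon>p * (fst x * sin \<theta> - snd x * cos \<theta>))"
  have eq: "u_inc \<kappa> \<epsilon>p \<theta> = (\<lambda>x. exp (?g x))" by (auto simp: u_inc_def fun_eq_iff)
  have "(?g has_derivative ?g) (at x)"
    by (intro bounded_linear_imp_has_derivative bounded_linear_const_mult bounded_linear_compose[OF bounded_linear_of_real]
        bounded_linear_sub bounded_linear_mult_const bounded_linear_fst bounded_linear_snd)
  from has_derivative_compose[OF this DERIV_exp[unfolded has_field_derivative_def]]
  show ?thesis unfolding eq by (simp only: mult.commute)
qed

lemma dpart_u_inc:
  "dpart b (u_inc \<kappa> \<epsilon>p \<theta>) = (\<lambda>x. \<i> * complex_of_real (\<kappa> * sqrt \<epsilon>p * (fst b * sin \<theta> - snd b * cos \<theta>)) * u_inc \<kappa> \<epsilon>p \<theta> x)"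
  by (rule ext) (rule dpart_eq[OF u_inc_derivative])

lemma continuous_u_inc: "continuous_on S (u_inc \<kappa> \<epsilon>p \<theta>)"
  unfolding u_inc_def case_prod_unfold by (intro continuous_intros)

lemma continuous_dpart_u_inc: "continuous_on S (dpart b (u_inc \<kappa> \<epsilon>p \<theta>))"
  unfolding dpart_u_inc by (intro continuous_intros continuous_u_inc)

lemma norm_dpart_u_inc:
  assumes "\<kappa> > 0" "\<epsilon>p > 0" "b \<in> Basis"
  shows "cmod (dpart b (u_inc \<kappa> \<epsilon>p \<theta>) x) \<le> \<kappa> * sqrt \<epsilon>p"
proof -
  have "cmod (u_inc \<kappa> \<epsilon>p \<theta> x) = 1" by (simp add: u_inc_def case_prod_unfold del: of_real_mult of_real_diff)
  hence "cmod (dpart b (u_inc \<kappa> \<epsilon>p \<theta>) x) = \<kappa> * sqrt \<epsilon>p * \<bar>fst b * sin \<theta> - snd b * cos \<theta>\<bar>"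
    using assms by (simp add: dpart_u_inc norm_mult abs_mult del: of_real_mult of_real_diff)
  also have "\<dots> \<le> \<kappa> * sqrt \<epsilon>p * 1"
    using assms by (intro mult_left_mono) (auto simp: Basis_point)
  finally show ?thesis by simp
qed

context grating
begin

abbreviation dui :: "real \<times> real \<Rightarrow> real \<times> real \<Rightarrow> complex" where
  "dui b \<equiv> dpart b (u_inc \<kappa> \<epsilon>p \<theta>)"

lemma dui_L2: "dui b \<in> L2 \<Omega>"
  by (rule continuous_L2_bounded[OF continuous_dpart_u_inc bounded_dom dom_lmeasurable])

lemma dui_trace_L2: "(\<lambda>t. dui b (t, y)) \<in> L2 {0<..<Lx}"
  by (rule continuous_L2_bounded[OF section_continuous(1)[OF continuous_dpart_u_inc] _ interval_lmeasurable]) simp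

definition contrast :: "(real \<times> real \<Rightarrow> complex) \<Rightarrow> real \<times> real \<Rightarrow> complex" where
  "contrast \<eta> x = 1 / complex_of_real \<epsilon>p - 1 / \<eta> x"

lemma contrast_dui_L2:
  assumes a: "admissible \<eta>"
  shows "(\<lambda>x. contrast \<eta> x * dui b x) \<in> L2 \<Omega>"
    and "L2_norm \<Omega> (\<lambda>x. contrast \<eta> x * dui b x) \<le> (1 / \<epsilon>p + 1 / c2) * L2_norm \<Omega> (dui b)"
proof -
  have m: "contrast \<eta> \<in> borel_measurable (lebesgue_on \<Omega>)"
    unfolding contrast_def[abs_def] by (intro borel_measurable_diff borel_measurable_const admissible_inverse(1)[OF a])
  have b: "cmod (contrast \<eta> x) \<le> 1 / \<epsilon>p + 1 / c2" if "x \<in> \<Omega>" for x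
  proof -
    have "cmod (contrast \<eta> x) \<le> cmod (1 / complex_of_real \<epsilon>p) + cmod (1 / \<eta> x)"
      unfolding contrast_def by (rule norm_triangle_ineq4)
    thus ?thesis using admissible_inverse(2)[OF a that] \<epsilon>p by (simp add: norm_divide)
  qed
  show "(\<lambda>x. contrast \<eta> x * dui b x) \<in> L2 \<Omega>"
    "L2_norm \<Omega> (\<lambda>x. contrast \<eta> x * dui b x) \<le> (1 / \<epsilon>p + 1 / c2) * L2_norm \<Omega> (dui b)"
    using L2_bounded_mult[OF dui_L2 m b] by blast+
qed

abbreviation flux :: complex where
  "flux \<equiv> 1 / complex_of_real \<epsilon>p - 1 / complex_of_real \<epsilon>m"

lemma src_expand:
  assumes a: "admissible \<eta>" and v: "v \<in> QP"
  shows "src \<eta> v = (\<Sum>b\<in>Basis. \<integral>x. (contrast \<eta> x * dui b x) * cnj (D b v x) \<partial>lebesgue_on \<Omega>)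
    + flux * (\<integral>t. dui (0, 1) (t, - H) * cnj (trace_at Lx H (- H) v t) \<partial>lebesgue_on {0<..<Lx})"
proof -
  have i: "integrable (lebesgue_on \<Omega>) (\<lambda>x. (contrast \<eta> x * dui b x) * cnj (D b v x))" if "b \<in> Basis" for b
    by (rule L2_integrable_cnj[OF contrast_dui_L2(1)[OF a] weak_deriv_spec(1)[OF QP_H1[OF v] that]])
  have "(\<integral>x. (1 / complex_of_real \<epsilon>p - 1 / \<eta> x) * (\<Sum>b\<in>Basis. dui b x * cnj (D b v x)) \<partial>lebesgue_on \<Omega>)
      = (\<integral>x. (\<Sum>b\<in>Basis. (contrast \<eta> x * dui b x) * cnj (D b v x)) \<partial>lebesgue_on \<Omega>)"
    unfolding contrast_def by (simp only: sum_distrib_left mult.assoc)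
  also have "\<dots> = (\<Sum>b\<in>Basis. \<integral>x. (contrast \<eta> x * dui b x) * cnj (D b v x) \<partial>lebesgue_on \<Omega>)"
    by (rule Bochner_Integration.integral_sum[OF i])
  finally show ?thesis unfolding source_def Let_def by simp
qed

lemma src_lin:
  assumes a: "admissible \<eta>" and u: "u \<in> QP" and v: "v \<in> QP"
  shows "src \<eta> (\<lambda>x. u x + c * v x) = src \<eta> u + cnj c * src \<eta> v"
proof -
  note h = QP_H1[OF u] QP_H1[OF v]
  let ?t = "trace_at Lx H (- H)"
  let ?I = "\<lambda>b v. \<integral>x. (contrast \<eta> x * dui b x) * cnj (D b v x) \<partial>lebesgue_on \<Omega>"
  have G: "?I b (\<lambda>x. u x + c * v x) = ?I b u + cnj c * ?I b v" if "b \<in> Basis" for b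
    by (rule weak_deriv_ip_lin[OF contrast_dui_L2(1)[OF a] h that])
  have S: "(\<Sum>b\<in>Basis. ?I b (\<lambda>x. u x + c * v x)) = (\<Sum>b\<in>Basis. ?I b u) + cnj c * (\<Sum>b\<in>Basis. ?I b v)"
    using G by (simp add: sum.distrib sum_distrib_left cong: sum.cong)
  note t = trace_at_L2[OF sides(2) u] trace_at_L2[OF sides(2) v]
  note tuv = trace_at_L2[OF sides(2) QP_lin[OF u v, of c]]
  have "AE s in lebesgue_on {0<..<Lx}. ?t (\<lambda>x. u x + c * v x) s - (?t u s + c * ?t v s) = 0"
    by (rule L2_norm_eq_0_AE[OF L2ip.diff_mem[OF tuv L2_lin[OF t]] trace_at_lin[OF sides(2) u v]])
  hence ae: "AE s in lebesgue_on {0<..<Lx}. ?t (\<lambda>x. u x + c * v x) s = ?t u s + c * ?t v s"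
    by eventually_elim simp
  note T = trans[OF integral_mult_cnj_cong_AE(1)[OF dui_trace_L2 tuv L2_lin[OF t] ae] L2ip.ip_lin2[OF t dui_trace_L2]]
  show ?thesis
    unfolding src_expand[OF a QP_lin[OF u v]] src_expand[OF a u] src_expand[OF a v] S T
    by (simp add: algebra_simps)
qed

lemma src_bound: "\<exists>F. \<forall>\<eta> v. admissible \<eta> \<and> v \<in> QP \<longrightarrow> cmod (src \<eta> v) \<le> F * H1_norm \<Omega> v"
proof -
  define N where "N b = (1 / \<epsilon>p + 1 / c2) * L2_norm \<Omega> (dui b)" for b
  define T where "T = cmod flux * (L2_norm {0<..<Lx} (\<lambda>t. dui (0, 1) (t, - H)) * sqrt (1 / H + 2))"
  have "cmod (src \<eta> v) \<le> ((\<Sum>b\<in>Basis. N b) + T) * H1_norm \<Omega> v" if a: "admissible \<eta>" and v: "v \<in> QP" for \<eta> v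
  proof -
    note h = QP_H1[OF v]
    have "cmod (\<integral>x. (contrast \<eta> x * dui b x) * cnj (D b v x) \<partial>lebesgue_on \<Omega>) \<le> N b * H1_norm \<Omega> v" if b: "b \<in> Basis" for b
    proof -
      have "cmod (\<integral>x. (contrast \<eta> x * dui b x) * cnj (D b v x) \<partial>lebesgue_on \<Omega>)
          \<le> L2_norm \<Omega> (\<lambda>x. contrast \<eta> x * dui b x) * L2_norm \<Omega> (D b v)"
        by (rule L2ip.Cauchy_Schwarz[OF contrast_dui_L2(1)[OF a] weak_deriv_spec(1)[OF h b]])
      also have "\<dots> \<le> N b * H1_norm \<Omega> v"
        unfolding N_def using \<epsilon>p c2
        by (intro mult_mono contrast_dui_L2(2)[OF a] weak_deriv_le_H1_norm[OF b] mult_nonneg_nonneg L2_norm_nonneg) simp_all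
      finally show ?thesis .
    qed
    hence 1: "cmod (\<Sum>b\<in>Basis. \<integral>x. (contrast \<eta> x * dui b x) * cnj (D b v x) \<partial>lebesgue_on \<Omega>) \<le> (\<Sum>b\<in>Basis. N b * H1_norm \<Omega> v)"
      by (rule sum_norm_le)
    have "(L2_norm {0<..<Lx} (trace_at Lx H (- H) v))\<^sup>2 \<le> (sqrt (1 / H + 2) * H1_norm \<Omega> v)\<^sup>2"
      using has_trace_bound[OF sides(2) h trace_at_spec[OF sides(2) v]] H0 by (simp add: power_mult_distrib)
    hence tb: "L2_norm {0<..<Lx} (trace_at Lx H (- H) v) \<le> sqrt (1 / H + 2) * H1_norm \<Omega> v"
      by (rule power2_le_imp_le) (use H0 in simp)
    have "cmod (\<integral>t. dui (0, 1) (t, - H) * cnj (trace_at Lx H (- H) v t) \<partial>lebesgue_on {0<..<Lx})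
        \<le> L2_norm {0<..<Lx} (\<lambda>t. dui (0, 1) (t, - H)) * L2_norm {0<..<Lx} (trace_at Lx H (- H) v)"
      by (rule L2ip.Cauchy_Schwarz[OF dui_trace_L2 trace_at_L2[OF sides(2) v]])
    also have "\<dots> \<le> L2_norm {0<..<Lx} (\<lambda>t. dui (0, 1) (t, - H)) * (sqrt (1 / H + 2) * H1_norm \<Omega> v)"
      by (intro mult_left_mono tb) simp
    finally have 2: "cmod (flux * (\<integral>t. dui (0, 1) (t, - H) * cnj (trace_at Lx H (- H) v t) \<partial>lebesgue_on {0<..<Lx})) \<le> T * H1_norm \<Omega> v"
      unfolding norm_mult T_def mult.assoc by (rule mult_left_mono) simp
    show ?thesis
      unfolding src_expand[OF a v] distrib_right sum_distrib_right
      by (rule norm_triangle_le[OF add_mono[OF 1 2]])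
  qed
  thus ?thesis by blast
qed

section \<open>Solvability and dependence on the coefficient\<close>

theorem unique_solvability:
  assumes a: "admissible \<eta>"
  shows "uniquely_solvable Lx H \<kappa> \<epsilon>p \<epsilon>m \<theta> \<eta>"
proof -
  obtain K where K: "\<And>w v. w \<in> QP \<Longrightarrow> v \<in> QP \<Longrightarrow> cmod (B \<eta> w v) \<le> K * H1_norm \<Omega> w * H1_norm \<Omega> v"
    using B_bound a by blast
  obtain c0 where c0: "c0 > 0" "\<And>u. u \<in> QP \<Longrightarrow> c0 * (H1_norm \<Omega> u)\<^sup>2 \<le> - Im (B \<eta> u u)"
    using B_coercive a by blast
  obtain F where F: "\<And>v. v \<in> QP \<Longrightarrow> cmod (src \<eta> v) \<le> F * H1_norm \<Omega> v"
    using src_bound a by blast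
  \<comment> \<open>Multiplying both sides by i turns -Im B into a real part, the form in which the
    Lax-Milgram theorem expects coercivity.\<close>
  have "\<exists>u\<in>QP. \<forall>v\<in>QP. \<i> * B \<eta> u v = \<i> * src \<eta> v"
  proof (rule QPip.Lax_Milgram[where K = K and ?c0.0 = c0 and F = F])
    show "\<i> * B \<eta> (\<lambda>x. u x + c * v x) w = \<i> * B \<eta> u w + c * (\<i> * B \<eta> v w)"
      if "u \<in> QP" "v \<in> QP" "w \<in> QP" for u v w c
      unfolding B_lin1[OF a that] by (simp add: algebra_simps)
    show "\<i> * B \<eta> w (\<lambda>x. u x + c * v x) = \<i> * B \<eta> w u + cnj c * (\<i> * B \<eta> w v)"
      if "u \<in> QP" "v \<in> QP" "w \<in> QP" for u v w c
      unfolding B_lin2[OF a that] by (simp add: algebra_simps)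
    show "cmod (\<i> * B \<eta> u v) \<le> K * H1_norm \<Omega> u * H1_norm \<Omega> v" if "u \<in> QP" "v \<in> QP" for u v
      using K[OF that] by (simp add: norm_mult)
    show "c0 * (H1_norm \<Omega> u)\<^sup>2 \<le> Re (\<i> * B \<eta> u u)" if "u \<in> QP" for u
      using c0(2)[OF that] by simp
    show "\<i> * src \<eta> (\<lambda>x. u x + c * v x) = \<i> * src \<eta> u + cnj c * (\<i> * src \<eta> v)"
      if "u \<in> QP" "v \<in> QP" for u v c
      unfolding src_lin[OF a that] by (simp add: algebra_simps)
    show "cmod (\<i> * src \<eta> v) \<le> F * H1_norm \<Omega> v" if "v \<in> QP" for v
      using F[OF that] by (simp add: norm_mult)
  qed (rule c0(1))
  then obtain u where u: "u \<in> QP" "\<And>v. v \<in> QP \<Longrightarrow> B \<eta> u v = src \<eta> v" by auto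
  have "AE x in lebesgue_on \<Omega>. u' x = u x" if "is_solution Lx H \<kappa> \<epsilon>p \<epsilon>m \<theta> \<eta> u'" for u'
  proof -
    have u': "u' \<in> QP" "\<And>v. v \<in> QP \<Longrightarrow> B \<eta> u' v = src \<eta> v"
      using that by (auto simp: is_solution_def)
    have d: "(\<lambda>x. u' x - u x) \<in> QP" by (rule QPip.diff_mem[OF u'(1) u(1)])
    have "B \<eta> (\<lambda>x. u' x - u x) (\<lambda>x. u' x - u x) = 0"
      using B_lin1[OF a u'(1) u(1) d, of "-1"] u'(2)[OF d] u(2)[OF d] by simp
    hence "c0 * (H1_norm \<Omega> (\<lambda>x. u' x - u x))\<^sup>2 \<le> 0" using c0(2)[OF d] by simp
    hence "H1_norm \<Omega> (\<lambda>x. u' x - u x) = 0" using c0(1) by (simp add: mult_le_0_iff)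
    thus ?thesis by (rule H1_norm_cong_AE[OF QP_H1[OF u'(1)] QP_H1[OF u(1)]])
  qed
  moreover have "is_solution Lx H \<kappa> \<epsilon>p \<epsilon>m \<theta> \<eta> u" using u by (simp add: is_solution_def)
  ultimately show ?thesis unfolding uniquely_solvable_def by blast
qed

text \<open>An estimate of Strang type: with e = u - u', coercivity of the form for \<eta>' is
  applied to B(e,e), which equals the difference of the two forms at (u,e) plus the difference of
  the sources. Mass and boundary terms cancel. The right-hand side contains the gradient of u but
  not of u', so the regularity of one fixed solution serves for all \<eta>'.\<close>

theorem coefficient_perturbation:
  "\<exists>c0>0. \<forall>\<eta> \<eta>' u u'. admissible \<eta> \<and> admissible \<eta>' \<and> is_solution Lx H \<kappa> \<epsilon>p \<epsilon>m \<theta> \<eta> u \<and>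
    is_solution Lx H \<kappa> \<epsilon>p \<epsilon>m \<theta> \<eta>' u' \<longrightarrow>
    c0 * H1_norm \<Omega> (\<lambda>x. u x - u' x) \<le> (\<Sum>b\<in>Basis. L2_norm \<Omega> (\<lambda>x. (1 / \<eta>' x - 1 / \<eta> x) * (D b u x + dui b x)))"
proof -
  obtain c0 where c0: "c0 > 0" "\<And>\<eta> u. admissible \<eta> \<Longrightarrow> u \<in> QP \<Longrightarrow> c0 * (H1_norm \<Omega> u)\<^sup>2 \<le> - Im (B \<eta> u u)"
    using B_coercive by blast
  have "c0 * H1_norm \<Omega> (\<lambda>x. u x - u' x) \<le> (\<Sum>b\<in>Basis. L2_norm \<Omega> (\<lambda>x. (1 / \<eta>' x - 1 / \<eta> x) * (D b u x + dui b x)))"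
    if a: "admissible \<eta>" and a': "admissible \<eta>'" and s: "is_solution Lx H \<kappa> \<epsilon>p \<epsilon>m \<theta> \<eta> u"
      and s': "is_solution Lx H \<kappa> \<epsilon>p \<epsilon>m \<theta> \<eta>' u'" for \<eta> \<eta>' u u'
  proof -
    have u: "u \<in> QP" "\<And>v. v \<in> QP \<Longrightarrow> B \<eta> u v = src \<eta> v" using s by (auto simp: is_solution_def)
    have u': "u' \<in> QP" "\<And>v. v \<in> QP \<Longrightarrow> B \<eta>' u' v = src \<eta>' v" using s' by (auto simp: is_solution_def)
    define e where "e = (\<lambda>x. u x - u' x)"
    have e: "e \<in> QP" unfolding e_def by (rule QPip.diff_mem[OF u(1) u'(1)])
    note h = QP_H1[OF u(1)] QP_H1[OF e]
    let ?R = "\<lambda>b x. (1 / \<eta>' x - 1 / \<eta> x) * (D b u x + dui b x)"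
    have RL: "?R b \<in> L2 \<Omega>" and RI: "(\<integral>x. ?R b x * cnj (D b e x) \<partial>lebesgue_on \<Omega>) =
        (Dform \<eta>' b u e - Dform \<eta> b u e) + ((\<integral>x. (contrast \<eta> x * dui b x) * cnj (D b e x) \<partial>lebesgue_on \<Omega>)
          - (\<integral>x. (contrast \<eta>' x * dui b x) * cnj (D b e x) \<partial>lebesgue_on \<Omega>))" if b: "b \<in> Basis" for b
    proof -
      note De = weak_deriv_spec(1)[OF h(2) b]
      note p = weighted_D_L2(1)[OF a' h(1) b] weighted_D_L2(1)[OF a h(1) b] contrast_dui_L2(1)[OF a, of b] contrast_dui_L2(1)[OF a', of b]
      note p12 = L2ip.diff_mem[OF p(1,2)] and p34 = L2ip.diff_mem[OF p(3,4)]
      \<comment> \<open>The differences of the forms and of the sources carry the same factor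
        1/\<eta>' - 1/\<eta>, so the gradients of u and of the incident field combine to the
        gradient of their sum.\<close>
      have eq: "(1 / \<eta>' x - 1 / \<eta> x) * (D b u x + dui b x)
          = ((1 / \<eta>' x * D b u x) - (1 / \<eta> x * D b u x)) + ((contrast \<eta> x * dui b x) - (contrast \<eta>' x * dui b x))" for x
        by (simp add: contrast_def algebra_simps)
      show "?R b \<in> L2 \<Omega>" unfolding eq by (rule L2ip.add_mem[OF p12 p34])
      show "(\<integral>x. ?R b x * cnj (D b e x) \<partial>lebesgue_on \<Omega>) =
        (Dform \<eta>' b u e - Dform \<eta> b u e) + ((\<integral>x. (contrast \<eta> x * dui b x) * cnj (D b e x) \<partial>lebesgue_on \<Omega>)
          - (\<integral>x. (contrast \<eta>' x * dui b x) * cnj (D b e x) \<partial>lebesgue_on \<Omega>))"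
        unfolding eq Dform_def L2ip.ip_diff[OF p(1,2) De, symmetric] L2ip.ip_diff[OF p(3,4) De, symmetric]
        using L2ip.ip_lin[OF p12 p34 De, of 1] by simp
    qed
    have "B \<eta>' e e = B \<eta>' u e - src \<eta>' e"
      using B_lin1[OF a' u(1) u'(1) e, of "-1"] u'(2)[OF e] by (simp add: e_def)
    also have "\<dots> = (B \<eta>' u e - B \<eta> u e) + (src \<eta> e - src \<eta>' e)" using u(2)[OF e] by simp
    also have "\<dots> = (\<Sum>b\<in>Basis. \<integral>x. ?R b x * cnj (D b e x) \<partial>lebesgue_on \<Omega>)"
      unfolding B_expand[OF a h] B_expand[OF a' h] src_expand[OF a e] src_expand[OF a' e]
      using RI by (simp add: sum.distrib sum_subtractf cong: sum.cong)
    finally have Be: "B \<eta>' e e = (\<Sum>b\<in>Basis. \<integral>x. ?R b x * cnj (D b e x) \<partial>lebesgue_on \<Omega>)" .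
    have "cmod (B \<eta>' e e) \<le> (\<Sum>b\<in>Basis. L2_norm \<Omega> (?R b) * H1_norm \<Omega> e)"
      unfolding Be
    proof (rule sum_norm_le)
      fix b :: "real \<times> real" assume b: "b \<in> Basis"
      have "cmod (\<integral>x. ?R b x * cnj (D b e x) \<partial>lebesgue_on \<Omega>) \<le> L2_norm \<Omega> (?R b) * L2_norm \<Omega> (D b e)"
        by (rule L2ip.Cauchy_Schwarz[OF RL[OF b] weak_deriv_spec(1)[OF h(2) b]])
      also have "\<dots> \<le> L2_norm \<Omega> (?R b) * H1_norm \<Omega> e" by (intro mult_left_mono weak_deriv_le_H1_norm[OF b]) simp
      finally show "cmod (\<integral>x. ?R b x * cnj (D b e x) \<partial>lebesgue_on \<Omega>) \<le> L2_norm \<Omega> (?R b) * H1_norm \<Omega> e" .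
    qed
    hence "c0 * (H1_norm \<Omega> e)\<^sup>2 \<le> (\<Sum>b\<in>Basis. L2_norm \<Omega> (?R b)) * H1_norm \<Omega> e"
      using c0(2)[OF a' e] abs_Im_le_cmod[of "B \<eta>' e e"] by (simp add: sum_distrib_right)
    hence "c0 * H1_norm \<Omega> e * H1_norm \<Omega> e \<le> (\<Sum>b\<in>Basis. L2_norm \<Omega> (?R b)) * H1_norm \<Omega> e"
      by (simp add: power2_eq_square mult.assoc)
    moreover have "0 \<le> (\<Sum>b\<in>Basis. L2_norm \<Omega> (?R b))" by (simp add: sum_nonneg)
    ultimately have "c0 * H1_norm \<Omega> e \<le> (\<Sum>b\<in>Basis. L2_norm \<Omega> (?R b))"
    proof (cases "H1_norm \<Omega> e = 0")
      case False
      hence "H1_norm \<Omega> e > 0" by (simp add: less_le)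
      thus ?thesis using \<open>c0 * H1_norm \<Omega> e * H1_norm \<Omega> e \<le> _\<close> by (simp only: mult_le_cancel_right_pos)
    qed simp
    thus ?thesis by (simp only: e_def)
  qed
  thus ?thesis using c0(1) by blast
qed

end

section \<open>Estimates on thin sets\<close>

lemma ex_borel_complex:
  fixes f :: "'a::euclidean_space \<Rightarrow> complex"
  assumes f: "f \<in> borel_measurable lebesgue"
  shows "\<exists>g\<in>borel_measurable lborel. AE x in lborel. f x = g x"
proof -
  have re: "(\<lambda>x. Re (f x)) \<in> borel_measurable lebesgue" and im: "(\<lambda>x. Im (f x)) \<in> borel_measurable lebesgue"
    using f by measurable
  obtain a where a: "a \<in> borel_measurable lborel" "AE x in lborel. Re (f x) = a x"
    using completion_ex_borel_measurable_real[OF re] by blast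
  obtain b where b: "b \<in> borel_measurable lborel" "AE x in lborel. Im (f x) = b x"
    using completion_ex_borel_measurable_real[OF im] by blast
  have m: "(\<lambda>x. Complex (a x) (b x)) \<in> borel_measurable lborel"
    unfolding borel_measurable_complex_iff using a(1) b(1) by simp
  have ae: "AE x in lborel. f x = Complex (a x) (b x)"
    using a(2) b(2) by eventually_elim (simp add: complex_eq_iff)
  show ?thesis by (rule bexI[where x = "\<lambda>x. Complex (a x) (b x)"], rule ae, rule m)
qed

text \<open>The product of a null set with the whole space is a null set. This allows the
  replacement of g by a Borel function in both variables of the Gagliardo integrand.\<close>

lemma AE_lborel_fst_snd:
  fixes P :: "'a::euclidean_space \<Rightarrow> bool"
  assumes "AE x in lborel. P x"
  shows "AE z in (lborel :: ('a \<times> 'b::euclidean_space) measure). P (fst z)"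
    and "AE z in (lborel :: ('b \<times> 'a) measure). P (snd z)"
proof -
  obtain N where N: "{x. \<not> P x} \<subseteq> N" "N \<in> null_sets lborel"
    using assms by (auto simp: eventually_ae_filter)
  have e: "emeasure lborel N = 0" "N \<in> sets lborel" using N(2) by auto
  have "emeasure (lborel \<Otimes>\<^sub>M (lborel :: 'b measure)) (N \<times> UNIV) = 0"
    using lborel.emeasure_pair_measure_Times[of N lborel UNIV] e by simp
  hence 1: "N \<times> UNIV \<in> null_sets (lborel :: ('a \<times> 'b) measure)"
    unfolding lborel_prod[symmetric] using e(2) by (intro null_setsI) auto
  show "AE z in (lborel :: ('a \<times> 'b) measure). P (fst z)"
    by (rule AE_I'[OF 1]) (use N(1) in auto)
  have "emeasure ((lborel :: 'b measure) \<Otimes>\<^sub>M lborel) (UNIV \<times> N) = 0"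
    using lborel.emeasure_pair_measure_Times[of UNIV lborel N] e by simp
  hence 2: "UNIV \<times> N \<in> null_sets (lborel :: ('b \<times> 'a) measure)"
    unfolding lborel_prod[symmetric] using e(2) by (intro null_setsI) auto
  show "AE z in (lborel :: ('b \<times> 'a) measure). P (snd z)"
    by (rule AE_I'[OF 2]) (use N(1) in auto)
qed

lemma nn_integral_lebesgue_on_lborel:
  fixes h h' :: "'a::euclidean_space \<Rightarrow> ennreal"
  assumes S: "S \<in> sets borel" and m: "(\<lambda>x. h' x * indicator S x) \<in> borel_measurable lborel"
    and ae: "AE x in lborel. x \<in> S \<longrightarrow> h x = h' x"
  shows "(\<integral>\<^sup>+x. h x \<partial>lebesgue_on S) = (\<integral>\<^sup>+x. h' x * indicator S x \<partial>lborel)"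
proof -
  have "(\<integral>\<^sup>+x. h x \<partial>lebesgue_on S) = (\<integral>\<^sup>+x. h x * indicator S x \<partial>lebesgue)"
    by (rule nn_integral_restrict_space) (use S in simp)
  also have "\<dots> = (\<integral>\<^sup>+x. h' x * indicator S x \<partial>lebesgue)"
  proof (rule nn_integral_cong_AE)
    show "AE x in lebesgue. h x * indicator S x = h' x * indicator S x"
      using AE_completion[OF ae] by eventually_elim (auto simp: indicator_def)
  qed
  also have "\<dots> = (\<integral>\<^sup>+x. h' x * indicator S x \<partial>lborel)" by (rule nn_integral_completion)
  finally show ?thesis .
qed

text \<open>On the side of t towards the farther endpoint there is room for a length of at least
  half the interval.\<close>

lemma subinterval_near:
  fixes t r a b :: real
  assumes "a < t" "t < b" "0 < r" "r \<le> (b - a) / 2"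
  shows "\<exists>c. {c<..<c + r} \<subseteq> {a<..<b} \<inter> {t - r<..<t + r}"
proof (cases "t \<le> (a + b) / 2")
  case True
  thus ?thesis using assms by (intro exI[of _ t]) (auto simp: field_simps)
next
  case False
  thus ?thesis using assms by (intro exI[of _ "t - r"]) (auto simp: field_simps)
qed

definition near :: "real \<Rightarrow> (real \<times> real) set \<Rightarrow> real \<times> real \<Rightarrow> (real \<times> real) set" where
  "near r U x = {y \<in> U. \<bar>fst x - fst y\<bar> < r \<and> \<bar>snd x - snd y\<bar> < r}"

text \<open>Even at a corner of the cell, one quarter of the square of side 2r around x remains
  inside.\<close>

lemma near_measure:
  assumes "x \<in> Omega Lx H" "0 < r" "r \<le> Lx / 2" "r \<le> H"
  shows "ennreal (r\<^sup>2) \<le> emeasure lborel (near r (Omega Lx H) x)"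
proof -
  obtain c where c: "{c<..<c + r} \<subseteq> {0<..<Lx} \<inter> {fst x - r<..<fst x + r}"
    using subinterval_near[of 0 "fst x" Lx r] assms by (auto simp: Omega_def)
  obtain d where d: "{d<..<d + r} \<subseteq> {-H<..<H} \<inter> {snd x - r<..<snd x + r}"
    using subinterval_near[of "- H" "snd x" H r] assms by (auto simp: Omega_def)
  have sub: "box (c, d) (c + r, d + r) \<subseteq> near r (Omega Lx H) x"
  proof
    fix y assume "y \<in> box (c, d) (c + r, d + r)"
    hence "fst y \<in> {c<..<c + r}" "snd y \<in> {d<..<d + r}" by (auto simp: box_point)
    with c d have "fst y \<in> {0<..<Lx} \<inter> {fst x - r<..<fst x + r}" "snd y \<in> {-H<..<H} \<inter> {snd x - r<..<snd x + r}" by blast+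
    thus "y \<in> near r (Omega Lx H) x" by (cases y) (auto simp: near_def Omega_def)
  qed
  have "near r (Omega Lx H) x = Omega Lx H \<inter> ({fst x - r<..<fst x + r} \<times> {snd x - r<..<snd x + r})"
    by (auto simp: near_def)
  moreover have "open (Omega Lx H \<inter> ({fst x - r<..<fst x + r} \<times> {snd x - r<..<snd x + r}))"
    unfolding Omega_def by (intro open_Int open_Times) simp_all
  ultimately have m: "near r (Omega Lx H) x \<in> sets lborel" by simp
  have "emeasure lborel (box (c, d) (c + r, d + r)) = ennreal (r\<^sup>2)"
    using assms(2) by (subst emeasure_lborel_box) (auto simp: Basis_point inner_prod_def power2_eq_square)
  thus ?thesis using emeasure_mono[OF sub m] by simp
qed

text \<open>For \<open>x\<close> in the thin set \<open>A\<close>, compare \<open>g x\<close> with the values \<open>g y\<close> on the square of size \<open>r\<close> around \<open>x\<close>: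
  the difference is controlled by the Gagliardo integral, and each \<open>y\<close> is used only for the few
  points \<open>x\<close> of \<open>A\<close> near it.\<close>

theorem strip_estimate:
  fixes g :: "real \<times> real \<Rightarrow> complex"
  assumes s: "s \<ge> 0" and g: "g \<in> Hs s (Omega Lx H)"
  shows "\<exists>C\<ge>0. \<forall>A m r. A \<in> sets borel \<and> A \<subseteq> Omega Lx H \<and> 0 < r \<and> r \<le> Lx / 2 \<and> r \<le> H \<and> m \<ge> 0 \<and>
      (\<forall>a. emeasure lborel (A \<inter> {x. \<bar>fst x - a\<bar> < r}) \<le> ennreal m) \<longrightarrow>
      (\<integral>\<^sup>+x. ennreal ((cmod (g x))\<^sup>2) \<partial>lebesgue_on A) \<le> ennreal (C * r powr (2 * s) + 2 * m / r\<^sup>2 * (L2_norm (Omega Lx H) g)\<^sup>2)"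
proof -
  let ?U = "Omega Lx H"
  have "open ?U" unfolding Omega_def by (intro open_Times) simp_all
  hence U: "?U \<in> sets borel" "open ?U" by simp_all
  have Ul: "?U \<inter> space lebesgue \<in> sets lebesgue" using U by simp
  have gL: "g \<in> L2 ?U" using g by (simp add: Hs_def)
  have "(\<lambda>x. indicat_real ?U x *\<^sub>R g x) \<in> borel_measurable lebesgue"
    using L2_measurable[OF gL] unfolding borel_measurable_restrict_space_iff[OF Ul] .
  \<comment> \<open>Exchanging the order of integration is done for Borel functions and
    \<open>lborel\<close>, so g is replaced by a Borel representative throughout and restored at the
    end.\<close>
  from ex_borel_complex[OF this] obtain g' where g'm: "g' \<in> borel_measurable lborel"
    and ae0: "AE x in lborel. indicat_real ?U x *\<^sub>R g x = g' x" by blast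
  have ae: "AE x in lborel. x \<in> ?U \<longrightarrow> g x = g' x" using ae0 by eventually_elim auto
  have g'b[measurable]: "g' \<in> borel_measurable borel" using g'm by simp
  have Ub[measurable]: "?U \<in> sets borel" by (rule U(1))
  \<comment> \<open>The Gagliardo exponent in two dimensions.\<close>
  define p where "p = 2 + 2 * s"
  define k where "k z = (cmod (g' (fst z) - g' (snd z)))\<^sup>2 / norm (fst z - snd z) powr p" for z :: "(real \<times> real) \<times> (real \<times> real)"
  have km: "(\<lambda>z. ennreal (k z) * indicator (?U \<times> ?U) z) \<in> borel_measurable lborel"
  proof -
    have "(\<lambda>z. ennreal (k z) * indicator (?U \<times> ?U) z) \<in> borel_measurable (borel \<Otimes>\<^sub>M borel)"
      unfolding k_def by measurable
    thus ?thesis by (simp add: borel_prod)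
  qed
  define E where "E = (\<integral>z. (case z of (x, y) \<Rightarrow> (cmod (g x - g y))\<^sup>2 / norm (x - y) powr (real DIM(real \<times> real) + 2 * s)) \<partial>lebesgue_on (?U \<times> ?U))"
  have E0: "E \<ge> 0" unfolding E_def by (intro integral_nonneg_AE AE_I2) (auto split: prod.splits)
  have Ek: "(\<integral>\<^sup>+x. \<integral>\<^sup>+y. ennreal (k (x, y)) * indicator (?U \<times> ?U) (x, y) \<partial>lborel \<partial>lborel) = ennreal E"
  proof -
    have "(\<integral>\<^sup>+x. \<integral>\<^sup>+y. ennreal (k (x, y)) * indicator (?U \<times> ?U) (x, y) \<partial>lborel \<partial>lborel)
        = (\<integral>\<^sup>+z. ennreal (k z) * indicator (?U \<times> ?U) z \<partial>lborel)"
      using lborel.nn_integral_fst[of "\<lambda>z. ennreal (k z) * indicator (?U \<times> ?U) z" lborel] km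
      unfolding lborel_prod by simp
    also have "\<dots> = (\<integral>\<^sup>+z. ennreal (case z of (x, y) \<Rightarrow> (cmod (g x - g y))\<^sup>2 / norm (x - y) powr (real DIM(real \<times> real) + 2 * s)) \<partial>lebesgue_on (?U \<times> ?U))"
    proof (rule nn_integral_lebesgue_on_lborel[OF _ km, symmetric])
      show "?U \<times> ?U \<in> sets borel" by (intro borel_open open_Times U(2))
      show "AE z in lborel. z \<in> ?U \<times> ?U \<longrightarrow> ennreal (case z of (x, y) \<Rightarrow> (cmod (g x - g y))\<^sup>2 / norm (x - y) powr (real DIM(real \<times> real) + 2 * s)) = ennreal (k z)"
        using AE_lborel_fst_snd(1)[OF ae] AE_lborel_fst_snd(2)[OF ae]
      proof eventually_elim
        case (elim z)
        thus ?case by (cases z) (auto simp: k_def p_def)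
      qed
    qed
    also have "\<dots> = ennreal E"
      unfolding E_def
      by (rule nn_integral_eq_integral) (use g in \<open>auto simp: Hs_def split: prod.splits\<close>)
    finally show ?thesis .
  qed
  have Ug: "(\<integral>\<^sup>+y. ennreal ((cmod (g' y))\<^sup>2) * indicator ?U y \<partial>lborel) = ennreal ((L2_norm ?U g)\<^sup>2)"
  proof -
    have "(\<integral>\<^sup>+y. ennreal ((cmod (g y))\<^sup>2) \<partial>lebesgue_on ?U) = (\<integral>\<^sup>+y. ennreal ((cmod (g' y))\<^sup>2) * indicator ?U y \<partial>lborel)"
      by (rule nn_integral_lebesgue_on_lborel[OF U(1)]) (measurable, use ae in eventually_elim, simp)
    thus ?thesis using nn_integral_L2[OF gL] by simp
  qed
  have main: "(\<integral>\<^sup>+x. ennreal ((cmod (g x))\<^sup>2) \<partial>lebesgue_on A)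
      \<le> ennreal ((2 * 2 powr p * E) * r powr (2 * s) + 2 * m / r\<^sup>2 * (L2_norm ?U g)\<^sup>2)"
    if A[measurable]: "A \<in> sets borel" and AU: "A \<subseteq> ?U" and r: "0 < r" "r \<le> Lx / 2" "r \<le> H" and m: "m \<ge> 0"
      and thin: "\<And>a. emeasure lborel (A \<inter> {x. \<bar>fst x - a\<bar> < r}) \<le> ennreal m" for A m r
  proof -
    \<comment> \<open>Points of the square around x have distance at most 2r from x, so 2 |g x - g
      y|^2 is at most c times the Gagliardo integrand. Division by the area r^2 leaves a multiple of
      r^(2s).\<close>
    define c where "c = 2 * (2 * r) powr p"
    have c: "c \<ge> 0" by (simp add: c_def)
    define Q where "Q x y = (indicator (near r ?U x) y :: ennreal)" for x y
    have Qm[measurable]: "(\<lambda>z. Q (fst z) (snd z)) \<in> borel_measurable (borel \<Otimes>\<^sub>M borel)"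
    proof -
      have eq: "{z. snd z \<in> near r ?U (fst z)} = (UNIV \<times> ?U) \<inter> {z. \<bar>fst (fst z) - fst (snd z)\<bar> < r} \<inter> {z. \<bar>snd (fst z) - snd (snd z)\<bar> < r}"
        by (auto simp: near_def)
      have "open {z. snd z \<in> near r ?U (fst z)}"
        unfolding eq by (intro open_Int open_Times open_UNIV U(2) open_Collect_less continuous_intros)
      hence "indicator {z. snd z \<in> near r ?U (fst z)} \<in> borel_measurable (borel \<Otimes>\<^sub>M borel)"
        unfolding borel_prod by (intro borel_measurable_indicator) simp
      moreover have "(\<lambda>z. Q (fst z) (snd z)) = indicator {z. snd z \<in> near r ?U (fst z)}"
        by (simp add: Q_def indicator_def fun_eq_iff)
      ultimately show ?thesis by (simp only:)
    qed
    have Q1[measurable]: "(\<lambda>y. Q x y) \<in> borel_measurable borel" for x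
      using measurable_compose[OF measurable_Pair1'[of x borel borel] Qm] by simp
    \<comment> \<open>The constant |g x|^2 is integrated over the square around x, whose area is at
      least r^2, after splitting it as 2 |g x - g y|^2 + 2 |g y|^2. The second part is kept together
      with the indicator of A, for the exchange of the order of integration.\<close>
    have pt: "ennreal (r\<^sup>2) * (ennreal ((cmod (g' x))\<^sup>2) * indicator A x) \<le>
        ennreal c * (\<integral>\<^sup>+y. ennreal (k (x, y)) * indicator (?U \<times> ?U) (x, y) \<partial>lborel)
        + 2 * (\<integral>\<^sup>+y. indicator A x * Q x y * ennreal ((cmod (g' y))\<^sup>2) \<partial>lborel)" for x
    proof (cases "x \<in> A")
      case True
      hence x: "x \<in> ?U" using AU by auto
      have kx: "(\<lambda>y. ennreal (k (x, y)) * indicator (?U \<times> ?U) (x, y)) \<in> borel_measurable lborel"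
      proof -
        have "(\<lambda>z. ennreal (k z) * indicator (?U \<times> ?U) z) \<in> borel_measurable (lborel \<Otimes>\<^sub>M lborel)"
          using km by (simp only: lborel_prod)
        from measurable_compose[OF measurable_Pair1'[of x lborel lborel] this] show ?thesis by simp
      qed
      have "ennreal (r\<^sup>2) * ennreal ((cmod (g' x))\<^sup>2) \<le> emeasure lborel (near r ?U x) * ennreal ((cmod (g' x))\<^sup>2)"
        by (rule mult_right_mono[OF near_measure[OF x r]]) simp
      also have "\<dots> = (\<integral>\<^sup>+y. ennreal ((cmod (g' x))\<^sup>2) * Q x y \<partial>lborel)"
      proof -
        have "near r ?U x = {y. Q x y = 1}" by (auto simp: Q_def indicator_def)
        hence "near r ?U x \<in> sets borel" by simp
        thus ?thesis unfolding Q_def by (subst nn_integral_cmult_indicator) (simp_all add: mult.commute)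
      qed
      also have "\<dots> \<le> (\<integral>\<^sup>+y. ennreal c * (ennreal (k (x, y)) * indicator (?U \<times> ?U) (x, y))
          + 2 * (indicator A x * Q x y * ennreal ((cmod (g' y))\<^sup>2)) \<partial>lborel)"
      proof (rule nn_integral_mono)
        fix y
        show "ennreal ((cmod (g' x))\<^sup>2) * Q x y \<le> ennreal c * (ennreal (k (x, y)) * indicator (?U \<times> ?U) (x, y))
          + 2 * (indicator A x * Q x y * ennreal ((cmod (g' y))\<^sup>2))"
        proof (cases "y \<in> near r ?U x")
          case y: True
          have n2: "norm (x - y) \<le> 2 * r"
          proof -
            have "norm (x - y) \<le> \<bar>fst (x - y)\<bar> + \<bar>snd (x - y)\<bar>"
              using norm_Pair_le[of "fst (x - y)" "snd (x - y)"] by (simp only: prod.collapse real_norm_def)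
            thus ?thesis using y by (simp add: near_def)
          qed
          have d: "2 * (cmod (g' x - g' y))\<^sup>2 \<le> c * k (x, y)"
          proof (cases "x = y")
            case False
            hence n0: "norm (x - y) powr p > 0" by simp
            have "norm (x - y) powr p \<le> (2 * r) powr p" by (rule powr_mono2) (use s n2 in \<open>auto simp: p_def\<close>)
            hence "2 * (cmod (g' x - g' y))\<^sup>2 * (norm (x - y) powr p) \<le> 2 * (cmod (g' x - g' y))\<^sup>2 * (2 * r) powr p"
              by (intro mult_left_mono) auto
            thus ?thesis using n0 by (simp add: c_def k_def field_simps)
          qed (simp add: k_def)
          have "(cmod (g' x))\<^sup>2 \<le> 2 * (cmod (g' x - g' y))\<^sup>2 + 2 * (cmod (g' y))\<^sup>2"
            using norm_add_sq_le[of "g' x - g' y" "g' y"] by simp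
          also have "\<dots> \<le> c * k (x, y) + 2 * (cmod (g' y))\<^sup>2" using d by simp
          finally have "ennreal ((cmod (g' x))\<^sup>2) \<le> ennreal (c * k (x, y) + 2 * (cmod (g' y))\<^sup>2)" by (rule ennreal_leI)
          also have "\<dots> = ennreal c * ennreal (k (x, y)) + 2 * ennreal ((cmod (g' y))\<^sup>2)"
          proof -
            have "0 \<le> k (x, y)" by (simp add: k_def)
            thus ?thesis using c by (simp add: ennreal_plus ennreal_mult)
          qed
          finally show ?thesis using y x True by (simp add: Q_def near_def)
        qed (simp add: Q_def)
      qed
      also have "\<dots> = ennreal c * (\<integral>\<^sup>+y. ennreal (k (x, y)) * indicator (?U \<times> ?U) (x, y) \<partial>lborel)
        + 2 * (\<integral>\<^sup>+y. indicator A x * Q x y * ennreal ((cmod (g' y))\<^sup>2) \<partial>lborel)"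
        using kx by (subst nn_integral_add) (auto simp: nn_integral_cmult)
      finally show ?thesis using True by simp
    qed simp
    have kxm: "(\<lambda>x. \<integral>\<^sup>+y. ennreal (k (x, y)) * indicator (?U \<times> ?U) (x, y) \<partial>lborel) \<in> borel_measurable borel"
    proof -
      have "(\<lambda>z. ennreal (k z) * indicator (?U \<times> ?U) z) \<in> borel_measurable (lborel \<Otimes>\<^sub>M lborel)"
        using km by (simp only: lborel_prod)
      from lborel.borel_measurable_nn_integral_fst[OF this] show ?thesis by simp
    qed
    have Im: "(\<lambda>z. indicator A (fst z) * Q (fst z) (snd z) * ennreal ((cmod (g' (snd z)))\<^sup>2)) \<in> borel_measurable (lborel \<Otimes>\<^sub>M lborel)"
    proof -
      have "(\<lambda>z. indicator A (fst z) * Q (fst z) (snd z) * ennreal ((cmod (g' (snd z)))\<^sup>2)) \<in> borel_measurable (borel \<Otimes>\<^sub>M borel)"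
        by measurable
      thus ?thesis by (simp cong: measurable_cong_sets)
    qed
    have Ixm: "(\<lambda>x. \<integral>\<^sup>+y. indicator A x * Q x y * ennreal ((cmod (g' y))\<^sup>2) \<partial>lborel) \<in> borel_measurable borel"
      using lborel.borel_measurable_nn_integral_fst[OF Im] by simp
    have Imeas: "(\<lambda>(x, y). indicator A x * Q x y * ennreal ((cmod (g' y))\<^sup>2)) \<in> borel_measurable (lborel \<Otimes>\<^sub>M lborel)"
      using Im by (simp add: case_prod_unfold)
    have "(\<integral>\<^sup>+x. \<integral>\<^sup>+y. indicator A x * Q x y * ennreal ((cmod (g' y))\<^sup>2) \<partial>lborel \<partial>lborel)
        = (\<integral>\<^sup>+y. \<integral>\<^sup>+x. indicator A x * Q x y * ennreal ((cmod (g' y))\<^sup>2) \<partial>lborel \<partial>lborel)"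
      using lborel_pair.Fubini'[OF Imeas] by simp
    \<comment> \<open>For fixed y the admissible x lie in A and in the vertical band of half-width r
      around y, a set of measure at most m by the thinness assumption.\<close>
    also have "\<dots> \<le> (\<integral>\<^sup>+y. ennreal m * (ennreal ((cmod (g' y))\<^sup>2) * indicator ?U y) \<partial>lborel)"
    proof (rule nn_integral_mono)
      fix y
      have "(\<integral>\<^sup>+x. indicator A x * Q x y * ennreal ((cmod (g' y))\<^sup>2) \<partial>lborel)
          \<le> (\<integral>\<^sup>+x. (ennreal ((cmod (g' y))\<^sup>2) * indicator ?U y) * indicator (A \<inter> {x. \<bar>fst x - fst y\<bar> < r}) x \<partial>lborel)"
        by (rule nn_integral_mono) (auto simp: Q_def near_def indicator_def)
      also have "\<dots> = (ennreal ((cmod (g' y))\<^sup>2) * indicator ?U y) * emeasure lborel (A \<inter> {x. \<bar>fst x - fst y\<bar> < r})"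
      proof (rule nn_integral_cmult_indicator)
        have "open {x :: real \<times> real. \<bar>fst x - fst y\<bar> < r}" by (intro open_Collect_less continuous_intros)
        thus "A \<inter> {x. \<bar>fst x - fst y\<bar> < r} \<in> sets lborel" using A by simp
      qed
      also have "\<dots> \<le> (ennreal ((cmod (g' y))\<^sup>2) * indicator ?U y) * ennreal m"
        by (rule mult_left_mono[OF thin]) simp
      finally show "(\<integral>\<^sup>+x. indicator A x * Q x y * ennreal ((cmod (g' y))\<^sup>2) \<partial>lborel) \<le> ennreal m * (ennreal ((cmod (g' y))\<^sup>2) * indicator ?U y)"
        by (simp add: mult.commute)
    qed
    also have "\<dots> = ennreal m * ennreal ((L2_norm ?U g)\<^sup>2)"
      by (subst nn_integral_cmult) (simp_all add: Ug)
    finally have second: "(\<integral>\<^sup>+x. \<integral>\<^sup>+y. indicator A x * Q x y * ennreal ((cmod (g' y))\<^sup>2) \<partial>lborel \<partial>lborel) \<le> ennreal m * ennreal ((L2_norm ?U g)\<^sup>2)" .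
    have "ennreal (r\<^sup>2) * (\<integral>\<^sup>+x. ennreal ((cmod (g' x))\<^sup>2) * indicator A x \<partial>lborel)
        = (\<integral>\<^sup>+x. ennreal (r\<^sup>2) * (ennreal ((cmod (g' x))\<^sup>2) * indicator A x) \<partial>lborel)"
      by (rule nn_integral_cmult[symmetric]) measurable
    also have "\<dots> \<le> (\<integral>\<^sup>+x. ennreal c * (\<integral>\<^sup>+y. ennreal (k (x, y)) * indicator (?U \<times> ?U) (x, y) \<partial>lborel)
        + 2 * (\<integral>\<^sup>+y. indicator A x * Q x y * ennreal ((cmod (g' y))\<^sup>2) \<partial>lborel) \<partial>lborel)"
      by (rule nn_integral_mono) (rule pt)
    also have "\<dots> = ennreal c * ennreal E + 2 * (\<integral>\<^sup>+x. \<integral>\<^sup>+y. indicator A x * Q x y * ennreal ((cmod (g' y))\<^sup>2) \<partial>lborel \<partial>lborel)"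
      using kxm Ixm by (subst nn_integral_add) (auto simp: nn_integral_cmult Ek)
    also have "\<dots> \<le> ennreal c * ennreal E + 2 * (ennreal m * ennreal ((L2_norm ?U g)\<^sup>2))"
      by (intro add_mono mult_left_mono second) auto
    also have "\<dots> = ennreal (c * E + 2 * (m * (L2_norm ?U g)\<^sup>2))"
      using c E0 m by (simp add: ennreal_plus ennreal_mult)
    finally have fin: "ennreal (r\<^sup>2) * (\<integral>\<^sup>+x. ennreal ((cmod (g' x))\<^sup>2) * indicator A x \<partial>lborel) \<le> ennreal (c * E + 2 * (m * (L2_norm ?U g)\<^sup>2))" .
    have r2: "r\<^sup>2 > 0" using r by simp
    have "(\<integral>\<^sup>+x. ennreal ((cmod (g' x))\<^sup>2) * indicator A x \<partial>lborel)
        = ennreal (1 / r\<^sup>2) * (ennreal (r\<^sup>2) * (\<integral>\<^sup>+x. ennreal ((cmod (g' x))\<^sup>2) * indicator A x \<partial>lborel))"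
    proof -
      have "ennreal (1 / r\<^sup>2) * ennreal (r\<^sup>2) = 1" using r2 by (simp flip: ennreal_mult)
      thus ?thesis by (simp flip: mult.assoc)
    qed
    also have "\<dots> \<le> ennreal (1 / r\<^sup>2) * ennreal (c * E + 2 * (m * (L2_norm ?U g)\<^sup>2))"
      by (rule mult_left_mono[OF fin]) simp
    also have "\<dots> = ennreal (1 / r\<^sup>2 * (c * E + 2 * (m * (L2_norm ?U g)\<^sup>2)))"
      using c E0 m by (subst ennreal_mult) auto
    also have "1 / r\<^sup>2 * (c * E + 2 * (m * (L2_norm ?U g)\<^sup>2)) = (2 * 2 powr p * E) * r powr (2 * s) + 2 * m / r\<^sup>2 * (L2_norm ?U g)\<^sup>2"
    proof -
      have "(2 * r) powr p = 2 powr p * (r\<^sup>2 * r powr (2 * s))"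
        using r by (simp add: powr_mult p_def powr_add)
      thus ?thesis using r by (simp add: c_def field_simps)
    qed
    finally have "(\<integral>\<^sup>+x. ennreal ((cmod (g' x))\<^sup>2) * indicator A x \<partial>lborel)
      \<le> ennreal ((2 * 2 powr p * E) * r powr (2 * s) + 2 * m / r\<^sup>2 * (L2_norm ?U g)\<^sup>2)" .
    moreover have "(\<integral>\<^sup>+x. ennreal ((cmod (g x))\<^sup>2) \<partial>lebesgue_on A) = (\<integral>\<^sup>+x. ennreal ((cmod (g' x))\<^sup>2) * indicator A x \<partial>lborel)"
    proof (rule nn_integral_lebesgue_on_lborel[OF A])
      show "AE x in lborel. x \<in> A \<longrightarrow> ennreal ((cmod (g x))\<^sup>2) = ennreal ((cmod (g' x))\<^sup>2)"
        using ae by eventually_elim (use AU in auto)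
    qed measurable
    ultimately show ?thesis by simp
  qed
  show ?thesis
    by (rule exI[of _ "2 * 2 powr p * E"]) (use main E0 in auto)
qed

section \<open>The slicing error\<close>

text \<open>On the bounded range h <= T every higher power of h is absorbed into h^s at the price of
  a constant.\<close>

lemma powr_le_powr_smaller:
  fixes h T p s :: real
  assumes "0 < h" "h \<le> T" "s \<le> p"
  shows "h powr p \<le> T powr (p - s) * h powr s"
proof -
  have "h powr p = h powr (p - s) * h powr s" by (simp flip: powr_add)
  also have "\<dots> \<le> T powr (p - s) * h powr s"
    using assms by (intro mult_right_mono powr_mono2) auto
  finally show ?thesis .
qed

context grating
begin

text \<open>The Gagliardo integral is used at the scale \<open>r\<close> proportional to \<open>sqrt h\<close>, which balances the
  two contributions \<open>r^(2s)\<close> and \<open>h / r\<close> of the strip estimate.\<close>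

lemma perturbation_L2_bound:
  assumes s: "0 < s" "s < 1 / 2" and g: "g \<in> Hs s \<Omega>" and b: "b \<in> Basis" and PQ: "P \<ge> 0" "Q \<ge> 0"
  shows "\<exists>K\<ge>0. \<forall>h A \<delta>. 0 < h \<and> h \<le> 2 * H \<and> A \<in> sets borel \<and> A \<subseteq> \<Omega> \<and>
      (\<forall>a r. r > 0 \<longrightarrow> emeasure lborel (A \<inter> {x. \<bar>fst x - a\<bar> < r}) \<le> ennreal (P * h * r)) \<and>
      \<delta> \<in> borel_measurable (lebesgue_on \<Omega>) \<and> (\<forall>x\<in>\<Omega>. cmod (\<delta> x) \<le> 2 / c2) \<and> (\<forall>x\<in>\<Omega> - A. cmod (\<delta> x) \<le> Q * h) \<longrightarrow>
      L2_norm \<Omega> (\<lambda>x. \<delta> x * (g x + dui b x)) \<le> K * h powr (s / 2)"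
proof -
  let ?G = "\<lambda>x. g x + dui b x"
  have gL: "g \<in> L2 \<Omega>" using g by (simp add: Hs_def)
  have GL: "?G \<in> L2 \<Omega>" by (rule L2ip.add_mem[OF gL dui_L2])
  from strip_estimate[OF less_imp_le[OF s(1)] g]
  obtain C where C: "C \<ge> 0" and strip0: "\<forall>A m r. A \<in> sets borel \<and> A \<subseteq> \<Omega> \<and> 0 < r \<and> r \<le> Lx / 2 \<and> r \<le> H \<and> m \<ge> 0 \<and>
      (\<forall>a. emeasure lborel (A \<inter> {x. \<bar>fst x - a\<bar> < r}) \<le> ennreal m) \<longrightarrow>
      (\<integral>\<^sup>+x. ennreal ((cmod (g x))\<^sup>2) \<partial>lebesgue_on A) \<le> ennreal (C * r powr (2 * s) + 2 * m / r\<^sup>2 * (L2_norm \<Omega> g)\<^sup>2)"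
    by (elim exE conjE)
  have strip: "(\<integral>\<^sup>+x. ennreal ((cmod (g x))\<^sup>2) \<partial>lebesgue_on A) \<le> ennreal (C * r powr (2 * s) + 2 * m / r\<^sup>2 * (L2_norm \<Omega> g)\<^sup>2)"
    if "A \<in> sets borel" "A \<subseteq> \<Omega>" "0 < r" "r \<le> Lx / 2" "r \<le> H" "m \<ge> 0"
      "\<And>a. emeasure lborel (A \<inter> {x. \<bar>fst x - a\<bar> < r}) \<le> ennreal m" for A m r
    by (rule strip0[rule_format]) (intro conjI allI that)
  \<comment> \<open>Chosen so that r = \<rho> sqrt h stays below Lx/2 and H for every h up to 2H, as
    the strip estimate demands.\<close>
  define \<rho> where "\<rho> = min (Lx / 2) H / sqrt (2 * H)"
  have \<rho>: "\<rho> > 0" using Lx0 H0 by (simp add: \<rho>_def)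
  define V where "V = \<kappa> * sqrt \<epsilon>p"
  define T where "T = 2 * H"
  have T: "T > 0" using H0 by (simp add: T_def)
  \<comment> \<open>The four contributions to the squared norm: \<open>K1\<close> from outside A,
    where the coefficient error is O(h); \<open>K2\<close> and \<open>K3\<close> from g on A, namely
    the terms r^(2s) and h/r of the strip estimate, the latter of order h^(1/2) with s < 1/2;
    \<open>K4\<close> from the bounded incident gradient on A, whose area is O(h).\<close>
  define K1 where "K1 = (Q\<^sup>2 * (L2_norm \<Omega> ?G)\<^sup>2) * T powr (2 - s)"
  define K2 where "K2 = C * \<rho> powr (2 * s)"
  define K3 where "K3 = (2 * P / \<rho> * (L2_norm \<Omega> g)\<^sup>2) * T powr (1 / 2 - s)"
  define K4 where "K4 = (V\<^sup>2 * P * Lx) * T powr (1 - s)"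
  define K where "K = K1 + (2 / c2)\<^sup>2 * (2 * (K2 + K3) + 2 * K4)"
  have Kn: "K1 \<ge> 0" "K2 \<ge> 0" "K3 \<ge> 0" "K4 \<ge> 0" using C \<rho> PQ Lx0 by (simp_all add: K1_def K2_def K3_def K4_def)
  hence K0: "K \<ge> 0" by (simp add: K_def)
  have main: "L2_norm \<Omega> (\<lambda>x. \<delta> x * ?G x) \<le> sqrt K * h powr (s / 2)"
    if h: "0 < h" "h \<le> 2 * H" and A: "A \<in> sets borel" "A \<subseteq> \<Omega>"
      and thin: "\<And>a r. r > 0 \<Longrightarrow> emeasure lborel (A \<inter> {x. \<bar>fst x - a\<bar> < r}) \<le> ennreal (P * h * r)"
      and dm: "\<delta> \<in> borel_measurable (lebesgue_on \<Omega>)" and d1: "\<And>x. x \<in> \<Omega> \<Longrightarrow> cmod (\<delta> x) \<le> 2 / c2"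
      and d2: "\<And>x. x \<in> \<Omega> - A \<Longrightarrow> cmod (\<delta> x) \<le> Q * h" for h A \<delta>
  proof -
    define r where "r = \<rho> * sqrt h"
    have r0: "r > 0" using \<rho> h by (simp add: r_def)
    have "r \<le> \<rho> * sqrt (2 * H)" unfolding r_def using \<rho> h by (intro mult_left_mono) auto
    also have "\<dots> = min (Lx / 2) H" using H0 by (simp add: \<rho>_def)
    finally have r1: "r \<le> Lx / 2" "r \<le> H" by auto
    define m where "m = P * h * r"
    have m0: "m \<ge> 0" using PQ h r0 by (simp add: m_def)
    have rp: "r powr (2 * s) = \<rho> powr (2 * s) * h powr s"
      unfolding r_def using \<rho> h by (simp add: powr_mult powr_powr flip: powr_half_sqrt)
    have mr: "2 * m / r\<^sup>2 = 2 * P / \<rho> * h powr (1 / 2)"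
    proof -
      have "h = sqrt h * sqrt h" using h by simp
      hence "2 * m / r\<^sup>2 = 2 * P / \<rho> * sqrt h"
        unfolding m_def using \<rho> h r0 by (simp add: r_def power2_eq_square field_simps)
      thus ?thesis using h by (simp add: powr_half_sqrt)
    qed
    have hT: "h \<le> T" using h by (simp add: T_def)
    have "C * r powr (2 * s) + 2 * m / r\<^sup>2 * (L2_norm \<Omega> g)\<^sup>2 = K2 * h powr s + 2 * P / \<rho> * (L2_norm \<Omega> g)\<^sup>2 * h powr (1 / 2)"
      by (simp add: rp mr K2_def)
    also have "2 * P / \<rho> * (L2_norm \<Omega> g)\<^sup>2 * h powr (1 / 2) \<le> 2 * P / \<rho> * (L2_norm \<Omega> g)\<^sup>2 * (T powr (1 / 2 - s) * h powr s)"
      using PQ \<rho> s by (intro mult_left_mono powr_le_powr_smaller h(1) hT) auto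
    finally have gb: "C * r powr (2 * s) + 2 * m / r\<^sup>2 * (L2_norm \<Omega> g)\<^sup>2 \<le> (K2 + K3) * h powr s"
      by (simp add: K3_def distrib_right mult.assoc)
    have g_A: "(\<integral>\<^sup>+x. ennreal ((cmod (g x))\<^sup>2) \<partial>lebesgue_on A) \<le> ennreal ((K2 + K3) * h powr s)"
      by (rule order_trans[OF strip[OF A r0 r1 m0] ennreal_leI[OF gb]]) (simp only: m_def thin[OF r0])
    \<comment> \<open>All of A lies in one band of half-width \<open>Lx\<close> around the centre
      line, so the thinness assumption also bounds its total area.\<close>
    have AU: "A = A \<inter> {x. \<bar>fst x - Lx / 2\<bar> < Lx}"
      using A(2) by (auto simp: Omega_def abs_less_iff field_simps)
    have eA: "emeasure lborel A \<le> ennreal (P * h * Lx)"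
      using thin[OF Lx0, of "Lx / 2"] AU by simp
    have Ab: "A \<inter> space lebesgue \<in> sets lebesgue" and Ob: "\<Omega> \<inter> space lebesgue \<in> sets lebesgue"
      using A open_dom by simp_all
    have dui_A: "(\<integral>\<^sup>+x. ennreal ((cmod (dui b x))\<^sup>2) \<partial>lebesgue_on A) \<le> ennreal (K4 * h powr s)"
    proof -
      have "(\<integral>\<^sup>+x. ennreal ((cmod (dui b x))\<^sup>2) \<partial>lebesgue_on A) \<le> (\<integral>\<^sup>+x. ennreal (V\<^sup>2) \<partial>lebesgue_on A)"
        unfolding V_def by (intro nn_integral_mono ennreal_leI power_mono norm_dpart_u_inc \<kappa> \<epsilon>p b) simp
      also have "\<dots> = ennreal (V\<^sup>2) * emeasure lborel A"
        using A by (simp add: emeasure_restrict_space)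
      also have "\<dots> \<le> ennreal (V\<^sup>2) * ennreal (P * h * Lx)" by (rule mult_left_mono[OF eA]) simp
      also have "\<dots> = ennreal ((V\<^sup>2 * P * Lx) * h powr 1)"
        using h PQ Lx0 by (simp add: mult_ac flip: ennreal_mult)
      also have "\<dots> \<le> ennreal ((V\<^sup>2 * P * Lx) * (T powr (1 - s) * h powr s))"
        using s PQ Lx0 by (intro ennreal_leI mult_left_mono powr_le_powr_smaller h(1) hT) auto
      finally show ?thesis by (simp add: K4_def mult.assoc)
    qed
    have to_A: "(\<integral>\<^sup>+x. f x * indicator A x \<partial>lebesgue_on \<Omega>) = (\<integral>\<^sup>+x. f x \<partial>lebesgue_on A)" for f :: "real \<times> real \<Rightarrow> ennreal"
      unfolding nn_integral_restrict_space[OF Ab] nn_integral_restrict_space[OF Ob]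
      by (rule nn_integral_cong) (use A(2) in \<open>auto simp: indicator_def\<close>)
    let ?c = "(2 / c2)\<^sup>2"
    have gm: "(\<lambda>x. ennreal ((cmod (f x))\<^sup>2)) \<in> borel_measurable (lebesgue_on \<Omega>)" if "f \<in> L2 \<Omega>" for f
      using L2_measurable[OF that] by measurable
    have Am: "(indicator A :: real \<times> real \<Rightarrow> ennreal) \<in> borel_measurable (lebesgue_on \<Omega>)"
      using A by (intro measurable_restrict_space1 borel_measurable_indicator) simp
    have pt: "ennreal ((cmod (\<delta> x * ?G x))\<^sup>2) \<le> ennreal (Q\<^sup>2 * h\<^sup>2) * ennreal ((cmod (?G x))\<^sup>2)
        + ennreal ?c * (2 * (ennreal ((cmod (g x))\<^sup>2) * indicator A x) + 2 * (ennreal ((cmod (dui b x))\<^sup>2) * indicator A x))"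
      if x: "x \<in> \<Omega>" for x
    proof (cases "x \<in> A")
      case True
      have "(cmod (\<delta> x * ?G x))\<^sup>2 \<le> ?c * (cmod (?G x))\<^sup>2"
        unfolding norm_mult power_mult_distrib using d1[OF x] by (intro mult_right_mono power_mono) auto
      also have "\<dots> \<le> ?c * (2 * (cmod (g x))\<^sup>2 + 2 * (cmod (dui b x))\<^sup>2)"
        by (intro mult_left_mono norm_add_sq_le) simp
      finally have "ennreal ((cmod (\<delta> x * ?G x))\<^sup>2) \<le> ennreal (?c * (2 * (cmod (g x))\<^sup>2 + 2 * (cmod (dui b x))\<^sup>2))"
        by (rule ennreal_leI)
      also have "\<dots> = ennreal ?c * (2 * ennreal ((cmod (g x))\<^sup>2) + 2 * ennreal ((cmod (dui b x))\<^sup>2))"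
        by (simp add: ennreal_mult ennreal_plus del: power_divide)
      finally show ?thesis using True by (simp add: add_increasing del: power_divide)
    next
      case False
      have "(cmod (\<delta> x * ?G x))\<^sup>2 \<le> (Q * h)\<^sup>2 * (cmod (?G x))\<^sup>2"
        unfolding norm_mult power_mult_distrib[of "cmod (\<delta> x)"] using d2[of x] x False by (intro mult_right_mono power_mono) auto
      hence "ennreal ((cmod (\<delta> x * ?G x))\<^sup>2) \<le> ennreal (Q\<^sup>2 * h\<^sup>2 * (cmod (?G x))\<^sup>2)"
        by (intro ennreal_leI) (simp add: power_mult_distrib)
      thus ?thesis using False by (simp add: ennreal_mult)
    qed
    have "(\<integral>\<^sup>+x. ennreal ((cmod (\<delta> x * ?G x))\<^sup>2) \<partial>lebesgue_on \<Omega>) \<le>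
        (\<integral>\<^sup>+x. ennreal (Q\<^sup>2 * h\<^sup>2) * ennreal ((cmod (?G x))\<^sup>2)
        + ennreal ?c * (2 * (ennreal ((cmod (g x))\<^sup>2) * indicator A x) + 2 * (ennreal ((cmod (dui b x))\<^sup>2) * indicator A x)) \<partial>lebesgue_on \<Omega>)"
      by (rule nn_integral_mono) (rule pt, simp)
    also have "\<dots> = ennreal (Q\<^sup>2 * h\<^sup>2) * (\<integral>\<^sup>+x. ennreal ((cmod (?G x))\<^sup>2) \<partial>lebesgue_on \<Omega>)
        + ennreal ?c * (2 * (\<integral>\<^sup>+x. ennreal ((cmod (g x))\<^sup>2) \<partial>lebesgue_on A) + 2 * (\<integral>\<^sup>+x. ennreal ((cmod (dui b x))\<^sup>2) \<partial>lebesgue_on A))"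
    proof -
      note mm = gm[OF GL] borel_measurable_times_ennreal[OF gm[OF gL] Am] borel_measurable_times_ennreal[OF gm[OF dui_L2[of b]] Am]
      have i2: "(\<integral>\<^sup>+x. 2 * (ennreal ((cmod (f x))\<^sup>2) * indicator A x) \<partial>lebesgue_on \<Omega>) = 2 * (\<integral>\<^sup>+x. ennreal ((cmod (f x))\<^sup>2) \<partial>lebesgue_on A)"
        if "f \<in> L2 \<Omega>" for f
        unfolding to_A[symmetric] by (rule nn_integral_cmult[OF borel_measurable_times_ennreal[OF gm[OF that] Am]])
      note m2 = borel_measurable_times_ennreal[OF borel_measurable_const mm(2)] borel_measurable_times_ennreal[OF borel_measurable_const mm(3)]
      show ?thesis
        by (subst nn_integral_add[OF borel_measurable_times_ennreal[OF borel_measurable_const mm(1)]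
              borel_measurable_times_ennreal[OF borel_measurable_const borel_measurable_add[OF m2]]],
            subst nn_integral_cmult[OF mm(1)], subst nn_integral_cmult[OF borel_measurable_add[OF m2]],
            subst nn_integral_add[OF m2], simp only: i2[OF gL] i2[OF dui_L2])
    qed
    also have "\<dots> \<le> ennreal (Q\<^sup>2 * h\<^sup>2) * ennreal ((L2_norm \<Omega> ?G)\<^sup>2)
        + ennreal ?c * (2 * ennreal ((K2 + K3) * h powr s) + 2 * ennreal (K4 * h powr s))"
      unfolding nn_integral_L2[OF GL] by (intro add_mono mult_left_mono g_A dui_A order_refl) simp_all
    also have "\<dots> = ennreal (Q\<^sup>2 * (L2_norm \<Omega> ?G)\<^sup>2 * h powr 2 + ?c * (2 * ((K2 + K3) * h powr s) + 2 * (K4 * h powr s)))"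
      using Kn h by (simp add: ennreal_mult ennreal_plus powr_numeral mult_ac del: power_divide)
    also have "\<dots> \<le> ennreal (K * h powr s)"
    proof (rule ennreal_leI)
      have "Q\<^sup>2 * (L2_norm \<Omega> ?G)\<^sup>2 * h powr 2 \<le> Q\<^sup>2 * (L2_norm \<Omega> ?G)\<^sup>2 * (T powr (2 - s) * h powr s)"
        using s by (intro mult_left_mono powr_le_powr_smaller h(1) hT) auto
      hence "Q\<^sup>2 * (L2_norm \<Omega> ?G)\<^sup>2 * h powr 2 \<le> K1 * h powr s" by (simp add: K1_def mult.assoc)
      moreover have "K * h powr s = K1 * h powr s + ?c * (2 * ((K2 + K3) * h powr s) + 2 * (K4 * h powr s))"
        unfolding K_def by (simp only: distrib_right distrib_left mult_ac)
      ultimately show "Q\<^sup>2 * (L2_norm \<Omega> ?G)\<^sup>2 * h powr 2 + ?c * (2 * ((K2 + K3) * h powr s) + 2 * (K4 * h powr s)) \<le> K * h powr s"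
        by simp
    qed
    also have "K * h powr s = (sqrt K * h powr (s / 2))\<^sup>2"
    proof -
      have "(h powr (s / 2))\<^sup>2 = h powr s" by (simp add: power2_eq_square flip: powr_add)
      thus ?thesis using K0 by (simp add: power_mult_distrib)
    qed
    finally have fin: "(\<integral>\<^sup>+x. ennreal ((cmod (\<delta> x * ?G x))\<^sup>2) \<partial>lebesgue_on \<Omega>) \<le> ennreal ((sqrt K * h powr (s / 2))\<^sup>2)" .
    show ?thesis
      by (rule L2_norm_le_of_nn_integral(2)[OF borel_measurable_times[OF dm L2_measurable[OF GL]] fin]) (use K0 in simp)
  qed
  show ?thesis
    by (rule exI[of _ "sqrt K"]) (use main K0 in auto)
qed

end

section \<open>Slices and the sliced coefficient\<close>

lemma nodes_mono:
  assumes "nodes a b N q" "i \<le> j" "j \<le> N"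
  shows "q i \<le> q j"
  using assms(2,3)
proof (induction j)
  case (Suc j)
  show ?case
  proof (cases "i = Suc j")
    case False
    hence "q i \<le> q j" using Suc by simp
    also have "q j < q (Suc j)" using assms(1) Suc.prems by (simp add: nodes_def)
    finally show ?thesis by simp
  qed simp
qed simp

lemma slice_unique:
  assumes n: "nodes a b N q" and i: "i < N" "q i < t" "t < q (Suc i)" and j: "j < N" "q j < t" "t < q (Suc j)"
  shows "i = j"
proof (rule ccontr)
  assume "i \<noteq> j"
  hence "Suc i \<le> j \<or> Suc j \<le> i" by arith
  thus False using nodes_mono[OF n, of "Suc i" j] nodes_mono[OF n, of "Suc j" i] i j by auto
qed

lemma sliced_in_slice:
  assumes n: "nodes a b N q" and j: "j < N" "q j < x2" "x2 < q (Suc j)"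
  shows "sliced N q \<epsilon> (x1, x2) = \<epsilon> (x1, (q j + q (Suc j)) / 2)"
proof -
  have "(THE j. j < N \<and> q j < x2 \<and> x2 < q (Suc j)) = j"
    using j slice_unique[OF n] by (intro the_equality) auto
  thus ?thesis using j by (auto simp: sliced_def Let_def)
qed

lemma sliced_outside:
  "\<not> (\<exists>j<N. q j < x2 \<and> x2 < q (Suc j)) \<Longrightarrow> sliced N q \<epsilon> (x1, x2) = \<epsilon> (x1, x2)"
  unfolding sliced_def prod.case by (rule if_not_P)

text \<open>The definition by a unique index is rewritten as a finite sum over the disjoint open
  slices plus the rest, where \<epsilon> is kept. On each slice the function depends on x1 through
  \<epsilon> at a fixed height.\<close>

lemma sliced_measurable:
  fixes \<epsilon> :: "real \<times> real \<Rightarrow> complex"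
  assumes n: "nodes a b N q" and m: "\<epsilon> \<in> borel_measurable borel"
  shows "sliced N q \<epsilon> \<in> borel_measurable borel"
proof -
  let ?I = "\<lambda>j. {q j<..<q (Suc j)}"
  have eq: "sliced N q \<epsilon> = (\<lambda>x. (\<Sum>j<N. indicat_real (?I j) (snd x) *\<^sub>R \<epsilon> (fst x, (q j + q (Suc j)) / 2))
      + indicat_real (- (\<Union>j<N. ?I j)) (snd x) *\<^sub>R \<epsilon> x)"
  proof (rule ext, goal_cases)
    case (1 x)
    obtain x1 x2 where x: "x = (x1, x2)" by (cases x)
    show ?case
    proof (cases "\<exists>j<N. q j < x2 \<and> x2 < q (Suc j)")
      case True
      then obtain j where j: "j < N" "q j < x2" "x2 < q (Suc j)" by blast
      have "(\<Sum>i<N. indicat_real (?I i) x2 *\<^sub>R \<epsilon> (x1, (q i + q (Suc i)) / 2))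
          = (\<Sum>i<N. if i = j then \<epsilon> (x1, (q j + q (Suc j)) / 2) else 0)"
      proof (rule sum.cong[OF refl])
        fix i assume "i \<in> {..<N}"
        hence iN: "i < N" by simp
        show "indicat_real (?I i) x2 *\<^sub>R \<epsilon> (x1, (q i + q (Suc i)) / 2) = (if i = j then \<epsilon> (x1, (q j + q (Suc j)) / 2) else 0)"
        proof (cases "i = j")
          case True
          thus ?thesis using j by simp
        next
          case False
          hence "x2 \<notin> ?I i" using slice_unique[OF n iN _ _ j] by auto
          thus ?thesis using False by simp
        qed
      qed
      also have "\<dots> = \<epsilon> (x1, (q j + q (Suc j)) / 2)" using j by simp
      finally have 1: "(\<Sum>i<N. indicat_real (?I i) x2 *\<^sub>R \<epsilon> (x1, (q i + q (Suc i)) / 2)) = \<epsilon> (x1, (q j + q (Suc j)) / 2)" .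
      have "x2 \<notin> - (\<Union>j<N. ?I j)" using j by auto
      hence 2: "indicat_real (- (\<Union>j<N. ?I j)) x2 = 0" by (rule indicator_simps(2))
      show ?thesis unfolding x fst_conv snd_conv sliced_in_slice[OF n j] 1 2 by simp
    next
      case False
      have 1: "(\<Sum>i<N. indicat_real (?I i) x2 *\<^sub>R \<epsilon> (x1, (q i + q (Suc i)) / 2)) = 0"
      proof (rule sum.neutral, rule ballI)
        fix i assume "i \<in> {..<N}"
        hence "x2 \<notin> ?I i" using False by auto
        thus "indicat_real (?I i) x2 *\<^sub>R \<epsilon> (x1, (q i + q (Suc i)) / 2) = 0" by simp
      qed
      have "x2 \<in> - (\<Union>j<N. ?I j)" using False by auto
      hence 2: "indicat_real (- (\<Union>j<N. ?I j)) x2 = 1" by (rule indicator_simps(1))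
      show ?thesis unfolding x fst_conv snd_conv sliced_outside[OF False] 1 2 by simp
    qed
  qed
  have fm: "(\<lambda>x :: real \<times> real. (fst x, c)) \<in> borel_measurable borel" for c :: real
    by (intro borel_measurable_continuous_onI continuous_intros)
  have em: "(\<lambda>x :: real \<times> real. \<epsilon> (fst x, c)) \<in> borel_measurable borel" for c
    by (rule measurable_compose[OF fm m])
  have sm: "(\<lambda>x :: real \<times> real. indicat_real S (snd x)) \<in> borel_measurable borel" if "S \<in> sets borel" for S
  proof (rule measurable_compose[of snd borel borel])
    show "snd \<in> borel_measurable (borel :: (real \<times> real) measure)"
      by (intro borel_measurable_continuous_onI continuous_intros)
  qed (use that in simp)
  have "open (\<Union>j<N. ?I j)" by (intro open_UN ballI open_greaterThanLessThan)
  hence co: "- (\<Union>j<N. ?I j) \<in> sets borel" by (intro borel_closed closed_Compl)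
  show ?thesis
    unfolding eq by (intro borel_measurable_add borel_measurable_sum borel_measurable_scaleR sm em m co) simp
qed

lemma periodic_int:
  fixes \<epsilon> :: "real \<times> real \<Rightarrow> complex"
  assumes p: "\<And>x1 x2. \<epsilon> (x1 + L, x2) = \<epsilon> (x1, x2)"
  shows "\<epsilon> (x1 + of_int k * L, x2) = \<epsilon> (x1, x2)"
proof -
  have n: "\<epsilon> (x1 + of_nat n * L, x2) = \<epsilon> (x1, x2)" for n x1
  proof (induction n)
    case (Suc n)
    have "\<epsilon> (x1 + of_nat (Suc n) * L, x2) = \<epsilon> ((x1 + of_nat n * L) + L, x2)" by (simp add: algebra_simps)
    thus ?case using Suc p by simp
  qed simp
  show ?thesis
  proof (cases "k \<ge> 0")
    case True
    thus ?thesis using n[of x1 "nat k"] by simp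
  next
    case False
    thus ?thesis using n[of "x1 + of_int k * L" "nat (- k)"] by simp
  qed
qed

section \<open>Boundedness from continuous extension to the closure\<close>

lemma continuous_extension_bounded:
  fixes f :: "'a::euclidean_space \<Rightarrow> complex"
  assumes "bounded S" "continuous_on (closure S) g" "\<forall>x\<in>S. g x = f x"
  shows "bounded (f ` S)"
proof -
  have "compact (g ` closure S)" using assms(1,2) by (intro compact_continuous_image) auto
  hence "bounded (g ` closure S)" by (rule compact_imp_bounded)
  moreover have "f ` S \<subseteq> g ` closure S"
  proof
    fix y assume "y \<in> f ` S"
    then obtain x where "x \<in> S" "y = f x" by blast
    thus "y \<in> g ` closure S" using assms(3) subsetD[OF closure_subset] by (intro image_eqI[of _ _ x]) auto
  qed
  ultimately show ?thesis by (rule bounded_subset)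
qed

lemma Ck_closure_bounded:
  assumes "Ck_closure k S f" "bounded S"
  shows "bounded (f ` S)"
proof -
  obtain g where "continuous_on (closure S) g" "\<forall>x\<in>S. g x = f x"
    using assms(1) by (cases k) auto
  from continuous_extension_bounded[OF assms(2) this] show ?thesis .
qed

section \<open>Area of vertical neighbourhoods of the interfaces\<close>

lemma graph_strip_measure:
  fixes g :: "real \<Rightarrow> real"
  assumes X: "X \<in> sets borel" and sub: "\<And>x. x \<in> X \<Longrightarrow> \<bar>fst x - a\<bar> < r \<and> \<bar>snd x - g (fst x)\<bar> \<le> h" and pos: "r > 0" "h \<ge> 0"
  shows "emeasure lborel X \<le> ennreal (4 * h * r)"
proof -
  have "emeasure (lborel \<Otimes>\<^sub>M lborel) X = (\<integral>\<^sup>+x. emeasure lborel (Pair x -` X) \<partial>lborel)"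
    by (rule lborel.emeasure_pair_measure_alt) (simp only: lborel_prod sets_lborel X)
  hence "emeasure lborel X = (\<integral>\<^sup>+x. emeasure lborel (Pair x -` X) \<partial>lborel)" by (simp only: lborel_prod)
  \<comment> \<open>Cavalieri's principle: the vertical section at a point within r of a lies in an
    interval of length 2h around the graph, and all other sections are empty.\<close>
  also have "\<dots> \<le> (\<integral>\<^sup>+x. ennreal (2 * h) * indicator {a - r<..<a + r} x \<partial>lborel)"
  proof (rule nn_integral_mono)
    fix x
    show "emeasure lborel (Pair x -` X) \<le> ennreal (2 * h) * indicator {a - r<..<a + r} x"
    proof (cases "\<bar>x - a\<bar> < r")
      case True
      have "Pair x -` X \<subseteq> {g x - h..g x + h}" using sub by (force simp: abs_le_iff)
      hence "emeasure lborel (Pair x -` X) \<le> emeasure lborel {g x - h..g x + h}" by (rule emeasure_mono) simp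
      also have "\<dots> = ennreal (2 * h)" using pos by simp
      finally show ?thesis using True by (auto simp: indicator_def abs_less_iff)
    next
      case False
      hence "Pair x -` X = {}" using sub by fastforce
      thus ?thesis by simp
    qed
  qed
  also have "\<dots> = ennreal (2 * h) * ennreal (2 * r)" using pos by (subst nn_integral_cmult_indicator) auto
  also have "\<dots> = ennreal (4 * h * r)" using pos by (simp flip: ennreal_mult)
  finally show ?thesis .
qed

text \<open>A neighbourhood in the vertical direction, because slicing compares values of \<epsilon>
  at points with the same x1.\<close>

definition strip :: "real \<Rightarrow> (real \<times> real) set \<Rightarrow> (real \<times> real) set" where
  "strip h \<sigma> = {x. \<exists>p\<in>\<sigma>. fst p = fst x \<and> \<bar>snd p - snd x\<bar> \<le> h}"

text \<open>The strip is a continuous image of the compact product of the interface with [-h, h],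
  hence compact.\<close>

lemma strip_borel:
  assumes "compact \<sigma>"
  shows "strip h \<sigma> \<in> sets borel"
proof -
  have "strip h \<sigma> = (\<lambda>z. fst z + (0, snd z)) ` (\<sigma> \<times> {-h..h})"
  proof (intro equalityI subsetI)
    fix x assume "x \<in> strip h \<sigma>"
    then obtain p where "p \<in> \<sigma>" "fst p = fst x" "\<bar>snd p - snd x\<bar> \<le> h" by (auto simp: strip_def)
    thus "x \<in> (\<lambda>z. fst z + (0, snd z)) ` (\<sigma> \<times> {-h..h})"
      by (intro image_eqI[of _ _ "(p, snd x - snd p)"]) (auto simp: prod_eq_iff)
  next
    fix x assume "x \<in> (\<lambda>z. fst z + (0, snd z)) ` (\<sigma> \<times> {-h..h})"
    then obtain p t where "p \<in> \<sigma>" "-h \<le> t" "t \<le> h" "x = p + (0, t)" by auto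
    thus "x \<in> strip h \<sigma>" unfolding strip_def by (intro CollectI bexI[of _ p]) auto
  qed
  also have "compact \<dots>" by (intro compact_continuous_image continuous_intros compact_Times assms) simp
  finally show ?thesis by (simp add: borel_compact)
qed

lemma strips_measure:
  assumes fin: "finite \<S>" and cpt: "\<And>\<sigma>. \<sigma> \<in> \<S> \<Longrightarrow> compact \<sigma>"
    and graph: "\<And>\<sigma>. \<sigma> \<in> \<S> \<Longrightarrow> \<exists>g. \<forall>p\<in>\<sigma>. snd p = g (fst p)" and pos: "h \<ge> 0" "r > 0"
  shows "emeasure lborel ((\<Union>\<sigma>\<in>\<S>. strip h \<sigma>) \<inter> {x. \<bar>fst x - a\<bar> < r}) \<le> ennreal (real (card \<S>) * 4 * h * r)"
proof -
  let ?W = "{x :: real \<times> real. \<bar>fst x - a\<bar> < r}"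
  have W: "?W \<in> sets borel" by (intro borel_open open_Collect_less continuous_intros)
  have meas: "strip h \<sigma> \<inter> ?W \<in> sets borel" if "\<sigma> \<in> \<S>" for \<sigma>
    by (rule sets.Int[OF strip_borel[OF cpt[OF that]] W])
  have one: "emeasure lborel (strip h \<sigma> \<inter> ?W) \<le> ennreal (4 * h * r)" if s: "\<sigma> \<in> \<S>" for \<sigma>
  proof -
    obtain g where g: "\<forall>p\<in>\<sigma>. snd p = g (fst p)" using graph[OF s] ..
    show ?thesis
    proof (rule graph_strip_measure[OF meas[OF s] _ pos(2,1), where g = g])
      fix x assume "x \<in> strip h \<sigma> \<inter> ?W"
      then obtain p where "p \<in> \<sigma>" "fst p = fst x" "\<bar>snd p - snd x\<bar> \<le> h" "\<bar>fst x - a\<bar> < r"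
        by (auto simp: strip_def)
      thus "\<bar>fst x - a\<bar> < r \<and> \<bar>snd x - g (fst x)\<bar> \<le> h" using g by (simp add: abs_minus_commute)
    qed
  qed
  have "(\<Union>\<sigma>\<in>\<S>. strip h \<sigma>) \<inter> ?W = (\<Union>\<sigma>\<in>\<S>. strip h \<sigma> \<inter> ?W)" by blast
  hence "emeasure lborel ((\<Union>\<sigma>\<in>\<S>. strip h \<sigma>) \<inter> ?W) \<le> (\<Sum>\<sigma>\<in>\<S>. emeasure lborel (strip h \<sigma> \<inter> ?W))"
    using emeasure_subadditive_finite[OF fin, of "\<lambda>\<sigma>. strip h \<sigma> \<inter> ?W" lborel] meas by (simp add: image_subset_iff)
  also have "\<dots> \<le> (\<Sum>\<sigma>\<in>\<S>. ennreal (4 * h * r))" by (rule sum_mono) (rule one)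
  also have "\<dots> = ennreal (real (card \<S>) * (4 * h * r))"
    using pos by (simp add: ennreal_of_nat_eq_real_of_nat flip: ennreal_mult)
  finally show ?thesis by (simp add: mult.assoc)
qed

text \<open>Each of the finitely many subdomains has a continuous extension of \<epsilon> to its
  compact closure. On an interface the value is a limit from some piece and inherits the bound; that
  piece may be a translate of a subdomain, where periodicity returns the values to the original
  one.\<close>

lemma permittivity_bounded:
  assumes pw: "piecewise_C2_permittivity Lx H \<epsilon> \<S> \<D>" and per: "\<And>x1 x2. \<epsilon> (x1 + Lx, x2) = \<epsilon> (x1, x2)"
  shows "\<exists>M>0. \<forall>x\<in>Omega Lx H. cmod (\<epsilon> x) \<le> M"
proof -
  have fin: "finite \<D>" and lip: "\<And>D. D \<in> \<D> \<Longrightarrow> Lipschitz_domain D" and un: "\<Union>\<D> = Omega Lx H - \<Union>\<S>"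
    and ck: "\<And>D. D \<in> \<D> \<Longrightarrow> Ck_closure 2 D \<epsilon>"
    using pw unfolding piecewise_C2_permittivity_def by blast+
  let ?P = "(\<Union>D\<in>\<D>. \<Union>k::int. {(\<lambda>x. x + (of_int k * Lx, 0)) ` D}) \<union> {{x. snd x > H}, {x. snd x < - H}}"
  have Z: "\<And>x. x \<in> periodized Lx (\<Union>\<S>) \<Longrightarrow> \<exists>P\<in>?P. x \<in> closure P \<and> (\<epsilon> \<longlongrightarrow> \<epsilon> x) (at x within P)"
    using pw unfolding piecewise_C2_permittivity_def Let_def by blast
  have "bounded (\<Union>D\<in>\<D>. \<epsilon> ` D)"
  proof (rule bounded_UN[OF fin], rule ballI)
    fix D assume D: "D \<in> \<D>"
    have "bounded D" using lip[OF D] unfolding Lipschitz_domain_def by blast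
    thus "bounded (\<epsilon> ` D)" by (rule Ck_closure_bounded[OF ck[OF D]])
  qed
  then obtain M where M: "\<forall>y\<in>(\<Union>D\<in>\<D>. \<epsilon> ` D). cmod y \<le> M" unfolding bounded_iff ..
  have MD: "cmod (\<epsilon> x) \<le> M" if "x \<in> D" "D \<in> \<D>" for x D using M that by blast
  have "cmod (\<epsilon> x) \<le> M" if x: "x \<in> Omega Lx H" for x
  proof (cases "x \<in> \<Union>\<D>")
    case True
    thus ?thesis using MD by blast
  next
    case False
    hence "x \<in> \<Union>\<S>" using un x by blast
    hence "x \<in> (\<lambda>x. x + (of_int 0 * Lx, 0)) ` \<Union>\<S>" by (intro image_eqI[of _ _ x]) (auto simp: zero_prod_def[symmetric])
    hence "x \<in> periodized Lx (\<Union>\<S>)" unfolding periodized_def by (rule UN_I[OF UNIV_I])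
    from Z[OF this] obtain P where P: "P \<in> ?P" "x \<in> closure P" "(\<epsilon> \<longlongrightarrow> \<epsilon> x) (at x within P)" by (elim bexE conjE)
    \<comment> \<open>A point of the cell lies strictly between the lines x2 = H and x2 = -H, so the
      one-sided limit there cannot come from an outer half-plane.\<close>
    have up: "P \<noteq> {x. snd x > H}"
    proof
      assume e: "P = {x. snd x > H}"
      have "closure P \<subseteq> {x. snd x \<ge> H}"
        unfolding e by (rule closure_minimal) (auto intro!: closed_Collect_le continuous_intros)
      thus False using P(2) x by (auto simp: Omega_def)
    qed
    have low: "P \<noteq> {x. snd x < - H}"
    proof
      assume e: "P = {x. snd x < - H}"
      have "closure P \<subseteq> {x. snd x \<le> - H}"
        unfolding e by (rule closure_minimal) (auto intro!: closed_Collect_le continuous_intros)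
      thus False using P(2) x by (auto simp: Omega_def)
    qed
    have "P \<in> (\<Union>D\<in>\<D>. \<Union>k::int. {(\<lambda>x. x + (of_int k * Lx, 0)) ` D})"
      using P(1) up low by (simp only: Un_iff insert_iff empty_iff simp_thms)
    then obtain D k where D: "D \<in> \<D>" and Pk: "P = (\<lambda>x. x + (of_int k * Lx, 0)) ` D"
      by (elim UN_E singletonE)
    have Pb: "cmod (\<epsilon> y) \<le> M" if y: "y \<in> P" for y
    proof -
      obtain d where d: "d \<in> D" "y = d + (of_int k * Lx, 0)" using y Pk by blast
      have "\<epsilon> y = \<epsilon> d" using periodic_int[of \<epsilon> Lx "fst d" k "snd d", OF per] d(2) by (cases d) simp
      thus ?thesis using MD[OF d(1) D] by simp
    qed
    show ?thesis
    proof (cases "x \<in> P")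
      case True
      thus ?thesis by (rule Pb)
    next
      case False
      \<comment> \<open>The bound transfers to the limit only along a nontrivial filter; a point of
        the closure outside P is a limit point.\<close>
      hence "x islimpt P" using P(2) by (simp add: closure_def)
      hence nt: "at x within P \<noteq> bot" by (simp add: trivial_limit_within)
      have "\<forall>\<^sub>F y in at x within P. cmod (\<epsilon> y) \<le> M"
        unfolding eventually_at_filter by (rule always_eventually) (use Pb in blast)
      from tendsto_upperbound[OF tendsto_norm[OF P(3)] this nt] show ?thesis .
    qed
  qed
  hence "\<forall>x\<in>Omega Lx H. cmod (\<epsilon> x) \<le> max M 1" using le_max_iff_disj by blast
  moreover have "max M 1 > 0" by linarith
  ultimately show ?thesis by blast
qed

text \<open>A segment that avoids the interfaces is connected and covered by disjoint open
  subdomains, so it stays in one of them. There the mean value inequality applies with the bound for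
  the vertical derivative; finitely many subdomains give one constant.\<close>

lemma permittivity_vertical_lipschitz:
  assumes pw: "piecewise_C2_permittivity Lx H \<epsilon> \<S> \<D>"
  shows "\<exists>\<Lambda>\<ge>0. \<forall>x1 a b. (\<forall>t\<in>closed_segment a b. (x1, t) \<in> Omega Lx H - \<Union>\<S>) \<longrightarrow>
    cmod (\<epsilon> (x1, a) - \<epsilon> (x1, b)) \<le> \<Lambda> * \<bar>a - b\<bar>"
proof -
  have fin: "finite \<D>" and lip: "\<And>D. D \<in> \<D> \<Longrightarrow> Lipschitz_domain D" and un: "\<Union>\<D> = Omega Lx H - \<Union>\<S>"
    and disj: "disjoint \<D>" and ck: "\<And>D. D \<in> \<D> \<Longrightarrow> Ck_closure 2 D \<epsilon>"
    using pw unfolding piecewise_C2_permittivity_def by blast+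
  have ck2: "\<epsilon> differentiable_on D" "Ck_closure (Suc 0) D (dpart (0, 1) \<epsilon>)" if "D \<in> \<D>" for D
  proof -
    have "Ck_closure (Suc (Suc 0)) D \<epsilon>" using ck[OF that] by (simp only: numeral_2_eq_2)
    hence 1: "\<epsilon> differentiable_on D" and 2: "\<forall>b\<in>Basis. Ck_closure (Suc 0) D (dpart b \<epsilon>)"
      unfolding Ck_closure.simps(2)[of "Suc 0"] by blast+
    show "\<epsilon> differentiable_on D" by (rule 1)
    show "Ck_closure (Suc 0) D (dpart (0, 1) \<epsilon>)" using 2 unfolding Basis_point by blast
  qed
  have "bounded (\<Union>D\<in>\<D>. dpart (0, 1) \<epsilon> ` D)"
  proof (rule bounded_UN[OF fin], rule ballI)
    fix D assume D: "D \<in> \<D>"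
    have "bounded D" using lip[OF D] unfolding Lipschitz_domain_def by blast
    thus "bounded (dpart (0, 1) \<epsilon> ` D)" by (rule Ck_closure_bounded[OF ck2(2)[OF D]])
  qed
  then obtain M where M: "\<forall>y\<in>(\<Union>D\<in>\<D>. dpart (0, 1) \<epsilon> ` D). cmod y \<le> M" unfolding bounded_iff ..
  have main: "cmod (\<epsilon> (x1, a) - \<epsilon> (x1, b)) \<le> max M 0 * \<bar>a - b\<bar>"
    if seg: "\<forall>t\<in>closed_segment a b. (x1, t) \<in> Omega Lx H - \<Union>\<S>" for x1 a b
  proof -
    let ?S = "Pair x1 ` closed_segment a b"
    have "(x1, a) \<in> \<Union>\<D>" using seg un by auto
    then obtain D where D: "D \<in> \<D>" "(x1, a) \<in> D" by blast
    have op: "open E" if "E \<in> \<D>" for E using lip[OF that] unfolding Lipschitz_domain_def by blast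
    have con: "connected ?S"
      by (intro connected_continuous_image connected_segment continuous_intros)
    have cover: "?S \<subseteq> D \<union> \<Union>(\<D> - {D})" using seg un by blast
    have "D \<inter> \<Union>(\<D> - {D}) = {}" using disj D(1) unfolding disjoint_def by blast
    hence "D \<inter> ?S = {} \<or> \<Union>(\<D> - {D}) \<inter> ?S = {}"
      using connectedD[OF con op[OF D(1)] open_Union _ cover] op by blast
    moreover have "(x1, a) \<in> D \<inter> ?S" using D(2) by simp
    ultimately have SD: "?S \<subseteq> D" using cover by blast
    let ?f' = "\<lambda>t h. h *\<^sub>R dpart (0, 1) \<epsilon> (x1, t)"
    have "norm (\<epsilon> (x1, a) - \<epsilon> (x1, b)) \<le> max M 0 * norm (a - b)"
    proof (rule differentiable_bound[of "closed_segment a b" "\<lambda>t. \<epsilon> (x1, t)" ?f'])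
      fix t assume t: "t \<in> closed_segment a b"
      hence tD: "(x1, t) \<in> D" using SD by blast
      have "\<epsilon> differentiable (at (x1, t))"
        using ck2(1)[OF D(1)] tD op[OF D(1)] by (simp add: differentiable_on_eq_differentiable_at)
      hence d: "(\<epsilon> has_derivative frechet_derivative \<epsilon> (at (x1, t))) (at (x1, t))"
        by (simp add: frechet_derivative_works)
      have e: "((\<lambda>t. (x1, t)) has_derivative (\<lambda>h. (0, h))) (at t within closed_segment a b)"
        by (auto intro!: derivative_eq_intros)
      have "frechet_derivative \<epsilon> (at (x1, t)) (0, h) = ?f' t h" for h
        using linear_scale[OF has_derivative_linear[OF d], of h "(0, 1)"] by (simp add: dpart_def)
      thus "((\<lambda>t. \<epsilon> (x1, t)) has_derivative ?f' t) (at t within closed_segment a b)"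
        using has_derivative_compose[OF e d] by simp
      have "cmod (dpart (0, 1) \<epsilon> (x1, t)) \<le> max M 0" using M D(1) tD by (auto simp: le_max_iff_disj)
      thus "onorm (?f' t) \<le> max M 0"
        by (intro onorm_bound) (auto simp: mult.commute[of "max M 0"] intro!: mult_left_mono)
    qed (rule convex_closed_segment ends_in_segment)+
    thus ?thesis by (simp only: real_norm_def)
  qed
  show ?thesis
    by (rule exI[of _ "max M 0"], intro conjI allI impI, rule max.cobounded2, rule main)
qed

section \<open>Application to the slicing of the cell\<close>

lemma nodes_thickness:
  assumes n: "nodes (- H) H N q" and H: "H > 0"
  shows "j < N \<Longrightarrow> q (Suc j) - q j \<le> thickness N q" and "0 < thickness N q" and "thickness N q \<le> 2 * H"
proof -
  have N: "N > 0" using n H by (cases N) (auto simp: nodes_def)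
  show le: "q (Suc j) - q j \<le> thickness N q" if "j < N" for j
    unfolding thickness_def using that by (intro Max_ge) auto
  have "q 0 < q (Suc 0)" using n N unfolding nodes_def by blast
  thus "0 < thickness N q" using le[OF N] by linarith
  have "q (Suc j) - q j \<le> 2 * H" if "j < N" for j
    using nodes_mono[OF n, of 0 j] nodes_mono[OF n, of "Suc j" N] n that by (simp add: nodes_def)
  thus "thickness N q \<le> 2 * H"
    unfolding thickness_def using N by (intro Max.boundedI) auto
qed

lemma slice_in_Omega:
  assumes n: "nodes (- H) H N q" and j: "j < N" and t: "q j < t" "t < q (Suc j)" and x: "(x1, x2) \<in> Omega Lx H"
  shows "(x1, t) \<in> Omega Lx H"
  using nodes_mono[OF n, of 0 j] nodes_mono[OF n, of "Suc j" N] n j t x by (auto simp: nodes_def Omega_def)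

text \<open>Midpoints of slices are again points of the cell, so the sliced coefficient inherits all
  pointwise bounds of \<epsilon> on it.\<close>

lemma sliced_value:
  assumes n: "nodes (- H) H N q" and x: "x \<in> Omega Lx H"
  obtains y where "y \<in> Omega Lx H" "sliced N q \<epsilon> x = \<epsilon> y"
proof (cases "\<exists>j<N. q j < snd x \<and> snd x < q (Suc j)")
  case True
  then obtain j where j: "j < N" "q j < snd x" "snd x < q (Suc j)" by blast
  have "(fst x, (q j + q (Suc j)) / 2) \<in> Omega Lx H"
    by (rule slice_in_Omega[OF n j(1), of _ _ "snd x"]) (use j x in auto)
  thus ?thesis using that sliced_in_slice[OF n j, of \<epsilon> "fst x"] by simp
next
  case False
  thus ?thesis using that[OF x] sliced_outside[OF False, of \<epsilon> "fst x"] by simp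
qed

theorem theorem9:
  fixes Lx H \<kappa> \<epsilon>p \<epsilon>m \<theta> c1 c2 :: real
    and \<epsilon> :: "real \<times> real \<Rightarrow> complex"
  assumes "Lx > 0" and "H > 0" and "\<kappa> > 0" and "\<epsilon>p > 0" and "\<epsilon>m > 0"
    and "- (pi / 2) < \<theta>" and "\<theta> < pi / 2"
    and "\<And>n::int. (alpha Lx (alpha0 \<kappa> \<epsilon>p \<theta>) n)\<^sup>2 \<noteq> \<kappa>\<^sup>2 * \<epsilon>p"
    and "\<And>n::int. (alpha Lx (alpha0 \<kappa> \<epsilon>p \<theta>) n)\<^sup>2 \<noteq> \<kappa>\<^sup>2 * \<epsilon>m"
    and "\<And>x1 x2. \<epsilon> (x1 + Lx, x2) = \<epsilon> (x1, x2)"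
    and "\<And>x1 x2. x2 > H \<Longrightarrow> \<epsilon> (x1, x2) = complex_of_real \<epsilon>p"
    and "\<And>x1 x2. x2 < - H \<Longrightarrow> \<epsilon> (x1, x2) = complex_of_real \<epsilon>m"
    and "\<epsilon> \<in> borel_measurable borel"
    and "\<exists>\<S> \<D>. piecewise_C2_permittivity Lx H \<epsilon> \<S> \<D> \<and> (\<forall>\<sigma>\<in>\<S>. is_piecewise_C2_graph Lx \<sigma>)"
    and "c1 > 0" and "c2 > 0"
    and "\<And>x. x \<in> Omega Lx H \<Longrightarrow> Im (\<epsilon> x) > c1"
    and "\<And>x. x \<in> Omega Lx H \<Longrightarrow> Re (\<epsilon> x) > c2"
  shows "uniquely_solvable Lx H \<kappa> \<epsilon>p \<epsilon>m \<theta> \<epsilon> \<and>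
    (\<forall>N q. nodes (- H) H N q \<longrightarrow> uniquely_solvable Lx H \<kappa> \<epsilon>p \<epsilon>m \<theta> (sliced N q \<epsilon>)) \<and>
    (\<forall>u s1. is_solution Lx H \<kappa> \<epsilon>p \<epsilon>m \<theta> \<epsilon> u \<and> s1 \<in> {0<..<1/2} \<and> u \<in> H1s s1 (Omega Lx H) \<longrightarrow>
       (\<exists>C>0. \<forall>N q uh. nodes (- H) H N q \<and>
            is_solution Lx H \<kappa> \<epsilon>p \<epsilon>m \<theta> (sliced N q \<epsilon>) uh \<longrightarrow>
            H1_norm (Omega Lx H) (\<lambda>x. u x - uh x) \<le> C * thickness N q powr (s1 / 2)))"
proof -
  note pos = assms(1-5) and per = assms(10) and meas = assms(13) and c = assms(15,16) and im = assms(17) and re = assms(18)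
  from assms(14) obtain \<S> \<D> where pw: "piecewise_C2_permittivity Lx H \<epsilon> \<S> \<D>"
    and gr: "\<forall>\<sigma>\<in>\<S>. is_piecewise_C2_graph Lx \<sigma>" by (elim exE conjE)
  have fin: "finite \<S>" and cl: "\<forall>\<sigma>\<in>\<S>. closed \<sigma> \<and> \<sigma> \<subseteq> closure (Omega Lx H)"
    using pw unfolding piecewise_C2_permittivity_def by blast+
  have "bounded (Omega Lx H)" unfolding Omega_def by (intro bounded_Times) auto
  hence cpt: "compact \<sigma>" if "\<sigma> \<in> \<S>" for \<sigma>
    using cl that bounded_subset[OF bounded_closure] unfolding compact_eq_bounded_closed by metis
  have graph: "\<exists>g. \<forall>p\<in>\<sigma>. snd p = g (fst p)" if \<sigma>: "\<sigma> \<in> \<S>" for \<sigma>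
  proof -
    obtain a b g where "\<sigma> = (\<lambda>t. (t, g t)) ` {a..b}"
      using bspec[OF gr \<sigma>] unfolding is_piecewise_C2_graph_def by (elim exE conjE)
    thus ?thesis by (intro exI[of _ g]) auto
  qed
  obtain M where M: "M > 0" "\<forall>x\<in>Omega Lx H. cmod (\<epsilon> x) \<le> M"
    using permittivity_bounded[OF pw per] by (elim exE conjE)
  obtain \<Lambda> where \<Lambda>: "\<Lambda> \<ge> 0" and lip: "\<forall>x1 a b. (\<forall>t\<in>closed_segment a b. (x1, t) \<in> Omega Lx H - \<Union>\<S>) \<longrightarrow>
    cmod (\<epsilon> (x1, a) - \<epsilon> (x1, b)) \<le> \<Lambda> * \<bar>a - b\<bar>"
    using permittivity_vertical_lipschitz[OF pw] by (elim exE conjE)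
  interpret grating Lx H \<kappa> \<epsilon>p \<epsilon>m \<theta> c1 c2 M
    by unfold_locales (fact pos c M(1))+
  have borel_leb: "f \<in> borel_measurable (lebesgue_on \<Omega>)" if "f \<in> borel_measurable borel" for f :: "real \<times> real \<Rightarrow> complex"
    by (rule measurable_restrict_space1) (use that in \<open>simp add: measurable_completion\<close>)
  have adm: "admissible \<epsilon>"
    unfolding admissible_def using borel_leb[OF meas] M(2) im re by blast
  have admN: "admissible (sliced N q \<epsilon>)" if n: "nodes (- H) H N q" for N q
  proof -
    have "cmod (sliced N q \<epsilon> x) \<le> M \<and> Im (sliced N q \<epsilon> x) > c1 \<and> Re (sliced N q \<epsilon> x) > c2" if x: "x \<in> \<Omega>" for x
    proof -
      obtain y where y: "y \<in> \<Omega>" "sliced N q \<epsilon> x = \<epsilon> y" by (rule sliced_value[OF n x])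
      show ?thesis unfolding y(2) using M(2) im re y(1) by blast
    qed
    thus ?thesis unfolding admissible_def using borel_leb[OF sliced_measurable[OF n meas]] by blast
  qed
  \<comment> \<open>The constant depends on u through the Gagliardo integrals of its derivatives and
    is fixed before the mesh and the discrete solution are introduced.\<close>
  have rate: "\<exists>C>0. \<forall>N q uh. nodes (- H) H N q \<and> is_solution Lx H \<kappa> \<epsilon>p \<epsilon>m \<theta> (sliced N q \<epsilon>) uh \<longrightarrow>
      H1_norm \<Omega> (\<lambda>x. u x - uh x) \<le> C * thickness N q powr (s1 / 2)"
    if sol: "is_solution Lx H \<kappa> \<epsilon>p \<epsilon>m \<theta> \<epsilon> u" and s: "s1 \<in> {0<..<1/2}" and uH: "u \<in> H1s s1 \<Omega>" for u s1
  proof -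
    have s01: "0 < s1" "s1 < 1 / 2" using s by auto
    have g: "D b u \<in> Hs s1 \<Omega>" if "b \<in> Basis" for b using uH that unfolding H1s_def by blast
    obtain c0 where c0: "c0 > 0" and pert: "\<forall>\<eta> \<eta>' u u'. admissible \<eta> \<and> admissible \<eta>' \<and> is_solution Lx H \<kappa> \<epsilon>p \<epsilon>m \<theta> \<eta> u \<and>
        is_solution Lx H \<kappa> \<epsilon>p \<epsilon>m \<theta> \<eta>' u' \<longrightarrow>
        c0 * H1_norm \<Omega> (\<lambda>x. u x - u' x) \<le> (\<Sum>b\<in>Basis. L2_norm \<Omega> (\<lambda>x. (1 / \<eta>' x - 1 / \<eta> x) * (D b u x + dui b x)))"
      using coefficient_perturbation by (elim exE conjE)
    \<comment> \<open>\<open>P\<close> is the factor in \<open>strips_measure\<close>, four for each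
      interface. \<open>Q\<close> comes from 1/a - 1/b = (b - a)/(ab): the Lipschitz constant of
      \<epsilon> times two factors 1/c2.\<close>
    define P where "P = real (card \<S>) * 4"
    define Q where "Q = \<Lambda> / c2\<^sup>2"
    have PQ: "P \<ge> 0" "Q \<ge> 0" using \<Lambda> by (simp_all add: P_def Q_def)
    let ?small = "\<lambda>b K. K \<ge> 0 \<and> (\<forall>h A \<delta>. 0 < h \<and> h \<le> 2 * H \<and> A \<in> sets borel \<and> A \<subseteq> \<Omega> \<and>
      (\<forall>a r. r > 0 \<longrightarrow> emeasure lborel (A \<inter> {x. \<bar>fst x - a\<bar> < r}) \<le> ennreal (P * h * r)) \<and>
      \<delta> \<in> borel_measurable (lebesgue_on \<Omega>) \<and> (\<forall>x\<in>\<Omega>. cmod (\<delta> x) \<le> 2 / c2) \<and> (\<forall>x\<in>\<Omega> - A. cmod (\<delta> x) \<le> Q * h) \<longrightarrow>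
      L2_norm \<Omega> (\<lambda>x. \<delta> x * (D b u x + dui b x)) \<le> K * h powr (s1 / 2))"
    have "\<forall>b\<in>Basis. \<exists>K. ?small b K"
      by (rule ballI) (rule perturbation_L2_bound[OF s01 g _ PQ])
    from bchoice[OF this] obtain K where K: "\<forall>b\<in>Basis. ?small b (K b)" ..
    \<comment> \<open>The summand 1 makes the constant positive even if all \<open>K b\<close>
      vanish.\<close>
    define C where "C = (\<Sum>b\<in>Basis. K b) / c0 + 1"
    have K0: "(\<Sum>b\<in>Basis. K b) \<ge> 0" by (rule sum_nonneg) (use K in blast)
    have C0: "C > 0" using K0 c0 by (simp add: C_def add_nonneg_pos)
    have "H1_norm \<Omega> (\<lambda>x. u x - uh x) \<le> C * thickness N q powr (s1 / 2)"
      if n: "nodes (- H) H N q" and uh: "is_solution Lx H \<kappa> \<epsilon>p \<epsilon>m \<theta> (sliced N q \<epsilon>) uh" for N q uh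
    proof -
      define h where "h = thickness N q"
      have h: "0 < h" "h \<le> 2 * H" using nodes_thickness(2,3)[OF n pos(2)] by (simp_all add: h_def)
      \<comment> \<open>Half-width h suffices, since a point and the midpoint of its slice lie in
        the same slice, whose height is at most h.\<close>
      define A where "A = (\<Union>\<sigma>\<in>\<S>. strip h \<sigma>) \<inter> \<Omega>"
      have Un_b: "(\<Union>\<sigma>\<in>\<S>. strip h \<sigma>) \<in> sets borel"
        by (rule sets.finite_UN[OF fin]) (rule strip_borel[OF cpt])
      have "open \<Omega>" unfolding Omega_def by (intro open_Times open_greaterThanLessThan)
      hence Om: "\<Omega> \<in> sets borel" by (rule borel_open)
      have A: "A \<in> sets borel" "A \<subseteq> \<Omega>" unfolding A_def using sets.Int[OF Un_b Om] by blast+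
      have mA: "emeasure lborel (A \<inter> {x. \<bar>fst x - a\<bar> < r}) \<le> ennreal (P * h * r)" if r: "r > 0" for a r
      proof -
        have W: "{x :: real \<times> real. \<bar>fst x - a\<bar> < r} \<in> sets borel"
          by (intro borel_open open_Collect_less continuous_intros)
        have "emeasure lborel (A \<inter> {x. \<bar>fst x - a\<bar> < r}) \<le> emeasure lborel ((\<Union>\<sigma>\<in>\<S>. strip h \<sigma>) \<inter> {x. \<bar>fst x - a\<bar> < r})"
          by (rule emeasure_mono) (use A_def sets.Int[OF Un_b W] in auto)
        also have "\<dots> \<le> ennreal (real (card \<S>) * 4 * h * r)"
          by (rule strips_measure[OF fin cpt graph less_imp_le[OF h(1)] r])
        finally show ?thesis by (simp only: P_def)
      qed
      define \<delta> where "\<delta> x = 1 / sliced N q \<epsilon> x - 1 / \<epsilon> x" for x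
      have \<delta>m: "\<delta> \<in> borel_measurable (lebesgue_on \<Omega>)"
        unfolding \<delta>_def[abs_def] by (rule borel_measurable_diff[OF admissible_inverse(1)[OF admN[OF n]] admissible_inverse(1)[OF adm]])
      have \<delta>b: "cmod (\<delta> x) \<le> 2 / c2" if "x \<in> \<Omega>" for x
      proof -
        have "cmod (\<delta> x) \<le> cmod (1 / sliced N q \<epsilon> x) + cmod (1 / \<epsilon> x)" unfolding \<delta>_def by (rule norm_triangle_ineq4)
        thus ?thesis using admissible_inverse(2)[OF admN[OF n] that] admissible_inverse(2)[OF adm that] by linarith
      qed
      have \<delta>s: "cmod (\<delta> x) \<le> Q * h" if x: "x \<in> \<Omega> - A" for x
      proof -
        obtain x1 x2 where x12: "x = (x1, x2)" by (cases x)
        show ?thesis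
        proof (cases "\<exists>j<N. q j < x2 \<and> x2 < q (Suc j)")
          case False
          \<comment> \<open>At heights outside the open slices, that is on slice boundaries,
            \<open>sliced\<close> keeps the value of \<epsilon>.\<close>
          have "\<delta> x = 0" unfolding \<delta>_def x12 sliced_outside[OF False] by (rule diff_self)
          thus ?thesis using PQ(2) h(1) by simp
        next
          case True
          then obtain j where j: "j < N" "q j < x2" "x2 < q (Suc j)" by (elim exE conjE)
          define m where "m = (q j + q (Suc j)) / 2"
          have m: "q j < m" "m < q (Suc j)" using j by (simp_all add: m_def)
          have jh: "q (Suc j) - q j \<le> h" unfolding h_def by (rule nodes_thickness(1)[OF n pos(2) j(1)])
          have xO: "(x1, x2) \<in> \<Omega>" using x x12 by blast
          \<comment> \<open>If the vertical segment from x to the midpoint of its slice met an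
            interface, x would be within vertical distance h of it and thus belong to A.\<close>
          have seg: "(x1, t) \<in> \<Omega> - \<Union>\<S>" if t: "t \<in> closed_segment x2 m" for t
          proof -
            have tj: "q j < t" "t < q (Suc j)" using t j m by (auto simp: closed_segment_eq_real_ivl split: if_splits)
            have "(x1, t) \<notin> \<sigma>" if \<sigma>: "\<sigma> \<in> \<S>" for \<sigma>
            proof
              assume i: "(x1, t) \<in> \<sigma>"
              have "\<bar>t - x2\<bar> \<le> h" using tj j jh by linarith
              hence "(x1, x2) \<in> strip h \<sigma>" unfolding strip_def using i by force
              thus False using x x12 \<sigma> xO unfolding A_def by blast
            qed
            thus ?thesis using slice_in_Omega[OF n j(1) tj xO] by blast
          qed
          have "cmod (\<epsilon> (x1, x2) - \<epsilon> (x1, m)) \<le> \<Lambda> * \<bar>x2 - m\<bar>"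
            using lip seg by blast
          also have "\<dots> \<le> \<Lambda> * h" using j m jh \<Lambda> by (intro mult_left_mono) linarith+
          finally have d: "cmod (\<epsilon> (x1, x2) - \<epsilon> (x1, m)) \<le> \<Lambda> * h" .
          have mO: "(x1, m) \<in> \<Omega>" by (rule slice_in_Omega[OF n j(1) m xO])
          have i1: "cmod (1 / \<epsilon> (x1, x2)) \<le> 1 / c2" "cmod (1 / \<epsilon> (x1, m)) \<le> 1 / c2"
            by (rule admissible_inverse(2)[OF adm xO], rule admissible_inverse(2)[OF adm mO])
          have nz: "\<epsilon> (x1, x2) \<noteq> 0" "\<epsilon> (x1, m) \<noteq> 0" using re[OF xO] re[OF mO] c by auto
          have "sliced N q \<epsilon> x = \<epsilon> (x1, m)" unfolding x12 m_def by (rule sliced_in_slice[OF n j])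
          hence "\<delta> x = (\<epsilon> (x1, x2) - \<epsilon> (x1, m)) * (1 / \<epsilon> (x1, x2)) * (1 / \<epsilon> (x1, m))"
            unfolding \<delta>_def x12 using nz by (simp add: field_simps)
          hence "cmod (\<delta> x) = cmod (\<epsilon> (x1, x2) - \<epsilon> (x1, m)) * cmod (1 / \<epsilon> (x1, x2)) * cmod (1 / \<epsilon> (x1, m))"
            by (simp only: norm_mult)
          also have "\<dots> \<le> (\<Lambda> * h) * (1 / c2) * (1 / c2)"
            using c(2) \<Lambda> h by (intro mult_mono d i1 mult_nonneg_nonneg norm_ge_zero) auto
          also have "\<dots> = Q * h" by (simp add: Q_def power2_eq_square)
          finally show ?thesis .
        qed
      qed
      have one: "L2_norm \<Omega> (\<lambda>x. \<delta> x * (D b u x + dui b x)) \<le> K b * h powr (s1 / 2)" if b: "b \<in> Basis" for b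
        using conjunct2[OF bspec[OF K b], rule_format, of h A \<delta>] h A mA \<delta>m \<delta>b \<delta>s by simp
      have "c0 * H1_norm \<Omega> (\<lambda>x. u x - uh x) \<le> (\<Sum>b\<in>Basis. L2_norm \<Omega> (\<lambda>x. \<delta> x * (D b u x + dui b x)))"
        unfolding \<delta>_def by (rule pert[rule_format]) (intro conjI adm admN[OF n] sol uh)
      also have "\<dots> \<le> (\<Sum>b\<in>Basis. K b * h powr (s1 / 2))" by (rule sum_mono) (rule one)
      also have "\<dots> = (\<Sum>b\<in>Basis. K b) * h powr (s1 / 2)" by (simp only: sum_distrib_right)
      finally have "H1_norm \<Omega> (\<lambda>x. u x - uh x) \<le> (\<Sum>b\<in>Basis. K b) / c0 * h powr (s1 / 2)"
        using c0 by (simp add: field_simps)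
      also have "\<dots> \<le> C * h powr (s1 / 2)" unfolding C_def by (rule mult_right_mono) simp_all
      finally show ?thesis by (simp only: h_def)
    qed
    thus ?thesis using C0 by blast
  qed
  show ?thesis
  proof (intro conjI allI impI)
    show "uniquely_solvable Lx H \<kappa> \<epsilon>p \<epsilon>m \<theta> \<epsilon>" by (rule unique_solvability[OF adm])
  next
    fix N q assume "nodes (- H) H N q"
    thus "uniquely_solvable Lx H \<kappa> \<epsilon>p \<epsilon>m \<theta> (sliced N q \<epsilon>)" by (rule unique_solvability[OF admN])
  next
    fix u s1
    assume "is_solution Lx H \<kappa> \<epsilon>p \<epsilon>m \<theta> \<epsilon> u \<and> s1 \<in> {0<..<1/2} \<and> u \<in> H1s s1 \<Omega>"
    thus "\<exists>C>0. \<forall>N q uh. nodes (- H) H N q \<and> is_solution Lx H \<kappa> \<epsilon>p \<epsilon>m \<theta> (sliced N q \<epsilon>) uh \<longrightarrow>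
        H1_norm \<Omega> (\<lambda>x. u x - uh x) \<le> C * thickness N q powr (s1 / 2)"
      using rate by blast
  qed
qed

end
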